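(* Let $(a,b)\subset\mathbb{R}$ be a finite interval and let $p,q,r$ be Lebesgue measurable functions on $(a,b)$ with $r>0$ a.e., $r\in L^1((a,b);dx)$; $p>0$ a.e., $1/p\in L^1((a,b);dx)$; $q$ real-valued a.e., $q\in L^1((a,b);dx)$. Let $T_{A,B}$ denote any self-adjoint extension of $T_{min}$, with either separated boundary conditions ($T_{A,B}=T_{\alpha,\beta}$, $\alpha,\beta\in[0,\pi)$) or coupled boundary conditions ($T_{A,B}=T_{\varphi,R}$, $\varphi\in[0,\pi)$, $R\in SL(2,\mathbb{R})$), and let $m_0\in\{0,1,2\}$ be the multiplicity of zero as an eigenvalue of $T_{A,B}$ ($m_0=0$ meaning that zero is not an eigenvalue). Suppose the characteristic function $F_{A,B}$ has the series expansion $$F_{A,B}(z)=\sum_{j=0}^\infty a_j z^j,\quad |z|\ge 0 \text{ sufficiently small}.$$ Then for all $n\in\mathbb{N}$, $$\zeta(n;T_{A,B})=-\operatorname{Res}\left[z^{-n}\frac{d}{dz}\ln(F_{A,B}(z));\ z=0\right]=-n\,b_n,$$ where $$b_1=\frac{a_{1+m_0}}{a_{m_0}},\qquad b_j=\frac{a_{j+m_0}}{a_{m_0}}-\sum_{\ell=1}^{j-1}\frac{\ell}{j}\,\frac{a_{j-\ell+m_0}}{a_{m_0}}\,b_\ell,\quad j\in\mathbb{N},\ j\ge 2.$$ In particular, if zero is not an eigenvalue of $T_{A,B}$, then $$\operatorname{tr}_{L^2((a,b);r\,dx)}\big(T_{A,B}^{-1}\big)=\zeta(1;T_{A,B})=-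\frac{a_1}{a_0}.$$
   Context: The differential expression is $\tau=\frac{1}{r(x)}\left[-\frac{d}{dx}p(x)\frac{d}{dx}+q(x)\right]$ on $(a,b)$; $y^{[1]}=py'$ is the first quasi-derivative. In $L^2((a,b);r\,dx)$, $T_{max}f=\tau f$ with $\mathrm{dom}(T_{max})=\{g\in L^2((a,b);r\,dx)\mid g,g^{[1]}\in AC([a,b]),\ \tau g\in L^2((a,b);r\,dx)\}$, and $T_{min}$ is its restriction to those $g$ with $g(a)=g^{[1]}(a)=g(b)=g^{[1]}(b)=0$. Separated boundary conditions: $T_{\alpha,\beta}$ is the restriction of $T_{max}$ to those $g$ with $g(a)\cos\alpha+g^{[1]}(a)\sin\alpha=0$ and $g(b)\cos\beta-g^{[1]}(b)\sin\beta=0$. Coupled boundary conditions: $T_{\varphi,R}$ is the restriction of $T_{max}$ to those $g$ with $\begin{pmatrix}g(b)\\ g^{[1]}(b)\end{pmatrix}=e^{i\varphi}R\begin{pmatrix}g(a)\\ g^{[1]}(a)\end{pmatrix}$. $\theta(z,x,a),\phi(z,x,a)$ are the solutions of $\tau y=zy$ ($z\in\mathbb{C}$) with $\theta(z,a,a)=\phi^{[1]}(z,a,a)=1$, $\theta^{[1]}(z,a,a)=\phi(z,a,a)=0$. The characteristic functions (entire in $z$) are $$F_{\alpha,\beta}(z)=\cos\alpha\,[-\sin\beta\,\phi^{[1]}(z,b,a)+\cos\beta\,\phi(z,b,a)]-\sin\alpha\,[-\sin\beta\,\theta^{[1]}(z,b,a)+\cos\beta\,\theta(z,b,a)],$$ $$F_{\varphi,R}(z)=e^{i\varphi}\big(R_{12}\theta^{[1]}(z,b,a)-R_{22}\theta(z,b,a)+R_{21}\phi(z,b,a)-R_{11}\phi^{[1]}(z,b,a)\big)+e^{2i\varphi}+1.$$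 $T_{A,B}$ has purely discrete spectrum, bounded from below. The spectral $\zeta$-function is $\zeta(s;T_{A,B})=\sum_{\lambda_j\ne0}\lambda_j^{-s}$, the sum being over all nonzero eigenvalues of $T_{A,B}$ counted with multiplicity, for $\mathrm{Re}(s)$ large enough for absolute convergence ($\mathrm{Re}(s)>1/2$). $\frac{d}{dz}\ln F$ means $F'/F$. *)

theory Defs
  imports
    "HOL-Complex_Analysis.Complex_Analysis"
    "HOL-Library.Function_Algebras"
begin

text \<open>
  Elements of the Hilbert space \<open>L\<^sup>2(M)\<close> are represented by square integrable functions, equality
  in \<open>L\<^sup>2(M)\<close> being equality almost everywhere. An operator, possibly not everywhere defined, is a
  pair of its domain and its action; the action is only relevant on the domain.
\<close>

definition L2 :: "'a measure \<Rightarrow> ('a \<Rightarrow> complex) set"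
  where "L2 M = {f \<in> borel_measurable M. integrable M (\<lambda>x. (norm (f x))\<^sup>2)}"

definition l2_inner :: "'a measure \<Rightarrow> ('a \<Rightarrow> complex) \<Rightarrow> ('a \<Rightarrow> complex) \<Rightarrow> complex"
  where "l2_inner M f g = (LINT x|M. cnj (f x) * g x)"

definition l2_norm :: "'a measure \<Rightarrow> ('a \<Rightarrow> complex) \<Rightarrow> real"
  where "l2_norm M f = sqrt (LINT x|M. (norm (f x))\<^sup>2)"

definition orthonormal_basis :: "'a measure \<Rightarrow> ('a \<Rightarrow> complex) set \<Rightarrow> bool"
  where "orthonormal_basis M E \<longleftrightarrow>
    E \<subseteq> L2 M \<and>
    (\<forall>e\<in>E. \<forall>e'\<in>E. l2_inner M e e' = (if e = e' then 1 else 0)) \<and>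
    (\<forall>f\<in>L2 M. (\<forall>e\<in>E. l2_inner M e f = 0) \<longrightarrow> (AE x in M. f x = 0))"

type_synonym 'a l2_operator = "('a \<Rightarrow> complex) set \<times> (('a \<Rightarrow> complex) \<Rightarrow> ('a \<Rightarrow> complex))"

abbreviation dom_op :: "'a l2_operator \<Rightarrow> ('a \<Rightarrow> complex) set"
  where "dom_op \<equiv> fst"

abbreviation app_op :: "'a l2_operator \<Rightarrow> ('a \<Rightarrow> complex) \<Rightarrow> ('a \<Rightarrow> complex)"
  where "app_op \<equiv> snd"

text \<open>
  Linearity together with boundedness makes the action independent of the representative modulo
  null functions.
\<close>

definition bounded_op :: "'a measure \<Rightarrow> 'a l2_operator \<Rightarrow> bool"
  where "bounded_op M A \<longleftrightarrow>
    dom_op A = L2 M \<and>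
    (\<forall>f\<in>L2 M. app_op A f \<in> L2 M) \<and>
    (\<forall>f\<in>L2 M. \<forall>g\<in>L2 M. \<forall>c d. AE x in M.
       app_op A (\<lambda>x. c * f x + d * g x) x = c * app_op A f x + d * app_op A g x) \<and>
    (\<exists>C. \<forall>f\<in>L2 M. l2_norm M (app_op A f) \<le> C * l2_norm M f)"

definition positive_op :: "'a measure \<Rightarrow> 'a l2_operator \<Rightarrow> bool"
  where "positive_op M S \<longleftrightarrow>
    bounded_op M S \<and> (\<forall>f\<in>L2 M. l2_inner M f (app_op S f) \<in> \<real>\<^sub>\<ge>\<^sub>0)"

text \<open>
  \<open>S\<close> is the absolute value \<open>(A* A)\<^sup>1\<^sup>/\<^sup>2\<close> of \<open>A\<close>: a positive operator \<open>S\<close> is self-adjoint, so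
  that the displayed identity of forms is \<open>S S = A* A\<close>.
\<close>

definition is_absolute_value :: "'a measure \<Rightarrow> 'a l2_operator \<Rightarrow> 'a l2_operator \<Rightarrow> bool"
  where "is_absolute_value M A S \<longleftrightarrow>
    positive_op M S \<and>
    (\<forall>f\<in>L2 M. \<forall>g\<in>L2 M. l2_inner M (app_op S f) (app_op S g) = l2_inner M (app_op A f) (app_op A g))"

definition trace_class :: "'a measure \<Rightarrow> 'a l2_operator \<Rightarrow> bool"
  where "trace_class M A \<longleftrightarrow>
    bounded_op M A \<and>
    (\<exists>S E. is_absolute_value M A S \<and> orthonormal_basis M E \<and>
       (\<lambda>e. l2_inner M e (app_op S e)) summable_on E)"

definition op_trace :: "'a measure \<Rightarrow> 'a l2_operator \<Rightarrow> complex"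
  where "op_trace M A =
    (THE t. \<forall>E. orthonormal_basis M E \<longrightarrow> ((\<lambda>e. l2_inner M e (app_op A e)) has_sum t) E)"

text \<open>The domain of the inverse is the range, closed under almost everywhere equality.\<close>

definition op_inverse :: "'a measure \<Rightarrow> 'a l2_operator \<Rightarrow> 'a l2_operator"
  where "op_inverse M T =
    ({f \<in> L2 M. \<exists>g\<in>dom_op T. AE x in M. app_op T g x = f x},
     \<lambda>f. SOME g. g \<in> dom_op T \<and> (AE x in M. app_op T g x = f x))"

definition eigenspace :: "'a measure \<Rightarrow> 'a l2_operator \<Rightarrow> complex \<Rightarrow> ('a \<Rightarrow> complex) set"
  where "eigenspace M T lam = {g \<in> dom_op T. AE x in M. app_op T g x = lam * g x}"

definition eigenvalues :: "'a measure \<Rightarrow> 'a l2_operator \<Rightarrow> complex set"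
  where "eigenvalues M T = {lam. \<exists>g\<in>eigenspace M T lam. \<not> (AE x in M. g x = 0)}"

lemma vector_space_complex_fun: "vector_space (\<lambda>(c::complex) (f::'a \<Rightarrow> complex) x. c * f x)"
  by unfold_locales (auto simp: fun_eq_iff algebra_simps)

text \<open>
  The dimension is taken in the space of functions, not modulo null functions. It is therefore
  meant for operators whose domain contains only one representative of each element of \<open>L\<^sup>2(M)\<close>,
  as is the case for the Sturm--Liouville operators below.
\<close>

definition multiplicity_op :: "'a measure \<Rightarrow> 'a l2_operator \<Rightarrow> complex \<Rightarrow> nat"
  where "multiplicity_op M T lam =
    vector_space.dim (\<lambda>(c::complex) (f::'a \<Rightarrow> complex) x. c * f x) (eigenspace M T lam)"

text \<open>
  Negative eigenvalues are raised to the power \<open>-s\<close> with the principal branch; the choice of the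
  branch has no influence at integers \<open>s\<close>.
\<close>

definition zeta_term :: "'a measure \<Rightarrow> 'a l2_operator \<Rightarrow> complex \<Rightarrow> complex \<Rightarrow> complex"
  where "zeta_term M T s lam = of_nat (multiplicity_op M T lam) * lam powr (- s)"

definition spectral_zeta :: "'a measure \<Rightarrow> 'a l2_operator \<Rightarrow> complex \<Rightarrow> complex"
  where "spectral_zeta M T s = (\<Sum>\<^sub>\<infinity>lam\<in>eigenvalues M T - {0}. zeta_term M T s lam)"

definition AC_on :: "real \<Rightarrow> real \<Rightarrow> (real \<Rightarrow> complex) \<Rightarrow> bool"
  where "AC_on a b f \<longleftrightarrow>
    (\<forall>\<epsilon>>0. \<exists>\<delta>>0. \<forall>(n::nat) u v.
       (\<forall>i<n. a \<le> u i \<and> u i \<le> v i \<and> v i \<le> b) \<longrightarrow>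
       disjoint_family_on (\<lambda>i. {u i<..<v i}) {..<n} \<longrightarrow>
       (\<Sum>i<n. v i - u i) < \<delta> \<longrightarrow>
       (\<Sum>i<n. norm (f (v i) - f (u i))) < \<epsilon>)"

text \<open>
  A function on \<open>[a,b]\<close> is represented by its extension by \<open>0\<close> to the real line, so that functions
  on \<open>[a,b]\<close> agree iff they are equal. The quasi-derivative \<open>p g'\<close>, defined only almost everywhere,
  stands for its absolutely continuous representative on \<open>[a,b]\<close>.
\<close>

definition is_quasi_deriv ::
    "real \<Rightarrow> real \<Rightarrow> (real \<Rightarrow> real) \<Rightarrow> (real \<Rightarrow> complex) \<Rightarrow> (real \<Rightarrow> complex) \<Rightarrow> bool"
  where "is_quasi_deriv a b p g h \<longleftrightarrow>
    AC_on a b h \<and> (\<forall>x. x \<notin> {a..b} \<longrightarrow> h x = 0) \<and>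
    (AE x in lebesgue_on {a<..<b}. h x = of_real (p x) * vector_derivative g (at x))"

definition quasi_deriv ::
    "real \<Rightarrow> real \<Rightarrow> (real \<Rightarrow> real) \<Rightarrow> (real \<Rightarrow> complex) \<Rightarrow> (real \<Rightarrow> complex)"
  where "quasi_deriv a b p g = (THE h. is_quasi_deriv a b p g h)"

definition sl_regular :: "real \<Rightarrow> real \<Rightarrow> (real \<Rightarrow> real) \<Rightarrow> (real \<Rightarrow> complex) set"
  where "sl_regular a b p =
    {g. AC_on a b g \<and> (\<forall>x. x \<notin> {a..b} \<longrightarrow> g x = 0) \<and> (\<exists>h. is_quasi_deriv a b p g h)}"

definition sl_tau ::
    "real \<Rightarrow> real \<Rightarrow> (real \<Rightarrow> real) \<Rightarrow> (real \<Rightarrow> real) \<Rightarrow> (real \<Rightarrow> real) \<Rightarrow>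
     (real \<Rightarrow> complex) \<Rightarrow> (real \<Rightarrow> complex)"
  where "sl_tau a b p q r g = (\<lambda>x.
    (1 / of_real (r x)) *
      (- vector_derivative (quasi_deriv a b p g) (at x) + of_real (q x) * g x))"

definition sl_measure :: "real \<Rightarrow> real \<Rightarrow> (real \<Rightarrow> real) \<Rightarrow> real measure"
  where "sl_measure a b r = density (lebesgue_on {a<..<b}) (\<lambda>x. ennreal (r x))"

definition sl_Tmax ::
    "real \<Rightarrow> real \<Rightarrow> (real \<Rightarrow> real) \<Rightarrow> (real \<Rightarrow> real) \<Rightarrow> (real \<Rightarrow> real) \<Rightarrow> real l2_operator"
  where "sl_Tmax a b p q r =
    ({g \<in> L2 (sl_measure a b r). g \<in> sl_regular a b p \<and> sl_tau a b p q r g \<in> L2 (sl_measure a b r)},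
     sl_tau a b p q r)"

datatype sl_bc =
    Separated (sep_alpha: real) (sep_beta: real)
  | Coupled (cpl_phi: real) (cpl_R: "real^2^2")

fun sl_bc_admissible :: "sl_bc \<Rightarrow> bool"
  where
    "sl_bc_admissible (Separated \<alpha> \<beta>) \<longleftrightarrow> \<alpha> \<in> {0..<pi} \<and> \<beta> \<in> {0..<pi}"
  | "sl_bc_admissible (Coupled \<phi> R) \<longleftrightarrow> \<phi> \<in> {0..<pi} \<and> det R = 1"

fun sl_bc_holds :: "real \<Rightarrow> real \<Rightarrow> (real \<Rightarrow> real) \<Rightarrow> sl_bc \<Rightarrow> (real \<Rightarrow> complex) \<Rightarrow> bool"
  where
    "sl_bc_holds a b p (Separated \<alpha> \<beta>) g \<longleftrightarrow>
       g a * of_real (cos \<alpha>) + quasi_deriv a b p g a * of_real (sin \<alpha>) = 0 \<and>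
       g b * of_real (cos \<beta>) - quasi_deriv a b p g b * of_real (sin \<beta>) = 0"
  | "sl_bc_holds a b p (Coupled \<phi> R) g \<longleftrightarrow>
       g b = exp (\<i> * of_real \<phi>) *
         (of_real (R$1$1) * g a + of_real (R$1$2) * quasi_deriv a b p g a) \<and>
       quasi_deriv a b p g b = exp (\<i> * of_real \<phi>) *
         (of_real (R$2$1) * g a + of_real (R$2$2) * quasi_deriv a b p g a)"

definition sl_op ::
    "real \<Rightarrow> real \<Rightarrow> (real \<Rightarrow> real) \<Rightarrow> (real \<Rightarrow> real) \<Rightarrow> (real \<Rightarrow> real) \<Rightarrow> sl_bc \<Rightarrow>
     real l2_operator"
  where "sl_op a b p q r bc =
    ({g \<in> dom_op (sl_Tmax a b p q r). sl_bc_holds a b p bc g}, app_op (sl_Tmax a b p q r))"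

definition sl_solution ::
    "real \<Rightarrow> real \<Rightarrow> (real \<Rightarrow> real) \<Rightarrow> (real \<Rightarrow> real) \<Rightarrow> (real \<Rightarrow> real) \<Rightarrow>
     complex \<Rightarrow> (real \<Rightarrow> complex) \<Rightarrow> bool"
  where "sl_solution a b p q r z y \<longleftrightarrow>
    y \<in> sl_regular a b p \<and>
    (AE x in lebesgue_on {a<..<b}. sl_tau a b p q r y x = z * y x)"

definition sl_theta ::
    "real \<Rightarrow> real \<Rightarrow> (real \<Rightarrow> real) \<Rightarrow> (real \<Rightarrow> real) \<Rightarrow> (real \<Rightarrow> real) \<Rightarrow>
     complex \<Rightarrow> (real \<Rightarrow> complex)"
  where "sl_theta a b p q r z =
    (THE y. sl_solution a b p q r z y \<and> y a = 1 \<and> quasi_deriv a b p y a = 0)"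

definition sl_phi ::
    "real \<Rightarrow> real \<Rightarrow> (real \<Rightarrow> real) \<Rightarrow> (real \<Rightarrow> real) \<Rightarrow> (real \<Rightarrow> real) \<Rightarrow>
     complex \<Rightarrow> (real \<Rightarrow> complex)"
  where "sl_phi a b p q r z =
    (THE y. sl_solution a b p q r z y \<and> y a = 0 \<and> quasi_deriv a b p y a = 1)"

fun sl_char ::
    "real \<Rightarrow> real \<Rightarrow> (real \<Rightarrow> real) \<Rightarrow> (real \<Rightarrow> real) \<Rightarrow> (real \<Rightarrow> real) \<Rightarrow> sl_bc \<Rightarrow>
     complex \<Rightarrow> complex"
  where
    "sl_char a b p q r (Separated \<alpha> \<beta>) z =
       of_real (cos \<alpha>) *
         (- of_real (sin \<beta>) * quasi_deriv a b p (sl_phi a b p q r z) b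
          + of_real (cos \<beta>) * sl_phi a b p q r z b)
       - of_real (sin \<alpha>) *
         (- of_real (sin \<beta>) * quasi_deriv a b p (sl_theta a b p q r z) b
          + of_real (cos \<beta>) * sl_theta a b p q r z b)"
  | "sl_char a b p q r (Coupled \<phi> R) z =
       exp (\<i> * of_real \<phi>) *
         (of_real (R$1$2) * quasi_deriv a b p (sl_theta a b p q r z) b
          - of_real (R$2$2) * sl_theta a b p q r z b
          + of_real (R$2$1) * sl_phi a b p q r z b
          - of_real (R$1$1) * quasi_deriv a b p (sl_phi a b p q r z) b)
       + exp (2 * \<i> * of_real \<phi>) + 1"

end

theory Submission
  imports Defs "HOL-Real_Asymp.Real_Asymp"
begin

text \<open>
  The characteristic function \<open>F\<close> is the determinant of the boundary conditions evaluated on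
  \<open>\<theta>, \<phi>\<close>, so its zeros are the eigenvalues. At an eigenvalue \<open>\<mu>\<close> the order of the zero is
  the dimension of the kernel of that \<open>2 \<times> 2\<close> matrix: otherwise there would be an eigenfunction \<open>y\<close>
  and \<open>\<eta>\<close> in the domain with \<open>(T - \<mu>) \<eta> = y\<close>, and the symmetry of \<open>T\<close> gives \<open>\<langle>y, y\<rangle> = 0\<close>.

  A weighted Gronwall estimate gives \<open>\<bar>F z\<bar> \<le> exp (C (1 + \<bar>z\<bar>\<^sup>1\<^sup>/\<^sup>2))\<close>. For such a function, dividing
  out \<open>z\<close> to the power \<open>m0\<close> and the other zeros in \<open>\<bar>z\<bar> \<le> R\<close> leaves a function whose logarithm has, by
  the Borel--Caratheodory inequality, Taylor coefficients at \<open>0\<close> that tend to \<open>0\<close> as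
  \<open>R \<rightarrow> \<infinity>\<close>. Hence the coefficients of \<open>F'/F\<close> beyond the pole are minus the power sums of the reciprocal
  zeros, and comparing coefficients in \<open>F' = (F'/F) F\<close> gives the recursion for \<open>bn\<close>.

  If \<open>0\<close> is not an eigenvalue, \<open>T\<close> has a symmetric inverse, which is compact by Arzela--Ascoli, so
  that orthonormal bases of the eigenspaces together form an orthonormal basis of \<open>L\<^sup>2\<close>. The inverse is
  diagonal in it with summable eigenvalues.
\<close>

section \<open>Indefinite integrals and absolute continuity\<close>

text \<open>The coefficients \<open>p\<close>, \<open>q\<close>, \<open>r\<close> are only
  measurable and integrable in the stated sense, so the classical theory of differential equations
  with continuous coefficients does not apply. Everything is reduced to integral equations for a
  function and its quasi-derivative; this rests on Lebesgue's theorem that epsilon-delta absolute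
  continuity is the same as being an indefinite integral.

  Growth of order one would leave an exponential factor beside the product over the zeros, hence an
  unknown additive constant in the formula for n = 1. With order one half the remainder in the
  coefficient of index m is of size R^(1/2) / R^(m+1), which tends to 0 even for m = 0, and no
  Hadamard product has to be formed.

  The trace is defined through all orthonormal bases and through an absolute value of the operator.
  Diagonal form settles both: an absolutely convergent double sum gives the same value in every
  basis, and the absolute value is the diagonal operator with the absolute eigenvalues.\<close>

lemma negligible_not_has_vector_derivative_indefinite_integral:
  fixes f :: "real \<Rightarrow> 'a::euclidean_space"
  assumes f: "f integrable_on {a..b}"
  shows "negligible {x \<in> {a<..<b}. \<not> ((\<lambda>u. integral {a..u} f) has_vector_derivative f x) (at x)}"
proof -
  \<comment> \<open>A bad interval has x as an endpoint, and on it the mean of f misses f x by at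
    least 1/(k+1). If the derivative at x is not f x, then for some k there are arbitrarily short
    bad intervals at x, so each \<open>E k\<close> may be treated separately.\<close>
  define bad where "bad = (\<lambda>k::nat. \<lambda>x u v. u < v \<and> (x = u \<or> x = v) \<and> {u..v} \<subseteq> {a..b} \<and>
    norm ((v - u) *\<^sub>R f x - integral {u..v} f) * real (Suc k) \<ge> (v - u))"
  define E where "E = (\<lambda>k. {x \<in> {a<..<b}. \<forall>d>0. \<exists>u v. v - u < d \<and> bad k x u v})"
  have "negligible (E k)" for k
    unfolding negligible_outer_le
  proof (intro allI impI)
    fix e :: real assume e: "e > 0"
    then have e': "e / real (Suc k) > 0" by simp
    obtain \<gamma> where \<gamma>: "gauge \<gamma>"
      and H: "\<And>p. p tagged_partial_division_of cbox a b \<Longrightarrow> \<gamma> fine p \<Longrightarrow>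
        (\<Sum>(x,k)\<in>p. norm (measure lborel k *\<^sub>R f x - integral k f)) < e / real (Suc k)"
      by (rule Henstock_lemma[OF f[folded box_real(2)] e']) (rule that, auto)
    \<comment> \<open>The Vitali covering consists of bad intervals inside
      \<open>\<gamma> x\<close>. Every finite disjoint subfamily is then a fine partial division, so
      Henstock's lemma bounds the sum of its errors by e/(k+1), and badness turns this into a total
      length of at most e.\<close>
    define K0 where "K0 = {(x,u,v). bad k x u v \<and> {u..v} \<subseteq> \<gamma> x}"
    define ct where "ct = (\<lambda>(x::real,u::real,v). (u + v) / 2)"
    define rd where "rd = (\<lambda>(x::real,u::real,v). (v - u) / 2)"
    have cb: "cball (ct i) (rd i) = (case i of (x,u,v) \<Rightarrow> {u..v})" for i
      by (auto simp: ct_def rd_def cball_eq_atLeastAtMost field_simps split: prod.splits)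
    have r: "0 < rd i" if "i \<in> K0" for i
      using that by (auto simp: K0_def rd_def bad_def)
    have S: "\<exists>i. i \<in> K0 \<and> x \<in> cball (ct i) (rd i) \<and> rd i < d" if x: "x \<in> E k" "0 < d" for x d
    proof -
      obtain d' where d': "d' > 0" "ball x d' \<subseteq> \<gamma> x"
        using \<gamma> by (meson gauge_def open_contains_ball)
      with x obtain u v where uv: "v - u < min d d'" "bad k x u v"
        unfolding E_def using min_less_iff_conj[of 0 d d'] by blast
      have "{u..v} \<subseteq> ball x d'"
        using uv by (auto simp: bad_def dist_real_def)
      then show ?thesis
        using uv d' unfolding cb by (intro exI[of _ "(x,u,v)"]) (auto simp: K0_def bad_def rd_def)
    qed
    obtain C where C: "countable C" "C \<subseteq> K0"
       "pairwise (\<lambda>i j. disjnt (cball (ct i) (rd i)) (cball (ct j) (rd j))) C"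
       "negligible (E k - (\<Union>i \<in> C. cball (ct i) (rd i)))"
      by (rule Vitali_covering_theorem_cballs[of K0 rd "E k" ct, OF r S]) (assumption | rule that)+
    have bnd: "(\<Sum>i\<in>F. measure lebesgue (cball (ct i) (rd i))) \<le> e" if F: "F \<subseteq> C" "finite F" for F
    proof -
      define h where "h = (\<lambda>(x::real,u::real,v::real). (x, cbox u v))"
      have inj: "inj_on h F"
      proof (rule inj_onI)
        fix i j assume ij: "i \<in> F" "j \<in> F" "h i = h j"
        then have "cball (ct i) (rd i) = cball (ct j) (rd j)"
          by (auto simp: cb h_def split: prod.splits)
        moreover have "cball (ct i) (rd i) \<noteq> {}"
          using r[of i] ij F C by auto
        ultimately show "i = j"
          using C(3) ij F(1) unfolding pairwise_def disjnt_def by blast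
      qed
      have hF: "\<exists>u v. K = cbox u v \<and> x \<in> K \<and> K \<subseteq> cbox a b \<and> K \<subseteq> \<gamma> x" if "(x, K) \<in> h ` F" for x K
      proof -
        from that obtain i where i: "(x, K) = h i" "i \<in> F" by (rule imageE)
        obtain y u v where iy: "i = (y,u,v)" by (cases i)
        have "i \<in> K0" using subsetD[OF C(2) subsetD[OF F(1) i(2)]] .
        then have "bad k y u v" "{u..v} \<subseteq> \<gamma> y" by (simp_all add: K0_def iy)
        moreover have "x = y" "K = cbox u v" using i(1) by (simp_all add: h_def iy)
        ultimately have "K = cbox u v \<and> x \<in> K \<and> K \<subseteq> cbox a b \<and> K \<subseteq> \<gamma> x"
          by (auto simp: bad_def)
        then show ?thesis by blast
      qed
      have tp: "h ` F tagged_partial_division_of cbox a b"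
        unfolding tagged_partial_division_of_def
      proof (intro conjI allI impI)
        fix x1 k1 x2 k2
        assume A: "(x1, k1) \<in> h ` F \<and> (x2, k2) \<in> h ` F \<and> (x1, k1) \<noteq> (x2, k2)"
        then obtain i j where ij: "i \<in> F" "j \<in> F" "h i = (x1,k1)" "h j = (x2,k2)"
          unfolding image_iff by (elim conjE bexE) metis
        then have "i \<noteq> j" using A ij(3,4) by metis
        then have "disjnt (cball (ct i) (rd i)) (cball (ct j) (rd j))"
          using ij C(3) F(1) unfolding pairwise_def by blast
        moreover obtain y u v where iy: "i = (y,u,v)" by (cases i)
        moreover obtain y' u' v' where jy: "j = (y',u',v')" by (cases j)
        moreover have "k1 = {u..v}" using ij(3) by (simp add: iy h_def)
        moreover have "k2 = {u'..v'}" using ij(4) by (simp add: jy h_def)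
        ultimately have "k1 \<inter> k2 = {}"
          by (simp add: disjnt_def cb)
        then show "interior k1 \<inter> interior k2 = {}"
          using interior_subset by blast
      next
        show "finite (h ` F)" using F by blast
      next
        fix x K assume xK: "(x, K) \<in> h ` F"
        show "x \<in> K" "K \<subseteq> cbox a b" "\<exists>a b. K = cbox a b" using hF[OF xK] by blast+
      qed
      have "\<gamma> fine h ` F"
        using hF unfolding fine_def by blast
      with H[OF tp] have "(\<Sum>(x,k)\<in>h ` F. norm (measure lborel k *\<^sub>R f x - integral k f)) < e / real (Suc k)"
        by blast
      moreover have "(\<Sum>(x,k)\<in>h ` F. norm (measure lborel k *\<^sub>R f x - integral k f)) =
          sum ((\<lambda>(x,k). norm (measure lborel k *\<^sub>R f x - integral k f)) \<circ> h) F"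
        by (rule sum.reindex[OF inj])
      moreover have "\<dots> = (\<Sum>(x,u,v)\<in>F. norm ((v - u) *\<^sub>R f x - integral {u..v} f))"
      proof (rule sum.cong[OF refl])
        fix i assume i: "i \<in> F"
        obtain x u v where iu: "i = (x,u,v)" by (cases i)
        have "i \<in> K0" using subsetD[OF C(2) subsetD[OF F(1) i]] .
        then have "u < v" by (simp add: K0_def bad_def iu)
        then show "((\<lambda>(x, k). norm (measure lborel k *\<^sub>R f x - integral k f)) \<circ> h) i =
          (case i of (x, u, v) \<Rightarrow> norm ((v - u) *\<^sub>R f x - integral {u..v} f))"
          by (simp add: h_def iu)
      qed
      ultimately have *: "(\<Sum>(x,u,v)\<in>F. norm ((v - u) *\<^sub>R f x - integral {u..v} f)) < e / real (Suc k)"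
        by linarith
      have "(\<Sum>i\<in>F. measure lebesgue (cball (ct i) (rd i))) \<le>
          (\<Sum>(x,u,v)\<in>F. norm ((v - u) *\<^sub>R f x - integral {u..v} f) * real (Suc k))"
      proof (rule sum_mono)
        fix i assume i: "i \<in> F"
        obtain x u v where [simp]: "i = (x,u,v)" by (cases i)
        have "bad k x u v" using i F C by (auto simp: K0_def)
        then show "measure lebesgue (cball (ct i) (rd i)) \<le>
           (case i of (x,u,v) \<Rightarrow> norm ((v - u) *\<^sub>R f x - integral {u..v} f) * real (Suc k))"
          unfolding cb by (simp add: bad_def)
      qed
      also have "\<dots> = (\<Sum>(x,u,v)\<in>F. norm ((v - u) *\<^sub>R f x - integral {u..v} f)) * real (Suc k)"
        by (simp add: sum_distrib_right split_def)
      also have "\<dots> \<le> e"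
        using * by (simp add: field_simps del: of_nat_Suc)
      finally show ?thesis .
    qed
    have U0: "measure lebesgue (\<Union>i\<in>F. cball (ct i) (rd i)) \<le> e" if "F \<subseteq> C" "finite F" for F
      using measure_UNION_le[of F "\<lambda>i. cball (ct i) (rd i)" lebesgue] that bnd[of F] by fastforce
    have U: "(\<Union>i \<in> C. cball (ct i) (rd i)) \<in> lmeasurable"
       "measure lebesgue (\<Union>i \<in> C. cball (ct i) (rd i)) \<le> e"
      using fmeasurable_UN_bound[OF C(1) _ U0] measure_UN_bound[OF C(1) _ U0] by simp_all
    show "\<exists>T. E k \<subseteq> T \<and> T \<in> lmeasurable \<and> measure lebesgue T \<le> e"
    proof (intro exI conjI)
      let ?N = "E k - (\<Union>i \<in> C. cball (ct i) (rd i))"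
      show "E k \<subseteq> ?N \<union> (\<Union>i \<in> C. cball (ct i) (rd i))" by blast
      show "?N \<union> (\<Union>i \<in> C. cball (ct i) (rd i)) \<in> lmeasurable"
        using U C(4) negligible_imp_measurable by (blast intro: fmeasurable.Un)
      show "measure lebesgue (?N \<union> (\<Union>i \<in> C. cball (ct i) (rd i))) \<le> e"
        using U(2) measure_Un_le[of ?N lebesgue "\<Union>i \<in> C. cball (ct i) (rd i)"] C(4) U(1)
        by (simp add: negligible_imp_measure0 negligible_imp_sets fmeasurableD)
    qed
  qed
  then have "negligible (\<Union>k. E k)"
    by auto
  moreover have "((\<lambda>u. integral {a..u} f) has_vector_derivative f x) (at x)"
    if x: "x \<in> {a<..<b}" "x \<notin> (\<Union>k. E k)" for x
  proof -
    show ?thesis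
      unfolding has_vector_derivative_def has_derivative_at_alt
    proof (intro conjI allI impI bounded_linear_scaleR_left)
      fix e :: real assume "e > 0"
      then obtain k where k: "1 / real (Suc k) < e"
        by (metis nat_approx_posE)
      obtain d where d: "d > 0" "\<And>u v. v - u < d \<Longrightarrow> \<not> bad k x u v"
        using x unfolding E_def UN_iff mem_Collect_eq by blast
      define d' where "d' = min d (min (x - a) (b - x))"
      have d': "d' > 0" using d x by (auto simp: d'_def)
      show "\<exists>d>0. \<forall>y. norm (y - x) < d \<longrightarrow>
          norm (integral {a..y} f - integral {a..x} f - (y - x) *\<^sub>R f x) \<le> e * norm (y - x)"
      proof (intro exI conjI allI impI)
        fix y assume y: "norm (y - x) < d'"
        have ab: "a \<le> y" "y \<le> b" "a \<le> x" "x \<le> b"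
          using y x by (auto simp: d'_def)
        have small: "norm ((v - u) *\<^sub>R f x - integral {u..v} f) \<le> e * (v - u)"
          if "u < v" "x = u \<or> x = v" "{u..v} \<subseteq> {a..b}" "v - u < d" for u v
        proof -
          have "norm ((v - u) *\<^sub>R f x - integral {u..v} f) * real (Suc k) < v - u"
            using d(2)[OF that(4)] that(1-3) by (auto simp: bad_def)
          then have "norm ((v - u) *\<^sub>R f x - integral {u..v} f) \<le> 1 / real (Suc k) * (v - u)"
            by (simp add: field_simps del: of_nat_Suc)
          also have "\<dots> \<le> e * (v - u)"
            using k that by (intro mult_right_mono) auto
          finally show ?thesis .
        qed
        consider "y = x" | "y < x" | "y > x" by linarith
        then show "norm (integral {a..y} f - integral {a..x} f - (y - x) *\<^sub>R f x) \<le> e * norm (y - x)"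
        proof cases
          case 2
          have "integral {a..y} f + integral {y..x} f = integral {a..x} f"
            using 2 ab f by (intro Henstock_Kurzweil_Integration.integral_combine)
              (auto intro: integrable_on_subinterval)
          then have "integral {a..y} f - integral {a..x} f - (y - x) *\<^sub>R f x =
             (x - y) *\<^sub>R f x - integral {y..x} f"
            by (simp add: algebra_simps)
          with small[of y x] 2 ab y show ?thesis by (auto simp: d'_def)
        next
          case 3
          have "integral {a..x} f + integral {x..y} f = integral {a..y} f"
            using 3 ab f by (intro Henstock_Kurzweil_Integration.integral_combine)
              (auto intro: integrable_on_subinterval)
          then have "integral {a..y} f - integral {a..x} f - (y - x) *\<^sub>R f x =
             - ((y - x) *\<^sub>R f x - integral {x..y} f)"
            by (simp add: algebra_simps)
          with small[of x y] 3 ab y show ?thesis by (auto simp: d'_def norm_minus_commute)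
        qed auto
      qed (fact d')
    qed
  qed
  ultimately show ?thesis
    by (rule_tac negligible_subset[of "\<Union>(range E)"]) (assumption, blast)
qed

section \<open>Absolute continuity in the epsilon-delta sense\<close>

definition abs_cont_delta :: "real \<Rightarrow> real \<Rightarrow> (real \<Rightarrow> 'a::real_normed_vector) \<Rightarrow> real \<Rightarrow> real \<Rightarrow> bool"
  where "abs_cont_delta a b f \<epsilon> \<delta> \<longleftrightarrow>
    (\<forall>(n::nat) u v.
       (\<forall>i<n. a \<le> u i \<and> u i \<le> v i \<and> v i \<le> b) \<longrightarrow>
       disjoint_family_on (\<lambda>i. {u i<..<v i}) {..<n} \<longrightarrow>
       (\<Sum>i<n. v i - u i) < \<delta> \<longrightarrow>
       (\<Sum>i<n. norm (f (v i) - f (u i))) < \<epsilon>)"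

text \<open>Unlike \<open>AC_on\<close> this is available over any normed space: the decomposition
  into monotone parts works with real functions and reaches complex ones through real and imaginary
  parts.\<close>

definition abs_cont :: "real \<Rightarrow> real \<Rightarrow> (real \<Rightarrow> 'a::real_normed_vector) \<Rightarrow> bool"
  where "abs_cont a b f \<longleftrightarrow> (\<forall>\<epsilon>>0. \<exists>\<delta>>0. abs_cont_delta a b f \<epsilon> \<delta>)"

lemma AC_on_eq_abs_cont: "AC_on a b f = abs_cont a b f"
  by (simp add: AC_on_def abs_cont_def abs_cont_delta_def)

text \<open>Later families of intervals are indexed by the intervals themselves or by pairs;
  renumbering lifts the restriction to initial segments of the naturals.\<close>

lemma abs_cont_deltaD:
  fixes u v :: "'i \<Rightarrow> real"
  assumes "abs_cont_delta a b f \<epsilon> \<delta>" and I: "finite I"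
    and uv: "\<And>i. i \<in> I \<Longrightarrow> a \<le> u i \<and> u i \<le> v i \<and> v i \<le> b"
    and disj: "disjoint_family_on (\<lambda>i. {u i<..<v i}) I"
    and less: "(\<Sum>i\<in>I. v i - u i) < \<delta>"
  shows "(\<Sum>i\<in>I. norm (f (v i) - f (u i))) < \<epsilon>"
proof -
  obtain h where h: "bij_betw h {..<card I} I"
    using I by (metis bij_betw_from_nat_into_finite)
  have mem: "h i \<in> I" if "i < card I" for i
    using h that by (auto simp: bij_betw_def)
  have 1: "\<forall>i<card I. a \<le> (u \<circ> h) i \<and> (u \<circ> h) i \<le> (v \<circ> h) i \<and> (v \<circ> h) i \<le> b"
    using uv mem by auto
  have 2: "disjoint_family_on (\<lambda>i. {(u \<circ> h) i<..<(v \<circ> h) i}) {..<card I}"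
    unfolding disjoint_family_on_def
  proof (intro ballI impI)
    fix m n assume mn: "m \<in> {..<card I}" "n \<in> {..<card I}" "m \<noteq> n"
    then have "h m \<noteq> h n"
      using h by (auto simp: bij_betw_def inj_on_def)
    then show "{(u \<circ> h) m<..<(v \<circ> h) m} \<inter> {(u \<circ> h) n<..<(v \<circ> h) n} = {}"
      using disj mem mn unfolding disjoint_family_on_def comp_def by auto
  qed
  have 3: "(\<Sum>i<card I. (v \<circ> h) i - (u \<circ> h) i) = (\<Sum>i\<in>I. v i - u i)"
    using sum.reindex_bij_betw[OF h, of "\<lambda>i. v i - u i"] by simp
  have 4: "(\<Sum>i<card I. norm (f ((v \<circ> h) i) - f ((u \<circ> h) i))) = (\<Sum>i\<in>I. norm (f (v i) - f (u i)))"
    using sum.reindex_bij_betw[OF h, of "\<lambda>i. norm (f (v i) - f (u i))"] by simp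
  show ?thesis
    using assms(1)[unfolded abs_cont_delta_def, rule_format, of "card I" "u \<circ> h" "v \<circ> h"]
      1 2 3 4 less by auto
qed

lemma abs_cont_le:
  assumes "abs_cont a b f"
    and "\<And>x y. a \<le> x \<Longrightarrow> x \<le> y \<Longrightarrow> y \<le> b \<Longrightarrow> norm (g y - g x) \<le> norm (f y - f x)"
  shows "abs_cont a b g"
proof -
  have *: "(\<Sum>i<n. norm (g (v i) - g (u i))) \<le> (\<Sum>i<n. norm (f (v i) - f (u i)))"
    if "\<forall>i<n. a \<le> u i \<and> u i \<le> v i \<and> v i \<le> b" for n u v
    using assms(2) that by (intro sum_mono) auto
  show ?thesis
    unfolding abs_cont_def
  proof (intro allI impI)
    fix e :: real assume "e > 0"
    then obtain d where d: "d > 0" "abs_cont_delta a b f e d"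
      using assms(1) unfolding abs_cont_def by blast
    have "abs_cont_delta a b g e d"
      unfolding abs_cont_delta_def
    proof (intro allI impI)
      fix n :: nat and u v :: "nat \<Rightarrow> real"
      assume 1: "\<forall>i<n. a \<le> u i \<and> u i \<le> v i \<and> v i \<le> b"
        "disjoint_family_on (\<lambda>i. {u i<..<v i}) {..<n}" "(\<Sum>i<n. v i - u i) < d"
      then have "(\<Sum>i<n. norm (f (v i) - f (u i))) < e"
        using d(2) unfolding abs_cont_delta_def by blast
      then show "(\<Sum>i<n. norm (g (v i) - g (u i))) < e"
        using *[OF 1(1)] by linarith
    qed
    with d show "\<exists>\<delta>>0. abs_cont_delta a b g e \<delta>" by blast
  qed
qed

text \<open>A single estimate for differences, products and exponentials: in each case an increment
  of the new function is dominated by increments of the old ones.\<close>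

lemma abs_cont_comb:
  assumes "abs_cont a b f" "abs_cont a b g" "C \<ge> 0"
    and h: "\<And>x y. a \<le> x \<Longrightarrow> x \<le> y \<Longrightarrow> y \<le> b \<Longrightarrow>
       norm (h y - h x) \<le> C * (norm (f y - f x) + norm (g y - g x))"
  shows "abs_cont a b h"
  unfolding abs_cont_def
proof (intro allI impI)
  fix e :: real assume e: "e > 0"
  \<comment> \<open>The summand 1 covers C = 0 and makes the final inequality strict, since C / (C +
    1) < 1.\<close>
  define e' where "e' = e / (C + 1) / 2"
  have e': "e' > 0" using e assms(3) by (simp add: e'_def)
  obtain d1 d2 where d: "d1 > 0" "d2 > 0" "abs_cont_delta a b f e' d1" "abs_cont_delta a b g e' d2"
    using assms e' unfolding abs_cont_def by meson
  have "abs_cont_delta a b h e (min d1 d2)"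
    unfolding abs_cont_delta_def
  proof (intro allI impI)
    fix n :: nat and u v :: "nat \<Rightarrow> real"
    assume uv: "\<forall>i<n. a \<le> u i \<and> u i \<le> v i \<and> v i \<le> b"
      and dj: "disjoint_family_on (\<lambda>i. {u i<..<v i}) {..<n}"
      and sm: "(\<Sum>i<n. v i - u i) < min d1 d2"
    have F: "(\<Sum>i<n. norm (f (v i) - f (u i))) < e'" "(\<Sum>i<n. norm (g (v i) - g (u i))) < e'"
      using d uv dj sm unfolding abs_cont_delta_def by auto
    have "(\<Sum>i<n. norm (h (v i) - h (u i))) \<le>
        (\<Sum>i<n. C * (norm (f (v i) - f (u i)) + norm (g (v i) - g (u i))))"
      using h uv by (intro sum_mono) auto
    also have "\<dots> = C * ((\<Sum>i<n. norm (f (v i) - f (u i))) + (\<Sum>i<n. norm (g (v i) - g (u i))))"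
      by (simp add: distrib_left sum.distrib flip: sum_distrib_left)
    also have "\<dots> \<le> C * (e' + e')"
      using F assms(3) by (intro mult_left_mono) auto
    also have "\<dots> < e"
    proof -
      have "C * (e' + e') = e * (C / (C + 1))"
        unfolding e'_def field_sum_of_halves by simp
      also have "\<dots> < e * 1"
        using e assms(3) by (intro mult_strict_left_mono) auto
      finally show ?thesis by simp
    qed
    finally show "(\<Sum>i<n. norm (h (v i) - h (u i))) < e" .
  qed
  then show "\<exists>\<delta>>0. abs_cont_delta a b h e \<delta>"
    using d by (intro exI[of _ "min d1 d2"]) auto
qed

lemma abs_cont_continuous_on:
  assumes "abs_cont a b f"
  shows "continuous_on {a..b} f"
  unfolding continuous_on_iff
proof (intro ballI allI impI)
  fix x e :: real assume x: "x \<in> {a..b}" and e: "e > 0"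
  then obtain d where d: "d > 0" "abs_cont_delta a b f e d"
    using assms unfolding abs_cont_def by blast
  have *: "norm (f t - f s) < e" if "a \<le> s" "s \<le> t" "t \<le> b" "t - s < d" for s t
    using abs_cont_deltaD[OF d(2), of "{()}" "\<lambda>_. s" "\<lambda>_. t"] that
    by (auto simp: disjoint_family_on_def)
  have "dist (f x') (f x) < e" if "x' \<in> {a..b}" "dist x' x < d" for x'
    using *[of x x'] *[of x' x] x that by (cases "x \<le> x'") (auto simp: dist_norm norm_minus_commute)
  then show "\<exists>d>0. \<forall>x'\<in>{a..b}. dist x' x < d \<longrightarrow> dist (f x') (f x) < e"
    using d by blast
qed

text \<open>A null set in [a,b] is covered by intervals with disjoint interiors and total length
  below delta. Absolute continuity bounds the Stieltjes measure of every finite union of them, hence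
  of the whole cover, by epsilon. Monotonicity and continuity on the whole line are what the
  formulas for \<open>interval_measure\<close> ask for.\<close>

lemma mono_abs_cont_absolutely_continuous:
  fixes F :: "real \<Rightarrow> real"
  assumes ac: "abs_cont a b F" and "a \<le> b"
    and mono: "\<And>x y. x \<le> y \<Longrightarrow> F x \<le> F y" and cont: "continuous_on UNIV F"
  shows "absolutely_continuous lborel (density (interval_measure F) (indicator {a..b}))"
  unfolding absolutely_continuous_def
proof
  let ?N = "interval_measure F"
  have Icc: "emeasure ?N {x..y} = ennreal (F y - F x)" if "x \<le> y" for x y
    using emeasure_interval_measure_Icc[OF that mono cont] by simp
  fix A :: "real set" assume A: "A \<in> null_sets lborel"
  define B where "B = A \<inter> {a..b}"
  have Bb: "B \<in> sets borel" using A by (auto simp: B_def)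
  have Bn: "negligible B"
    using A negligible_iff_null_sets null_sets_completion_iff2 unfolding B_def
    by (metis inf_le1 negligible_subset null_sets_completionI)
  have fB: "B \<in> fmeasurable ?N"
  proof (rule fmeasurableI2)
    show "{a..b} \<in> fmeasurable ?N"
      using \<open>a \<le> b\<close> by (intro fmeasurableI) (auto simp: Icc)
  qed (use Bb in \<open>auto simp: B_def\<close>)
  have "measure ?N B \<le> e" if e: "e > 0" for e
  proof -
    obtain d where d: "d > 0" "abs_cont_delta a b F e d"
      using ac e unfolding abs_cont_def by blast
    have d2: "d / 2 > 0" using d by simp
    have Bl: "B \<in> lmeasurable" "B \<subseteq> cbox a b"
      using Bn negligible_imp_measurable by (auto simp: B_def)
    obtain \<D> where D: "countable \<D>"
        "\<And>K. K \<in> \<D> \<Longrightarrow> K \<subseteq> cbox a b \<and> K \<noteq> {} \<and> (\<exists>c d. K = cbox c d)"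
        "pairwise (\<lambda>A B. interior A \<inter> interior B = {}) \<D>"
        "B \<subseteq> \<Union>\<D>" "\<Union>\<D> \<in> lmeasurable" "measure lebesgue (\<Union>\<D>) \<le> measure lebesgue B + d / 2"
      by (rule measurable_outer_intervals_bounded[OF Bl d2]) (rule that, assumption+)
    define lo where "lo = (\<lambda>K::real set. Inf K)"
    define hi where "hi = (\<lambda>K::real set. Sup K)"
    have K: "K = {lo K..hi K} \<and> a \<le> lo K \<and> lo K \<le> hi K \<and> hi K \<le> b" if K: "K \<in> \<D>" for K
    proof -
      obtain c e where ce: "K = {c..e}" using D(2)[OF K] by auto
      with D(2)[OF K] show ?thesis by (auto simp: lo_def hi_def)
    qed
    have fin: "measure ?N (\<Union>\<F>) \<le> e" if F: "\<F> \<subseteq> \<D>" "finite \<F>" for \<F>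
    proof -
      have dj: "disjoint_family_on (\<lambda>K. {lo K<..<hi K}) \<F>"
        unfolding disjoint_family_on_def
      proof (intro ballI impI)
        fix m n assume mn: "m \<in> \<F>" "n \<in> \<F>" "m \<noteq> n"
        then have "interior m \<inter> interior n = {}"
          using D(3) F unfolding pairwise_def by blast
        moreover have "interior m = {lo m<..<hi m}" "interior n = {lo n<..<hi n}"
          using K mn F by (metis interior_atLeastAtMost_real subsetD)+
        ultimately show "{lo m<..<hi m} \<inter> {lo n<..<hi n} = {}" by simp
      qed
      have "(\<Sum>K\<in>\<F>. hi K - lo K) = (\<Sum>K\<in>\<F>. measure lebesgue {lo K<..<hi K})"
        using K F by (intro sum.cong) auto
      also have "\<dots> = measure lebesgue (\<Union>K\<in>\<F>. {lo K<..<hi K})"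
        using dj F K by (intro measure_finite_Union[symmetric]) (auto dest: K simp: subset_iff)
      also have "\<dots> \<le> measure lebesgue (\<Union>\<D>)"
      proof (rule measure_mono_fmeasurable)
        show "(\<Union>K\<in>\<F>. {lo K<..<hi K}) \<subseteq> \<Union>\<D>"
          using K F by fastforce
        show "(\<Union>K\<in>\<F>. {lo K<..<hi K}) \<in> sets lebesgue"
          using F by (intro sets.finite_UN) auto
      qed (use D in auto)
      also have "\<dots> < d"
        using D(6) Bn d by (simp add: negligible_imp_measure0)
      finally have lt: "(\<Sum>K\<in>\<F>. hi K - lo K) < d" .
      have "(\<Sum>K\<in>\<F>. norm (F (hi K) - F (lo K))) < e"
        using F K by (intro abs_cont_deltaD[OF d(2)] dj lt) auto
      moreover have "measure ?N (\<Union>K\<in>\<F>. {lo K..hi K}) \<le> (\<Sum>K\<in>\<F>. measure ?N {lo K..hi K})"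
        using F by (intro measure_UNION_le) auto
      moreover have "(\<Sum>K\<in>\<F>. measure ?N {lo K..hi K}) = (\<Sum>K\<in>\<F>. norm (F (hi K) - F (lo K)))"
        using K F mono by (intro sum.cong refl) (subst measure_def, subst Icc, auto)
      moreover have "(\<Union>K\<in>\<F>. {lo K..hi K}) = \<Union>\<F>"
        using K F by fastforce
      ultimately show ?thesis by simp
    qed
    have mb: "K \<in> fmeasurable ?N" if "K \<in> \<D>" for K
    proof -
      have "{lo K..hi K} \<in> fmeasurable ?N"
        using K[OF that, THEN conjunct2] by (intro fmeasurableI) (auto simp: Icc)
      then show ?thesis by (simp only: K[OF that, THEN conjunct1, symmetric])
    qed
    have "(\<Union>K\<in>\<D>. K) \<in> fmeasurable ?N" "measure ?N (\<Union>K\<in>\<D>. K) \<le> e"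
      using fmeasurable_UN_bound[of \<D> "\<lambda>K. K" ?N e] measure_UN_bound[of \<D> "\<lambda>K. K" ?N e] D(1) mb fin
      by simp_all
    moreover have "measure ?N B \<le> measure ?N (\<Union>K\<in>\<D>. K)"
      using D(4) fB calculation(1) by (intro measure_mono_fmeasurable) auto
    ultimately show ?thesis by linarith
  qed
  then have "measure ?N B \<le> 0"
    by (rule field_le_epsilon[of _ 0, simplified])
  then have "emeasure ?N B = 0"
    using fB by (simp add: emeasure_eq_measure2 measure_le_0_iff)
  then show "A \<in> null_sets (density ?N (indicator {a..b}))"
    using A Bb by (auto simp: null_sets_def emeasure_density B_def nn_integral_indicator
        simp flip: indicator_inter_arith mult.commute[of "indicator A _"])
qed

text \<open>The integrand is the Radon-Nikodym density of the Stieltjes measure of \<open>F\<close>,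
  which gives [a,x] the mass F x - F a.\<close>

lemma mono_abs_cont_imp_indefinite_integral:
  fixes F :: "real \<Rightarrow> real"
  assumes "a \<le> b" and ac: "abs_cont a b F"
    and mono: "\<And>x y. a \<le> x \<Longrightarrow> x \<le> y \<Longrightarrow> y \<le> b \<Longrightarrow> F x \<le> F y"
  shows "\<exists>g. g absolutely_integrable_on {a..b} \<and> (\<forall>x\<in>{a..b}. F x = F a + integral {a..x} g)"
proof -
  \<comment> \<open>Freezing \<open>F\<close> at its endpoint values outside [a,b] makes it monotone
    and continuous on the whole line.\<close>
  define F' where "F' = (\<lambda>x. F (max a (min b x)))"
  have F'[simp]: "F' x = F x" if "x \<in> {a..b}" for x
    using that by (auto simp: F'_def)
  have mono': "F' x \<le> F' y" if "x \<le> y" for x y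
    unfolding F'_def using that \<open>a \<le> b\<close> by (intro mono) auto
  have cont': "continuous_on UNIV F'"
    unfolding F'_def
    by (rule continuous_on_compose2[OF abs_cont_continuous_on[OF ac]])
      (use \<open>a \<le> b\<close> in \<open>auto intro!: continuous_intros\<close>)
  have ac': "abs_cont a b F'"
    by (rule abs_cont_le[OF ac]) auto
  let ?N = "density (interval_measure F') (indicator {a..b})"
  have absc: "absolutely_continuous lborel ?N"
    by (rule mono_abs_cont_absolutely_continuous[OF ac' \<open>a \<le> b\<close> mono' cont'])
  have "\<exists>f\<in>borel_measurable lborel. density lborel f = ?N"
    using absc by (intro sigma_finite_measure.Radon_Nikodym lborel.sigma_finite_measure_axioms) simp_all
  then obtain f where f: "f \<in> borel_measurable borel" "density lborel f = ?N"
    by auto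
  have N: "(\<integral>\<^sup>+t. f t * indicator {a..x} t \<partial>lborel) = ennreal (F x - F a)" if x: "x \<in> {a..b}" for x
  proof -
    have "(\<integral>\<^sup>+t. f t * indicator {a..x} t \<partial>lborel) = emeasure ?N {a..x}"
      using f(1) unfolding f(2)[symmetric] by (simp add: emeasure_density)
    also have "\<dots> = (\<integral>\<^sup>+t. indicator {a..x} t \<partial>interval_measure F')"
    proof -
      have "(\<lambda>t. indicator {a..b} t * indicator {a..x} t :: ennreal) = indicator {a..x}"
        using x by (auto simp: indicator_def fun_eq_iff)
      then show ?thesis by (simp add: emeasure_density)
    qed
    also have "\<dots> = ennreal (F x - F a)"
      using emeasure_interval_measure_Icc[OF _ mono' cont', of a x] x by simp
    finally show ?thesis .
  qed
  have fin: "AE t in lborel. f t * indicator {a..b} t \<noteq> \<infinity>"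
    using N[of b] \<open>a \<le> b\<close> f by (intro nn_integral_PInf_AE) auto
  define g where "g = (\<lambda>t. enn2real (f t))"
  have gm: "g \<in> borel_measurable borel"
    using f by (simp add: g_def)
  have hb: "has_bochner_integral lborel (\<lambda>t. indicator {a..x} t *\<^sub>R g t) (F x - F a)" if x: "x \<in> {a..b}" for x
  proof (rule has_bochner_integral_nn_integral)
    have "(\<integral>\<^sup>+t. ennreal (indicator {a..x} t *\<^sub>R g t) \<partial>lborel) = (\<integral>\<^sup>+t. f t * indicator {a..x} t \<partial>lborel)"
    proof (rule nn_integral_cong_AE, use fin in eventually_elim)
      case (elim t)
      then show ?case
        using x by (auto simp: g_def indicator_def less_top ennreal_enn2real split: if_splits)
    qed
    then show "(\<integral>\<^sup>+t. ennreal (indicator {a..x} t *\<^sub>R g t) \<partial>lborel) = ennreal (F x - F a)"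
      using N[OF x] by simp
    show "0 \<le> F x - F a" using mono[of a x] x by simp
  qed (use gm in \<open>auto simp: g_def\<close>)
  have si: "set_integrable lborel {a..x} g" and ie: "integral {a..x} g = F x - F a" if x: "x \<in> {a..b}" for x
  proof -
    show si: "set_integrable lborel {a..x} g"
      using hb[OF x] unfolding set_integrable_def by (rule integrable.intros)
    show "integral {a..x} g = F x - F a"
      using set_borel_integral_eq_integral(2)[OF si] hb[OF x]
      by (simp add: set_lebesgue_integral_def has_bochner_integral_integral_eq)
  qed
  have "g absolutely_integrable_on {a..b}"
    using si[of b] \<open>a \<le> b\<close> gm unfolding set_integrable_def
    by (subst integrable_completion) auto
  then show ?thesis
    using ie by (intro exI[of _ g]) auto
qed

text \<open>The increments are signed and the intervals need not exhaust [x,y], so increments of the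
  wrong sign can be left out: the supremum is the positive variation, not the total one.\<close>

definition var_sums :: "(real \<Rightarrow> real) \<Rightarrow> real \<Rightarrow> real \<Rightarrow> real set"
  where "var_sums f x y = {s. \<exists>(I::nat set) u v. finite I \<and> (\<forall>i\<in>I. x \<le> u i \<and> u i \<le> v i \<and> v i \<le> y) \<and>
     disjoint_family_on (\<lambda>i. {u i<..<v i}) I \<and> s = (\<Sum>i\<in>I. f (v i) - f (u i))}"

lemma var_sumsI:
  assumes "finite I" "\<And>i. i \<in> I \<Longrightarrow> x \<le> u i \<and> u i \<le> v i \<and> v i \<le> y"
    "disjoint_family_on (\<lambda>i. {u i<..<v i}) (I::nat set)"
  shows "(\<Sum>i\<in>I. f (v i) - f (u i)) \<in> var_sums f x y"
  using assms unfolding var_sums_def by blast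

lemma var_sumsE:
  assumes "s \<in> var_sums f x y"
  obtains I :: "nat set" and u v where "finite I" "\<forall>i\<in>I. x \<le> u i \<and> u i \<le> v i \<and> v i \<le> y"
    "disjoint_family_on (\<lambda>i. {u i<..<v i}) I" "s = (\<Sum>i\<in>I. f (v i) - f (u i))"
  using assms unfolding var_sums_def by blast

lemma zero_in_var_sums: "0 \<in> var_sums f x y"
  using var_sumsI[of "{}" x "\<lambda>_. 0" "\<lambda>_. 0" y f] by (simp add: disjoint_family_on_def)

text \<open>This is what makes the positive variation minus \<open>f\<close> monotone: [y,z] can be
  added to any family inside [x,y].\<close>

lemma var_sums_append:
  assumes "s \<in> var_sums f x y" "x \<le> y" "y \<le> z"
  shows "s + (f z - f y) \<in> var_sums f x z"
proof -
  obtain I :: "nat set" and u v where I: "finite I" "\<forall>i\<in>I. x \<le> u i \<and> u i \<le> v i \<and> v i \<le> y"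
    "disjoint_family_on (\<lambda>i. {u i<..<v i}) I" "s = (\<Sum>i\<in>I. f (v i) - f (u i))"
    using assms(1) by (rule var_sumsE)
  note I2 = bspec[OF I(2)]
  obtain k where k: "k \<notin> I" using I(1) ex_new_if_finite infinite_UNIV_nat by blast
  define u' where "u' = u(k := y)"
  define v' where "v' = v(k := z)"
  have "(\<Sum>i\<in>insert k I. f (v' i) - f (u' i)) \<in> var_sums f x z"
  proof (rule var_sumsI)
    show "x \<le> u' i \<and> u' i \<le> v' i \<and> v' i \<le> z" if "i \<in> insert k I" for i
      using I2[of i] that assms k by (auto simp: u'_def v'_def)
    show "disjoint_family_on (\<lambda>i. {u' i<..<v' i}) (insert k I)"
      unfolding disjoint_family_on_def
    proof (intro ballI impI)
      fix m n assume mn: "m \<in> insert k I" "n \<in> insert k I" "m \<noteq> n"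
      consider "m \<in> I" "n \<in> I" | "m = k" "n \<in> I" | "n = k" "m \<in> I" using mn by auto
      then show "{u' m<..<v' m} \<inter> {u' n<..<v' n} = {}"
      proof cases
        case 1
        then have "m \<noteq> k" "n \<noteq> k" using k by auto
        with 1 I(3) mn(3) show ?thesis
          unfolding disjoint_family_on_def u'_def v'_def by auto
      next
        case 2
        then show ?thesis using I2[of n] k by (force simp: u'_def v'_def)
      next
        case 3
        then show ?thesis using I2[of m] k by (force simp: u'_def v'_def)
      qed
    qed
  qed (use I in auto)
  moreover have "(\<Sum>i\<in>insert k I. f (v' i) - f (u' i)) = (f z - f y) + s"
  proof -
    have "(\<Sum>i\<in>I. f (v' i) - f (u' i)) = s"
      unfolding I(4) using k by (intro sum.cong) (auto simp: u'_def v'_def)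
    then show ?thesis using I(1) k by (simp add: u'_def v'_def)
  qed
  ultimately show ?thesis by (simp add: add.commute)
qed

text \<open>Clamping every interval at \<open>y\<close> from either side works since
  \<open>f (min t y) + f (max t y) = f t + f y\<close>.\<close>

lemma var_sums_split:
  assumes "s \<in> var_sums f x z" "x \<le> y" "y \<le> z"
  obtains s1 s2 where "s1 \<in> var_sums f x y" "s2 \<in> var_sums f y z" "s = s1 + s2"
proof -
  obtain I :: "nat set" and u v where I: "finite I" "\<forall>i\<in>I. x \<le> u i \<and> u i \<le> v i \<and> v i \<le> z"
    "disjoint_family_on (\<lambda>i. {u i<..<v i}) I" "s = (\<Sum>i\<in>I. f (v i) - f (u i))"
    using assms(1) by (rule var_sumsE)
  note I2 = bspec[OF I(2)]
  show ?thesis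
  proof
    show "(\<Sum>i\<in>I. f (min (v i) y) - f (min (u i) y)) \<in> var_sums f x y"
    proof (rule var_sumsI)
      show "disjoint_family_on (\<lambda>i. {min (u i) y<..<min (v i) y}) I"
        using I(3) unfolding disjoint_family_on_def by fastforce
      show "x \<le> min (u i) y \<and> min (u i) y \<le> min (v i) y \<and> min (v i) y \<le> y" if "i \<in> I" for i
        using I2[OF that] assms by auto
    qed fact
    show "(\<Sum>i\<in>I. f (max (v i) y) - f (max (u i) y)) \<in> var_sums f y z"
    proof (rule var_sumsI)
      show "disjoint_family_on (\<lambda>i. {max (u i) y<..<max (v i) y}) I"
        using I(3) unfolding disjoint_family_on_def by fastforce
      show "y \<le> max (u i) y \<and> max (u i) y \<le> max (v i) y \<and> max (v i) y \<le> z" if "i \<in> I" for i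
        using I2[OF that] assms by auto
    qed fact
    show "s = (\<Sum>i\<in>I. f (min (v i) y) - f (min (u i) y)) + (\<Sum>i\<in>I. f (max (v i) y) - f (max (u i) y))"
      unfolding I(4) sum.distrib[symmetric]
      by (intro sum.cong) (auto simp: min_def max_def)
  qed
qed

lemma disjoint_intervals_length_le:
  fixes u v :: "'i \<Rightarrow> real"
  assumes "finite I" "\<And>i. i \<in> I \<Longrightarrow> x \<le> u i \<and> u i \<le> v i \<and> v i \<le> y"
    "disjoint_family_on (\<lambda>i. {u i<..<v i}) I" "x \<le> y"
  shows "(\<Sum>i\<in>I. v i - u i) \<le> y - x"
proof -
  have "(\<Sum>i\<in>I. v i - u i) = (\<Sum>i\<in>I. measure lebesgue {u i<..<v i})"
    using assms(2) by (intro sum.cong) auto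
  also have "\<dots> = measure lebesgue (\<Union>i\<in>I. {u i<..<v i})"
    using assms by (intro measure_finite_Union[symmetric]) (auto dest: assms(2) simp: subset_iff)
  also have "\<dots> \<le> measure lebesgue {x..y}"
  proof (rule measure_mono_fmeasurable)
    show "(\<Union>i\<in>I. {u i<..<v i}) \<subseteq> {x..y}"
      using assms(2) by fastforce
    show "(\<Union>i\<in>I. {u i<..<v i}) \<in> sets lebesgue"
      using assms(1) by (intro sets.finite_UN) auto
  qed simp
  finally show ?thesis using assms(4) by simp
qed

text \<open>On a piece shorter than the delta belonging to epsilon = 1 every sum is at most 1, so
  the number of pieces bounds the sums over [a,b].\<close>

lemma bdd_above_var_sums:
  assumes "abs_cont a b f" "a \<le> b"
  shows "bdd_above (var_sums f a b)"
proof -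
  obtain d where d: "d > 0" "abs_cont_delta a b f 1 d"
    using assms(1) unfolding abs_cont_def by (meson zero_less_one)
  have step: "s \<le> 1" if s: "s \<in> var_sums f x y" and xy: "a \<le> x" "x \<le> y" "y \<le> b" "y - x < d" for x y s
  proof -
    obtain I :: "nat set" and u v where I: "finite I" "\<forall>i\<in>I. x \<le> u i \<and> u i \<le> v i \<and> v i \<le> y"
      "disjoint_family_on (\<lambda>i. {u i<..<v i}) I" "s = (\<Sum>i\<in>I. f (v i) - f (u i))"
      using s by (rule var_sumsE)
  note I2 = bspec[OF I(2)]
    have "(\<Sum>i\<in>I. v i - u i) < d"
      using disjoint_intervals_length_le[OF I(1) I2 I(3)] xy by linarith
    then have "(\<Sum>i\<in>I. norm (f (v i) - f (u i))) < 1"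
      using I(1,3) I2 xy by (intro abs_cont_deltaD[OF d(2)]) (auto intro: order_trans dest: I2)
    moreover have "s \<le> (\<Sum>i\<in>I. norm (f (v i) - f (u i)))"
      unfolding I(4) by (intro sum_mono) auto
    ultimately show ?thesis by linarith
  qed
  \<comment> \<open>A grid of mesh d/2, safely below d, cut off at b; it reaches b after finitely
    many steps.\<close>
  define t where "t = (\<lambda>k::nat. min b (a + real k * (d / 2)))"
  have tt: "a \<le> t k" "t k \<le> t (Suc k)" "t (Suc k) \<le> b" "t (Suc k) - t k < d" for k
  proof -
    define c where "c = real k * (d / 2)"
    have "t k = min b (a + c)" "t (Suc k) = min b (a + c + d / 2)" "c \<ge> 0"
      using d(1) by (simp_all add: t_def c_def field_simps)
    then show "a \<le> t k" "t k \<le> t (Suc k)" "t (Suc k) \<le> b" "t (Suc k) - t k < d"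
      using d(1) assms(2) by (auto simp: min_def)
  qed
  have "\<forall>s\<in>var_sums f a (t k). s \<le> real (Suc k)" for k
  proof (induction k)
    case 0
    then show ?case using step[of _ a a] assms d by (auto simp: t_def)
  next
    case (Suc k)
    show ?case
    proof
      fix s assume "s \<in> var_sums f a (t (Suc k))"
      then obtain s1 s2 where "s1 \<in> var_sums f a (t k)" "s2 \<in> var_sums f (t k) (t (Suc k))" "s = s1 + s2"
        using var_sums_split tt by metis
      with Suc step[of s2 "t k" "t (Suc k)"] tt show "s \<le> real (Suc (Suc k))"
        by fastforce
    qed
  qed
  moreover obtain k where "real k > (b - a) / (d / 2)"
    using reals_Archimedean2 by blast
  then have "t k = b" using d(1) by (simp add: t_def field_simps min_def)
  ultimately show ?thesis unfolding bdd_above_def by metis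
qed

lemma abs_cont_subinterval:
  assumes "abs_cont a b f" "a \<le> c" "d \<le> b"
  shows "abs_cont c d f"
proof -
  have "abs_cont_delta c d f e \<delta>" if "abs_cont_delta a b f e \<delta>" for e \<delta>
    using that assms(2,3) unfolding abs_cont_delta_def by (meson order_trans)
  then show ?thesis using assms(1) unfolding abs_cont_def by blast
qed

text \<open>Jordan decomposition: f = W - (W - f) with monotone, absolutely continuous parts. For
  the absolute continuity of \<open>W\<close>, nearly optimal families inside the given intervals
  are merged into one disjoint family, to which the condition on \<open>f\<close> applies.\<close>

lemma abs_cont_positive_variation:
  assumes ac: "abs_cont a b f" and ab: "a \<le> b"
  defines "W \<equiv> \<lambda>x. Sup (var_sums f a x)"
  shows "abs_cont a b W"
    and "\<And>x y. a \<le> x \<Longrightarrow> x \<le> y \<Longrightarrow> y \<le> b \<Longrightarrow> W x \<le> W y"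
    and "\<And>x y. a \<le> x \<Longrightarrow> x \<le> y \<Longrightarrow> y \<le> b \<Longrightarrow> W x - f x \<le> W y - f y"
proof -
  have bdd: "bdd_above (var_sums f a x)" if "x \<in> {a..b}" for x
    using bdd_above_var_sums[OF abs_cont_subinterval[OF ac, of a x]] that by auto
  have ne: "var_sums f x y \<noteq> {}" for x y
    using zero_in_var_sums by blast
  have up: "s \<le> W x" if "s \<in> var_sums f a x" "x \<in> {a..b}" for s x
    unfolding W_def using that bdd by (intro cSup_upper) auto
  show mono1: "W x \<le> W y" if "a \<le> x" "x \<le> y" "y \<le> b" for x y
    unfolding W_def
  proof (rule cSup_subset_mono)
    show "var_sums f a x \<subseteq> var_sums f a y"
      using that unfolding var_sums_def by (blast intro: order_trans)
  qed (use that ne bdd in auto)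
  show "W x - f x \<le> W y - f y" if "a \<le> x" "x \<le> y" "y \<le> b" for x y
  proof -
    have "W x \<le> W y - (f y - f x)"
      unfolding W_def
    proof (rule cSup_least)
      fix s assume "s \<in> var_sums f a x"
      then have "s + (f y - f x) \<in> var_sums f a y"
        using that by (intro var_sums_append)
      then show "s \<le> Sup (var_sums f a y) - (f y - f x)"
        using up[of _ y] that unfolding W_def by fastforce
    qed (fact ne)
    then show ?thesis by simp
  qed
  have approx: "\<exists>s\<in>var_sums f x y. W y - W x \<le> s + h" if xyh: "a \<le> x" "x \<le> y" "y \<le> b" "h > 0" for x y h
  proof -
    have "y \<in> {a..b}" "W y - h < Sup (var_sums f a y)" using that by (auto simp: W_def)
    then obtain s where s: "s \<in> var_sums f a y" "W y - h < s"
      using less_cSup_iff[OF ne bdd, of y "W y - h"] by blast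
    obtain s1 s2 where "s1 \<in> var_sums f a x" "s2 \<in> var_sums f x y" "s = s1 + s2"
      by (rule var_sums_split[OF s(1) xyh(1,2)])
    with s up[of s1 x] that show ?thesis by (intro bexI[of _ s2]) auto
  qed
  show "abs_cont a b W"
    unfolding abs_cont_def
  proof (intro allI impI)
    fix e :: real assume e: "e > 0"
    then obtain d where d: "d > 0" "abs_cont_delta a b f (e / 2) d"
      using ac unfolding abs_cont_def by (meson half_gt_zero)
    have "abs_cont_delta a b W e d"
      unfolding abs_cont_delta_def
    proof (intro allI impI)
      fix n :: nat and x y :: "nat \<Rightarrow> real"
      assume xy: "\<forall>i<n. a \<le> x i \<and> x i \<le> y i \<and> y i \<le> b"
        and dj: "disjoint_family_on (\<lambda>i. {x i<..<y i}) {..<n}"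
        and sm: "(\<Sum>i<n. y i - x i) < d"
      \<comment> \<open>Each of the n intervals may lose h against its supremum. The total loss is
        at most e/2, and the other half is granted to \<open>f\<close>.\<close>
      define h where "h = e / (2 * real (Suc n))"
      have h: "h > 0" using e by (simp add: h_def)
      have "\<forall>j\<in>{..<n}. \<exists>s\<in>var_sums f (x j) (y j). W (y j) - W (x j) \<le> s + h"
        using xy approx h by auto
      then obtain s where s: "\<And>j. j < n \<Longrightarrow> s j \<in> var_sums f (x j) (y j)"
          "\<And>j. j < n \<Longrightarrow> W (y j) - W (x j) \<le> s j + h"
        by (metis lessThan_iff)
      have "\<forall>j\<in>{..<n}. \<exists>(I::nat set) u v. finite I \<and> (\<forall>i\<in>I. x j \<le> u i \<and> u i \<le> v i \<and> v i \<le> y j) \<and>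
         disjoint_family_on (\<lambda>i. {u i<..<v i}) I \<and> s j = (\<Sum>i\<in>I. f (v i) - f (u i))"
        using s(1) unfolding var_sums_def by blast
      then obtain I :: "nat \<Rightarrow> nat set" and u v where I: "\<And>j. j < n \<Longrightarrow> finite (I j)"
         "\<And>j i. j < n \<Longrightarrow> i \<in> I j \<Longrightarrow> x j \<le> u j i \<and> u j i \<le> v j i \<and> v j i \<le> y j"
         "\<And>j. j < n \<Longrightarrow> disjoint_family_on (\<lambda>i. {u j i<..<v j i}) (I j)"
         "\<And>j. j < n \<Longrightarrow> s j = (\<Sum>i\<in>I j. f (v j i) - f (u j i))"
        unfolding bchoice_iff lessThan_iff by blast
      let ?K = "SIGMA j:{..<n}. I j"
      have dj': "disjoint_family_on (\<lambda>(j,i). {u j i<..<v j i}) ?K"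
        unfolding disjoint_family_on_def
      proof (intro ballI impI)
        fix k l assume kl: "k \<in> ?K" "l \<in> ?K" "k \<noteq> l"
        obtain j i j' i' where [simp]: "k = (j,i)" "l = (j',i')" by (cases k, cases l)
        have mem: "j < n" "i \<in> I j" "j' < n" "i' \<in> I j'" using kl by auto
        show "(case k of (j,i) \<Rightarrow> {u j i<..<v j i}) \<inter> (case l of (j,i) \<Rightarrow> {u j i<..<v j i}) = {}"
        proof (cases "j = j'")
          case True
          then show ?thesis using I(3)[of j] mem kl unfolding disjoint_family_on_def by auto
        next
          case False
          then have "{x j<..<y j} \<inter> {x j'<..<y j'} = {}"
            using dj mem unfolding disjoint_family_on_def by auto
          moreover have "{u j i<..<v j i} \<subseteq> {x j<..<y j}" "{u j' i'<..<v j' i'} \<subseteq> {x j'<..<y j'}"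
            using I(2)[OF mem(1,2)] I(2)[OF mem(3,4)] by auto
          ultimately have "{u j i<..<v j i} \<inter> {u j' i'<..<v j' i'} = {}" by blast
          then show ?thesis by simp
        qed
      qed
      have len: "(\<Sum>k\<in>?K. case k of (j,i) \<Rightarrow> v j i - u j i) < d"
      proof -
        have "(\<Sum>k\<in>?K. case k of (j,i) \<Rightarrow> v j i - u j i) = (\<Sum>j<n. \<Sum>i\<in>I j. v j i - u j i)"
          using I(1) by (subst sum.Sigma) auto
        also have "\<dots> \<le> (\<Sum>j<n. y j - x j)"
        proof (rule sum_mono)
          fix j assume "j \<in> {..<n}"
          then show "(\<Sum>i\<in>I j. v j i - u j i) \<le> y j - x j"
            using xy I(1-3)[of j] by (intro disjoint_intervals_length_le) auto
        qed
        finally show ?thesis using sm by simp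
      qed
      have "(\<Sum>k\<in>?K. norm (f ((case k of (j,i) \<Rightarrow> v j i)) - f (case k of (j,i) \<Rightarrow> u j i))) < e / 2"
      proof (rule abs_cont_deltaD[OF d(2)])
        show "finite ?K" using I(1) by auto
        show "a \<le> (case k of (j,i) \<Rightarrow> u j i) \<and> (case k of (j,i) \<Rightarrow> u j i) \<le> (case k of (j,i) \<Rightarrow> v j i) \<and>
          (case k of (j,i) \<Rightarrow> v j i) \<le> b" if k: "k \<in> ?K" for k
        proof -
          obtain j i where "k = (j,i)" by (cases k)
          with k I(2)[of j i] xy show ?thesis by fastforce
        qed
      qed (use dj' len in \<open>simp_all add: split_def\<close>)
      moreover have "(\<Sum>j<n. s j) \<le> (\<Sum>k\<in>?K. norm (f ((case k of (j,i) \<Rightarrow> v j i)) - f (case k of (j,i) \<Rightarrow> u j i)))"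
      proof -
        have "(\<Sum>j<n. s j) = (\<Sum>j<n. \<Sum>i\<in>I j. f (v j i) - f (u j i))"
          using I(4) by (intro sum.cong) auto
        also have "\<dots> = (\<Sum>k\<in>?K. case k of (j,i) \<Rightarrow> f (v j i) - f (u j i))"
          using I(1) by (subst sum.Sigma) auto
        also have "\<dots> \<le> (\<Sum>k\<in>?K. norm (f ((case k of (j,i) \<Rightarrow> v j i)) - f (case k of (j,i) \<Rightarrow> u j i)))"
          by (intro sum_mono) (auto simp: split_def)
        finally show ?thesis .
      qed
      moreover have "(\<Sum>i<n. norm (W (y i) - W (x i))) \<le> (\<Sum>j<n. s j) + real n * h"
      proof -
        have "(\<Sum>i<n. norm (W (y i) - W (x i))) \<le> (\<Sum>j<n. s j + h)"
        proof (rule sum_mono)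
          fix i assume "i \<in> {..<n}"
          then show "norm (W (y i) - W (x i)) \<le> s i + h"
            using s(2)[of i] mono1[of "x i" "y i"] xy by auto
        qed
        then show ?thesis by (simp add: sum.distrib)
      qed
      moreover have "real n * h \<le> e / 2"
      proof -
        have "real n * h \<le> real (Suc n) * h" using h by (intro mult_right_mono) auto
        also have "\<dots> = e / 2" unfolding h_def by (simp add: field_simps del: of_nat_Suc)
        finally show ?thesis .
      qed
      ultimately show "(\<Sum>i<n. norm (W (y i) - W (x i))) < e" by linarith
    qed
    then show "\<exists>\<delta>>0. abs_cont_delta a b W e \<delta>" using d by blast
  qed
qed


text \<open>The integrand is carried along because it is the almost everywhere derivative: a
  differential equation is stated by prescribing it. For real and complex functions the existence of
  some integrand is equivalent to absolute continuity on [a,b].\<close>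

definition indef_int :: "real \<Rightarrow> real \<Rightarrow> (real \<Rightarrow> 'a::euclidean_space) \<Rightarrow> (real \<Rightarrow> 'a) \<Rightarrow> bool"
  where "indef_int a b f g \<longleftrightarrow>
    g absolutely_integrable_on {a..b} \<and> (\<forall>x\<in>{a..b}. f x = f a + integral {a..x} g)"

lemma indef_intD:
  assumes "indef_int a b f g"
  shows "g absolutely_integrable_on {a..b}" "\<And>x. x \<in> {a..b} \<Longrightarrow> f x = f a + integral {a..x} g"
    "\<And>x. x \<in> {a..b} \<Longrightarrow> g integrable_on {a..x}"
proof -
  show 1: "g absolutely_integrable_on {a..b}" "\<And>x. x \<in> {a..b} \<Longrightarrow> f x = f a + integral {a..x} g"
    using assms unfolding indef_int_def by (blast, blast)
  show "g integrable_on {a..x}" if "x \<in> {a..b}" for x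
    using that by (intro integrable_on_subinterval[OF set_lebesgue_integral_eq_integral(1)[OF 1(1)]]) auto
qed

lemma indef_int_diff:
  assumes "indef_int a b f g" "a \<le> x" "x \<le> y" "y \<le> b"
  shows "f y - f x = integral {x..y} g"
proof -
  have "integral {a..x} g + integral {x..y} g = integral {a..y} g"
    using assms indef_intD(3)[OF assms(1), of y]
    by (intro Henstock_Kurzweil_Integration.integral_combine) auto
  then show ?thesis
    using indef_intD(2)[OF assms(1), of x] indef_intD(2)[OF assms(1), of y] assms(2-)
    by (auto simp: algebra_simps)
qed

lemma abs_cont_imp_indef_int_real:
  fixes f :: "real \<Rightarrow> real"
  assumes ac: "abs_cont a b f" and ab: "a \<le> b"
  shows "\<exists>g. indef_int a b f g"
proof -
  define W where "W = (\<lambda>x. Sup (var_sums f a x))"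
  have W: "abs_cont a b W"
    "\<And>x y. a \<le> x \<Longrightarrow> x \<le> y \<Longrightarrow> y \<le> b \<Longrightarrow> W x \<le> W y"
    "\<And>x y. a \<le> x \<Longrightarrow> x \<le> y \<Longrightarrow> y \<le> b \<Longrightarrow> W x - f x \<le> W y - f y"
    using abs_cont_positive_variation[OF ac ab] unfolding W_def by blast+
  have Wf: "abs_cont a b (\<lambda>x. W x - f x)"
    by (rule abs_cont_comb[OF W(1) ac, of 1]) (auto simp: abs_if)
  obtain g1 where g1: "g1 absolutely_integrable_on {a..b}" "\<And>x. x \<in> {a..b} \<Longrightarrow> W x = W a + integral {a..x} g1"
    using mono_abs_cont_imp_indefinite_integral[OF ab W(1,2)] by blast
  obtain g2 where g2: "g2 absolutely_integrable_on {a..b}"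
    "\<And>x. x \<in> {a..b} \<Longrightarrow> W x - f x = W a - f a + integral {a..x} g2"
    using mono_abs_cont_imp_indefinite_integral[OF ab Wf W(3)] by blast
  have "integral {a..x} (\<lambda>t. g1 t - g2 t) = integral {a..x} g1 - integral {a..x} g2" if "x \<in> {a..b}" for x
    using that by (intro Henstock_Kurzweil_Integration.integral_diff
        integrable_on_subinterval[OF set_lebesgue_integral_eq_integral(1)[OF g1(1)]]
        integrable_on_subinterval[OF set_lebesgue_integral_eq_integral(1)[OF g2(1)]]) auto
  then have "indef_int a b f (\<lambda>t. g1 t - g2 t)"
    unfolding indef_int_def using g1(2) g2(2) set_integral_diff(1)[OF g1(1) g2(1)]
    by (smt (verit, best))
  then show ?thesis by blast
qed

lemma abs_cont_imp_indef_int: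
  fixes f :: "real \<Rightarrow> complex"
  assumes ac: "abs_cont a b f" and ab: "a \<le> b"
  shows "\<exists>g. indef_int a b f g"
proof -
  have "abs_cont a b (\<lambda>x. Re (f x))" "abs_cont a b (\<lambda>x. Im (f x))"
    by (rule abs_cont_le[OF ac]; metis abs_Re_le_cmod abs_Im_le_cmod minus_complex.simps real_norm_def)+
  then obtain g1 g2 where g: "indef_int a b (\<lambda>x. Re (f x)) g1" "indef_int a b (\<lambda>x. Im (f x)) g2"
    using abs_cont_imp_indef_int_real[OF _ ab] by metis
  note i1 = indef_intD[OF g(1)] and i2 = indef_intD[OF g(2)]
  have "indef_int a b f (\<lambda>t. of_real (g1 t) + \<i> * of_real (g2 t))"
    unfolding indef_int_def
  proof (intro conjI ballI)
    have 1: "(\<lambda>t. complex_of_real (g t)) absolutely_integrable_on {a..b}" if "g absolutely_integrable_on {a..b}" for g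
      using absolutely_integrable_linear[OF that bounded_linear_of_real] by (simp add: comp_def)
    have 2: "(\<lambda>t. \<i> * complex_of_real (g2 t)) absolutely_integrable_on {a..b}"
      using absolutely_integrable_linear[OF 1[OF i2(1)] bounded_linear_mult_right[of \<i>]] by (simp add: comp_def)
    show "(\<lambda>t. of_real (g1 t) + \<i> * of_real (g2 t)) absolutely_integrable_on {a..b}"
      using set_integral_add(1)[OF 1[OF i1(1)] 2] by simp
    fix x assume x: "x \<in> {a..b}"
    have "((\<lambda>t. complex_of_real (g1 t) + \<i> * of_real (g2 t)) has_integral
       of_real (integral {a..x} g1) + \<i> * of_real (integral {a..x} g2)) {a..x}"
      using integrable_integral[OF i1(3)[OF x]] integrable_integral[OF i2(3)[OF x]]
      by (intro has_integral_add has_integral_mult_right has_integral_of_real)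
    then show "f x = f a + integral {a..x} (\<lambda>t. of_real (g1 t) + \<i> * of_real (g2 t))"
      using i1(2)[OF x] i2(2)[OF x] by (auto simp: integral_unique complex_eq_iff)
  qed
  then show ?thesis by blast
qed

lemma AE_lebesgue_on_iff_negligible:
  assumes "S \<in> sets lebesgue"
  shows "(AE x in lebesgue_on S. P x) \<longleftrightarrow> negligible {x \<in> S. \<not> P x}"
proof -
  have "(AE x in lebesgue_on S. P x) \<longleftrightarrow> (AE x in lebesgue. x \<in> S \<longrightarrow> P x)"
    using assms by (simp add: AE_restrict_space_iff)
  also have "\<dots> \<longleftrightarrow> negligible {x \<in> S. \<not> P x}"
    unfolding eventually_ae_filter negligible_iff_null_sets
    by (auto intro: null_sets_completion_subset)
  finally show ?thesis .
qed

lemma absolutely_integrable_sum_interval_le: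
  fixes h :: "real \<Rightarrow> real"
  assumes h: "h absolutely_integrable_on {a..b}" "\<And>x. x \<in> {a..b} \<Longrightarrow> h x \<ge> 0"
    and I: "finite (I::nat set)" "\<And>i. i \<in> I \<Longrightarrow> a \<le> u i \<and> u i \<le> v i \<and> v i \<le> b"
    "disjoint_family_on (\<lambda>i. {u i<..<v i}) I"
  shows "(\<Sum>i\<in>I. integral {u i..v i} h) \<le> integral {a..b} h"
proof -
  have si: "set_integrable lebesgue A h" if "A \<subseteq> {a..b}" "A \<in> sets lebesgue" for A
    by (rule set_integrable_subset[OF h(1)]) (use that in auto)
  have sub: "{u i<..<v i} \<subseteq> {a..b}" if "i \<in> I" for i
    using I(2)[OF that] by auto
  have "(\<Sum>i\<in>I. integral {u i..v i} h) = (\<Sum>i\<in>I. (LINT x:{u i<..<v i}|lebesgue. h x))"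
  proof (rule sum.cong[OF refl])
    fix i assume i: "i \<in> I"
    have "integral {u i..v i} h = integral {u i<..<v i} h"
      using integral_open_interval_real by metis
    also have "\<dots> = (LINT x:{u i<..<v i}|lebesgue. h x)"
      using set_lebesgue_integral_eq_integral(2)[OF si[OF sub[OF i]]] by simp
    finally show "integral {u i..v i} h = (LINT x:{u i<..<v i}|lebesgue. h x)" .
  qed
  also have "\<dots> = (LINT x:(\<Union>i\<in>I. {u i<..<v i})|lebesgue. h x)"
    using I sub by (intro set_integral_finite_Union[symmetric] si) auto
  also have "\<dots> \<le> (LINT x:{a..b}|lebesgue. h x)"
  proof -
    have "(\<Union>i\<in>I. {u i<..<v i}) \<subseteq> {a..b}" "(\<Union>i\<in>I. {u i<..<v i}) \<in> sets lebesgue"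
      using sub I(1) by (blast, intro sets.finite_UN) auto
    then show ?thesis
      using h(2) si[unfolded set_integrable_def] h(1)[unfolded set_integrable_def]
      unfolding set_lebesgue_integral_def
      by (intro integral_mono) (simp, simp, metis (no_types, lifting) indicator_simps(1) indicator_simps(2) mult_zero_left
          order_refl real_scaleR_def subsetD zero_le_mult_iff zero_le_one mult_1)
  qed
  also have "\<dots> = integral {a..b} h"
    by (rule set_lebesgue_integral_eq_integral(2)[OF h(1)])
  finally show ?thesis .
qed

text \<open>The integrand is split at height n: the excess of its norm over n has small integral by
  dominated convergence, and the rest contributes at most n times the total length.\<close>

lemma indef_int_imp_abs_cont:
  assumes f: "indef_int a b f g" and ab: "a \<le> b"
  shows "abs_cont a b f"
  unfolding abs_cont_def
proof (intro allI impI)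
  fix e :: real assume e: "e > 0"
  note g = indef_intD[OF f]
  define h where "h = (\<lambda>n x. max 0 (norm (g x) - real n))"
  have ng: "(\<lambda>x. norm (g x)) absolutely_integrable_on {a..b}"
    using absolutely_integrable_norm[OF g(1)] by (simp add: comp_def)
  have h: "h n absolutely_integrable_on {a..b}" for n
    unfolding h_def using ng
    by (intro absolutely_integrable_max_1 set_integral_diff) auto
  have hi: "h n integrable_on {a..b}" for n
    using h set_lebesgue_integral_eq_integral(1) by blast
  have "(\<lambda>n. integral {a..b} (h n)) \<longlonglongrightarrow> integral {a..b} (\<lambda>x. 0)"
  proof (rule dominated_convergence(2))
    show "norm (h n x) \<le> norm (g x)" for n x
      by (simp add: h_def)
    show "(\<lambda>n. h n x) \<longlonglongrightarrow> 0" for x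
    proof (rule tendsto_eventually)
      obtain N where "norm (g x) < real N" using reals_Archimedean2 by blast
      then show "\<forall>\<^sub>F n in sequentially. h n x = 0"
        unfolding eventually_sequentially h_def by (intro exI[of _ N]) auto
    qed
    show "(\<lambda>x. norm (g x)) integrable_on {a..b}"
      using ng set_lebesgue_integral_eq_integral(1) by blast
  qed (rule hi)
  then have "\<forall>\<^sub>F n in sequentially. integral {a..b} (h n) < e / 2"
    using e by (intro order_tendstoD) auto
  then obtain n where n: "integral {a..b} (h n) < e / 2"
    by (meson eventually_happens sequentially_bot)
  define d where "d = e / (2 * (real n + 1))"
  have d: "d > 0" using e by (simp add: d_def)
  have "abs_cont_delta a b f e d"
    unfolding abs_cont_delta_def
  proof (intro allI impI)
    fix N :: nat and u v :: "nat \<Rightarrow> real"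
    assume uv: "\<forall>i<N. a \<le> u i \<and> u i \<le> v i \<and> v i \<le> b"
      and dj: "disjoint_family_on (\<lambda>i. {u i<..<v i}) {..<N}"
      and sm: "(\<Sum>i<N. v i - u i) < d"
    have "norm (f (v i) - f (u i)) \<le> integral {u i..v i} (h n) + real n * (v i - u i)" if i: "i < N" for i
    proof -
      have sub: "{u i..v i} \<subseteq> {a..b}" using uv i by auto
      have "f (v i) - f (u i) = integral {u i..v i} g"
        using uv i by (intro indef_int_diff[OF f]) auto
      then have "norm (f (v i) - f (u i)) \<le> integral {u i..v i} (\<lambda>x. h n x + real n)"
      proof (simp, intro integral_norm_bound_integral)
        show "g integrable_on {u i..v i}"
          using g(3)[of b] sub ab integrable_on_subinterval by (metis atLeastAtMost_iff order_refl)
        show "(\<lambda>x. h n x + real n) integrable_on {u i..v i}"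
          using integrable_on_subinterval[OF hi sub] by (intro integrable_add) auto
      qed (auto simp: h_def)
      also have "\<dots> = integral {u i..v i} (h n) + integral {u i..v i} (\<lambda>x. real n)"
        using integrable_on_subinterval[OF hi sub] by (intro integral_add) auto
      also have "integral {u i..v i} (\<lambda>x. real n) = real n * (v i - u i)"
        using uv i by simp
      finally show ?thesis .
    qed
    then have "(\<Sum>i<N. norm (f (v i) - f (u i))) \<le> (\<Sum>i<N. integral {u i..v i} (h n) + real n * (v i - u i))"
      by (intro sum_mono) auto
    also have "\<dots> = (\<Sum>i<N. integral {u i..v i} (h n)) + real n * (\<Sum>i<N. v i - u i)"
      by (simp add: sum.distrib sum_distrib_left)
    also have "\<dots> \<le> integral {a..b} (h n) + real n * d"
      using sm uv by (intro add_mono absolutely_integrable_sum_interval_le h dj mult_left_mono) (auto simp: h_def)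
    also have "real n * d \<le> e / 2"
    proof -
      have "real n * d \<le> (real n + 1) * d" using d by (intro mult_right_mono) auto
      also have "\<dots> = e / 2" by (simp add: d_def field_simps)
      finally show ?thesis .
    qed
    finally show "(\<Sum>i<N. norm (f (v i) - f (u i))) < e"
      using n by simp
  qed
  with d show "\<exists>\<delta>>0. abs_cont_delta a b f e \<delta>" by blast
qed

lemma indef_int_continuous_on:
  assumes "indef_int a b f g"
  shows "continuous_on {a..b} f"
proof (cases "a \<le> b")
  case True
  then show ?thesis using abs_cont_continuous_on indef_int_imp_abs_cont assms by blast
qed auto

lemma indef_int_AE_deriv:
  assumes f: "indef_int a b f g"
  shows "AE x in lebesgue_on {a<..<b}. (f has_vector_derivative g x) (at x)"
proof (cases "a < b")
  case True
  note g = indef_intD[OF f]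
  have "negligible {x \<in> {a<..<b}. \<not> ((\<lambda>u. integral {a..u} g) has_vector_derivative g x) (at x)}"
    using g(3)[of b] True by (intro negligible_not_has_vector_derivative_indefinite_integral) auto
  moreover have "(f has_vector_derivative g x) (at x)"
    if x: "x \<in> {a<..<b}" "((\<lambda>u. integral {a..u} g) has_vector_derivative g x) (at x)" for x
  proof -
    have "((\<lambda>u. f a + integral {a..u} g) has_vector_derivative g x) (at x)"
      using x(2) by (auto intro!: derivative_eq_intros)
    then show ?thesis
    proof (rule has_vector_derivative_transform_within_open)
      show "f a + integral {a..y} g = f y" if "y \<in> {a<..<b}" for y
        by (rule g(2)[symmetric]) (use that in auto)
    qed (use x(1) in auto)
  qed
  then have "{x \<in> {a<..<b}. \<not> (f has_vector_derivative g x) (at x)} \<subseteq>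
    {x \<in> {a<..<b}. \<not> ((\<lambda>u. integral {a..u} g) has_vector_derivative g x) (at x)}"
    by blast
  ultimately show ?thesis
    using negligible_subset by (subst AE_lebesgue_on_iff_negligible) (simp, blast)
qed (simp add: AE_restrict_space_iff)

lemma indef_int_cong_AE:
  assumes f: "indef_int a b f g" and k: "AE x in lebesgue_on {a<..<b}. g x = k x"
  shows "indef_int a b f k"
proof -
  note g = indef_intD[OF f]
  have "negligible ({x \<in> {a<..<b}. g x \<noteq> k x} \<union> {a,b})"
    using k AE_lebesgue_on_iff_negligible[of "{a<..<b}" "\<lambda>x. g x = k x"] by (simp add: negligible_Un)
  then have n: "negligible {x \<in> {a..b}. g x \<noteq> k x}"
    by (rule negligible_subset) auto
  have i: "integral {a..x} g = integral {a..x} k" if "x \<in> {a..b}" for x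
    by (rule integral_spike[OF n]) (use that in auto)
  have "k absolutely_integrable_on {a..b}"
    by (rule absolutely_integrable_spike[OF g(1) n]) auto
  then show ?thesis
    unfolding indef_int_def using g(2) i by metis
qed

text \<open>Product and chain rules are obtained this way: absolute continuity yields some
  integrand, and a pointwise rule for derivatives tells which one.\<close>

lemma indef_int_of_deriv:
  assumes f: "indef_int a b f g"
    and k: "AE x in lebesgue_on {a<..<b}. (f has_vector_derivative k x) (at x)"
  shows "indef_int a b f k"
  using f
proof (rule indef_int_cong_AE)
  show "AE x in lebesgue_on {a<..<b}. g x = k x"
    using indef_int_AE_deriv[OF f] k
    by eventually_elim (rule vector_derivative_unique_at)
qed

section \<open>Calculus rules for indefinite integrals and Gronwall's inequality\<close>

lemma indef_int_cong:
  assumes "indef_int a b f g" "\<And>x. x \<in> {a..b} \<Longrightarrow> f x = f' x" "a \<le> b"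
  shows "indef_int a b f' g"
  using assms unfolding indef_int_def by (metis atLeastAtMost_iff order_refl)

lemma indef_int_add:
  assumes "indef_int a b f g" "indef_int a b f' g'"
  shows "indef_int a b (\<lambda>x. f x + f' x) (\<lambda>x. g x + g' x)"
  unfolding indef_int_def
proof (intro conjI ballI)
  note g = indef_intD[OF assms(1)] and g' = indef_intD[OF assms(2)]
  show "(\<lambda>x. g x + g' x) absolutely_integrable_on {a..b}"
    by (rule set_integral_add(1)[OF g(1) g'(1)])
  fix x assume x: "x \<in> {a..b}"
  have "integral {a..x} (\<lambda>x. g x + g' x) = integral {a..x} g + integral {a..x} g'"
    by (rule Henstock_Kurzweil_Integration.integral_add[OF g(3)[OF x] g'(3)[OF x]])
  with g(2)[OF x] g'(2)[OF x]
  show "f x + f' x = f a + f' a + integral {a..x} (\<lambda>x. g x + g' x)" by (simp add: algebra_simps)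
qed

lemma indef_int_linear:
  assumes "indef_int a b f g" "bounded_linear h"
  shows "indef_int a b (\<lambda>x. h (f x)) (\<lambda>x. h (g x))"
  unfolding indef_int_def
proof (intro conjI ballI)
  note g = indef_intD[OF assms(1)]
  interpret bounded_linear h by fact
  show "(\<lambda>x. h (g x)) absolutely_integrable_on {a..b}"
    using absolutely_integrable_linear[OF g(1) assms(2)] by (simp add: comp_def)
  fix x assume x: "x \<in> {a..b}"
  have "integral {a..x} (\<lambda>x. h (g x)) = h (integral {a..x} g)"
    using integral_linear[OF g(3)[OF x] assms(2)] by (simp add: comp_def)
  with g(2)[OF x] show "h (f x) = h (f a) + integral {a..x} (\<lambda>x. h (g x))"
    by (simp add: add)
qed

lemma abs_cont_mult:
  fixes f1 f2 :: "real \<Rightarrow> 'a::real_normed_algebra"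
  assumes "abs_cont a b f1" "abs_cont a b f2"
  shows "abs_cont a b (\<lambda>x. f1 x * f2 x)"
proof -
  have "bounded (f1 ` {a..b})" "bounded (f2 ` {a..b})"
    using assms abs_cont_continuous_on compact_imp_bounded compact_continuous_image compact_Icc by blast+
  then obtain B1 B2 where B: "\<And>x. x \<in> {a..b} \<Longrightarrow> norm (f1 x) \<le> B1" "\<And>x. x \<in> {a..b} \<Longrightarrow> norm (f2 x) \<le> B2"
    unfolding bounded_iff by blast
  define C where "C = max 0 (max B1 B2)"
  have C: "norm (f1 x) \<le> C" "norm (f2 x) \<le> C" if "x \<in> {a..b}" for x
    using B[OF that] by (auto simp: C_def)
  show ?thesis
  proof (rule abs_cont_comb[OF assms, of C])
    fix x y assume xy: "a \<le> x" "x \<le> y" "y \<le> b"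
    have C0: "C \<ge> 0" by (simp add: C_def)
    have "f1 y * f2 y - f1 x * f2 x = (f1 y - f1 x) * f2 y + f1 x * (f2 y - f2 x)"
      by (simp add: algebra_simps)
    then have "norm (f1 y * f2 y - f1 x * f2 x) \<le> norm (f1 y - f1 x) * norm (f2 y) + norm (f1 x) * norm (f2 y - f2 x)"
      by (metis norm_triangle_le add_mono norm_mult_ineq)
    also have "\<dots> \<le> norm (f1 y - f1 x) * C + C * norm (f2 y - f2 x)"
      using xy C0 C[of x] C[of y] by (intro add_mono mult_mono) auto
    finally show "norm (f1 y * f2 y - f1 x * f2 x) \<le> C * (norm (f1 y - f1 x) + norm (f2 y - f2 x))"
      by (simp add: algebra_simps)
  qed (simp add: C_def)
qed

lemma AE_deriv_mult:
  fixes f1 f2 :: "real \<Rightarrow> 'a::real_normed_algebra"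
  assumes "AE x in M. (f1 has_vector_derivative g1 x) (at x)" "AE x in M. (f2 has_vector_derivative g2 x) (at x)"
  shows "AE x in M. ((\<lambda>x. f1 x * f2 x) has_vector_derivative (f1 x * g2 x + g1 x * f2 x)) (at x)"
  using assms by eventually_elim (rule has_vector_derivative_mult)

lemma indef_int_mult:
  fixes f1 f2 :: "real \<Rightarrow> complex"
  assumes "indef_int a b f1 g1" "indef_int a b f2 g2" "a \<le> b"
  shows "indef_int a b (\<lambda>x. f1 x * f2 x) (\<lambda>x. f1 x * g2 x + g1 x * f2 x)"
proof -
  have "abs_cont a b (\<lambda>x. f1 x * f2 x)"
    using indef_int_imp_abs_cont[OF assms(1,3)] indef_int_imp_abs_cont[OF assms(2,3)] by (rule abs_cont_mult)
  from abs_cont_imp_indef_int[OF this assms(3)] obtain k where "indef_int a b (\<lambda>x. f1 x * f2 x) k" ..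
  then show ?thesis
    by (rule indef_int_of_deriv)
      (rule AE_deriv_mult[OF indef_int_AE_deriv[OF assms(1)] indef_int_AE_deriv[OF assms(2)]])
qed

lemma indef_int_mult_real:
  fixes f1 f2 :: "real \<Rightarrow> real"
  assumes "indef_int a b f1 g1" "indef_int a b f2 g2" "a \<le> b"
  shows "indef_int a b (\<lambda>x. f1 x * f2 x) (\<lambda>x. f1 x * g2 x + g1 x * f2 x)"
proof -
  have "abs_cont a b (\<lambda>x. f1 x * f2 x)"
    using indef_int_imp_abs_cont[OF assms(1,3)] indef_int_imp_abs_cont[OF assms(2,3)] by (rule abs_cont_mult)
  from abs_cont_imp_indef_int_real[OF this assms(3)] obtain k where "indef_int a b (\<lambda>x. f1 x * f2 x) k" ..
  then show ?thesis
    by (rule indef_int_of_deriv)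
      (rule AE_deriv_mult[OF indef_int_AE_deriv[OF assms(1)] indef_int_AE_deriv[OF assms(2)]])
qed

lemma indef_int_power_real:
  fixes f :: "real \<Rightarrow> real"
  assumes "indef_int a b f g" "a \<le> b"
  shows "indef_int a b (\<lambda>x. f x ^ Suc n) (\<lambda>x. real (Suc n) * (g x * f x ^ n))"
proof (induction n)
  case 0
  then show ?case using assms by simp
next
  case (Suc n)
  have "(\<lambda>x. f x * (real (Suc n) * (g x * f x ^ n)) + g x * f x ^ Suc n) =
     (\<lambda>x. real (Suc (Suc n)) * (g x * f x ^ Suc n))"
    by (auto simp: algebra_simps)
  with indef_int_mult_real[OF assms(1) Suc assms(2)] show ?case by simp
qed

text \<open>The exponential is Lipschitz on the bounded range of \<open>f\<close>, so the
  composition stays absolutely continuous.\<close>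

lemma indef_int_exp_real:
  fixes f :: "real \<Rightarrow> real"
  assumes f: "indef_int a b f g" and ab: "a \<le> b"
  shows "indef_int a b (\<lambda>x. exp (f x)) (\<lambda>x. g x * exp (f x))"
proof -
  have "bounded (f ` {a..b})"
    using indef_int_continuous_on[OF f] compact_imp_bounded compact_continuous_image compact_Icc by blast
  then obtain B where B: "\<And>x. x \<in> {a..b} \<Longrightarrow> \<bar>f x\<bar> \<le> B"
    unfolding bounded_iff real_norm_def by blast
  have lip: "\<bar>exp s - exp t\<bar> \<le> exp B * \<bar>s - t\<bar>" if "\<bar>s\<bar> \<le> B" "\<bar>t\<bar> \<le> B" for s t :: real
  proof -
    have "norm (exp s - exp t) \<le> exp B * norm (s - t)"
    proof (rule field_differentiable_bound[of "{-B..B}" exp exp])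
      show "(exp has_field_derivative exp z) (at z within {-B..B})" for z :: real
        by (auto intro!: derivative_eq_intros)
    qed (use that in auto)
    then show ?thesis by simp
  qed
  have ac: "abs_cont a b (\<lambda>x. exp (f x))"
  proof (rule abs_cont_comb[OF indef_int_imp_abs_cont[OF f ab] indef_int_imp_abs_cont[OF f ab], of "exp B"])
    fix x y assume xy: "a \<le> x" "x \<le> y" "y \<le> b"
    have "\<bar>exp (f y) - exp (f x)\<bar> \<le> exp B * \<bar>f y - f x\<bar>"
      using xy by (intro lip B) auto
    then show "norm (exp (f y) - exp (f x)) \<le> exp B * (norm (f y - f x) + norm (f y - f x))"
      by (simp add: distrib_left)
  qed simp
  have "AE x in lebesgue_on {a<..<b}. ((\<lambda>x. exp (f x)) has_vector_derivative g x * exp (f x)) (at x)"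
    using indef_int_AE_deriv[OF f]
    by eventually_elim (auto simp flip: has_real_derivative_iff_has_vector_derivative intro!: derivative_eq_intros)
  moreover obtain k where "indef_int a b (\<lambda>x. exp (f x)) k"
    using abs_cont_imp_indef_int_real[OF ac ab] ..
  ultimately show ?thesis by (rule indef_int_of_deriv[rotated])
qed

lemma absolutely_integrable_continuous_mult:
  fixes f g :: "real \<Rightarrow> 'a::{euclidean_space,real_normed_algebra}"
  assumes "continuous_on {a..b} f" "g absolutely_integrable_on {a..b}"
  shows "(\<lambda>x. f x * g x) absolutely_integrable_on {a..b}"
proof (rule absolutely_integrable_bounded_measurable_product[OF bilinear_times _ _ _ assms(2)])
  show "f \<in> borel_measurable (lebesgue_on {a..b})"
    using assms(1) by (intro continuous_imp_measurable_on_sets_lebesgue) auto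
  show "bounded (f ` {a..b})"
    using assms(1) by (intro compact_imp_bounded compact_continuous_image) auto
qed auto

lemma indef_int_integral:
  assumes "g absolutely_integrable_on {a..b}"
  shows "indef_int a b (\<lambda>x. c + integral {a..x} g) g"
  using assms by (simp add: indef_int_def)

text \<open>Integrating factor: the majorant \<open>H\<close> times the exponential of minus the
  integral of \<omega> has a nonpositive derivative, hence stays below its initial value c.\<close>

lemma gronwall:
  fixes \<phi> \<omega> :: "real \<Rightarrow> real"
  assumes ab: "a \<le> b" and cont: "continuous_on {a..b} \<phi>"
    and w: "\<omega> absolutely_integrable_on {a..b}" "\<And>x. x \<in> {a..b} \<Longrightarrow> \<omega> x \<ge> 0"
    and le: "\<And>x. x \<in> {a..b} \<Longrightarrow> \<phi> x \<le> c + integral {a..x} (\<lambda>t. \<phi> t * \<omega> t)"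
    and x: "x \<in> {a..b}"
  shows "\<phi> x \<le> c * exp (integral {a..x} \<omega>)"
proof -
  define H where "H = (\<lambda>x. c + integral {a..x} (\<lambda>t. \<phi> t * \<omega> t))"
  define E where "E = (\<lambda>x. exp (0 + integral {a..x} (\<lambda>t. - \<omega> t)))"
  have H: "indef_int a b H (\<lambda>t. \<phi> t * \<omega> t)"
    unfolding H_def by (intro indef_int_integral absolutely_integrable_continuous_mult cont w)
  have E: "indef_int a b E (\<lambda>t. - \<omega> t * E t)"
    unfolding E_def using absolutely_integrable_scaleR_left[OF w(1), of "-1"] by (intro indef_int_exp_real indef_int_integral ab) simp
  have HE: "indef_int a b (\<lambda>x. H x * E x) (\<lambda>x. H x * (- \<omega> x * E x) + \<phi> x * \<omega> x * E x)"
    by (rule indef_int_mult_real[OF H E ab])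
  have "H x * E x - H a * E a = integral {a..x} (\<lambda>x. H x * (- \<omega> x * E x) + \<phi> x * \<omega> x * E x)"
    using x by (intro indef_int_diff[OF HE]) auto
  also have "\<dots> \<le> integral {a..x} (\<lambda>x. 0)"
  proof (rule integral_le[OF indef_intD(3)[OF HE x] integrable_0])
    fix t assume t: "t \<in> {a..x}"
    have "\<phi> t \<le> H t" "\<omega> t * E t \<ge> 0" using le[of t] w(2)[of t] x t by (auto simp: H_def E_def)
    then have "\<phi> t * (\<omega> t * E t) \<le> H t * (\<omega> t * E t)" by (rule mult_right_mono)
    then show "H t * (- \<omega> t * E t) + \<phi> t * \<omega> t * E t \<le> 0" by (simp add: algebra_simps)
  qed
  finally have "H x * E x \<le> c" by (simp add: H_def E_def)
  moreover have "E x * exp (integral {a..x} \<omega>) = 1"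
    by (simp add: E_def flip: exp_add)
  ultimately have "H x \<le> c * exp (integral {a..x} \<omega>)"
    by (metis (no_types, opaque_lifting) exp_ge_zero mult.assoc mult.right_neutral mult_right_mono)
  with le[OF x] show ?thesis by (simp add: H_def)
qed

section \<open>Linear first-order systems\<close>

lemma absolutely_integrable_mult_continuous:
  fixes f g :: "real \<Rightarrow> 'a::{euclidean_space,real_normed_field}"
  assumes "g absolutely_integrable_on {a..b}" "continuous_on {a..b} f"
  shows "(\<lambda>x. g x * f x) absolutely_integrable_on {a..b}"
  using absolutely_integrable_continuous_mult[OF assms(2,1)] by (simp add: mult.commute)

lemma absolutely_integrable_on_imp_integrable_on:
  fixes f :: "'a::euclidean_space \<Rightarrow> 'b::euclidean_space"
  shows "f absolutely_integrable_on S \<Longrightarrow> f integrable_on S"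
  by (rule set_lebesgue_integral_eq_integral(1))

lemma absolutely_integrable_norm':
  fixes f :: "real \<Rightarrow> 'b::euclidean_space"
  assumes "f absolutely_integrable_on S" shows "(\<lambda>x. norm (f x)) absolutely_integrable_on S"
  using absolutely_integrable_norm[OF assms] by (simp add: comp_def)

lemma absolutely_integrable_on_subinterval:
  fixes f :: "real \<Rightarrow> 'b::euclidean_space"
  assumes "f absolutely_integrable_on {a..b}" "x \<le> b"
  shows "f absolutely_integrable_on {a..x}"
  by (rule set_integrable_subset[OF assms(1)]) (use assms in auto)

text \<open>For \<alpha> = 1/p, \<beta> = q - z r and \<gamma> = - r f this is the equation tau u =
  z u + f, written as a first-order system for u and its quasi-derivative v.\<close>

definition lin_sys where
  "lin_sys a b \<alpha> \<beta> \<gamma> u v \<longleftrightarrow>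
     indef_int a b u (\<lambda>t. \<alpha> t * v t) \<and> indef_int a b v (\<lambda>t. \<beta> t * u t + \<gamma> t)"
  for \<alpha> \<beta> \<gamma> u v :: "real \<Rightarrow> complex"

lemma lin_sysD:
  assumes "lin_sys a b \<alpha> \<beta> \<gamma> u v"
  shows "indef_int a b u (\<lambda>t. \<alpha> t * v t)" "indef_int a b v (\<lambda>t. \<beta> t * u t + \<gamma> t)"
    "continuous_on {a..b} u" "continuous_on {a..b} v"
  using assms indef_int_continuous_on unfolding lin_sys_def by blast+

lemma lin_sys_combination:
  assumes "lin_sys a b \<alpha> \<beta> \<gamma>1 u1 v1" "lin_sys a b \<alpha> \<beta> \<gamma>2 u2 v2"
  shows "lin_sys a b \<alpha> \<beta> (\<lambda>t. c1 * \<gamma>1 t + c2 * \<gamma>2 t) (\<lambda>t. c1 * u1 t + c2 * u2 t) (\<lambda>t. c1 * v1 t + c2 * v2 t)"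
proof -
  note d1 = lin_sysD[OF assms(1)] and d2 = lin_sysD[OF assms(2)]
  note bl = bounded_linear_mult_right
  have "indef_int a b (\<lambda>t. c1 * u1 t + c2 * u2 t) (\<lambda>t. c1 * (\<alpha> t * v1 t) + c2 * (\<alpha> t * v2 t))"
    by (intro indef_int_add indef_int_linear[OF d1(1) bl] indef_int_linear[OF d2(1) bl])
  moreover have "indef_int a b (\<lambda>t. c1 * v1 t + c2 * v2 t) (\<lambda>t. c1 * (\<beta> t * u1 t + \<gamma>1 t) + c2 * (\<beta> t * u2 t + \<gamma>2 t))"
    by (intro indef_int_add indef_int_linear[OF d1(2) bl] indef_int_linear[OF d2(2) bl])
  ultimately show ?thesis
    unfolding lin_sys_def by (simp add: algebra_simps)
qed

lemma indef_int_norm_le: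
  fixes f :: "real \<Rightarrow> 'b::euclidean_space"
  assumes f: "indef_int a b f g" and x: "x \<in> {a..b}"
    and h: "h integrable_on {a..x}" "\<And>t. t \<in> {a..x} \<Longrightarrow> norm (g t) \<le> h t"
  shows "norm (f x) \<le> norm (f a) + integral {a..x} h"
proof -
  have "norm (integral {a..x} g) \<le> integral {a..x} h"
    by (rule integral_norm_bound_integral[OF indef_intD(3)[OF f x] h])
  moreover have "norm (f x) \<le> norm (f a) + norm (integral {a..x} g)"
    by (subst indef_intD(2)[OF f x]) (rule norm_triangle_ineq)
  ultimately show ?thesis by linarith
qed

text \<open>The weight \<open>k\<close> is chosen as \<open>sqrt (norm z)\<close> to see that solutions have order \<open>1/2\<close> in the
  spectral parameter.\<close>

lemma lin_sys_bound:
  assumes s: "lin_sys a b \<alpha> \<beta> \<gamma> u v" and ab: "a \<le> b"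
    and i: "\<alpha> absolutely_integrable_on {a..b}" "\<beta> absolutely_integrable_on {a..b}"
      "\<gamma> absolutely_integrable_on {a..b}"
    and k: "k > 0" and x: "x \<in> {a..b}"
  shows "k * norm (u x) + norm (v x) \<le> (k * norm (u a) + norm (v a) + integral {a..b} (\<lambda>t. norm (\<gamma> t))) *
     exp (integral {a..b} (\<lambda>t. k * norm (\<alpha> t) + norm (\<beta> t) / k))"
proof -
  note d = lin_sysD[OF s]
  \<comment> \<open>The quantity k |u| + |v| grows at most at the rate k |\<alpha>| + |\<beta>| / k.
    If \<beta> is of size k^2, both summands are of size k, whereas k = 1 would leave a rate of the
    size of \<beta>.\<close>
  define \<omega> where "\<omega> = (\<lambda>t. k * norm (\<alpha> t) + norm (\<beta> t) / k)"
  define \<phi> where "\<phi> = (\<lambda>t. k * norm (u t) + norm (v t))"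
  define c where "c = k * norm (u a) + norm (v a) + integral {a..b} (\<lambda>t. norm (\<gamma> t))"
  have ng: "(\<lambda>t. norm (\<alpha> t)) absolutely_integrable_on {a..b}" "(\<lambda>t. norm (\<beta> t)) absolutely_integrable_on {a..b}"
    "(\<lambda>t. norm (\<gamma> t)) absolutely_integrable_on {a..b}"
    using i absolutely_integrable_norm' by blast+
  have w: "\<omega> absolutely_integrable_on {a..b}"
    unfolding \<omega>_def using absolutely_integrable_scaleR_left[OF ng(1), of k] absolutely_integrable_scaleR_left[OF ng(2), of "1/k"]
    by (intro set_integral_add(1)) auto
  have cphi: "continuous_on {a..b} \<phi>"
    unfolding \<phi>_def using d(3,4) by (intro continuous_intros)
  have le: "\<phi> x \<le> c + integral {a..x} (\<lambda>t. \<phi> t * \<omega> t)" if x: "x \<in> {a..b}" for x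
  proof -
    have cx: "continuous_on {a..x} u" "continuous_on {a..x} v"
      using d(3,4) x by (auto intro: continuous_on_subset)
    have ngx: "(\<lambda>t. norm (\<alpha> t)) absolutely_integrable_on {a..x}" "(\<lambda>t. norm (\<beta> t)) absolutely_integrable_on {a..x}"
      "(\<lambda>t. norm (\<gamma> t)) absolutely_integrable_on {a..x}"
      using ng x absolutely_integrable_on_subinterval by auto
    have A: "(\<lambda>t. norm (\<alpha> t) * norm (v t)) integrable_on {a..x}"
      by (intro absolutely_integrable_on_imp_integrable_on absolutely_integrable_mult_continuous ngx continuous_intros cx)
    have B: "(\<lambda>t. norm (\<beta> t) * norm (u t)) integrable_on {a..x}"
      by (intro absolutely_integrable_on_imp_integrable_on absolutely_integrable_mult_continuous ngx continuous_intros cx)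
    have C: "(\<lambda>t. norm (\<gamma> t)) integrable_on {a..x}"
      by (intro absolutely_integrable_on_imp_integrable_on ngx)
    have 1: "norm (u x) \<le> norm (u a) + integral {a..x} (\<lambda>t. norm (\<alpha> t) * norm (v t))"
      by (rule indef_int_norm_le[OF d(1) x A]) (simp add: norm_mult)
    have 2: "norm (v x) \<le> norm (v a) + integral {a..x} (\<lambda>t. norm (\<beta> t) * norm (u t) + norm (\<gamma> t))"
      by (rule indef_int_norm_le[OF d(2) x integrable_add[OF B C]])
        (metis norm_triangle_ineq norm_mult)
    have 3: "integral {a..x} (\<lambda>t. norm (\<beta> t) * norm (u t) + norm (\<gamma> t)) =
       integral {a..x} (\<lambda>t. norm (\<beta> t) * norm (u t)) + integral {a..x} (\<lambda>t. norm (\<gamma> t))"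
      by (rule integral_add[OF B C])
    have 4: "integral {a..x} (\<lambda>t. norm (\<gamma> t)) \<le> integral {a..b} (\<lambda>t. norm (\<gamma> t))"
      using x ng(3) by (intro integral_subset_le absolutely_integrable_on_imp_integrable_on ngx) auto
    have 5: "k * integral {a..x} (\<lambda>t. norm (\<alpha> t) * norm (v t)) + integral {a..x} (\<lambda>t. norm (\<beta> t) * norm (u t)) =
       integral {a..x} (\<lambda>t. k * (norm (\<alpha> t) * norm (v t)) + norm (\<beta> t) * norm (u t))"
      using integral_add[OF integrable_on_mult_right[OF A, of k] B] by simp
    have 6: "\<dots> \<le> integral {a..x} (\<lambda>t. \<phi> t * \<omega> t)"
    proof (rule integral_le)
      show "(\<lambda>t. k * (norm (\<alpha> t) * norm (v t)) + norm (\<beta> t) * norm (u t)) integrable_on {a..x}"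
        by (rule integrable_add[OF integrable_on_mult_right[OF A, of k] B])
      show "(\<lambda>t. \<phi> t * \<omega> t) integrable_on {a..x}"
        using absolutely_integrable_on_subinterval[OF absolutely_integrable_continuous_mult[OF cphi w], of x] x
        by (intro absolutely_integrable_on_imp_integrable_on) auto
      fix t
      have "\<phi> t * \<omega> t - (k * (norm (\<alpha> t) * norm (v t)) + norm (\<beta> t) * norm (u t)) =
         k * k * norm (u t) * norm (\<alpha> t) + norm (v t) * norm (\<beta> t) / k"
        using k by (simp add: \<phi>_def \<omega>_def field_simps)
      also have "\<dots> \<ge> 0" using k by simp
      finally show "k * (norm (\<alpha> t) * norm (v t)) + norm (\<beta> t) * norm (u t) \<le> \<phi> t * \<omega> t" by simp
    qed
    have "k * norm (u x) \<le> k * norm (u a) + k * integral {a..x} (\<lambda>t. norm (\<alpha> t) * norm (v t))"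
      using mult_left_mono[OF 1, of k] k by (simp add: distrib_left)
    with 2 3 4 5 6 show ?thesis by (simp add: \<phi>_def c_def)
  qed
  have "\<phi> x \<le> c * exp (integral {a..x} \<omega>)"
    by (rule gronwall[OF ab cphi w _ le x]) (use k in \<open>auto simp: \<omega>_def\<close>)
  also have "\<dots> \<le> c * exp (integral {a..b} \<omega>)"
  proof (rule mult_left_mono)
    have "integral {a..x} \<omega> \<le> integral {a..b} \<omega>"
      using x k w absolutely_integrable_on_subinterval[OF w, of x]
      by (intro integral_subset_le absolutely_integrable_on_imp_integrable_on) (auto simp: \<omega>_def)
    then show "exp (integral {a..x} \<omega>) \<le> exp (integral {a..b} \<omega>)" by simp
    have "integral {a..b} (\<lambda>t. norm (\<gamma> t)) \<ge> 0"
      using ng(3) by (intro integral_nonneg absolutely_integrable_on_imp_integrable_on) auto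
    then show "c \<ge> 0" using k by (simp add: c_def)
  qed
  finally show ?thesis by (simp add: \<phi>_def c_def \<omega>_def)
qed

lemma lin_sys_unique:
  assumes "lin_sys a b \<alpha> \<beta> \<gamma> u1 v1" "lin_sys a b \<alpha> \<beta> \<gamma> u2 v2" "a \<le> b"
    "\<alpha> absolutely_integrable_on {a..b}" "\<beta> absolutely_integrable_on {a..b}"
    "u1 a = u2 a" "v1 a = v2 a" "x \<in> {a..b}"
  shows "u1 x = u2 x" "v1 x = v2 x"
proof -
  have "lin_sys a b \<alpha> \<beta> (\<lambda>t. 0) (\<lambda>t. u1 t - u2 t) (\<lambda>t. v1 t - v2 t)"
    using lin_sys_combination[OF assms(1,2), of 1 "-1"] by simp
  from lin_sys_bound[OF this assms(3-5) _ _ assms(8), of 1] assms(6,7)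
  have "norm (u1 x - u2 x) + norm (v1 x - v2 x) \<le> 0"
    by (simp add: absolutely_integrable_on_def)
  then have "norm (u1 x - u2 x) = 0" "norm (v1 x - v2 x) = 0"
    using norm_ge_zero[of "u1 x - u2 x"] norm_ge_zero[of "v1 x - v2 x"] by linarith+
  then show "u1 x = u2 x" "v1 x = v2 x" by auto
qed

text \<open>Picard iteration. The coefficients are merely integrable, so powers of m x, the integral
  of |\<alpha>| + |\<beta>| up to x, take the place of powers of x - a in the factorial estimate;
  they are integrated by the rule for the derivative of a power of \<open>m\<close>.\<close>

lemma lin_sys_exists:
  assumes ab: "a \<le> b"
    and i: "\<alpha> absolutely_integrable_on {a..b}" "\<beta> absolutely_integrable_on {a..b}"
      "\<gamma> absolutely_integrable_on {a..b}"
  shows "\<exists>u v. lin_sys a b \<alpha> \<beta> \<gamma> u v \<and> u a = c \<and> v a = d"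
proof -
  define P where "P = (\<lambda>(u::real \<Rightarrow> complex, v). (\<lambda>x. c + integral {a..x} (\<lambda>t. \<alpha> t * v t),
      \<lambda>x. d + integral {a..x} (\<lambda>t. \<beta> t * u t + \<gamma> t)))"
  define U where "U = (\<lambda>n. fst ((P ^^ n) (\<lambda>_. c, \<lambda>_. d)))"
  define V where "V = (\<lambda>n. snd ((P ^^ n) (\<lambda>_. c, \<lambda>_. d)))"
  have U0: "U 0 = (\<lambda>_. c)" "V 0 = (\<lambda>_. d)" by (auto simp: U_def V_def)
  have US: "U (Suc n) = (\<lambda>x. c + integral {a..x} (\<lambda>t. \<alpha> t * V n t))"
    "V (Suc n) = (\<lambda>x. d + integral {a..x} (\<lambda>t. \<beta> t * U n t + \<gamma> t))" for n
    by (auto simp: U_def V_def P_def split_def)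
  have cont: "continuous_on {a..b} (U n) \<and> continuous_on {a..b} (V n)" for n
  proof (induction n)
    case (Suc n)
    then have "indef_int a b (U (Suc n)) (\<lambda>t. \<alpha> t * V n t)" "indef_int a b (V (Suc n)) (\<lambda>t. \<beta> t * U n t + \<gamma> t)"
      unfolding US by (intro indef_int_integral absolutely_integrable_mult_continuous set_integral_add(1) i; simp)+
    then show ?case using indef_int_continuous_on by blast
  qed (simp add: U0)
  have ai: "(\<lambda>t. \<alpha> t * V n t) absolutely_integrable_on {a..b}"
    "(\<lambda>t. \<beta> t * U n t + \<gamma> t) absolutely_integrable_on {a..b}" for n
    using cont by (intro absolutely_integrable_mult_continuous set_integral_add(1) i; simp)+
  have II: "indef_int a b (U (Suc n)) (\<lambda>t. \<alpha> t * V n t)" "indef_int a b (V (Suc n)) (\<lambda>t. \<beta> t * U n t + \<gamma> t)" for n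
    unfolding US by (intro indef_int_integral ai)+
  define \<omega> where "\<omega> = (\<lambda>t. norm (\<alpha> t) + norm (\<beta> t))"
  have w: "\<omega> absolutely_integrable_on {a..b}"
    unfolding \<omega>_def by (intro set_integral_add(1) absolutely_integrable_norm' i)
  define m where "m = (\<lambda>x. 0 + integral {a..x} \<omega>)"
  have im: "indef_int a b m \<omega>" unfolding m_def by (rule indef_int_integral[OF w])
  have m0: "m a = 0" by (simp add: m_def)
  have mpos: "m x \<ge> 0" and mle: "m x \<le> m b" if "x \<in> {a..b}" for x
  proof -
    have "\<omega> integrable_on {a..x}" "\<omega> integrable_on {a..b}"
      using indef_intD(3)[OF im] that ab by auto
    then show "m x \<ge> 0" "m x \<le> m b"
      using that unfolding m_def by (auto simp: \<omega>_def intro!: integral_nonneg integral_subset_le)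
  qed
  define D where "D = (\<lambda>n x. norm (U (Suc n) x - U n x) + norm (V (Suc n) x - V n x))"
  have cD: "continuous_on {a..b} (D n)" for n
    unfolding D_def using cont by (intro continuous_intros) auto
  have "bounded (D 0 ` {a..b})"
    using cD compact_imp_bounded compact_continuous_image compact_Icc by blast
  then obtain K where K: "\<And>x. x \<in> {a..b} \<Longrightarrow> norm (D 0 x) \<le> K"
    unfolding bounded_iff by blast
  have bound: "\<forall>x\<in>{a..b}. D n x \<le> K * m x ^ n / fact n" for n
  proof (induction n)
    case 0
    then show ?case using K by (auto simp: abs_le_iff)
  next
    case (Suc n)
    show ?case
    proof
      fix x assume x: "x \<in> {a..b}"
      have dU: "indef_int a b (\<lambda>x. U (Suc (Suc n)) x - U (Suc n) x) (\<lambda>t. \<alpha> t * (V (Suc n) t - V n t))"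
        using indef_int_add[OF II(1)[of "Suc n"] indef_int_linear[OF II(1)[of n] bounded_linear_minus[OF bounded_linear_ident]]]
        by (simp add: algebra_simps)
      have dV: "indef_int a b (\<lambda>x. V (Suc (Suc n)) x - V (Suc n) x) (\<lambda>t. \<beta> t * (U (Suc n) t - U n t))"
        using indef_int_add[OF II(2)[of "Suc n"] indef_int_linear[OF II(2)[of n] bounded_linear_minus[OF bounded_linear_ident]]]
        by (simp add: algebra_simps)
      have A: "(\<lambda>t. norm (\<alpha> t) * norm (V (Suc n) t - V n t)) integrable_on {a..x}"
        and B: "(\<lambda>t. norm (\<beta> t) * norm (U (Suc n) t - U n t)) integrable_on {a..x}"
        using cont x by (intro absolutely_integrable_on_imp_integrable_on absolutely_integrable_on_subinterval[of a b _ x]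
           absolutely_integrable_mult_continuous absolutely_integrable_norm' i continuous_intros; simp)+
      have z: "U (Suc k) a = c" "V (Suc k) a = d" for k by (simp_all add: US)
      have "norm (U (Suc (Suc n)) x - U (Suc n) x) \<le> integral {a..x} (\<lambda>t. norm (\<alpha> t) * norm (V (Suc n) t - V n t))"
        using indef_int_norm_le[OF dU x A] by (simp add: norm_mult z)
      moreover have "norm (V (Suc (Suc n)) x - V (Suc n) x) \<le> integral {a..x} (\<lambda>t. norm (\<beta> t) * norm (U (Suc n) t - U n t))"
        using indef_int_norm_le[OF dV x B] by (simp add: norm_mult z)
      ultimately have "D (Suc n) x \<le> integral {a..x} (\<lambda>t. norm (\<alpha> t) * norm (V (Suc n) t - V n t) + norm (\<beta> t) * norm (U (Suc n) t - U n t))"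
        using integral_add[OF A B] by (simp add: D_def)
      also have "\<dots> \<le> integral {a..x} (\<lambda>t. K / fact n * (\<omega> t * m t ^ n))"
      proof (rule integral_le[OF integrable_add[OF A B]])
        have "(\<lambda>t. \<omega> t * m t ^ n) absolutely_integrable_on {a..b}"
          using indef_int_continuous_on[OF im] by (intro absolutely_integrable_mult_continuous w continuous_intros)
        then show "(\<lambda>t. K / fact n * (\<omega> t * m t ^ n)) integrable_on {a..x}"
          using x by (intro integrable_on_mult_right absolutely_integrable_on_imp_integrable_on
              absolutely_integrable_on_subinterval[of a b _ x]) auto
        fix t assume t: "t \<in> {a..x}"
        have "norm (\<alpha> t) * norm (V (Suc n) t - V n t) + norm (\<beta> t) * norm (U (Suc n) t - U n t) \<le> \<omega> t * D n t"
          by (simp add: \<omega>_def D_def algebra_simps)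
        also have "\<dots> \<le> \<omega> t * (K * m t ^ n / fact n)"
          using Suc t x by (intro mult_left_mono) (auto simp: \<omega>_def)
        finally show "norm (\<alpha> t) * norm (V (Suc n) t - V n t) + norm (\<beta> t) * norm (U (Suc n) t - U n t)
            \<le> K / fact n * (\<omega> t * m t ^ n)" by (simp add: field_simps)
      qed
      also have "\<dots> = K / fact n * integral {a..x} (\<lambda>t. \<omega> t * m t ^ n)"
        by simp
      also have "integral {a..x} (\<lambda>t. \<omega> t * m t ^ n) = m x ^ Suc n / real (Suc n)"
      proof -
        have "m x ^ Suc n - m a ^ Suc n = integral {a..x} (\<lambda>t. real (Suc n) * (\<omega> t * m t ^ n))"
          using x by (intro indef_int_diff[OF indef_int_power_real[OF im ab]]) auto
        also have "\<dots> = real (Suc n) * integral {a..x} (\<lambda>t. \<omega> t * m t ^ n)"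
          by (rule integral_mult_right)
        finally show ?thesis by (simp add: m0 del: of_nat_Suc)
      qed
      finally show "D (Suc n) x \<le> K * m x ^ Suc n / fact (Suc n)"
        by (simp add: field_simps)
    qed
  qed
  have K0: "K \<ge> 0" using K[of a] ab norm_ge_zero[of "D 0 a"] by (auto intro: order_trans)
  define M where "M = (\<lambda>n. K * m b ^ n / fact n)"
  have sM: "summable M"
    using summable_mult[OF summable_exp[of "m b"], of K] by (simp add: M_def field_simps)
  have DM: "D n x \<le> M n" if "x \<in> {a..b}" for n x
  proof -
    have "K * m x ^ n / fact n \<le> K * m b ^ n / fact n"
      using mpos[OF that] mle[OF that] K0 by (intro divide_right_mono mult_left_mono power_mono) auto
    then show ?thesis using bound[of n] that by (force simp: M_def)
  qed
  have nU: "norm (U (Suc n) x - U n x) \<le> M n" and nV: "norm (V (Suc n) x - V n x) \<le> M n" if "x \<in> {a..b}" for n x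
    using DM[OF that, of n] norm_ge_zero[of "U (Suc n) x - U n x"] norm_ge_zero[of "V (Suc n) x - V n x"]
    unfolding D_def by linarith+
  have tele: "U n x = c + (\<Sum>k<n. U (Suc k) x - U k x)" "V n x = d + (\<Sum>k<n. V (Suc k) x - V k x)" for n x
    using sum_lessThan_telescope[of "\<lambda>k. U k x" n] sum_lessThan_telescope[of "\<lambda>k. V k x" n] by (simp_all add: U0)
  have ul: "uniform_limit {a..b} U (\<lambda>x. c + (\<Sum>k. U (Suc k) x - U k x)) sequentially"
    "uniform_limit {a..b} V (\<lambda>x. d + (\<Sum>k. V (Suc k) x - V k x)) sequentially"
  proof -
    have "uniform_limit {a..b} (\<lambda>n x. c + (\<Sum>k<n. U (Suc k) x - U k x)) (\<lambda>x. c + (\<Sum>k. U (Suc k) x - U k x)) sequentially"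
      "uniform_limit {a..b} (\<lambda>n x. d + (\<Sum>k<n. V (Suc k) x - V k x)) (\<lambda>x. d + (\<Sum>k. V (Suc k) x - V k x)) sequentially"
      by (rule uniform_limit_add[OF uniform_limit_const Weierstrass_m_test[OF nU sM]]
          uniform_limit_add[OF uniform_limit_const Weierstrass_m_test[OF nV sM]]; assumption)+
    then show "uniform_limit {a..b} U (\<lambda>x. c + (\<Sum>k. U (Suc k) x - U k x)) sequentially"
      "uniform_limit {a..b} V (\<lambda>x. d + (\<Sum>k. V (Suc k) x - V k x)) sequentially"
      by (simp_all flip: tele)
  qed
  define u where "u = (\<lambda>x. c + (\<Sum>k. U (Suc k) x - U k x))"
  define v where "v = (\<lambda>x. d + (\<Sum>k. V (Suc k) x - V k x))"
  note ul = ul[folded u_def v_def]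
  have cu: "continuous_on {a..b} u" "continuous_on {a..b} v"
    by (rule uniform_limit_theorem[OF _ ul(1)] uniform_limit_theorem[OF _ ul(2)]; simp add: cont)+
  have ptU: "(\<lambda>n. U n x) \<longlonglongrightarrow> u x" and ptV: "(\<lambda>n. V n x) \<longlonglongrightarrow> v x" if "x \<in> {a..b}" for x
    by (rule tendsto_uniform_limitI[OF ul(1) that] tendsto_uniform_limitI[OF ul(2) that])+
  \<comment> \<open>A common bound for all iterates. It provides the majorant under which the limit
    passes through the integrals by dominated convergence.\<close>
  define B where "B = norm c + norm d + suminf M"
  have Mnn: "M n \<ge> 0" for n using K0 mpos[of b] ab by (simp add: M_def)
  have UB: "norm (U n x) \<le> B" "norm (V n x) \<le> B" if x: "x \<in> {a..b}" for n x
  proof -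
    have "norm (\<Sum>k<n. U (Suc k) x - U k x) \<le> (\<Sum>k<n. M k)" "norm (\<Sum>k<n. V (Suc k) x - V k x) \<le> (\<Sum>k<n. M k)"
      using nU[OF x] nV[OF x] by (intro sum_norm_le; simp)+
    moreover have "(\<Sum>k<n. M k) \<le> suminf M"
      by (rule sum_le_suminf[OF sM]) (auto simp: Mnn)
    ultimately show "norm (U n x) \<le> B" "norm (V n x) \<le> B"
      using norm_triangle_ineq[of c "\<Sum>k<n. U (Suc k) x - U k x"] norm_triangle_ineq[of d "\<Sum>k<n. V (Suc k) x - V k x"]
        norm_ge_zero[of c] norm_ge_zero[of d]
      unfolding B_def tele(1)[of n x] tele(2)[of n x] by linarith+
  qed
  have eq: "u x = c + integral {a..x} (\<lambda>t. \<alpha> t * v t)" "v x = d + integral {a..x} (\<lambda>t. \<beta> t * u t + \<gamma> t)"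
    if x: "x \<in> {a..b}" for x
  proof -
    have sub: "t \<in> {a..b}" if "t \<in> {a..x}" for t using that x by auto
    have ax: "(\<lambda>t. norm (\<alpha> t)) integrable_on {a..x}" "(\<lambda>t. norm (\<beta> t)) integrable_on {a..x}" "(\<lambda>t. norm (\<gamma> t)) integrable_on {a..x}"
      using x by (intro absolutely_integrable_on_imp_integrable_on absolutely_integrable_on_subinterval[of a b _ x] absolutely_integrable_norm' i; simp)+
    have "(\<lambda>n. integral {a..x} (\<lambda>t. \<alpha> t * V n t)) \<longlonglongrightarrow> integral {a..x} (\<lambda>t. \<alpha> t * v t)"
    proof (rule dominated_convergence(2))
      show "(\<lambda>t. \<alpha> t * V n t) integrable_on {a..x}" for n
        using x by (intro absolutely_integrable_on_imp_integrable_on absolutely_integrable_on_subinterval[OF ai(1)]) auto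
      show "(\<lambda>t. B * norm (\<alpha> t)) integrable_on {a..x}" by (rule integrable_on_mult_right[OF ax(1)])
      show "norm (\<alpha> t * V n t) \<le> B * norm (\<alpha> t)" if "t \<in> {a..x}" for t n
        using mult_right_mono[OF UB(2)[OF sub[OF that], of n] norm_ge_zero[of "\<alpha> t"]] by (simp add: norm_mult mult.commute)
      show "(\<lambda>n. \<alpha> t * V n t) \<longlonglongrightarrow> \<alpha> t * v t" if "t \<in> {a..x}" for t
        by (rule tendsto_mult[OF tendsto_const ptV[OF sub[OF that]]])
    qed
    then have "(\<lambda>n. U (Suc n) x) \<longlonglongrightarrow> c + integral {a..x} (\<lambda>t. \<alpha> t * v t)"
      unfolding US by (rule tendsto_add[OF tendsto_const])
    then show "u x = c + integral {a..x} (\<lambda>t. \<alpha> t * v t)"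
      by (rule LIMSEQ_unique[OF LIMSEQ_Suc[OF ptU[OF x]]])
    have "(\<lambda>n. integral {a..x} (\<lambda>t. \<beta> t * U n t + \<gamma> t)) \<longlonglongrightarrow> integral {a..x} (\<lambda>t. \<beta> t * u t + \<gamma> t)"
    proof (rule dominated_convergence(2))
      show "(\<lambda>t. \<beta> t * U n t + \<gamma> t) integrable_on {a..x}" for n
        using x by (intro absolutely_integrable_on_imp_integrable_on absolutely_integrable_on_subinterval[OF ai(2)]) auto
      show "(\<lambda>t. B * norm (\<beta> t) + norm (\<gamma> t)) integrable_on {a..x}"
        by (rule integrable_add[OF integrable_on_mult_right[OF ax(2)] ax(3)])
      show "norm (\<beta> t * U n t + \<gamma> t) \<le> B * norm (\<beta> t) + norm (\<gamma> t)" if "t \<in> {a..x}" for t n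
        using mult_right_mono[OF UB(1)[OF sub[OF that], of n] norm_ge_zero[of "\<beta> t"]]
          norm_triangle_ineq[of "\<beta> t * U n t" "\<gamma> t"] by (simp add: norm_mult mult.commute)
      show "(\<lambda>n. \<beta> t * U n t + \<gamma> t) \<longlonglongrightarrow> \<beta> t * u t + \<gamma> t" if "t \<in> {a..x}" for t
        by (rule tendsto_add[OF tendsto_mult[OF tendsto_const ptU[OF sub[OF that]]] tendsto_const])
    qed
    then have "(\<lambda>n. V (Suc n) x) \<longlonglongrightarrow> d + integral {a..x} (\<lambda>t. \<beta> t * u t + \<gamma> t)"
      unfolding US by (rule tendsto_add[OF tendsto_const])
    then show "v x = d + integral {a..x} (\<lambda>t. \<beta> t * u t + \<gamma> t)"
      by (rule LIMSEQ_unique[OF LIMSEQ_Suc[OF ptV[OF x]]])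
  qed
  have "u a = c" "v a = d" using eq[of a] ab by auto
  moreover have "lin_sys a b \<alpha> \<beta> \<gamma> u v"
    unfolding lin_sys_def indef_int_def \<open>u a = c\<close> \<open>v a = d\<close>
    using eq cu by (intro conjI ballI absolutely_integrable_mult_continuous set_integral_add(1) i) auto
  ultimately show ?thesis by blast
qed

section \<open>Power sums of the zeros of an entire function of order one half\<close>

lemma entire_factor_zero:
  assumes hol: "f holomorphic_on UNIV" and nz: "f w0 \<noteq> 0" and \<xi>: "f \<xi> = 0"
  obtains g where "g holomorphic_on UNIV" "g \<xi> \<noteq> 0" "\<And>z. f z = (z - \<xi>) ^ nat (zorder f \<xi>) * g z" "zorder f \<xi> > 0"
proof -
  have nc: "\<not> f constant_on UNIV"
    using nz \<xi> by (metis UNIV_I constant_on_def)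
  obtain g r n where gr: "0 < (n::nat)" "0 < r" "g holomorphic_on ball \<xi> r"
      "\<And>w. w \<in> ball \<xi> r \<Longrightarrow> f w = (w - \<xi>) ^ n * g w" "\<And>w. w \<in> ball \<xi> r \<Longrightarrow> g w \<noteq> 0"
    by (rule holomorphic_factor_zero_nonconstant[OF hol open_UNIV connected_UNIV UNIV_I \<xi>(1) nc]) (rule that, auto)
  define h where "h = (\<lambda>z. if z = \<xi> then g \<xi> else f z / (z - \<xi>) ^ n)"
  have hg: "h w = g w" if "w \<in> ball \<xi> r" for w
    using gr(4)[OF that] by (auto simp: h_def)
  have fh: "f z = (z - \<xi>) ^ n * h z" for z
    using gr(1) \<xi> by (auto simp: h_def)
  have h1: "h holomorphic_on ball \<xi> r"
    using gr(3) hg by (subst holomorphic_cong[OF refl, of _ h g]) auto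
  have "(\<lambda>z. f z / (z - \<xi>) ^ n) holomorphic_on (- {\<xi>})"
    by (intro holomorphic_intros holomorphic_on_subset[OF hol]) auto
  then have h2: "h holomorphic_on (- {\<xi>})"
    by (subst holomorphic_cong[OF refl, of _ h "\<lambda>z. f z / (z - \<xi>) ^ n"]) (auto simp: h_def)
  have "h holomorphic_on (ball \<xi> r \<union> - {\<xi>})"
    by (rule holomorphic_on_Un[OF h1 h2]) auto
  moreover have "ball \<xi> r \<union> - {\<xi>} = UNIV"
    using gr(2) by auto
  ultimately have h: "h holomorphic_on UNIV" by simp
  have h0: "h \<xi> \<noteq> 0" using gr(2,5) hg[of \<xi>] by auto
  have "zorder f \<xi> = int n"
    by (rule zorder_eqI[where S = UNIV and g = h]) (use h h0 fh in \<open>auto simp: mult.commute\<close>)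
  with that[OF h h0] fh gr(1) show ?thesis by simp
qed

text \<open>The factor is normalized to the value 1 at the origin, so that dividing it out leaves
  the value at the origin unchanged.\<close>

lemma entire_divide_out_zero:
  assumes hol: "f holomorphic_on UNIV" and nz: "f w0 \<noteq> 0" and \<xi>: "f \<xi> = 0" "\<xi> \<noteq> 0"
  obtains m :: nat and g where "g holomorphic_on UNIV" "g \<xi> \<noteq> 0" "\<And>z. f z = g z * (1 - z / \<xi>) ^ m"
proof -
  obtain h where h: "h holomorphic_on UNIV" "h \<xi> \<noteq> 0" "\<And>z. f z = (z - \<xi>) ^ nat (zorder f \<xi>) * h z"
    by (rule entire_factor_zero[OF hol nz \<xi>(1)]) blast
  define n where "n = nat (zorder f \<xi>)"
  show ?thesis
  proof
    show "(\<lambda>z. (-\<xi>) ^ n * h z) holomorphic_on UNIV"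
      by (intro holomorphic_intros h)
    show "(-\<xi>) ^ n * h \<xi> \<noteq> 0" using \<xi> h(2) by simp
    show "f z = (-\<xi>) ^ n * h z * (1 - z / \<xi>) ^ n" for z
    proof -
      have "(-\<xi>) * (1 - z / \<xi>) = z - \<xi>"
        using \<xi> by (simp add: field_simps)
      then have "(-\<xi>) ^ n * (1 - z / \<xi>) ^ n = (z - \<xi>) ^ n"
        by (metis power_mult_distrib)
      then show ?thesis unfolding h(3)[of z] n_def[symmetric] by (simp add: mult_ac)
    qed
  qed
qed

lemma entire_divide_out_zeros:
  assumes hol: "f holomorphic_on UNIV" and nz: "f 0 \<noteq> 0"
    and "finite S" "\<And>\<xi>. \<xi> \<in> S \<Longrightarrow> f \<xi> = 0"
  shows "\<exists>g. g holomorphic_on UNIV \<and> (\<forall>\<xi>\<in>S. g \<xi> \<noteq> 0) \<and>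
     (\<forall>z. f z = g z * (\<Prod>\<xi>\<in>S. (1 - z / \<xi>) ^ nat (zorder f \<xi>)))"
proof -
  \<comment> \<open>The exponents stay unspecified during the induction. They are recognized as the
    orders of \<open>f\<close> afterwards, when the cofactor is known not to vanish at any point of
    \<open>S\<close>.\<close>
  have "\<exists>g m. g holomorphic_on UNIV \<and> (\<forall>\<xi>\<in>S. g \<xi> \<noteq> 0) \<and>
     (\<forall>z. f z = g z * (\<Prod>\<xi>\<in>S. (1 - z / \<xi>) ^ m \<xi>))"
    using assms(3,4)
  proof (induction S)
    case empty
    show ?case using hol by (intro exI[of _ f]) auto
  next
    case (insert \<xi> S)
    then obtain g m where g: "g holomorphic_on UNIV" "\<forall>\<xi>\<in>S. g \<xi> \<noteq> 0"
      "\<And>z. f z = g z * (\<Prod>\<xi>\<in>S. (1 - z / \<xi>) ^ m \<xi>)" by auto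
    have \<xi>0: "\<xi> \<noteq> 0" "f \<xi> = 0" using nz insert.prems by auto
    have S0: "w \<noteq> 0" if "w \<in> S" for w using nz insert.prems[of w] that by auto
    have "(\<Prod>w\<in>S. (1 - \<xi> / w) ^ m w) \<noteq> 0"
      using insert.hyps S0 by (auto simp: field_simps)
    then have g\<xi>: "g \<xi> = 0" using g(3)[of \<xi>] \<xi>0 by auto
    have "g 0 \<noteq> 0" using g(3)[of 0] nz by auto
    then obtain k h where h: "h holomorphic_on UNIV" "h \<xi> \<noteq> 0" "\<And>z. g z = h z * (1 - z / \<xi>) ^ k"
      using entire_divide_out_zero[OF g(1) _ g\<xi> \<xi>0(1)] by metis
    have prod: "(\<Prod>w\<in>S. (1 - z / w) ^ (m(\<xi> := k)) w) = (\<Prod>w\<in>S. (1 - z / w) ^ m w)" for z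
      using insert.hyps by (intro prod.cong) auto
    show ?case
    proof (intro exI[of _ h] exI[of _ "m(\<xi> := k)"] conjI ballI allI)
      show "h w \<noteq> 0" if "w \<in> insert \<xi> S" for w
        using that h(2) h(3)[of w] g(2) by auto
      show "f z = h z * (\<Prod>w\<in>insert \<xi> S. (1 - z / w) ^ (m(\<xi> := k)) w)" for z
        using insert.hyps prod[of z] g(3)[of z] h(3)[of z] by simp
    qed (fact h(1))
  qed
  then obtain g m where g: "g holomorphic_on UNIV" "\<forall>\<xi>\<in>S. g \<xi> \<noteq> 0"
     "\<And>z. f z = g z * (\<Prod>\<xi>\<in>S. (1 - z / \<xi>) ^ m \<xi>)" by blast
  have S0: "w \<noteq> 0" if "w \<in> S" for w using nz assms(4)[of w] that by auto
  have "nat (zorder f \<xi>) = m \<xi>" if \<xi>: "\<xi> \<in> S" for \<xi>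
  proof -
    define h where "h = (\<lambda>z. g z * (- 1 / \<xi>) ^ m \<xi> * (\<Prod>w\<in>S - {\<xi>}. (1 - z / w) ^ m w))"
    have "zorder f \<xi> = int (m \<xi>)"
    proof (rule zorder_eqI[where S = UNIV and g = h])
      show "h holomorphic_on UNIV"
        unfolding h_def using S0 by (intro holomorphic_intros g(1)) auto
      show "h \<xi> \<noteq> 0"
        unfolding h_def using g(2) \<xi> S0 assms(3) by (auto simp: field_simps)
      fix z assume "z \<noteq> \<xi>"
      have "(1 - z / \<xi>) ^ m \<xi> = ((- 1 / \<xi>) * (z - \<xi>)) ^ m \<xi>"
        using S0[OF \<xi>] by (intro arg_cong[of _ _ "\<lambda>x. x ^ m \<xi>"]) (simp add: field_simps)
      also have "\<dots> = (- 1 / \<xi>) ^ m \<xi> * (z - \<xi>) ^ m \<xi>"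
        by (rule power_mult_distrib)
      finally show "f z = h z * (z - \<xi>) powi int (m \<xi>)"
        using g(3)[of z] prod.remove[OF assms(3) \<xi>, of "\<lambda>w. (1 - z / w) ^ m w"] by (simp add: h_def mult_ac)
    qed auto
    then show ?thesis by simp
  qed
  with g show ?thesis by (intro exI[of _ g]) (auto intro!: prod.cong)
qed

text \<open>Borel--Caratheodory, by applying the Schwarz lemma to \<open>L / (2 A - L)\<close>.\<close>

lemma borel_caratheodory_half:
  assumes hol: "L holomorphic_on ball 0 R" and L0: "L 0 = 0" and R: "R > 0"
    and re: "\<And>z. norm z < R \<Longrightarrow> Re (L z) < A" and z: "norm z \<le> R / 2"
  shows "norm (L z) \<le> 2 * A"
proof -
  have A: "A > 0" using re[of 0] L0 R by simp
  define f where "f = (\<lambda>w. L (of_real R * w) / (2 * of_real A - L (of_real R * w)))"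
  have w: "norm (of_real R * w) < R" if "norm w < 1" for w :: complex
    using that R by (simp add: norm_mult)
  have ne: "2 * of_real A - L (of_real R * w) \<noteq> 0" if "norm w < 1" for w
    using re[OF w[OF that]] A by (auto simp: complex_eq_iff)
  have "norm (f w) \<le> norm w" if "norm w < 1" for w
  proof (rule Schwarz_Lemma(1)[of f])
    show "f holomorphic_on ball 0 1"
      unfolding f_def using w ne
      by (intro holomorphic_intros holomorphic_on_compose_gen[of "\<lambda>w. of_real R * w" _ L "ball 0 R", unfolded comp_def] hol)
        auto
    show "norm (f w) < 1" if "norm w < 1" for w
    proof -
      let ?l = "L (of_real R * w)"
      \<comment> \<open>Re L < A says precisely that L is nearer to 0 than to 2 A, so the quotient
        maps into the unit disc.\<close>
      have "(norm ?l)\<^sup>2 < (norm (2 * of_real A - ?l))\<^sup>2"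
      proof -
        have "(norm (2 * of_real A - ?l))\<^sup>2 - (norm ?l)\<^sup>2 = 4 * A * (A - Re ?l)"
          unfolding cmod_power2 by (simp add: power2_eq_square algebra_simps)
        also have "\<dots> > 0" using A re[OF w[OF that]] by simp
        finally show ?thesis by simp
      qed
      then have "norm ?l < norm (2 * of_real A - ?l)"
        by (rule power2_less_imp_less) simp
      then show ?thesis by (simp add: f_def norm_divide divide_less_eq)
    qed
  qed (use that L0 in \<open>auto simp: f_def\<close>)
  moreover have "norm (z / of_real R) < 1" using z R by (simp add: norm_divide field_simps)
  ultimately have "norm (f (z / of_real R)) \<le> norm (z / of_real R)" by blast
  also have "\<dots> \<le> 1 / 2" using z R by (simp add: norm_divide field_simps)
  finally have f: "norm (f (z / of_real R)) \<le> 1 / 2" .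
  have z1: "norm (z / of_real R) < 1" using z R by (simp add: norm_divide field_simps)
  have Rz: "of_real R * (z / of_real R) = z" using R by simp
  \<comment> \<open>The inequality |L| \<le> (2 A + |L|) / 2 is then solved for |L|.\<close>
  have "norm (L z) \<le> 1 / 2 * norm (2 * of_real A - L z)"
    using f ne[OF z1] unfolding f_def Rz by (simp add: norm_divide field_simps)
  also have "\<dots> \<le> 1 / 2 * (2 * A + norm (L z))"
    using norm_triangle_ineq4[of "2 * of_real A" "L z"] A by (simp add: norm_mult)
  finally show ?thesis by simp
qed

text \<open>A zero at the origin is supposed to be removed already, so that all zeros have
  reciprocals and the logarithmic derivative has a Taylor series at 0.\<close>

locale entire_half_order =
  fixes G :: "complex \<Rightarrow> complex" and C :: real
  assumes hol: "G holomorphic_on UNIV" and G0: "G 0 \<noteq> 0"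
    and growth: "\<And>z. norm (G z) \<le> exp (C * (1 + sqrt (norm z)))" and C: "C \<ge> 0"
begin

definition Z where "Z = {z. G z = 0}"
definition n where "n z = real (nat (zorder G z))"
definition S where "S R = Z \<inter> cball 0 R"
text \<open>This exceeds ln |f z / G 0| for |z| \<le> 3 R, where f is the quotient of
  \<open>G\<close> by the zeros in the disc of radius R. The summand 1 makes the inequality strict,
  as the hypothesis of Borel--Caratheodory requires.\<close>

definition A where "A R = C * (1 + sqrt (3 * R)) + \<bar>ln (norm (G 0))\<bar> + 1"

lemma n_nonneg: "n z \<ge> 0" by (simp add: n_def)

lemma Z_nonzero: "z \<in> Z \<Longrightarrow> z \<noteq> 0"
  using G0 by (auto simp: Z_def)

lemma finite_S: "finite (S R)"
proof (cases "G constant_on UNIV")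
  case True
  then have "S R = {}" using G0 by (auto simp: S_def Z_def constant_on_def)
  then show ?thesis by simp
next
  case False
  have "S R = {z \<in> cball 0 R. G z = 0}" by (auto simp: S_def Z_def)
  then show ?thesis
    using holomorphic_compact_finite_zeros[OF hol open_UNIV connected_UNIV _ _ False, of "cball 0 R"] by simp
qed

text \<open>On the circle of radius 3 R every factor has modulus at least 2, because |w / \<xi>|
  \<ge> 3 there, and the maximum principle carries the resulting bound inside. The power of 2 is
  kept in the estimate since at the origin it counts the zeros.\<close>

lemma quotient_bound:
  assumes R: "R > 0"
  obtains f where "f holomorphic_on UNIV" "\<And>z. norm z \<le> R \<Longrightarrow> f z \<noteq> 0" "f 0 = G 0"
    "\<And>z. G z = f z * (\<Prod>\<xi>\<in>S R. (1 - z / \<xi>) ^ nat (zorder G \<xi>))"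
    "\<And>z. norm z \<le> 3 * R \<Longrightarrow> norm (f z) * 2 powr (\<Sum>\<xi>\<in>S R. n \<xi>) \<le> exp (C * (1 + sqrt (3 * R)))"
proof -
  obtain f where f: "f holomorphic_on UNIV" "\<And>\<xi>. \<xi> \<in> S R \<Longrightarrow> f \<xi> \<noteq> 0"
    "\<And>z. G z = f z * (\<Prod>\<xi>\<in>S R. (1 - z / \<xi>) ^ nat (zorder G \<xi>))"
  proof -
    have "G \<xi> = 0" if "\<xi> \<in> S R" for \<xi> using that by (simp add: S_def Z_def)
    from entire_divide_out_zeros[OF hol G0 finite_S this] show thesis using that by blast
  qed
  define N where "N = (\<Sum>\<xi>\<in>S R. nat (zorder G \<xi>))"
  have N: "(\<Sum>\<xi>\<in>S R. n \<xi>) = real N" by (simp add: N_def n_def)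
  have bd: "norm (f z) \<le> exp (C * (1 + sqrt (3 * R))) / 2 ^ N" if z: "norm z \<le> 3 * R" for z
  proof (rule maximum_modulus_frontier[of f "cball 0 (3 * R)"])
    fix w :: complex assume "w \<in> frontier (cball 0 (3 * R))"
    then have w: "norm w = 3 * R" by simp
    have "2 ^ N = (\<Prod>\<xi>\<in>S R. 2 ^ nat (zorder G \<xi>) :: real)"
      by (simp add: N_def power_sum)
    also have "\<dots> \<le> (\<Prod>\<xi>\<in>S R. norm (1 - w / \<xi>) ^ nat (zorder G \<xi>))"
    proof (intro prod_mono conjI power_mono)
      fix \<xi> assume \<xi>: "\<xi> \<in> S R"
      then have "norm \<xi> \<le> R" "\<xi> \<noteq> 0" using Z_nonzero by (auto simp: S_def)
      then have "3 \<le> norm (w / \<xi>)" using w R by (simp add: norm_divide field_simps)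
      then show "2 \<le> norm (1 - w / \<xi>)"
        using norm_triangle_ineq2[of "w / \<xi>" 1] by (simp add: norm_minus_commute)
    qed auto
    finally have "norm (f w) * 2 ^ N \<le> norm (G w)"
      by (subst f(3)) (simp add: norm_mult prod_norm norm_power mult_left_mono flip: prod_norm)
    also have "\<dots> \<le> exp (C * (1 + sqrt (3 * R)))" using growth[of w] w by simp
    finally show "norm (f w) \<le> exp (C * (1 + sqrt (3 * R))) / 2 ^ N"
      by (simp add: field_simps)
  qed (use z f(1) in \<open>auto intro: holomorphic_on_subset holomorphic_on_imp_continuous_on\<close>)
  show ?thesis
  proof
    show "f z \<noteq> 0" if "norm z \<le> R" for z
    proof
      assume "f z = 0"
      then have "z \<in> S R" using f(3)[of z] that by (auto simp: S_def Z_def)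
      with f(2) \<open>f z = 0\<close> show False by blast
    qed
    show "f 0 = G 0" using f(3)[of 0] by simp
    show "norm (f z) * 2 powr (\<Sum>\<xi>\<in>S R. n \<xi>) \<le> exp (C * (1 + sqrt (3 * R)))" if "norm z \<le> 3 * R" for z
      using bd[OF that] unfolding N by (simp add: powr_realpow field_simps)
  qed (fact f)+
qed

lemma exp_A: "exp (C * (1 + sqrt (3 * R))) < norm (G 0) * exp (A R)"
proof -
  have "exp (C * (1 + sqrt (3 * R))) = norm (G 0) * exp (C * (1 + sqrt (3 * R)) - ln (norm (G 0)))"
    using G0 by (simp add: exp_diff)
  also have "\<dots> < norm (G 0) * exp (A R)"
    using G0 by (intro mult_strict_left_mono) (auto simp: A_def)
  finally show ?thesis .
qed

text \<open>At the origin the quotient equals G 0, so 2 to the number of zeros is below exp (A R).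
  The factor 2 covers 1 / ln 2.\<close>

lemma count_bound:
  assumes R: "R > 0"
  shows "(\<Sum>\<xi>\<in>S R. n \<xi>) \<le> 2 * A R"
proof -
  obtain f :: "complex \<Rightarrow> complex" where f: "f 0 = G 0"
    "\<And>z. norm z \<le> 3 * R \<Longrightarrow> norm (f z) * 2 powr (\<Sum>\<xi>\<in>S R. n \<xi>) \<le> exp (C * (1 + sqrt (3 * R)))"
    by (rule quotient_bound[OF R]) (rule that; blast)
  have "norm (G 0) * 2 powr (\<Sum>\<xi>\<in>S R. n \<xi>) < norm (G 0) * exp (A R)"
    using f(2)[of 0] R f(1) exp_A[of R] by simp
  then have "2 powr (\<Sum>\<xi>\<in>S R. n \<xi>) < exp (A R)" using G0 by simp
  then have "(\<Sum>\<xi>\<in>S R. n \<xi>) * ln 2 < A R"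
    by (simp add: powr_def)
  moreover have "(\<Sum>\<xi>\<in>S R. n \<xi>) * (1 / 2) \<le> (\<Sum>\<xi>\<in>S R. n \<xi>) * ln 2"
    using ln2_ge_two_thirds by (intro mult_left_mono sum_nonneg n_nonneg) auto
  ultimately show ?thesis by linarith
qed

lemma A_le: "R \<ge> 1 \<Longrightarrow> A R \<le> (3 * C + \<bar>ln (norm (G 0))\<bar> + 1) * sqrt R"
proof -
  assume R: "R \<ge> 1"
  have s: "sqrt R \<ge> 1" using R by simp
  have "sqrt (3 * R) \<le> 2 * sqrt R" by (rule real_le_lsqrt) (use R in \<open>auto simp: power_mult_distrib\<close>)
  then have "C * (1 + sqrt (3 * R)) \<le> C * (3 * sqrt R)"
    using s C \<open>sqrt (3 * R) \<le> 2 * sqrt R\<close> by (intro mult_left_mono) linarith+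
  moreover have "(\<bar>ln (norm (G 0))\<bar> + 1) * 1 \<le> (\<bar>ln (norm (G 0))\<bar> + 1) * sqrt R"
    using s by (intro mult_left_mono) auto
  ultimately show ?thesis by (simp add: A_def algebra_simps)
qed

text \<open>Dyadic annuli: up to radius 2^(J+1) there are at most K sqrt (2^(J+1)) zeros, and those
  beyond 2^J have reciprocals below 2^(-J). The annuli thus contribute a geometric series with ratio
  1 / sqrt 2.\<close>

lemma sum_reciprocal_bounded:
  "\<exists>B. \<forall>R. (\<Sum>\<xi>\<in>S R. n \<xi> / norm \<xi>) \<le> B"
proof -
  define K where "K = 2 * (3 * C + \<bar>ln (norm (G 0))\<bar> + 1)"
  have K: "K \<ge> 0" using C by (simp add: K_def)
  define B0 where "B0 = (\<Sum>\<xi>\<in>S 1. n \<xi> / norm \<xi>)"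
  define q where "q = 1 / sqrt 2"
  have q: "0 < q" "q < 1" by (auto simp: q_def)
  have step: "(\<Sum>\<xi>\<in>S (2 ^ J). n \<xi> / norm \<xi>) \<le> B0 + (\<Sum>j<J. 2 * K * q ^ j)" for J
  proof (induction J)
    case 0 show ?case by (simp add: B0_def)
  next
    case (Suc J)
    let ?A = "S (2 ^ Suc J) - S (2 ^ J)"
    have sub: "S (2 ^ J) \<subseteq> S (2 ^ Suc J)"
      unfolding S_def by (intro Int_mono subset_cball) auto
    have "(\<Sum>\<xi>\<in>S (2 ^ Suc J). n \<xi> / norm \<xi>) = (\<Sum>\<xi>\<in>?A. n \<xi> / norm \<xi>) + (\<Sum>\<xi>\<in>S (2 ^ J). n \<xi> / norm \<xi>)"
      by (rule sum.subset_diff[OF sub finite_S])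
    also have "(\<Sum>\<xi>\<in>?A. n \<xi> / norm \<xi>) \<le> (\<Sum>\<xi>\<in>?A. n \<xi> / 2 ^ J)"
      by (intro sum_mono divide_left_mono) (auto simp: S_def n_nonneg intro!: mult_pos_pos elim: order.strict_trans[rotated])
    also have "\<dots> = (\<Sum>\<xi>\<in>?A. n \<xi>) / 2 ^ J" by (simp add: sum_divide_distrib)
    also have "\<dots> \<le> (\<Sum>\<xi>\<in>S (2 ^ Suc J). n \<xi>) / 2 ^ J"
      by (intro divide_right_mono sum_mono2 finite_S) (auto simp: n_nonneg)
    also have "\<dots> \<le> (K * sqrt (2 ^ Suc J)) / 2 ^ J"
    proof (rule divide_right_mono)
      have "(1::real) \<le> 2 ^ Suc J" by (rule one_le_power) simp
      then show "(\<Sum>\<xi>\<in>S (2 ^ Suc J). n \<xi>) \<le> K * sqrt (2 ^ Suc J)"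
        using count_bound[of "2 ^ Suc J"] A_le[of "2 ^ Suc J"]
        unfolding K_def mult.assoc[of 2] by linarith
    qed simp
    also have "\<dots> = K * sqrt 2 * q ^ J"
    proof -
      have "sqrt (2 ^ J) / 2 ^ J = q ^ J"
      proof -
        have "(2::real) ^ J = sqrt (2 ^ J) * sqrt (2 ^ J)" by simp
        then have "sqrt (2 ^ J) / 2 ^ J = 1 / sqrt (2 ^ J)"
          by (metis divide_divide_eq_left' div_self real_sqrt_eq_zero_cancel_iff power_not_zero zero_neq_numeral)
        then show ?thesis by (simp add: q_def real_sqrt_power power_one_over)
      qed
      then show ?thesis by (simp add: real_sqrt_mult flip: times_divide_eq_right)
    qed
    also have "\<dots> \<le> K * 2 * q ^ J"
      using K q by (intro mult_right_mono mult_left_mono real_le_lsqrt) auto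
    finally show ?case using Suc by simp
  qed
  have geo: "(\<Sum>j<J. 2 * K * q ^ j) \<le> 2 * K * (1 / (1 - q))" for J
  proof -
    have "(\<Sum>j<J. q ^ j) \<le> (\<Sum>j. q ^ j)"
      using q by (intro sum_le_suminf summable_geometric) auto
    also have "\<dots> = 1 / (1 - q)" using q by (intro suminf_geometric) auto
    finally have "2 * K * (\<Sum>j<J. q ^ j) \<le> 2 * K * (1 / (1 - q))"
      using K by (intro mult_left_mono) auto
    then show ?thesis by (simp only: sum_distrib_left)
  qed
  show ?thesis
  proof (intro exI[of _ "B0 + 2 * K * (1 / (1 - q))"] allI)
    fix R :: real
    obtain J :: nat where J: "R < 2 ^ J" using real_arch_pow[of 2 R] by auto
    have "(\<Sum>\<xi>\<in>S R. n \<xi> / norm \<xi>) \<le> (\<Sum>\<xi>\<in>S (2 ^ J). n \<xi> / norm \<xi>)"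
      using J by (intro sum_mono2 finite_S) (auto simp: S_def n_nonneg)
    with step[of J] geo[of J] show "(\<Sum>\<xi>\<in>S R. n \<xi> / norm \<xi>) \<le> B0 + 2 * K * (1 / (1 - q))" by linarith
  qed
qed

lemma finite_subset_S:
  assumes "finite F" "F \<subseteq> Z" shows "\<exists>R0. \<forall>R\<ge>R0. F \<subseteq> S R"
proof -
  have "bounded F" using assms(1) by (rule finite_imp_bounded)
  then obtain R0 where "\<And>z. z \<in> F \<Longrightarrow> norm z \<le> R0" unfolding bounded_iff by blast
  then show ?thesis using assms(2) by (intro exI[of _ R0]) (force simp: S_def)
qed

lemma summable_reciprocal: "(\<lambda>\<xi>. n \<xi> / norm \<xi>) summable_on Z"
proof (rule nonneg_bdd_above_summable_on)
  obtain B where B: "\<And>R. (\<Sum>\<xi>\<in>S R. n \<xi> / norm \<xi>) \<le> B" using sum_reciprocal_bounded by blast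
  show "bdd_above (sum (\<lambda>\<xi>. n \<xi> / norm \<xi>) ` {F. F \<subseteq> Z \<and> finite F})"
  proof (rule bdd_aboveI2)
    fix F assume F: "F \<in> {F. F \<subseteq> Z \<and> finite F}"
    then obtain R where "F \<subseteq> S R" using finite_subset_S[of F] by auto
    then have "(\<Sum>\<xi>\<in>F. n \<xi> / norm \<xi>) \<le> (\<Sum>\<xi>\<in>S R. n \<xi> / norm \<xi>)"
      by (intro sum_mono2 finite_S) (auto simp: n_nonneg)
    then show "(\<Sum>\<xi>\<in>F. n \<xi> / norm \<xi>) \<le> B" using B[of R] by linarith
  qed
qed (simp add: n_nonneg)

end

lemma has_field_derivative_prod_linear_powers:
  assumes "finite S" "\<And>\<xi>. \<xi> \<in> S \<Longrightarrow> \<xi> \<noteq> 0 \<and> z \<noteq> (\<xi>::complex)"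
  shows "((\<lambda>z. \<Prod>\<xi>\<in>S. (1 - z / \<xi>) ^ m \<xi>) has_field_derivative
    (\<Prod>\<xi>\<in>S. (1 - z / \<xi>) ^ m \<xi>) * (\<Sum>\<xi>\<in>S. of_nat (m \<xi>) / (z - \<xi>))) (at z)"
  using assms
proof (induction S)
  case (insert \<xi> S)
  have \<xi>: "\<xi> \<noteq> 0" "z \<noteq> \<xi>" using insert.prems by auto
  have "((\<lambda>z. (1 - z / \<xi>) ^ m \<xi>) has_field_derivative (1 - z / \<xi>) ^ m \<xi> * (of_nat (m \<xi>) / (z - \<xi>))) (at z)"
  proof (cases "m \<xi>")
    case (Suc k)
    have "((\<lambda>z. (1 - z / \<xi>) ^ m \<xi>) has_field_derivative of_nat (m \<xi>) * (- 1 / \<xi>) * (1 - z / \<xi>) ^ k) (at z)"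
      unfolding Suc by (rule derivative_eq_intros refl | use \<xi> in simp)+
    moreover have "of_nat (m \<xi>) * (- 1 / \<xi>) * (1 - z / \<xi>) ^ k = (1 - z / \<xi>) ^ m \<xi> * (of_nat (m \<xi>) / (z - \<xi>))"
    proof -
      have "- 1 / \<xi> = (1 - z / \<xi>) / (z - \<xi>)" using \<xi> by (simp add: field_simps)
      then show ?thesis unfolding Suc by (simp add: mult_ac)
    qed
    ultimately show ?thesis by simp
  qed auto
  from DERIV_mult[OF this insert.IH] insert.prems insert.hyps show ?case
    by (simp add: algebra_simps)
qed auto

lemma higher_deriv_sum_poles:
  assumes "finite S" "w \<notin> S"
  shows "(deriv ^^ m) (\<lambda>z. \<Sum>\<xi>\<in>S. c \<xi> / (z - \<xi>)) w =
    (\<Sum>\<xi>\<in>S. c \<xi> * (- 1) ^ m * fact m / (w - \<xi>) ^ Suc m)"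
  using assms(2)
proof (induction m arbitrary: w)
  case (Suc m)
  have "open (- S)" using assms(1) by (simp add: finite_imp_closed open_Compl)
  then have ev: "\<forall>\<^sub>F w in nhds w. w \<notin> S"
    using Suc.prems eventually_nhds_in_open[of "- S" w] by (auto elim: eventually_mono)
  have "deriv ((deriv ^^ m) (\<lambda>z. \<Sum>\<xi>\<in>S. c \<xi> / (z - \<xi>))) w =
     deriv (\<lambda>w. \<Sum>\<xi>\<in>S. c \<xi> * (- 1) ^ m * fact m / (w - \<xi>) ^ Suc m) w"
    by (rule deriv_cong_ev[OF eventually_mono[OF ev Suc.IH] refl])
  also have "\<dots> = (\<Sum>\<xi>\<in>S. c \<xi> * (- 1) ^ Suc m * fact (Suc m) / (w - \<xi>) ^ Suc (Suc m))"
  proof (rule DERIV_imp_deriv, rule DERIV_sum)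
    fix \<xi> assume "\<xi> \<in> S"
    then have "w - \<xi> \<noteq> 0" using Suc.prems by auto
    have "((\<lambda>w. (c \<xi> * (- 1) ^ m * fact m) * inverse ((w - \<xi>) ^ Suc m)) has_field_derivative
      (c \<xi> * (- 1) ^ m * fact m) * (- (inverse ((w - \<xi>) ^ Suc m) * ((1 + of_nat m) * ((1 - 0) * (w - \<xi>) ^ m)) * inverse ((w - \<xi>) ^ Suc m)))) (at w)"
      by (rule DERIV_cmult[OF DERIV_inverse'[OF DERIV_power_Suc[OF DERIV_diff[OF DERIV_ident DERIV_const]]]])
        (use \<open>w - \<xi> \<noteq> 0\<close> in simp)
    moreover have "(c \<xi> * (- 1) ^ m * fact m) * (- (inverse ((w - \<xi>) ^ Suc m) * ((1 + of_nat m) * ((1 - 0) * (w - \<xi>) ^ m)) * inverse ((w - \<xi>) ^ Suc m)))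
       = c \<xi> * (- 1) ^ Suc m * fact (Suc m) / (w - \<xi>) ^ Suc (Suc m)"
    proof -
      have "inverse (x * y) * (N * y) * inverse (x * y) = N / (x * (x * y))" if "x \<noteq> 0" "y \<noteq> 0" for x y N :: 'a
        using that by (simp add: field_simps)
      from this[of "w - \<xi>" "(w - \<xi>) ^ m" "1 + of_nat m"] \<open>w - \<xi> \<noteq> 0\<close> show ?thesis
        by simp
    qed
    moreover have "(\<lambda>w. (c \<xi> * (- 1) ^ m * fact m) * inverse ((w - \<xi>) ^ Suc m)) = (\<lambda>w. c \<xi> * (- 1) ^ m * fact m / (w - \<xi>) ^ Suc m)"
      by (simp only: divide_inverse)
    ultimately show "((\<lambda>w. c \<xi> * (- 1) ^ m * fact m / (w - \<xi>) ^ Suc m) has_field_derivative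
       c \<xi> * (- 1) ^ Suc m * fact (Suc m) / (w - \<xi>) ^ Suc (Suc m)) (at w)"
      by (simp only:)
  qed
  finally show ?case by simp
qed simp

context entire_half_order
begin

text \<open>Let L be the logarithm of the zero-free quotient divided by G 0. Its derivative is G'/G
  minus the poles at the zeros in the disc, and 1 / (z - \<xi>) has the Taylor coefficients - 1 /
  \<xi>^(m+1), whence the plus sign. The right side is Cauchy's estimate on |z| = R / 2, where
  Borel--Caratheodory gives |L| \<le> 2 A R; the factor m + 1 is a quotient of factorials.\<close>

lemma log_derivative_coeff_approx:
  assumes R: "R > 0"
  shows "norm ((deriv ^^ m) (\<lambda>z. deriv G z / G z) 0 / fact m + (\<Sum>\<xi>\<in>S R. of_real (n \<xi>) / \<xi> ^ Suc m))
     \<le> real (Suc m) * (2 * A R) / (R / 2) ^ Suc m"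
proof -
  obtain f where f: "f holomorphic_on UNIV" "\<And>z. norm z \<le> R \<Longrightarrow> f z \<noteq> 0" "f 0 = G 0"
    "\<And>z. G z = f z * (\<Prod>\<xi>\<in>S R. (1 - z / \<xi>) ^ nat (zorder G \<xi>))"
    "\<And>z. norm z \<le> 3 * R \<Longrightarrow> norm (f z) * 2 powr (\<Sum>\<xi>\<in>S R. n \<xi>) \<le> exp (C * (1 + sqrt (3 * R)))"
    by (rule quotient_bound[OF R]) (rule that; blast)
  define h where "h = (\<lambda>z. f z / G 0)"
  have h: "h holomorphic_on ball 0 R" "\<And>z. z \<in> ball 0 R \<Longrightarrow> h z \<noteq> 0" "h 0 = 1"
    unfolding h_def using f G0 by (auto intro!: holomorphic_intros holomorphic_on_subset[OF f(1)])
  have R0: "0 \<in> ball 0 R" using R by simp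
  obtain L0 where L0: "L0 holomorphic_on ball 0 R" "\<And>z. z \<in> ball 0 R \<Longrightarrow> exp (L0 z) = h z"
    using holomorphic_logarithm_exists[OF convex_ball open_ball h(1,2) R0] by metis
  \<comment> \<open>The constant is chosen such that L vanishes at 0, a hypothesis of
    Borel--Caratheodory.\<close>
  define L where "L = (\<lambda>z. L0 z - L0 0)"
  have L: "L holomorphic_on ball 0 R" "L 0 = 0"
    unfolding L_def by (intro holomorphic_intros L0) simp
  have expL: "exp (L z) = h z" if "z \<in> ball 0 R" for z
    using L0(2)[OF that] L0(2)[OF R0] h(3) by (simp add: L_def exp_diff)
  have re: "Re (L z) < A R" if z: "norm z < R" for z
  proof -
    have "norm (f z) * 1 \<le> norm (f z) * 2 powr (\<Sum>\<xi>\<in>S R. n \<xi>)"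
      by (intro mult_left_mono) (auto simp: ge_one_powr_ge_zero sum_nonneg n_nonneg)
    also have "\<dots> \<le> exp (C * (1 + sqrt (3 * R)))" using z R by (intro f(5)) auto
    also have "\<dots> < norm (G 0) * exp (A R)" by (rule exp_A)
    finally have "norm (h z) < exp (A R)"
      using G0 by (simp add: h_def norm_divide divide_less_eq mult.commute)
    moreover have "norm (h z) = exp (Re (L z))"
      using expL[of z] z by (metis mem_ball_0 norm_exp_eq_Re)
    ultimately show ?thesis by simp
  qed
  have Lb: "norm ((deriv ^^ Suc m) L 0) \<le> fact (Suc m) * (2 * A R) / (R / 2) ^ Suc m"
  proof (rule Cauchy_inequality)
    show "L holomorphic_on ball 0 (R / 2)"
      using R by (intro holomorphic_on_subset[OF L(1)]) auto
    show "continuous_on (cball 0 (R / 2)) L"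
      using R by (intro holomorphic_on_imp_continuous_on holomorphic_on_subset[OF L(1)]) auto
    show "norm (L x) \<le> 2 * A R" if "norm (0 - x) = R / 2" for x
      by (rule borel_caratheodory_half[OF L(1,2) R re]) (use that in auto)
  qed (use R in simp)
  have "continuous (at 0) G"
    using holomorphic_on_imp_continuous_on[OF hol] by (simp add: continuous_on_eq_continuous_at)
  from continuous_at_avoid[OF this G0] obtain \<rho> where \<rho>: "\<rho> > 0" "\<And>z. norm z < \<rho> \<Longrightarrow> G z \<noteq> 0"
    by (auto simp: dist_norm)
  \<comment> \<open>\<open>G\<close> has no zeros in this ball, so G'/G and the sum of the poles are
    both holomorphic on it and can be differentiated separately.\<close>
  define U where "U = ball (0::complex) (min \<rho> R)"
  have U: "open U" "0 \<in> U" "U \<subseteq> ball 0 R" using \<rho> R by (auto simp: U_def)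
  have eq: "deriv L z = deriv G z / G z - (\<Sum>\<xi>\<in>S R. of_real (n \<xi>) / (z - \<xi>))" if z: "z \<in> U" for z
  proof -
    have zR: "z \<in> ball 0 R" and Gz: "G z \<noteq> 0" using z \<rho> by (auto simp: U_def)
    have fd: "(f has_field_derivative deriv f z) (at z)"
      by (rule holomorphic_derivI[OF f(1) open_UNIV UNIV_I])
    have Ld: "(L has_field_derivative deriv L z) (at z)"
      by (rule holomorphic_derivI[OF L(1) open_ball zR])
    have "((\<lambda>z. exp (L z)) has_field_derivative exp (L z) * deriv L z) (at z)"
      using Ld by (auto intro!: derivative_eq_intros)
    then have "(h has_field_derivative exp (L z) * deriv L z) (at z)"
      by (rule has_field_derivative_transform_within_open[OF _ open_ball zR expL])
    moreover have "(h has_field_derivative deriv f z / G 0) (at z)"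
      unfolding h_def by (rule DERIV_cdivide[OF fd])
    ultimately have "h z * deriv L z = deriv f z / G 0"
      using DERIV_unique expL[OF zR] by metis
    then have dL: "deriv L z = deriv f z / f z"
      using G0 f(2)[of z] zR by (simp add: h_def field_simps)
    have neS: "\<xi> \<noteq> 0 \<and> z \<noteq> \<xi>" if "\<xi> \<in> S R" for \<xi>
    proof -
      have "\<xi> \<in> Z" "G \<xi> = 0" using that by (simp_all add: S_def Z_def)
      then show ?thesis using Z_nonzero[of \<xi>] Gz by metis
    qed
    let ?P = "\<lambda>z. \<Prod>\<xi>\<in>S R. (1 - z / \<xi>) ^ nat (zorder G \<xi>)"
    let ?s = "\<Sum>\<xi>\<in>S R. of_nat (nat (zorder G \<xi>)) / (z - \<xi>)"
    have "((\<lambda>z. f z * ?P z) has_field_derivative (deriv f z * ?P z + ?P z * ?s * f z)) (at z)"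
      by (rule DERIV_mult[OF fd has_field_derivative_prod_linear_powers[OF finite_S neS]])
    then have "deriv G z = deriv f z * ?P z + ?P z * ?s * f z"
      using f(4) by (metis (no_types, lifting) DERIV_imp_deriv ext)
    moreover have "?P z \<noteq> 0" "f z \<noteq> 0" using Gz f(4)[of z] by auto
    ultimately have "deriv G z / G z = deriv f z / f z + ?s"
      unfolding f(4)[of z] by (simp add: field_simps)
    then show ?thesis unfolding dL by (simp add: n_def)
  qed
  have hq: "(\<lambda>z. deriv G z / G z) holomorphic_on U"
    using \<rho> by (intro holomorphic_intros holomorphic_deriv holomorphic_on_subset[OF hol]) (auto simp: U_def)
  have hp: "(\<lambda>z. \<Sum>\<xi>\<in>S R. of_real (n \<xi>) / (z - \<xi>)) holomorphic_on U"
    using \<rho>(2) by (intro holomorphic_intros) (auto simp: U_def S_def Z_def)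
  have hL: "deriv L holomorphic_on U"
    by (rule holomorphic_on_subset[OF holomorphic_deriv[OF L(1) open_ball] U(3)])
  have "(deriv ^^ Suc m) L 0 = (deriv ^^ m) (deriv L) 0"
    by (simp only: funpow_Suc_right comp_def)
  also have "\<dots> = (deriv ^^ m) (\<lambda>z. deriv G z / G z - (\<Sum>\<xi>\<in>S R. of_real (n \<xi>) / (z - \<xi>))) 0"
    by (rule higher_deriv_transform_within_open[OF hL holomorphic_on_diff[OF hq hp] U(1,2) eq])
  also have "\<dots> = (deriv ^^ m) (\<lambda>z. deriv G z / G z) 0 - (deriv ^^ m) (\<lambda>z. \<Sum>\<xi>\<in>S R. of_real (n \<xi>) / (z - \<xi>)) 0"
    by (rule higher_deriv_diff[OF hq hp U(1,2)])
  also have "(deriv ^^ m) (\<lambda>z. \<Sum>\<xi>\<in>S R. of_real (n \<xi>) / (z - \<xi>)) 0 =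
      - fact m * (\<Sum>\<xi>\<in>S R. of_real (n \<xi>) / \<xi> ^ Suc m)"
  proof (subst higher_deriv_sum_poles)
    have "of_real (n \<xi>) * (- 1) ^ m * fact m / (0 - \<xi>) ^ Suc m = - fact m * (of_real (n \<xi>) / \<xi> ^ Suc m)" for \<xi>
    proof -
      have "(0 - \<xi>) ^ Suc m = (- 1) ^ Suc m * \<xi> ^ Suc m"
        by (metis diff_0 mult_minus1 power_mult_distrib)
      then show ?thesis by (simp add: field_simps power_minus')
    qed
    then show "(\<Sum>\<xi>\<in>S R. of_real (n \<xi>) * (- 1) ^ m * fact m / (0 - \<xi>) ^ Suc m) =
       - fact m * (\<Sum>\<xi>\<in>S R. of_real (n \<xi>) / \<xi> ^ Suc m)"
      by (simp only: sum_distrib_left)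
    show "0 \<notin> S R" using Z_nonzero by (auto simp: S_def)
  qed (rule finite_S)
  finally have eq0: "(deriv ^^ Suc m) L 0 = fact m * ((deriv ^^ m) (\<lambda>z. deriv G z / G z) 0 / fact m + (\<Sum>\<xi>\<in>S R. of_real (n \<xi>) / \<xi> ^ Suc m))"
    by (simp add: field_simps)
  have "fact m * norm ((deriv ^^ m) (\<lambda>z. deriv G z / G z) 0 / fact m + (\<Sum>\<xi>\<in>S R. of_real (n \<xi>) / \<xi> ^ Suc m))
    \<le> fact m * (real (Suc m) * (2 * A R) / (R / 2) ^ Suc m)"
    using Lb unfolding eq0 norm_mult by (simp add: mult_ac)
  then show ?thesis by (rule mult_left_le_imp_le) simp
qed

text \<open>Growing discs exhaust the zeros, so that a limit of sums over discs is the unordered sum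
  over all zeros.\<close>

lemma filterlim_S: "filterlim S (finite_subsets_at_top Z) at_top"
proof (rule filterlim_finite_subsets_at_top[THEN iffD2], intro allI impI)
  fix F assume "finite F \<and> F \<subseteq> Z"
  then obtain R0 where R0: "\<forall>R\<ge>R0. F \<subseteq> S R" using finite_subset_S by blast
  show "\<forall>\<^sub>F R in at_top. finite (S R) \<and> F \<subseteq> S R \<and> S R \<subseteq> Z"
  proof (rule eventually_mono[OF eventually_ge_at_top[of R0]])
    fix R assume "R0 \<le> R"
    then show "finite (S R) \<and> F \<subseteq> S R \<and> S R \<subseteq> Z"
      using R0 finite_S[of R] by (simp add: S_def)
  qed
qed

lemma summable_powers: "(\<lambda>\<xi>. n \<xi> / norm \<xi> ^ Suc m) summable_on Z"
proof -
  have fin: "finite (S 1)" by (rule finite_S)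
  have "(\<lambda>\<xi>. n \<xi> / norm \<xi> ^ Suc m) summable_on (Z - S 1)"
  proof (rule summable_on_comparison_test)
    show "(\<lambda>\<xi>. n \<xi> / norm \<xi>) summable_on (Z - S 1)"
      by (rule summable_on_subset_banach[OF summable_reciprocal]) auto
    fix \<xi> assume "\<xi> \<in> Z - S 1"
    then have "norm \<xi> > 1" by (auto simp: S_def)
    then have "norm \<xi> ^ Suc m \<ge> norm \<xi> ^ 1" by (intro power_increasing) auto
    then show "n \<xi> / norm \<xi> ^ Suc m \<le> n \<xi> / norm \<xi>"
      using \<open>norm \<xi> > 1\<close> n_nonneg[of \<xi>]
      by (intro divide_left_mono mult_pos_pos zero_less_power) auto
  qed (auto simp: n_nonneg)
  moreover have "(\<lambda>\<xi>. n \<xi> / norm \<xi> ^ Suc m) summable_on S 1"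
    using fin by simp
  ultimately have "(\<lambda>\<xi>. n \<xi> / norm \<xi> ^ Suc m) summable_on ((Z - S 1) \<union> S 1)"
    by (rule summable_on_Un_disjoint) auto
  moreover have "(Z - S 1) \<union> S 1 = Z" by (auto simp: S_def)
  ultimately show ?thesis by simp
qed

theorem has_sum_reciprocal_powers:
  "((\<lambda>\<xi>. of_real (n \<xi>) / \<xi> ^ Suc m) has_sum - ((deriv ^^ m) (\<lambda>z. deriv G z / G z) 0 / fact m)) Z"
proof -
  let ?D = "(deriv ^^ m) (\<lambda>z. deriv G z / G z) 0 / fact m"
  have "(\<lambda>\<xi>. norm (of_real (n \<xi>) / \<xi> ^ Suc m)) summable_on Z"
    using summable_powers[of m] by (simp add: norm_divide norm_mult norm_power n_nonneg)
  then have "(\<lambda>\<xi>. of_real (n \<xi>) / \<xi> ^ Suc m) summable_on Z"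
    by (rule abs_summable_summable)
  then obtain s where s: "((\<lambda>\<xi>. of_real (n \<xi>) / \<xi> ^ Suc m) has_sum s) Z"
    by (auto simp: summable_on_def)
  then have 1: "((\<lambda>R. \<Sum>\<xi>\<in>S R. of_real (n \<xi>) / \<xi> ^ Suc m) \<longlongrightarrow> s) at_top"
    unfolding has_sum_def by (rule filterlim_compose[OF _ filterlim_S])
  have 2: "((\<lambda>R. ?D + (\<Sum>\<xi>\<in>S R. of_real (n \<xi>) / \<xi> ^ Suc m)) \<longlongrightarrow> 0) at_top"
  proof (rule Lim_null_comparison)
    \<comment> \<open>\<open>A R\<close> is of size sqrt R, and R^(m+1) \<ge> R for R \<ge> 1. The
      worst case m = 0 still leaves sqrt R / R.\<close>
    let ?K = "real (Suc m) * 2 * (3 * C + \<bar>ln (norm (G 0))\<bar> + 1) * 2 ^ Suc m"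
    show "\<forall>\<^sub>F R in at_top. norm (?D + (\<Sum>\<xi>\<in>S R. of_real (n \<xi>) / \<xi> ^ Suc m)) \<le> ?K * (sqrt R / R)"
      using eventually_ge_at_top[of 1]
    proof eventually_elim
      fix R :: real assume R: "R \<ge> 1"
      have "norm (?D + (\<Sum>\<xi>\<in>S R. of_real (n \<xi>) / \<xi> ^ Suc m)) \<le> real (Suc m) * (2 * A R) / (R / 2) ^ Suc m"
        using R by (intro log_derivative_coeff_approx) auto
      also have "\<dots> = real (Suc m) * 2 * 2 ^ Suc m * (A R / R ^ Suc m)"
        by (simp add: power_divide)
      also have "\<dots> \<le> real (Suc m) * 2 * 2 ^ Suc m * (((3 * C + \<bar>ln (norm (G 0))\<bar> + 1) * sqrt R) / R)"
      proof (intro mult_left_mono frac_le)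
        show "R \<le> R ^ Suc m" using power_increasing[of 1 "Suc m" R] R by simp
      qed (use R A_le[OF R] C in auto)
      finally show "norm (?D + (\<Sum>\<xi>\<in>S R. of_real (n \<xi>) / \<xi> ^ Suc m)) \<le> ?K * (sqrt R / R)"
        by (simp add: mult_ac)
    qed
    have "((\<lambda>R::real. sqrt R / R) \<longlongrightarrow> 0) at_top" by real_asymp
    from tendsto_mult_right_zero[OF this] show "((\<lambda>R. ?K * (sqrt R / R)) \<longlongrightarrow> 0) at_top" .
  qed
  have "((\<lambda>R. ?D + (\<Sum>\<xi>\<in>S R. of_real (n \<xi>) / \<xi> ^ Suc m)) \<longlongrightarrow> ?D + s) at_top"
    by (intro tendsto_intros 1)
  from tendsto_unique[OF _ this 2] have "?D + s = 0" by simp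
  then have "s = - ?D" by (simp add: eq_neg_iff_add_eq_0 add.commute)
  with s show ?thesis by simp
qed

end

section \<open>The Taylor coefficients of the logarithmic derivative\<close>

lemma sums_imp_has_fps_expansion:
  fixes c :: "nat \<Rightarrow> complex"
  assumes "\<forall>\<^sub>F z in nhds 0. (\<lambda>j. c j * z ^ j) sums F z"
  shows "F has_fps_expansion Abs_fps c"
  unfolding has_fps_expansion_def
proof (intro conjI)
  obtain d where d: "d > 0" "\<And>z. norm z < d \<Longrightarrow> (\<lambda>j. c j * z ^ j) sums F z"
    using assms unfolding eventually_nhds_metric by auto
  have "summable (\<lambda>j. c j * of_real (d / 2) ^ j)"
    using d(2)[of "of_real (d / 2)"] d(1) by (auto simp: sums_iff simp del: of_real_divide)
  from conv_radius_geI[OF this] d(1) show "fps_conv_radius (Abs_fps c) > 0"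
    by (simp add: fps_conv_radius_def) (metis ereal_less(2) half_gt_zero less_le_trans zero_ereal_def)
  show "\<forall>\<^sub>F z in nhds 0. eval_fps (Abs_fps c) z = F z"
    using assms by eventually_elim (simp add: eval_fps_def sums_iff)
qed

lemma has_fps_expansion_power_mult:
  fixes G :: "complex \<Rightarrow> complex"
  assumes "G has_fps_expansion fG"
  shows "(\<lambda>z. z ^ m * G z) has_fps_expansion fps_X ^ m * fG"
proof (induction m)
  case (Suc m)
  from has_fps_expansion_mult[OF has_fps_expansion_fps_X this] show ?case
    by (simp add: mult.assoc)
qed (use assms in simp)

text \<open>The complex-analytic content, kept apart from the operator: here \<open>m0\<close> is
  the order of the zero at the origin, which is matched with the multiplicity of the eigenvalue 0
  only in the final proof. The point \<open>w0\<close> witnesses that \<open>F\<close> is not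
  identically zero.\<close>

locale entire_zeros =
  fixes F :: "complex \<Rightarrow> complex" and C :: real and m0 :: nat and coef bn :: "nat \<Rightarrow> complex" and w0 :: complex
  assumes hol: "F holomorphic_on UNIV" and nz: "F w0 \<noteq> 0" and C: "C \<ge> 0"
    and growth: "\<And>z. norm (F z) \<le> exp (C * (1 + sqrt (norm z)))"
    and m0: "m0 = (if F 0 = 0 then nat (zorder F 0) else 0)"
    and coef: "\<forall>\<^sub>F z in nhds 0. (\<lambda>j. coef j * z ^ j) sums F z"
    and bn1: "bn 1 = coef (1 + m0) / coef m0"
    and bn: "\<forall>j\<ge>2. bn j = coef (j + m0) / coef m0
           - (\<Sum>l=1..j-1. of_nat l / of_nat j * (coef (j - l + m0) / coef m0) * bn l)"
begin

lemma factor: "\<exists>G. G holomorphic_on UNIV \<and> G 0 \<noteq> 0 \<and> (\<forall>z. F z = z ^ m0 * G z)"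
proof (cases "F 0 = 0")
  case True
  obtain g where g: "g holomorphic_on UNIV" "g 0 \<noteq> 0" "\<And>z. F z = (z - 0) ^ nat (zorder F 0) * g z" "zorder F 0 > 0"
    by (rule entire_factor_zero[OF hol nz True]) (rule that; blast)
  then show ?thesis using True by (intro exI[of _ g]) (auto simp: m0)
next
  case False
  then show ?thesis using hol by (intro exI[of _ F]) (auto simp: m0)
qed

definition "G = (SOME G. G holomorphic_on UNIV \<and> G 0 \<noteq> 0 \<and> (\<forall>z. F z = z ^ m0 * G z))"

lemma G: "G holomorphic_on UNIV" "G 0 \<noteq> 0" "\<And>z. F z = z ^ m0 * G z"
  using someI_ex[OF factor] unfolding G_def[symmetric] by auto

text \<open>Division by z^m0 does not increase the modulus for |z| \<ge> 1. Inside the unit disc the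
  maximum principle gives exp (2 C), the bound on the unit circle; this is the reason for doubling
  the constant.\<close>

lemma G_growth: "norm (G z) \<le> exp ((2 * C) * (1 + sqrt (norm z)))"
proof -
  have big: "norm (G z) \<le> exp (C * (1 + sqrt (norm z)))" if "norm z \<ge> 1" for z
  proof -
    have "1 * norm (G z) \<le> norm z ^ m0 * norm (G z)"
      using that by (intro mult_right_mono one_le_power) auto
    also have "\<dots> = norm (F z)" by (simp add: G(3) norm_mult norm_power)
    finally show ?thesis using growth[of z] by simp
  qed
  show ?thesis
  proof (cases "norm z \<ge> 1")
    case True
    have "C * (1 + sqrt (norm z)) \<le> (2 * C) * (1 + sqrt (norm z))"
      using C by (intro mult_right_mono) auto
    with big[OF True] show ?thesis by (meson exp_le_cancel_iff order_trans)
  next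
    case False
    have "norm (G z) \<le> exp (2 * C)"
    proof (rule maximum_modulus_frontier[of G "cball 0 1"])
      show "norm (G w) \<le> exp (2 * C)" if "w \<in> frontier (cball 0 1)" for w
        using big[of w] that by (simp add: mult.commute)
    qed (use False G(1) in \<open>auto intro: holomorphic_on_subset holomorphic_on_imp_continuous_on\<close>)
    also have "\<dots> \<le> exp ((2 * C) * (1 + sqrt (norm z)))"
      using C mult_left_mono[of 1 "1 + sqrt (norm z)" "2 * C"] by simp
    finally show ?thesis .
  qed
qed

sublocale G: entire_half_order G "2 * C"
  by unfold_locales (use G C G_growth in auto)

definition "L z = deriv G z / G z"
text \<open>The numbers \<open>bn j\<close> turn out to be the Taylor coefficients of ln (G / G 0)
  for j \<ge> 1. Differentiation shifts the index, so \<open>g k\<close> will equal (k + 1) times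
  \<open>bn (k + 1)\<close>.\<close>

definition "g k = (deriv ^^ k) L 0 / fact k"

lemma G_ball: obtains d where "d > 0" "\<And>z. z \<in> ball 0 d \<Longrightarrow> G z \<noteq> 0"
proof -
  have "continuous (at 0) G"
    using holomorphic_on_imp_continuous_on[OF G(1)] by (simp add: continuous_on_eq_continuous_at)
  from continuous_at_avoid[OF this G(2)] that show ?thesis by (auto simp: dist_norm)
qed

lemma L_expansion: "L has_fps_expansion Abs_fps g"
proof -
  obtain d where d: "d > 0" "\<And>z. z \<in> ball 0 d \<Longrightarrow> G z \<noteq> 0" by (rule G_ball) blast
  have "L holomorphic_on ball 0 d"
    unfolding L_def[abs_def] using d(2)
    by (intro holomorphic_intros holomorphic_deriv holomorphic_on_subset[OF G(1)]) auto
  from has_fps_expansion_fps_expansion[OF open_ball _ this] d(1) show ?thesis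
    by (simp add: fps_expansion_def g_def[abs_def])
qed

lemma G_expansion: "G has_fps_expansion Abs_fps (\<lambda>j. coef (j + m0))" and coef_m0: "coef m0 \<noteq> 0"
proof -
  let ?fG = "fps_expansion G 0"
  have fG: "G has_fps_expansion ?fG"
    by (rule has_fps_expansion_fps_expansion[OF open_UNIV _ G(1)]) simp
  have "F = (\<lambda>z. z ^ m0 * G z)" using G(3) by blast
  then have "F has_fps_expansion fps_X ^ m0 * ?fG"
    using has_fps_expansion_power_mult[OF fG, of m0] by simp
  from fps_nth_fps_expansion[OF this] fps_nth_fps_expansion[OF sums_imp_has_fps_expansion[OF coef]]
  have "coef j = fps_nth (fps_X ^ m0 * ?fG) j" for j by simp
  then have c: "coef (j + m0) = fps_nth ?fG j" for j by (simp add: fps_X_power_mult_nth)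
  then have "Abs_fps (\<lambda>j. coef (j + m0)) = ?fG" by (simp add: fps_eq_iff)
  with fG show "G has_fps_expansion Abs_fps (\<lambda>j. coef (j + m0))" by simp
  show "coef m0 \<noteq> 0" using c[of 0] G(2) by (simp add: fps_expansion_def)
qed

lemma g_recursion: "of_nat (Suc k) * coef (Suc k + m0) = (\<Sum>i\<le>k. g i * coef (k - i + m0))"
proof -
  let ?fG = "Abs_fps (\<lambda>j. coef (j + m0))"
  obtain d where d: "d > 0" "\<And>z. z \<in> ball 0 d \<Longrightarrow> G z \<noteq> 0" by (rule G_ball) blast
  have e1: "(\<lambda>z. L z * G z) has_fps_expansion Abs_fps g * ?fG"
    by (rule has_fps_expansion_mult[OF L_expansion G_expansion])
  have e2: "deriv G has_fps_expansion fps_deriv ?fG"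
    by (rule has_fps_expansion_deriv[OF G_expansion])
  have "\<forall>\<^sub>F z in nhds 0. z \<in> ball (0::complex) d"
    by (rule eventually_nhds_in_open) (use d in auto)
  then have "\<forall>\<^sub>F z in nhds 0. L z * G z = deriv G z"
    by eventually_elim (use d(2) in \<open>auto simp: L_def\<close>)
  then have "(deriv ^^ k) (\<lambda>z. L z * G z) 0 = (deriv ^^ k) (deriv G) 0"
    by (rule higher_deriv_cong_ev) simp
  then have "fps_nth (Abs_fps g * ?fG) k = fps_nth (fps_deriv ?fG) k"
    using fps_nth_fps_expansion[OF e1, of k] fps_nth_fps_expansion[OF e2, of k] by simp
  then show ?thesis by (simp add: fps_mult_nth atLeast0AtMost)
qed

lemma g_eq_bn: "n \<ge> 1 \<Longrightarrow> g (n - 1) = of_nat n * bn n"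
proof (induction n rule: less_induct)
  case (less n)
  show ?case
  proof (cases "n = 1")
    case True
    then show ?thesis using g_recursion[of 0] bn1 coef_m0 by (simp add: field_simps)
  next
    case False
    with less.prems have n: "n \<ge> 2" by simp
    define k where "k = n - 2"
    have k: "n = Suc (Suc k)" using n by (simp add: k_def)
    have "of_nat n * coef (n + m0) = (\<Sum>i\<le>Suc k. g i * coef (Suc k - i + m0))"
      using g_recursion[of "Suc k"] k by simp
    also have "\<dots> = (\<Sum>i\<le>k. g i * coef (Suc k - i + m0)) + g (Suc k) * coef m0"
      by simp
    \<comment> \<open>Index shift l = i + 1, under which \<open>g i\<close> becomes l times
      \<open>bn l\<close> by induction.\<close>
    also have "(\<Sum>i\<le>k. g i * coef (Suc k - i + m0)) = (\<Sum>l=1..n-1. g (l - 1) * coef (n - l + m0))"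
      by (rule sum.reindex_bij_witness[of _ "\<lambda>l. l - 1" Suc]) (auto simp: k)
    also have "\<dots> = (\<Sum>l=1..n-1. of_nat l * bn l * coef (n - l + m0))"
      by (intro sum.cong refl) (use less.IH in auto)
    finally have "g (Suc k) = of_nat n * (coef (n + m0) / coef m0) - (\<Sum>l=1..n-1. of_nat l * bn l * coef (n - l + m0)) / coef m0"
      using coef_m0 by (simp add: field_simps)
    also have "\<dots> = of_nat n * (coef (n + m0) / coef m0 - (\<Sum>l=1..n-1. of_nat l / of_nat n * (coef (n - l + m0) / coef m0) * bn l))"
    proof -
      have "(\<Sum>l=1..n-1. of_nat l * bn l * coef (n - l + m0)) / coef m0 =
         of_nat n * (\<Sum>l=1..n-1. of_nat l / of_nat n * (coef (n - l + m0) / coef m0) * bn l)"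
        unfolding sum_divide_distrib sum_distrib_left using n by (intro sum.cong) auto
      then show ?thesis by (simp add: right_diff_distrib)
    qed
    finally show ?thesis using bn n k by simp
  qed
qed

text \<open>The function z F'/F = m0 + z G'/G is holomorphic near 0, and the residue is its
  coefficient at z^(k+1). The pole of F'/F that stems from a zero at the origin enters the constant
  coefficient only.\<close>

lemma residue_eq: "residue (\<lambda>z. z powi (- int (Suc k)) * (deriv F z / F z)) 0 = g k"
proof -
  obtain d where d: "d > 0" "\<And>z. z \<in> ball 0 d \<Longrightarrow> G z \<noteq> 0" by (rule G_ball) blast
  define h where "h = (\<lambda>z. of_nat m0 + z * L z)"
  have Lh: "L holomorphic_on ball 0 d"
    unfolding L_def[abs_def] using d(2)
    by (intro holomorphic_intros holomorphic_deriv holomorphic_on_subset[OF G(1)]) auto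
  have hh: "h holomorphic_on ball 0 d"
    unfolding h_def by (intro holomorphic_intros Lh)
  have "\<forall>\<^sub>F z in at 0. z \<in> ball (0::complex) d \<and> z \<noteq> 0"
    using d(1) eventually_at_in_open[of "ball 0 d" 0] by (auto elim: eventually_mono)
  then have "\<forall>\<^sub>F z in at 0. z powi (- int (Suc k)) * (deriv F z / F z) = h z / z ^ Suc (Suc k)"
  proof eventually_elim
    case (elim z)
    have "(F has_field_derivative of_nat m0 * z ^ (m0 - 1) * G z + deriv G z * z ^ m0) (at z)"
    proof -
      have "(G has_field_derivative deriv G z) (at z)"
        by (rule holomorphic_derivI[OF G(1) open_UNIV UNIV_I])
      then have "((\<lambda>z. z ^ m0 * G z) has_field_derivative of_nat m0 * z ^ (m0 - 1) * G z + deriv G z * z ^ m0) (at z)"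
        by (auto intro!: derivative_eq_intros)
      moreover have "F = (\<lambda>z. z ^ m0 * G z)" using G(3) by blast
      ultimately show ?thesis by simp
    qed
    then have dF: "deriv F z = of_nat m0 * z ^ (m0 - 1) * G z + deriv G z * z ^ m0"
      by (rule DERIV_imp_deriv)
    have "z * deriv F z = z ^ m0 * G z * h z"
    proof -
      have "z * (of_nat m0 * z ^ (m0 - 1)) = of_nat m0 * z ^ m0" by (cases m0) auto
      moreover have "z * deriv F z = (z * (of_nat m0 * z ^ (m0 - 1))) * G z + z * deriv G z * z ^ m0"
        unfolding dF by (simp add: algebra_simps)
      ultimately have "z * deriv F z = of_nat m0 * z ^ m0 * G z + z * deriv G z * z ^ m0" by simp
      then show ?thesis using elim d(2)[of z] by (simp add: h_def L_def algebra_simps)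
    qed
    then have "deriv F z / F z = h z / z"
      using elim d(2)[of z] by (simp add: G(3)[of z] field_simps)
    moreover have "z powi (- int (Suc k)) = 1 / z ^ Suc k"
      by (simp only: power_int_minus power_int_of_nat inverse_eq_divide)
    ultimately show ?case using elim by (simp add: field_simps)
  qed
  then have "residue (\<lambda>z. z powi (- int (Suc k)) * (deriv F z / F z)) 0 = residue (\<lambda>z. h z / z ^ Suc (Suc k)) 0"
    by (rule residue_cong) simp
  also have "\<dots> = (deriv ^^ Suc k) h 0 / fact (Suc k)"
    by (rule residue_holomorphic_over_power'[OF open_ball _ hh]) (use d in simp)
  also have "\<dots> = fps_nth (fps_const (of_nat m0) + fps_X * Abs_fps g) (Suc k)"
  proof (rule fps_nth_fps_expansion[symmetric])
    show "h has_fps_expansion fps_const (of_nat m0) + fps_X * Abs_fps g"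
      unfolding h_def by (intro fps_expansion_intros L_expansion)
  qed
  also have "\<dots> = g k" by simp
  finally show ?thesis .
qed

lemma zorder_G: "\<xi> \<noteq> 0 \<Longrightarrow> F \<xi> = 0 \<Longrightarrow> zorder G \<xi> = zorder F \<xi>"
proof -
  assume \<xi>: "\<xi> \<noteq> 0" "F \<xi> = 0"
  then have "G \<xi> = 0" using G(3)[of \<xi>] by simp
  then obtain h where h: "h holomorphic_on UNIV" "h \<xi> \<noteq> 0" "\<And>z. G z = (z - \<xi>) ^ nat (zorder G \<xi>) * h z" "zorder G \<xi> > 0"
    by (rule entire_factor_zero[OF G(1,2)]) (rule that; blast)
  have "zorder F \<xi> = zorder G \<xi>"
  proof (rule zorder_eqI[where S = UNIV and g = "\<lambda>z. z ^ m0 * h z"])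
    show "(\<lambda>z. z ^ m0 * h z) holomorphic_on UNIV" by (intro holomorphic_intros h)
    show "F w = w ^ m0 * h w * (w - \<xi>) powi zorder G \<xi>" for w
      using G(3)[of w] h(3)[of w] h(4) by (simp add: power_int_def)
  qed (use h \<xi> in auto)
  then show ?thesis by simp
qed

lemma Z_eq: "G.Z = {z. F z = 0} - {0}"
  using G(2,3) by (auto simp: G.Z_def)

theorem zeros_power_sums:
  "((\<lambda>\<xi>. of_nat (nat (zorder F \<xi>)) / \<xi> ^ Suc k) has_sum - g k) ({z. F z = 0} - {0})"
  "(\<lambda>\<xi>. real (nat (zorder F \<xi>)) / norm \<xi> ^ Suc k) summable_on ({z. F z = 0} - {0})"
proof -
  have "((\<lambda>\<xi>. of_real (G.n \<xi>) / \<xi> ^ Suc k) has_sum - g k) G.Z"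
    using G.has_sum_reciprocal_powers[of k] by (simp add: g_def L_def[abs_def])
  then show "((\<lambda>\<xi>. of_nat (nat (zorder F \<xi>)) / \<xi> ^ Suc k) has_sum - g k) ({z. F z = 0} - {0})"
    unfolding Z_eq by (rule has_sum_cong[THEN iffD1, rotated]) (auto simp: G.n_def zorder_G)
  show "(\<lambda>\<xi>. real (nat (zorder F \<xi>)) / norm \<xi> ^ Suc k) summable_on ({z. F z = 0} - {0})"
    using G.summable_powers[of k] unfolding Z_eq
    by (rule summable_on_cong[THEN iffD1, rotated]) (auto simp: G.n_def zorder_G)
qed

end

section \<open>Square integrable functions and orthonormal bases\<close>

abbreviation l2_sq :: "'a measure \<Rightarrow> ('a \<Rightarrow> complex) \<Rightarrow> real"
  where "l2_sq M f \<equiv> LINT x|M. (norm (f x))\<^sup>2"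

lemma L2_measurable: "f \<in> L2 M \<Longrightarrow> f \<in> borel_measurable M"
  by (simp add: L2_def)

lemma norm_sq_add_le: "(norm (x + y :: complex))\<^sup>2 \<le> 2 * (norm x)\<^sup>2 + 2 * (norm y)\<^sup>2"
proof -
  have "(norm (x + y))\<^sup>2 \<le> (norm x + norm y)\<^sup>2"
    by (intro power_mono norm_triangle_ineq norm_ge_zero)
  also have "\<dots> \<le> 2 * (norm x)\<^sup>2 + 2 * (norm y)\<^sup>2"
    using sum_squares_bound[of "norm x" "norm y"] by (simp add: power2_sum)
  finally show ?thesis .
qed

lemma L2_scale: "f \<in> L2 M \<Longrightarrow> (\<lambda>x. c * f x) \<in> L2 M"
  unfolding L2_def by (auto simp: norm_mult power_mult_distrib)

lemma L2_add:
  assumes "f \<in> L2 M" "g \<in> L2 M" shows "(\<lambda>x. f x + g x) \<in> L2 M"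
proof -
  have [measurable]: "f \<in> borel_measurable M" "g \<in> borel_measurable M"
    and i: "integrable M (\<lambda>x. (norm (f x))\<^sup>2)" "integrable M (\<lambda>x. (norm (g x))\<^sup>2)"
    using assms by (auto simp: L2_def)
  have "integrable M (\<lambda>x. (norm (f x + g x))\<^sup>2)"
  proof (rule Bochner_Integration.integrable_bound)
    show "integrable M (\<lambda>x. 2 * (norm (f x))\<^sup>2 + 2 * (norm (g x))\<^sup>2)" using i by auto
    show "AE x in M. norm ((norm (f x + g x))\<^sup>2) \<le> norm (2 * (norm (f x))\<^sup>2 + 2 * (norm (g x))\<^sup>2)"
      using norm_sq_add_le by (intro AE_I2) (metis abs_of_nonneg real_norm_def zero_le_power2 order_trans abs_ge_self)
  qed measurable
  then show ?thesis by (simp add: L2_def)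
qed

lemma L2_comb: "f \<in> L2 M \<Longrightarrow> g \<in> L2 M \<Longrightarrow> (\<lambda>x. c * f x + d * g x) \<in> L2 M"
  by (intro L2_add L2_scale)

lemma L2_diff: "f \<in> L2 M \<Longrightarrow> g \<in> L2 M \<Longrightarrow> (\<lambda>x. f x - g x) \<in> L2 M"
  using L2_comb[of f M g 1 "-1"] by simp

lemma L2_zero: "(\<lambda>_. 0) \<in> L2 M"
  by (simp add: L2_def)

lemma L2_sum: "(\<And>i. i \<in> I \<Longrightarrow> f i \<in> L2 M) \<Longrightarrow> (\<lambda>x. \<Sum>i\<in>I. c i * f i x) \<in> L2 M"
proof (induction I rule: infinite_finite_induct)
  case (insert i I)
  then have "(\<lambda>x. c i * f i x + (\<Sum>i\<in>I. c i * f i x)) \<in> L2 M" by (intro L2_add L2_scale) auto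
  with insert.hyps show ?case by simp
qed (simp_all add: L2_zero)

lemma l2_inner_integrable:
  assumes "f \<in> L2 M" "g \<in> L2 M" shows "integrable M (\<lambda>x. cnj (f x) * g x)"
proof (rule Bochner_Integration.integrable_bound)
  show "integrable M (\<lambda>x. (norm (f x))\<^sup>2 + (norm (g x))\<^sup>2)" using assms by (auto simp: L2_def)
  have "f \<in> borel_measurable M" "g \<in> borel_measurable M" using assms by (auto simp: L2_def)
  then show "(\<lambda>x. cnj (f x) * g x) \<in> borel_measurable M"
    by (intro borel_measurable_times borel_measurable_continuous_on[of cnj] continuous_intros)
  show "AE x in M. norm (cnj (f x) * g x) \<le> norm ((norm (f x))\<^sup>2 + (norm (g x))\<^sup>2)"
  proof (rule AE_I2)
    fix x
    have "norm (f x) * norm (g x) \<le> 2 * norm (f x) * norm (g x)" by simp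
    also have "\<dots> \<le> (norm (f x))\<^sup>2 + (norm (g x))\<^sup>2" by (rule sum_squares_bound)
    finally show "norm (cnj (f x) * g x) \<le> norm ((norm (f x))\<^sup>2 + (norm (g x))\<^sup>2)" by (simp add: norm_mult)
  qed
qed

lemma l2_inner_comb_right:
  assumes "h \<in> L2 M" "f \<in> L2 M" "g \<in> L2 M"
  shows "l2_inner M h (\<lambda>x. c * f x + d * g x) = c * l2_inner M h f + d * l2_inner M h g"
proof -
  have "l2_inner M h (\<lambda>x. c * f x + d * g x) = (LINT x|M. c * (cnj (h x) * f x) + d * (cnj (h x) * g x))"
    unfolding l2_inner_def by (simp add: algebra_simps)
  also have "\<dots> = c * l2_inner M h f + d * l2_inner M h g"
    unfolding l2_inner_def using l2_inner_integrable[OF assms(1,2)] l2_inner_integrable[OF assms(1,3)]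
    by (subst Bochner_Integration.integral_add) auto
  finally show ?thesis .
qed

lemma l2_inner_cnj: "cnj (l2_inner M f g) = l2_inner M g f"
proof -
  have "cnj (l2_inner M f g) = (LINT x|M. cnj (cnj (f x) * g x))"
    unfolding l2_inner_def by (simp flip: Bochner_Integration.integral_cnj)
  also have "\<dots> = l2_inner M g f" unfolding l2_inner_def by (simp add: mult.commute)
  finally show ?thesis .
qed

lemma l2_inner_comb_left:
  assumes "h \<in> L2 M" "f \<in> L2 M" "g \<in> L2 M"
  shows "l2_inner M (\<lambda>x. c * f x + d * g x) h = cnj c * l2_inner M f h + cnj d * l2_inner M g h"
  using arg_cong[OF l2_inner_comb_right[OF assms, of c d], of cnj] by (simp add: l2_inner_cnj)

lemma l2_inner_sum_right:
  assumes "finite I" "h \<in> L2 M" "\<And>i. i \<in> I \<Longrightarrow> f i \<in> L2 M"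
  shows "l2_inner M h (\<lambda>x. \<Sum>i\<in>I. c i * f i x) = (\<Sum>i\<in>I. c i * l2_inner M h (f i))"
  using assms
proof (induction I)
  case empty
  then show ?case by (simp add: l2_inner_def)
next
  case (insert i I)
  have "l2_inner M h (\<lambda>x. c i * f i x + 1 * (\<Sum>i\<in>I. c i * f i x)) =
     c i * l2_inner M h (f i) + 1 * l2_inner M h (\<lambda>x. \<Sum>i\<in>I. c i * f i x)"
    using insert.prems by (intro l2_inner_comb_right L2_sum) auto
  then show ?case using insert by simp
qed

lemma l2_inner_self_eq: "l2_inner M f f = of_real (l2_sq M f)"
proof -
  have "(\<lambda>x. cnj (f x) * f x) = (\<lambda>x. of_real ((norm (f x))\<^sup>2))"
    by (metis complex_norm_square mult.commute)
  then show ?thesis by (simp only: l2_inner_def integral_complex_of_real)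
qed

lemma l2_sq_nonneg: "l2_sq M f \<ge> 0" by simp

lemma l2_norm_sq: "(l2_norm M f)\<^sup>2 = l2_sq M f" by (simp add: l2_norm_def)

lemma l2_sq_eq_0_iff: "f \<in> L2 M \<Longrightarrow> l2_sq M f = 0 \<longleftrightarrow> (AE x in M. f x = 0)"
  by (subst integral_nonneg_eq_0_iff_AE) (auto simp: L2_def)

lemma l2_inner_self_eq_0_iff: "f \<in> L2 M \<Longrightarrow> l2_inner M f f = 0 \<longleftrightarrow> (AE x in M. f x = 0)"
  unfolding l2_inner_self_eq of_real_eq_0_iff by (rule l2_sq_eq_0_iff)

lemma l2_inner_scale: "l2_inner M (\<lambda>x. c * f x) g = cnj c * l2_inner M f g"
  "l2_inner M f (\<lambda>x. c * g x) = c * l2_inner M f g"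
  unfolding l2_inner_def by (simp_all add: mult.assoc mult.left_commute flip: integral_mult_right_zero)

lemma l2_inner_cong_AE:
  assumes "f \<in> L2 M" "f' \<in> L2 M" "g \<in> L2 M" "g' \<in> L2 M" "AE x in M. f x = f' x" "AE x in M. g x = g' x"
  shows "l2_inner M f g = l2_inner M f' g'"
  unfolding l2_inner_def
proof (rule integral_cong_AE)
  show "AE x in M. cnj (f x) * g x = cnj (f' x) * g' x" using assms(5,6) by eventually_elim simp
  show "(\<lambda>x. cnj (f x) * g x) \<in> borel_measurable M" "(\<lambda>x. cnj (f' x) * g' x) \<in> borel_measurable M"
    by (rule borel_measurable_integrable, rule l2_inner_integrable, fact, fact)+
qed

lemma l2_sq_cong_AE:
  assumes "f \<in> L2 M" "f' \<in> L2 M" "AE x in M. f x = f' x"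
  shows "l2_sq M f = l2_sq M f'"
  using l2_inner_cong_AE[OF assms(1,2,1,2,3,3)] unfolding l2_inner_self_eq by (simp only: of_real_eq_iff)

lemma l2_inner_AE_zero: "f \<in> L2 M \<Longrightarrow> g \<in> L2 M \<Longrightarrow> AE x in M. g x = 0 \<Longrightarrow> l2_inner M f g = 0"
  using l2_inner_cong_AE[of f M f g "\<lambda>_. 0"] L2_zero by (auto simp: l2_inner_def)

lemma l2_cauchy_schwarz:
  assumes f: "f \<in> L2 M" and g: "g \<in> L2 M"
  shows "(norm (l2_inner M f g))\<^sup>2 \<le> l2_sq M f * l2_sq M g"
proof (cases "l2_sq M g = 0")
  case True
  then have "AE x in M. g x = 0" using l2_sq_eq_0_iff[OF g] by simp
  then show ?thesis using True l2_inner_AE_zero[OF f g] by simp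
next
  case False
  then have G: "l2_sq M g > 0" using l2_sq_nonneg[of M g] by linarith
  define c where "c = l2_inner M g f / of_real (l2_sq M g)"
  let ?h = "\<lambda>x. 1 * f x + (- c) * g x"
  have h: "?h \<in> L2 M" by (rule L2_comb[OF f g])
  have "l2_inner M ?h ?h = cnj 1 * l2_inner M f ?h + cnj (- c) * l2_inner M g ?h"
    by (rule l2_inner_comb_left[OF h f g])
  also have "l2_inner M g ?h = 0"
    using l2_inner_comb_right[OF g f g, of 1 "- c"] G
    by (simp add: c_def l2_inner_self_eq)
  also have "l2_inner M f ?h = of_real (l2_sq M f) - c * l2_inner M f g"
    using l2_inner_comb_right[OF f f g, of 1 "- c"] by (simp add: l2_inner_self_eq)
  also have "c * l2_inner M f g = of_real ((norm (l2_inner M f g))\<^sup>2 / l2_sq M g)"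
  proof -
    have "l2_inner M g f * l2_inner M f g = of_real ((norm (l2_inner M f g))\<^sup>2)"
      by (metis complex_norm_square l2_inner_cnj mult.commute)
    then show ?thesis unfolding c_def by simp
  qed
  finally have "of_real (l2_sq M ?h) = (of_real (l2_sq M f - (norm (l2_inner M f g))\<^sup>2 / l2_sq M g) :: complex)"
    unfolding l2_inner_self_eq by simp
  then have "l2_sq M f - (norm (l2_inner M f g))\<^sup>2 / l2_sq M g = l2_sq M ?h"
    by (simp only: of_real_eq_iff)
  also have "\<dots> \<ge> 0" by (rule l2_sq_nonneg)
  finally show ?thesis using G by (simp add: field_simps)
qed

lemma l2_sq_comb_expand:
  assumes "f \<in> L2 M" "g \<in> L2 M"
  shows "of_real (l2_sq M (\<lambda>x. f x + c * g x)) =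
    of_real (l2_sq M f) + c * l2_inner M f g + cnj c * l2_inner M g f + c * cnj c * (of_real (l2_sq M g) :: complex)"
proof -
  have h: "(\<lambda>x. 1 * f x + c * g x) \<in> L2 M" by (rule L2_comb[OF assms])
  have "of_real (l2_sq M (\<lambda>x. f x + c * g x)) = l2_inner M (\<lambda>x. 1 * f x + c * g x) (\<lambda>x. 1 * f x + c * g x)"
    by (simp add: l2_inner_self_eq)
  also have "\<dots> = l2_inner M f f + c * l2_inner M f g + cnj c * (l2_inner M g f + c * l2_inner M g g)"
    by (simp only: l2_inner_comb_left[OF h assms] l2_inner_comb_right[OF assms(1) assms] l2_inner_comb_right[OF assms(2) assms])
       (simp add: algebra_simps)
  finally show ?thesis by (simp add: l2_inner_self_eq algebra_simps)
qed

lemma l2_sq_diff_expand: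
  assumes "f \<in> L2 M" "g \<in> L2 M"
  shows "of_real (l2_sq M (\<lambda>x. f x - g x)) =
    of_real (l2_sq M f) - l2_inner M f g - l2_inner M g f + (of_real (l2_sq M g) :: complex)"
  using l2_sq_comb_expand[OF assms, of "-1"] by simp

lemma l2_sq_triangle:
  assumes "f \<in> L2 M" "g \<in> L2 M"
  shows "l2_sq M (\<lambda>x. f x + g x) \<le> 2 * l2_sq M f + 2 * l2_sq M g"
proof -
  have i: "integrable M (\<lambda>x. (norm (f x))\<^sup>2)" "integrable M (\<lambda>x. (norm (g x))\<^sup>2)" "integrable M (\<lambda>x. (norm (f x + g x))\<^sup>2)"
    using assms L2_add[OF assms] by (auto simp: L2_def)
  have "l2_sq M (\<lambda>x. f x + g x) \<le> (LINT x|M. 2 * (norm (f x))\<^sup>2 + 2 * (norm (g x))\<^sup>2)"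
    using i by (intro integral_mono) (auto simp: norm_sq_add_le)
  also have "\<dots> = 2 * l2_sq M f + 2 * l2_sq M g" using i by simp
  finally show ?thesis .
qed

text \<open>Riesz--Fischer on the level of representatives: a fast subsequence converges almost
  everywhere, and Fatou's lemma shows that its pointwise limit is the limit in the mean.\<close>

lemma l2_complete:
  assumes f: "\<And>n. f n \<in> L2 M"
    and cauchy: "\<And>e. e > 0 \<Longrightarrow> \<exists>N. \<forall>m\<ge>N. \<forall>n\<ge>N. l2_sq M (\<lambda>x. f m x - f n x) < e"
  shows "\<exists>g\<in>L2 M. (\<lambda>n. l2_sq M (\<lambda>x. f n x - g x)) \<longlonglongrightarrow> 0"
proof -
  have [measurable]: "f n \<in> borel_measurable M" for n using f by (rule L2_measurable)
  have int: "integrable M (\<lambda>x. (norm (f m x - f n x))\<^sup>2)" for m n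
    using L2_diff[OF f f, of m n] by (simp add: L2_def)
  have nn: "(\<integral>\<^sup>+x. ennreal ((norm (f m x - f n x))\<^sup>2) \<partial>M) = ennreal (l2_sq M (\<lambda>x. f m x - f n x))" for m n
    by (rule nn_integral_eq_integral[OF int]) simp
  \<comment> \<open>Squared distances below 4^(-k) remain summable after multiplication by 2^k.
    Hence 2^k |d k x|^2 is bounded in k for almost every x, and |d k x| decays like
    2^(-k/2).\<close>
  have "\<forall>k. \<exists>N. \<forall>m\<ge>N. \<forall>n\<ge>N. l2_sq M (\<lambda>x. f m x - f n x) < (1/4) ^ k"
    by (intro allI cauchy) simp
  then obtain N where N: "\<And>k m n. m \<ge> N k \<Longrightarrow> n \<ge> N k \<Longrightarrow> l2_sq M (\<lambda>x. f m x - f n x) < (1/4) ^ k"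
    by metis
  define s where "s = rec_nat (N 0) (\<lambda>k r. max (Suc r) (N (Suc k)))"
  have s_Suc: "s (Suc k) = max (Suc (s k)) (N (Suc k))" for k by (simp add: s_def)
  have sN: "s k \<ge> N k" for k by (cases k) (auto simp: s_def)
  have "s k < s (Suc k)" for k by (simp add: s_Suc)
  then have smono: "strict_mono s" by (simp add: strict_mono_Suc_iff)
  define d where "d = (\<lambda>k x. f (s (Suc k)) x - f (s k) x)"
  have d: "l2_sq M (d k) < (1/4) ^ k" for k
    unfolding d_def using sN[of k] smono by (intro N) (auto intro: order_trans simp: strict_mono_less_eq)
  have dm [measurable]: "d k \<in> borel_measurable M" for k unfolding d_def by measurable
  have "(\<integral>\<^sup>+x. (\<Sum>k. ennreal (2 ^ k * (norm (d k x))\<^sup>2)) \<partial>M) = (\<Sum>k. \<integral>\<^sup>+x. ennreal (2 ^ k * (norm (d k x))\<^sup>2) \<partial>M)"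
    by (rule nn_integral_suminf) measurable
  also have "\<dots> \<le> (\<Sum>k. ennreal ((1/2) ^ k))"
  proof (intro suminf_le)
    fix k
    have "(\<integral>\<^sup>+x. ennreal (2 ^ k * (norm (d k x))\<^sup>2) \<partial>M) = ennreal (2 ^ k) * (\<integral>\<^sup>+x. ennreal ((norm (d k x))\<^sup>2) \<partial>M)"
      by (simp add: ennreal_mult nn_integral_cmult)
    also have "(\<integral>\<^sup>+x. ennreal ((norm (d k x))\<^sup>2) \<partial>M) = ennreal (l2_sq M (d k))"
      unfolding d_def by (rule nn)
    also have "ennreal (2 ^ k) * ennreal (l2_sq M (d k)) = ennreal (2 ^ k * l2_sq M (d k))"
      by (rule ennreal_mult[symmetric]) auto
    also have "\<dots> \<le> ennreal ((1/2) ^ k)"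
    proof (rule ennreal_leI)
      have "2 ^ k * l2_sq M (d k) \<le> 2 ^ k * (1/4) ^ k" using d[of k] by (intro mult_left_mono) auto
      also have "\<dots> = (1/2) ^ k" by (simp flip: power_mult_distrib)
      finally show "2 ^ k * l2_sq M (d k) \<le> (1/2) ^ k" .
    qed
    finally show "(\<integral>\<^sup>+x. ennreal (2 ^ k * (norm (d k x))\<^sup>2) \<partial>M) \<le> ennreal ((1/2) ^ k)" .
  qed auto
  also have "(\<Sum>k. ennreal ((1/2) ^ k)) < \<infinity>"
    by (subst suminf_ennreal2) (auto intro: summable_geometric)
  finally have "AE x in M. (\<Sum>k. ennreal (2 ^ k * (norm (d k x))\<^sup>2)) \<noteq> \<infinity>"
    by (intro nn_integral_PInf_AE) (auto simp: less_top)
  then have conv: "AE x in M. convergent (\<lambda>k. f (s k) x)"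
  proof eventually_elim
    case (elim x)
    have "summable (\<lambda>k. 2 ^ k * (norm (d k x))\<^sup>2)"
      by (rule summable_suminf_not_top) (use elim in auto)
    then have "(\<lambda>k. 2 ^ k * (norm (d k x))\<^sup>2) \<longlonglongrightarrow> 0" by (rule summable_LIMSEQ_zero)
    then have "Bseq (\<lambda>k. 2 ^ k * (norm (d k x))\<^sup>2)" by (intro convergent_imp_Bseq) (auto simp: convergent_def)
    then obtain B where B: "B > 0" "\<And>k. norm (2 ^ k * (norm (d k x))\<^sup>2) \<le> B" by (auto elim: BseqE)
    have "norm (d k x) \<le> sqrt B * (1 / sqrt 2) ^ k" for k
    proof -
      have "(norm (d k x))\<^sup>2 \<le> B / 2 ^ k" using B(2)[of k] by (simp add: field_simps)
      then have "norm (d k x) \<le> sqrt (B / 2 ^ k)" by (rule real_le_rsqrt)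
      also have "\<dots> = sqrt B * (1 / sqrt 2) ^ k"
        by (simp add: real_sqrt_divide real_sqrt_power power_one_over)
      finally show ?thesis .
    qed
    moreover have "summable (\<lambda>k. sqrt B * (1 / sqrt 2) ^ k)"
      by (intro summable_mult summable_geometric) auto
    ultimately have "summable (\<lambda>k. d k x)"
      by (rule summable_comparison_test'[rotated, where N=0])
    then have "convergent (\<lambda>n. \<Sum>k<n. d k x)" by (simp add: summable_iff_convergent)
    moreover have "(\<Sum>k<n. d k x) = f (s n) x - f (s 0) x" for n
      unfolding d_def by (rule sum_lessThan_telescope)
    ultimately have "convergent (\<lambda>n. f (s n) x - f (s 0) x)" by simp
    from convergent_add[OF this convergent_const[of "f (s 0) x"]] show ?case by simp
  qed
  define g where "g = (\<lambda>x. lim (\<lambda>k. f (s k) x))"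
  have gm [measurable]: "g \<in> borel_measurable M"
    unfolding g_def by (rule borel_measurable_lim_metric) measurable
  have lim: "AE x in M. (\<lambda>k. f (s k) x) \<longlonglongrightarrow> g x"
    using conv by eventually_elim (simp add: g_def convergent_LIMSEQ_iff)
  \<comment> \<open>The Cauchy bound for \<open>f n\<close> against the subsequence passes to the
    limit; this also places the limit in L2.\<close>
  have fatou: "(\<integral>\<^sup>+x. ennreal ((norm (f n x - g x))\<^sup>2) \<partial>M) \<le> ennreal e"
    if e: "\<And>m. m \<ge> K \<Longrightarrow> l2_sq M (\<lambda>x. f n x - f m x) \<le> e" for n K e
  proof -
    have "(\<integral>\<^sup>+x. ennreal ((norm (f n x - g x))\<^sup>2) \<partial>M) = (\<integral>\<^sup>+x. liminf (\<lambda>k. ennreal ((norm (f n x - f (s k) x))\<^sup>2)) \<partial>M)"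
    proof (rule nn_integral_cong_AE, use lim in eventually_elim)
      case (elim x)
      have "(\<lambda>k. ennreal ((norm (f n x - f (s k) x))\<^sup>2)) \<longlonglongrightarrow> ennreal ((norm (f n x - g x))\<^sup>2)"
        by (intro tendsto_ennrealI tendsto_intros elim)
      then show ?case by (rule lim_imp_Liminf[OF trivial_limit_sequentially, symmetric])
    qed
    also have "\<dots> \<le> liminf (\<lambda>k. \<integral>\<^sup>+x. ennreal ((norm (f n x - f (s k) x))\<^sup>2) \<partial>M)"
      by (rule nn_integral_liminf) measurable
    also have "\<dots> \<le> liminf (\<lambda>k. ennreal e)"
    proof (rule Liminf_mono)
      show "\<forall>\<^sub>F k in sequentially. (\<integral>\<^sup>+x. ennreal ((norm (f n x - f (s k) x))\<^sup>2) \<partial>M) \<le> ennreal e"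
        using eventually_ge_at_top[of K]
      proof eventually_elim
        case (elim k)
        then have "s k \<ge> K" using seq_suble[OF smono, of k] by linarith
        then show ?case unfolding nn using e by (intro ennreal_leI) auto
      qed
    qed
    also have "\<dots> = ennreal e" by (simp add: Liminf_const)
    finally show ?thesis .
  qed
  have fg: "(\<lambda>x. f n x - g x) \<in> L2 M \<and> l2_sq M (\<lambda>x. f n x - g x) \<le> e"
    if e: "\<And>m. m \<ge> K \<Longrightarrow> l2_sq M (\<lambda>x. f n x - f m x) \<le> e" and e0: "e \<ge> 0" for n K e
  proof -
    have fin: "(\<integral>\<^sup>+x. ennreal ((norm (f n x - g x))\<^sup>2) \<partial>M) \<le> ennreal e" by (rule fatou[OF e])
    have i: "integrable M (\<lambda>x. (norm (f n x - g x))\<^sup>2)"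
      by (rule integrableI_bounded) (use fin in \<open>auto simp: le_less_trans\<close>)
    then have "ennreal (l2_sq M (\<lambda>x. f n x - g x)) \<le> ennreal e"
      using fin nn_integral_eq_integral[OF i] by simp
    with i e0 show ?thesis by (simp add: L2_def)
  qed
  obtain N1 where N1: "\<forall>m\<ge>N1. \<forall>n\<ge>N1. l2_sq M (\<lambda>x. f m x - f n x) < 1" using cauchy[of 1] by auto
  have "(\<lambda>x. f N1 x - g x) \<in> L2 M"
    using fg[of N1 N1 1] N1 by (simp add: less_imp_le)
  from L2_diff[OF f[of N1] this] have g: "g \<in> L2 M" by simp
  have "(\<lambda>n. l2_sq M (\<lambda>x. f n x - g x)) \<longlonglongrightarrow> 0"
  proof (rule LIMSEQ_I)
    fix e :: real assume "e > 0"
    then obtain N2 where N2: "\<forall>m\<ge>N2. \<forall>n\<ge>N2. l2_sq M (\<lambda>x. f m x - f n x) < e / 2"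
      using cauchy[of "e / 2"] by auto
    have "l2_sq M (\<lambda>x. f n x - g x) \<le> e / 2" if "n \<ge> N2" for n
      using fg[of N2 n "e / 2"] N2 that \<open>e > 0\<close> by (simp add: less_imp_le)
    then show "\<exists>no. \<forall>n\<ge>no. norm (l2_sq M (\<lambda>x. f n x - g x) - 0) < e"
      using \<open>e > 0\<close> by (intro exI[of _ N2]) force
  qed
  with g show ?thesis by blast
qed

lemma l2_inner_tendsto:
  assumes h: "h \<in> L2 M" and f: "\<And>n. f n \<in> L2 M" and g: "g \<in> L2 M"
    and lim: "(\<lambda>n. l2_sq M (\<lambda>x. f n x - g x)) \<longlonglongrightarrow> 0"
  shows "(\<lambda>n. l2_inner M h (f n)) \<longlonglongrightarrow> l2_inner M h g"
proof -
  have "(\<lambda>n. sqrt (l2_sq M h * l2_sq M (\<lambda>x. f n x - g x))) \<longlonglongrightarrow> sqrt (l2_sq M h * 0)"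
    by (intro tendsto_intros lim)
  then have lim': "(\<lambda>n. sqrt (l2_sq M h * l2_sq M (\<lambda>x. f n x - g x))) \<longlonglongrightarrow> 0" by simp
  have "(\<lambda>n. l2_inner M h (f n) - l2_inner M h g) \<longlonglongrightarrow> 0"
  proof (rule Lim_null_comparison[OF always_eventually lim'], rule allI)
    fix n
    have "l2_inner M h (f n) - l2_inner M h g = l2_inner M h (\<lambda>x. f n x - g x)"
      using l2_inner_comb_right[OF h f[of n] g, of 1 "-1"] by simp
    then show "norm (l2_inner M h (f n) - l2_inner M h g) \<le> sqrt (l2_sq M h * l2_sq M (\<lambda>x. f n x - g x))"
      using l2_cauchy_schwarz[OF h L2_diff[OF f[of n] g]] by (simp add: real_le_rsqrt)
  qed
  then show ?thesis by (simp add: LIM_zero_iff)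
qed

lemma l2_sq_tendsto:
  assumes f: "\<And>n. f n \<in> L2 M" and g: "g \<in> L2 M"
    and lim: "(\<lambda>n. l2_sq M (\<lambda>x. f n x - g x)) \<longlonglongrightarrow> 0"
  shows "(\<lambda>n. l2_sq M (f n)) \<longlonglongrightarrow> l2_sq M g"
proof -
  have lim1: "(\<lambda>n. l2_inner M g (f n)) \<longlonglongrightarrow> l2_inner M g g" by (rule l2_inner_tendsto[OF g f g lim])
  have "(\<lambda>n. of_real (l2_sq M (\<lambda>x. f n x - g x)) + cnj (l2_inner M g (f n)) + l2_inner M g (f n) - of_real (l2_sq M g) :: complex)
      \<longlonglongrightarrow> of_real 0 + cnj (l2_inner M g g) + l2_inner M g g - of_real (l2_sq M g)"
    by (intro tendsto_intros lim lim1)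
  moreover have "of_real (l2_sq M (\<lambda>x. f n x - g x)) + cnj (l2_inner M g (f n)) + l2_inner M g (f n) - of_real (l2_sq M g)
      = (of_real (l2_sq M (f n)) :: complex)" for n
    by (subst l2_sq_diff_expand[OF f g]) (simp add: l2_inner_cnj)
  ultimately have "(\<lambda>n. of_real (l2_sq M (f n)) :: complex) \<longlonglongrightarrow> of_real (l2_sq M g)"
    by (simp add: l2_inner_self_eq)
  then show ?thesis by (simp only: tendsto_of_real_iff)
qed

lemma sum_apply_fun: "(\<Sum>i\<in>I. f i) x = (\<Sum>i\<in>I. f i x)" for f :: "'i \<Rightarrow> 'x \<Rightarrow> complex"
  by (induction I rule: infinite_finite_induct) auto

section \<open>Orthonormal families: Bessel, Riesz--Fischer and Parseval\<close>

locale orthonormal =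
  fixes M :: "'a measure" and E :: "('a \<Rightarrow> complex) set"
  assumes sub: "E \<subseteq> L2 M"
    and on: "\<And>e e'. e \<in> E \<Longrightarrow> e' \<in> E \<Longrightarrow> l2_inner M e e' = (if e = e' then 1 else 0)"
begin

lemma in_L2: "e \<in> E \<Longrightarrow> e \<in> L2 M" using sub by auto

lemma sum_in_L2: "I \<subseteq> E \<Longrightarrow> (\<lambda>x. \<Sum>e\<in>I. c e * e x) \<in> L2 M"
  using sub by (intro L2_sum) auto

lemma inner_sum:
  assumes "finite I" "I \<subseteq> E" "e' \<in> E"
  shows "l2_inner M e' (\<lambda>x. \<Sum>e\<in>I. c e * e x) = (if e' \<in> I then c e' else 0)"
proof -
  have "l2_inner M e' (\<lambda>x. \<Sum>e\<in>I. c e * e x) = (\<Sum>e\<in>I. c e * l2_inner M e' e)"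
    using assms sub by (intro l2_inner_sum_right) auto
  also have "\<dots> = (\<Sum>e\<in>I. if e = e' then c e' else 0)"
    using assms by (intro sum.cong refl) (subst on, auto)
  finally show ?thesis using assms(1) by (simp add: sum.delta)
qed

lemma l2_sq_sum:
  assumes "finite I" "I \<subseteq> E"
  shows "l2_sq M (\<lambda>x. \<Sum>e\<in>I. c e * e x) = (\<Sum>e\<in>I. (norm (c e))\<^sup>2)"
proof -
  let ?S = "\<lambda>x. \<Sum>e\<in>I. c e * e x"
  have "complex_of_real (l2_sq M ?S) = l2_inner M ?S ?S" by (simp only: l2_inner_self_eq)
  also have "\<dots> = (\<Sum>e\<in>I. c e * l2_inner M ?S e)"
    using assms sub sum_in_L2[OF assms(2)] by (intro l2_inner_sum_right) auto
  also have "\<dots> = (\<Sum>e\<in>I. c e * cnj (l2_inner M e ?S))" by (simp only: l2_inner_cnj)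
  also have "\<dots> = (\<Sum>e\<in>I. c e * cnj (c e))"
    using assms by (intro sum.cong refl) (simp add: inner_sum subset_iff)
  also have "\<dots> = complex_of_real (\<Sum>e\<in>I. (norm (c e))\<^sup>2)"
    unfolding of_real_sum by (intro sum.cong refl) (simp only: complex_norm_square)
  finally show ?thesis by (simp only: of_real_eq_iff)
qed

lemma independent:
  "\<not> module.dependent (\<lambda>(c::complex) (f::'a \<Rightarrow> complex) x. c * f x) E"
proof -
  interpret vs: vector_space "\<lambda>(c::complex) (f::'a \<Rightarrow> complex) x. c * f x"
    by (rule vector_space_complex_fun)
  show ?thesis
    unfolding vs.independent_explicit_finite_subsets
  proof (intro allI impI ballI)
    fix S u v assume S: "S \<subseteq> E" "finite S" and 0: "(\<Sum>v\<in>S. (\<lambda>x. u v * v x)) = 0" and v: "v \<in> S"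
    have "(\<lambda>x. \<Sum>v\<in>S. u v * v x) = (\<lambda>_. 0)"
      using fun_cong[OF 0] unfolding sum_apply_fun by (simp add: fun_eq_iff)
    then show "u v = 0" using inner_sum[OF S(2,1), of v u] v S(1) by (auto simp: l2_inner_def)
  qed
qed

lemma bessel:
  assumes f: "f \<in> L2 M" and I: "finite I" "I \<subseteq> E"
  shows "(\<Sum>e\<in>I. (norm (l2_inner M e f))\<^sup>2) \<le> l2_sq M f"
proof -
  let ?c = "\<lambda>e. l2_inner M e f"
  let ?S = "\<lambda>x. \<Sum>e\<in>I. ?c e * e x"
  have S: "?S \<in> L2 M" by (rule sum_in_L2[OF I(2)])
  have "l2_inner M f ?S = (\<Sum>e\<in>I. ?c e * l2_inner M f e)"
    using assms sub by (intro l2_inner_sum_right) auto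
  also have "\<dots> = (\<Sum>e\<in>I. ?c e * cnj (?c e))" by (simp only: l2_inner_cnj)
  also have "\<dots> = complex_of_real (\<Sum>e\<in>I. (norm (?c e))\<^sup>2)"
    unfolding of_real_sum by (intro sum.cong refl) (simp only: complex_norm_square)
  finally have fS: "l2_inner M f ?S = complex_of_real (\<Sum>e\<in>I. (norm (?c e))\<^sup>2)" .
  then have Sf: "l2_inner M ?S f = complex_of_real (\<Sum>e\<in>I. (norm (?c e))\<^sup>2)"
    unfolding l2_inner_cnj[of M f, symmetric] by (simp only: complex_cnj_complex_of_real)
  have "complex_of_real (l2_sq M (\<lambda>x. f x - ?S x)) = complex_of_real (l2_sq M f - (\<Sum>e\<in>I. (norm (?c e))\<^sup>2))"
    by (subst l2_sq_diff_expand[OF f S]) (simp add: fS Sf l2_sq_sum[OF I])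
  then have "l2_sq M (\<lambda>x. f x - ?S x) = l2_sq M f - (\<Sum>e\<in>I. (norm (?c e))\<^sup>2)" by (simp only: of_real_eq_iff)
  moreover have "l2_sq M (\<lambda>x. f x - ?S x) \<ge> 0" by simp
  ultimately show ?thesis by linarith
qed

lemma bessel_summable:
  assumes "f \<in> L2 M" shows "(\<lambda>e. (norm (l2_inner M e f))\<^sup>2) summable_on E"
  by (rule nonneg_bdd_above_summable_on) (auto intro!: bdd_aboveI2[where M="l2_sq M f"] bessel[OF assms])

text \<open>The family may be uncountable. Finite sets that exhaust the sum up to 1/(n+1) are
  accumulated into an increasing sequence \<open>I n\<close>; any coefficient outside
  \<open>I n\<close> has squared modulus below 1/(n+1), so the partial sums over \<open>I n\<close>
  determine all coefficients in the limit.\<close>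

lemma synthesis:
  fixes c :: "('a \<Rightarrow> complex) \<Rightarrow> complex"
  assumes "(\<lambda>e. (norm (c e))\<^sup>2) summable_on E"
  shows "\<exists>g\<in>L2 M. (\<forall>e\<in>E. l2_inner M e g = c e) \<and> ((\<lambda>e. (norm (c e))\<^sup>2) has_sum l2_sq M g) E"
proof -
  define t where "t = infsum (\<lambda>e. (norm (c e))\<^sup>2) E"
  have t: "((\<lambda>e. (norm (c e))\<^sup>2) has_sum t) E" unfolding t_def using assms by simp
  have le_t: "(\<Sum>e\<in>I. (norm (c e))\<^sup>2) \<le> t" if "finite I" "I \<subseteq> E" for I
    by (rule finite_sum_le_has_sum[OF t that]) auto
  have "\<exists>F. finite F \<and> F \<subseteq> E \<and> t - 1 / real (Suc n) < (\<Sum>e\<in>F. (norm (c e))\<^sup>2)" for n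
  proof -
    have "eventually (\<lambda>F. t - 1 / real (Suc n) < (\<Sum>e\<in>F. (norm (c e))\<^sup>2)) (finite_subsets_at_top E)"
      using t unfolding has_sum_def by (rule order_tendstoD) simp
    then show ?thesis unfolding eventually_finite_subsets_at_top by blast
  qed
  then obtain F where F: "\<And>n. finite (F n)" "\<And>n. F n \<subseteq> E"
      "\<And>n. t - 1 / real (Suc n) < (\<Sum>e\<in>F n. (norm (c e))\<^sup>2)" by metis
  define I where "I n = (\<Union>k\<le>n. F k)" for n
  have I: "finite (I n)" "I n \<subseteq> E" for n using F by (auto simp: I_def)
  have mono: "m \<le> n \<Longrightarrow> I m \<subseteq> I n" for m n by (force simp: I_def)
  have I_gt: "t - 1 / real (Suc n) < (\<Sum>e\<in>I n. (norm (c e))\<^sup>2)" for n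
  proof -
    have "(\<Sum>e\<in>F n. (norm (c e))\<^sup>2) \<le> (\<Sum>e\<in>I n. (norm (c e))\<^sup>2)"
      by (intro sum_mono2 I) (auto simp: I_def)
    with F(3)[of n] show ?thesis by linarith
  qed
  have rest: "(\<Sum>e\<in>J. (norm (c e))\<^sup>2) < 1 / real (Suc n)" if "finite J" "J \<subseteq> E - I n" for n J
  proof -
    have "(\<Sum>e\<in>I n. (norm (c e))\<^sup>2) + (\<Sum>e\<in>J. (norm (c e))\<^sup>2) = (\<Sum>e\<in>I n \<union> J. (norm (c e))\<^sup>2)"
      using that I(1) by (intro sum.union_disjoint[symmetric]) auto
    also have "\<dots> \<le> t" using that I[of n] by (intro le_t) auto
    finally show ?thesis using I_gt[of n] by linarith
  qed
  define S where "S n = (\<lambda>x. \<Sum>e\<in>I n. c e * e x)" for n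
  have S: "S n \<in> L2 M" for n unfolding S_def by (rule sum_in_L2[OF I(2)])
  have diff: "l2_sq M (\<lambda>x. S n x - S m x) < 1 / real (Suc m)" if "m \<le> n" for m n
  proof -
    have "S n x - S m x = (\<Sum>e\<in>I n - I m. c e * e x)" for x
      unfolding S_def using I(1)[of n] mono[OF that] by (simp add: sum_diff)
    then have "l2_sq M (\<lambda>x. S n x - S m x) = (\<Sum>e\<in>I n - I m. (norm (c e))\<^sup>2)"
      using I[of n] by (subst l2_sq_sum[symmetric]) auto
    also have "\<dots> < 1 / real (Suc m)" using I[of n] by (intro rest) auto
    finally show ?thesis .
  qed
  have inv0: "(\<lambda>n. 1 / real (Suc n)) \<longlonglongrightarrow> 0"
    using LIMSEQ_inverse_real_of_nat by (simp add: inverse_eq_divide)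
  obtain g where g: "g \<in> L2 M" and lim: "(\<lambda>n. l2_sq M (\<lambda>x. S n x - g x)) \<longlonglongrightarrow> 0"
  proof -
    have "\<exists>N. \<forall>m\<ge>N. \<forall>n\<ge>N. l2_sq M (\<lambda>x. S m x - S n x) < e" if "e > 0" for e
    proof -
      obtain N where N: "1 / real (Suc N) < e" using \<open>e > 0\<close> nat_approx_posE by blast
      have *: "l2_sq M (\<lambda>x. S m x - S n x) < e" if "m \<ge> n" "n \<ge> N" for m n
      proof -
        have "1 / real (Suc n) \<le> 1 / real (Suc N)" using that by (intro divide_left_mono) auto
        with diff[OF \<open>m \<ge> n\<close>] N show ?thesis by linarith
      qed
      have "l2_sq M (\<lambda>x. S m x - S n x) < e" if "m \<ge> N" "n \<ge> N" for m n
        using *[of n m] *[of m n] that by (cases "n \<le> m") (auto simp: norm_minus_commute)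
      then show ?thesis by blast
    qed
    from l2_complete[OF S this] show ?thesis using that by blast
  qed
  have "l2_inner M e g = c e" if e: "e \<in> E" for e
  proof -
    have "(\<lambda>n. l2_inner M e (S n) - c e) \<longlonglongrightarrow> 0"
    proof (rule Lim_null_comparison[where g="\<lambda>n. sqrt (1 / real (Suc n))"])
      show "(\<lambda>n. sqrt (1 / real (Suc n))) \<longlonglongrightarrow> 0" using tendsto_real_sqrt[OF inv0] by simp
      have "(norm (l2_inner M e (S n) - c e))\<^sup>2 \<le> 1 / real (Suc n)" for n
        using rest[of "{e}" n] e unfolding S_def inner_sum[OF I e] by auto
      then show "\<forall>\<^sub>F n in sequentially. norm (l2_inner M e (S n) - c e) \<le> sqrt (1 / real (Suc n))"
        by (intro always_eventually allI real_le_rsqrt)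
    qed
    then have "(\<lambda>n. l2_inner M e (S n)) \<longlonglongrightarrow> c e" by (simp only: LIM_zero_iff)
    with l2_inner_tendsto[OF in_L2[OF e] S g lim] show ?thesis by (rule LIMSEQ_unique)
  qed
  moreover have "l2_sq M g = t"
  proof (rule LIMSEQ_unique[OF l2_sq_tendsto[OF S g lim]])
    have "(\<lambda>n. t - 1 / real (Suc n)) \<longlonglongrightarrow> t - 0" by (intro tendsto_intros inv0)
    then have lim_t: "(\<lambda>n. t - 1 / real (Suc n)) \<longlonglongrightarrow> t" by simp
    have eq: "l2_sq M (S n) = (\<Sum>e\<in>I n. (norm (c e))\<^sup>2)" for n
      unfolding S_def by (rule l2_sq_sum[OF I])
    have low: "\<forall>\<^sub>F n in sequentially. t - 1 / real (Suc n) \<le> l2_sq M (S n)"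
      unfolding eq by (rule always_eventually, rule allI, rule less_imp_le, rule I_gt)
    have up: "\<forall>\<^sub>F n in sequentially. l2_sq M (S n) \<le> t"
      unfolding eq by (rule always_eventually, rule allI, rule le_t[OF I])
    show "(\<lambda>n. l2_sq M (S n)) \<longlonglongrightarrow> t"
      by (rule tendsto_sandwich[OF low up lim_t tendsto_const])
  qed
  ultimately show ?thesis using g t by auto
qed

end

lemma orthonormal_basis_iff:
  "orthonormal_basis M E \<longleftrightarrow> orthonormal M E \<and> (\<forall>f\<in>L2 M. (\<forall>e\<in>E. l2_inner M e f = 0) \<longrightarrow> (AE x in M. f x = 0))"
  unfolding orthonormal_basis_def orthonormal_def by blast

locale orthonormal_base =
  fixes M :: "'a measure" and E :: "('a \<Rightarrow> complex) set"
  assumes basis: "orthonormal_basis M E"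
begin

sublocale orthonormal M E using basis by (simp add: orthonormal_basis_iff)

lemma eq_AE:
  assumes "f \<in> L2 M" "g \<in> L2 M" "\<And>e. e \<in> E \<Longrightarrow> l2_inner M e f = l2_inner M e g"
  shows "AE x in M. f x = g x"
proof -
  have "l2_inner M e (\<lambda>x. f x - g x) = 0" if "e \<in> E" for e
    using l2_inner_comb_right[OF in_L2[OF that] assms(1,2), of 1 "-1"] assms(3)[OF that] by simp
  then have "AE x in M. f x - g x = 0" using basis L2_diff[OF assms(1,2)] unfolding orthonormal_basis_def by blast
  then show ?thesis by simp
qed

lemma parseval_sq:
  assumes f: "f \<in> L2 M" shows "((\<lambda>e. (norm (l2_inner M e f))\<^sup>2) has_sum l2_sq M f) E"
proof -
  obtain g where g: "g \<in> L2 M" "\<forall>e\<in>E. l2_inner M e g = l2_inner M e f"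
      "((\<lambda>e. (norm (l2_inner M e f))\<^sup>2) has_sum l2_sq M g) E"
    using synthesis[OF bessel_summable[OF f]] by blast
  have "AE x in M. f x = g x" by (rule eq_AE) (use f g in auto)
  then show ?thesis using g l2_sq_cong_AE[OF f g(1)] by simp
qed

text \<open>Polarization of \<open>parseval_sq\<close> with the factors 1, -1, i, -i; the weights
  fit an inner product that is conjugate linear in the first argument.\<close>

lemma parseval:
  assumes f: "f \<in> L2 M" and g: "g \<in> L2 M"
  shows "((\<lambda>e. cnj (l2_inner M e f) * l2_inner M e g) has_sum l2_inner M f g) E"
proof -
  have polar: "((\<lambda>e. of_real ((norm (l2_inner M e f + c * l2_inner M e g))\<^sup>2) :: complex)
      has_sum of_real (l2_sq M (\<lambda>x. f x + c * g x))) E" for c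
  proof -
    have "l2_inner M e (\<lambda>x. f x + c * g x) = l2_inner M e f + c * l2_inner M e g" if "e \<in> E" for e
      using l2_inner_comb_right[OF in_L2[OF that] f g, of 1 c] by simp
    then have "((\<lambda>e. (norm (l2_inner M e f + c * l2_inner M e g))\<^sup>2) has_sum l2_sq M (\<lambda>x. f x + c * g x)) E"
      using parseval_sq[OF L2_add[OF f L2_scale[OF g]], of c] by (simp cong: has_sum_cong)
    then show ?thesis by (rule has_sum_of_real)
  qed
  define a where "a c = (of_real (l2_sq M (\<lambda>x. f x + c * g x)) :: complex)" for c
  define h where "h e c = (of_real ((norm (l2_inner M e f + c * l2_inner M e g))\<^sup>2) :: complex)" for e c
  have hs: "((\<lambda>e. h e c) has_sum a c) E" for c unfolding h_def a_def by (rule polar)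
  have "((\<lambda>e. (1/4) * (h e 1 + ((-1) * h e (-1) + ((-\<i>) * h e \<i> + \<i> * h e (-\<i>)))))
      has_sum ((1/4) * (a 1 + ((-1) * a (-1) + ((-\<i>) * a \<i> + \<i> * a (-\<i>)))))) E"
    by (intro has_sum_cmult_right has_sum_add hs)
  moreover have "(1/4) * (h e 1 + ((-1) * h e (-1) + ((-\<i>) * h e \<i> + \<i> * h e (-\<i>))))
      = cnj (l2_inner M e f) * l2_inner M e g" for e
    unfolding h_def complex_norm_square by (simp add: algebra_simps)
  moreover have "(1/4) * (a 1 + ((-1) * a (-1) + ((-\<i>) * a \<i> + \<i> * a (-\<i>)))) = l2_inner M f g"
    unfolding a_def l2_sq_comb_expand[OF f g] by (simp add: algebra_simps)
  ultimately show ?thesis by simp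
qed

text \<open>Both sides are iterated sums of \<open>\<nu> e\<close> times the squared modulus of the
  inner product of e and e'. Summing over e' first gives \<open>\<nu> e\<close>, because e has norm
  1; absolute summability of \<open>\<nu>\<close> allows the other order, which gives the diagonal
  entries in the basis \<open>E'\<close>.\<close>

lemma diagonal_has_sum:
  fixes \<nu> :: "('a \<Rightarrow> complex) \<Rightarrow> real"
  assumes A: "\<And>f. f \<in> L2 M \<Longrightarrow> A f \<in> L2 M"
    and diag: "\<And>e f. e \<in> E \<Longrightarrow> f \<in> L2 M \<Longrightarrow> l2_inner M e (A f) = of_real (\<nu> e) * l2_inner M e f"
    and summ: "(\<lambda>e. norm (\<nu> e)) summable_on E"
    and E': "orthonormal_basis M E'"
  shows "((\<lambda>e. l2_inner M e (A e)) has_sum of_real (infsum \<nu> E)) E'"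
proof -
  interpret E': orthonormal_base M E' by unfold_locales (rule E')
  define h where "h = (\<lambda>(e, e'). \<nu> e * (norm (l2_inner M e e'))\<^sup>2)"
  have sum1: "((\<lambda>e'. (norm (l2_inner M e e'))\<^sup>2) has_sum 1) E'" if "e \<in> E" for e
  proof -
    have "l2_sq M e = 1" using l2_inner_self_eq[of M e] on[OF that that]
      by (metis of_real_1 of_real_eq_iff)
    moreover have "norm (l2_inner M e e') = norm (l2_inner M e' e)" for e'
      by (metis complex_mod_cnj l2_inner_cnj)
    ultimately show ?thesis using E'.parseval_sq[OF in_L2[OF that]] by simp
  qed
  have abs1: "((\<lambda>e'. norm (h (e, e'))) has_sum norm (\<nu> e)) E'" if "e \<in> E" for e
    using has_sum_cmult_right[OF sum1[OF that], of "norm (\<nu> e)"] by (simp add: h_def abs_mult)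
  have "(\<lambda>z. norm (h z)) summable_on (E \<times> E')"
    by (rule summable_on_SigmaI[OF abs1 summ]) auto
  then have "h summable_on (E \<times> E')" by (rule abs_summable_summable)
  then obtain s where s: "(h has_sum s) (E \<times> E')" by (auto simp: summable_on_def)
  have "(\<nu> has_sum s) E"
  proof (rule has_sum_SigmaD[OF s])
    fix e assume "e \<in> E"
    then show "((\<lambda>e'. h (e, e')) has_sum \<nu> e) E'"
      using has_sum_cmult_right[OF sum1, of e "\<nu> e"] by (simp add: h_def)
  qed
  then have s_eq: "infsum \<nu> E = s" by (rule infsumI)
  have "(h has_sum s) (E \<times> E') \<longleftrightarrow> ((\<lambda>(x, y). h (y, x)) has_sum s) (E' \<times> E)"
    by (rule has_sum_swap)
  then have "((\<lambda>(x, y). h (y, x)) has_sum s) (E' \<times> E)" using s by simp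
  then have "((\<lambda>z. of_real ((\<lambda>(x, y). h (y, x)) z) :: complex) has_sum of_real s) (E' \<times> E)"
    by (rule has_sum_of_real)
  then show ?thesis unfolding s_eq
  proof (rule has_sum_SigmaD)
    fix e' assume "e' \<in> E'"
    then have e': "e' \<in> L2 M" by (rule E'.in_L2)
    have "((\<lambda>e. cnj (l2_inner M e e') * l2_inner M e (A e')) has_sum l2_inner M e' (A e')) E"
      by (rule parseval[OF e' A[OF e']])
    moreover have "cnj (l2_inner M e e') * l2_inner M e (A e') = of_real (case (e', e) of (x, y) \<Rightarrow> h (y, x))" if "e \<in> E" for e
      unfolding diag[OF that e'] h_def prod.case of_real_mult complex_norm_square by simp
    ultimately show "((\<lambda>e. of_real (case (e', e) of (x, y) \<Rightarrow> h (y, x))) has_sum l2_inner M e' (A e')) E"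
      by (simp cong: has_sum_cong)
  qed
qed

text \<open>The absolute value is constructed from its coefficients |\<mu> e| by
  \<open>synthesis\<close>, its positivity and the identity of forms being read off Parseval.
  Independence of the basis, both for the trace and for the sum of the absolute value, comes from
  \<open>diagonal_has_sum\<close>.\<close>

theorem trace_class_diagonal:
  fixes \<mu> :: "('a \<Rightarrow> complex) \<Rightarrow> real"
  assumes K: "bounded_op M K"
    and diag: "\<And>e f. e \<in> E \<Longrightarrow> f \<in> L2 M \<Longrightarrow> l2_inner M e (app_op K f) = of_real (\<mu> e) * l2_inner M e f"
    and summ: "(\<lambda>e. norm (\<mu> e)) summable_on E"
  shows "trace_class M K" "op_trace M K = of_real (infsum \<mu> E)"
proof -
  have K_L2: "app_op K f \<in> L2 M" if "f \<in> L2 M" for f using K that by (auto simp: bounded_op_def)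
  have hs: "((\<lambda>e. l2_inner M e (app_op K e)) has_sum of_real (infsum \<mu> E)) E'" if "orthonormal_basis M E'" for E'
    by (rule diagonal_has_sum[OF K_L2 diag summ that])
  show "op_trace M K = of_real (infsum \<mu> E)"
    unfolding op_trace_def
  proof (rule the_equality)
    fix t assume "\<forall>E. orthonormal_basis M E \<longrightarrow> ((\<lambda>e. l2_inner M e (app_op K e)) has_sum t) E"
    then show "t = of_real (infsum \<mu> E)" using hs[OF basis] basis has_sum_unique by blast
  qed (use hs in blast)
  define B where "B = infsum (\<lambda>e. norm (\<mu> e)) E"
  have B: "\<bar>\<mu> e\<bar> \<le> B" if "e \<in> E" for e
    using finite_sum_le_infsum[OF summ, of "{e}"] that by (simp add: B_def)
  have B0: "B \<ge> 0" unfolding B_def by (rule infsum_nonneg) auto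
  have sq_le: "(norm (of_real \<bar>\<mu> e\<bar> * x))\<^sup>2 \<le> B\<^sup>2 * (norm x)\<^sup>2" if "e \<in> E" for e and x :: complex
    unfolding norm_mult power_mult_distrib norm_of_real abs_abs
    by (rule mult_right_mono[OF power_mono[OF B[OF that] abs_ge_zero] zero_le_power2])
  have "\<exists>g. g \<in> L2 M \<and> (\<forall>e\<in>E. l2_inner M e g = of_real \<bar>\<mu> e\<bar> * l2_inner M e f)" if f: "f \<in> L2 M" for f
  proof -
    have "(\<lambda>e. (norm (of_real \<bar>\<mu> e\<bar> * l2_inner M e f))\<^sup>2) summable_on E"
      by (rule summable_on_comparison_test[OF summable_on_cmult_right[OF bessel_summable[OF f], of "B\<^sup>2"] sq_le]) auto
    from synthesis[OF this] show ?thesis by blast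
  qed
  then obtain S where S: "\<And>f. f \<in> L2 M \<Longrightarrow> S f \<in> L2 M"
      "\<And>e f. f \<in> L2 M \<Longrightarrow> e \<in> E \<Longrightarrow> l2_inner M e (S f) = of_real \<bar>\<mu> e\<bar> * l2_inner M e f"
    by metis
  have "bounded_op M (L2 M, S)"
    unfolding bounded_op_def fst_conv snd_conv
  proof (intro conjI refl ballI allI exI[of _ B])
    fix f assume f: "f \<in> L2 M"
    show "S f \<in> L2 M" by (rule S(1)[OF f])
    have "l2_sq M (S f) \<le> B\<^sup>2 * l2_sq M f"
    proof (rule has_sum_mono[OF parseval_sq[OF S(1)[OF f]] has_sum_cmult_right[OF parseval_sq[OF f]]])
      fix e assume "e \<in> E"
      then show "(norm (l2_inner M e (S f)))\<^sup>2 \<le> B\<^sup>2 * (norm (l2_inner M e f))\<^sup>2"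
        unfolding S(2)[OF f \<open>e \<in> E\<close>] by (rule sq_le)
    qed
    then have "sqrt (l2_sq M (S f)) \<le> sqrt (B\<^sup>2 * l2_sq M f)" by (rule real_sqrt_le_mono)
    then show "l2_norm M (S f) \<le> B * l2_norm M f" using B0 by (simp add: l2_norm_def real_sqrt_mult)
    fix g c d assume g: "g \<in> L2 M"
    have L: "(\<lambda>x. c * f x + d * g x) \<in> L2 M" by (rule L2_comb[OF f g])
    show "AE x in M. S (\<lambda>x. c * f x + d * g x) x = c * S f x + d * S g x"
    proof (rule eq_AE[OF S(1)[OF L] L2_comb[OF S(1)[OF f] S(1)[OF g]]])
      fix e assume e: "e \<in> E"
      show "l2_inner M e (S (\<lambda>x. c * f x + d * g x)) = l2_inner M e (\<lambda>x. c * S f x + d * S g x)"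
        unfolding S(2)[OF L e] l2_inner_comb_right[OF in_L2[OF e] f g] l2_inner_comb_right[OF in_L2[OF e] S(1)[OF f] S(1)[OF g]]
          S(2)[OF f e] S(2)[OF g e] by (simp add: algebra_simps)
    qed
  qed
  moreover have "l2_inner M f (S f) \<in> \<real>\<^sub>\<ge>\<^sub>0" if f: "f \<in> L2 M" for f
  proof -
    have eq: "cnj (l2_inner M e f) * l2_inner M e (S f) = of_real (\<bar>\<mu> e\<bar> * (norm (l2_inner M e f))\<^sup>2)" if "e \<in> E" for e
      unfolding S(2)[OF f that] of_real_mult complex_norm_square by simp
    have hs: "((\<lambda>e. complex_of_real (\<bar>\<mu> e\<bar> * (norm (l2_inner M e f))\<^sup>2)) has_sum l2_inner M f (S f)) E"
      using parseval[OF f S(1)[OF f]] eq by (simp cong: has_sum_cong del: of_real_mult)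
    have "((\<lambda>e. \<bar>\<mu> e\<bar> * (norm (l2_inner M e f))\<^sup>2) has_sum Re (l2_inner M f (S f))) E"
      using has_sum_Re[OF hs] by (simp only: Re_complex_of_real)
    then have "0 \<le> Re (l2_inner M f (S f))" by (rule has_sum_nonneg) auto
    moreover have "((\<lambda>e. 0) has_sum Im (l2_inner M f (S f))) E"
      using has_sum_Im[OF hs] by (simp only: Im_complex_of_real)
    then have "Im (l2_inner M f (S f)) = 0" by (rule has_sum_unique) (rule has_sum_0, rule refl)
    ultimately show ?thesis by (simp add: complex_nonneg_Reals_iff)
  qed
  ultimately have pos: "positive_op M (L2 M, S)" by (simp add: positive_op_def)
  have "l2_inner M (S f) (S g) = l2_inner M (app_op K f) (app_op K g)" if f: "f \<in> L2 M" and g: "g \<in> L2 M" for f g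
  proof -
    have "cnj (l2_inner M e (S f)) * l2_inner M e (S g) = cnj (l2_inner M e (app_op K f)) * l2_inner M e (app_op K g)" if "e \<in> E" for e
    proof -
      have "complex_of_real \<bar>\<mu> e\<bar> * of_real \<bar>\<mu> e\<bar> = of_real (\<mu> e) * of_real (\<mu> e)"
        by (simp flip: of_real_mult)
      then show ?thesis unfolding S(2)[OF f that] S(2)[OF g that] diag[OF that f] diag[OF that g]
        by (simp add: algebra_simps)
    qed
    then show ?thesis
      using parseval[OF S(1)[OF f] S(1)[OF g]] parseval[OF K_L2[OF f] K_L2[OF g]]
      by (auto cong: has_sum_cong dest: has_sum_unique)
  qed
  with pos have "is_absolute_value M K (L2 M, S)" by (simp add: is_absolute_value_def)
  moreover have "((\<lambda>e. l2_inner M e (S e)) has_sum of_real (infsum (\<lambda>e. \<bar>\<mu> e\<bar>) E)) E"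
    by (rule diagonal_has_sum[OF S(1) S(2) _ basis]) (use summ in auto)
  ultimately show "trace_class M K"
    unfolding trace_class_def using K basis
    by (intro conjI exI[of _ "(L2 M, S)"] exI[of _ E]) (auto simp: summable_on_def)
qed

end

section \<open>Compact symmetric operators\<close>

text \<open>The operator acts on representatives, hence is linear only up to null sets.
  \<open>C\<close> bounds the square of its norm.\<close>

locale compact_symmetric =
  fixes M :: "'a measure" and K :: "('a \<Rightarrow> complex) \<Rightarrow> ('a \<Rightarrow> complex)" and C :: real
  assumes K_L2: "\<And>f. f \<in> L2 M \<Longrightarrow> K f \<in> L2 M"
    and K_lin: "\<And>f g c d. f \<in> L2 M \<Longrightarrow> g \<in> L2 M \<Longrightarrow> AE x in M. K (\<lambda>x. c * f x + d * g x) x = c * K f x + d * K g x"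
    and K_bound: "\<And>f. f \<in> L2 M \<Longrightarrow> l2_sq M (K f) \<le> C * l2_sq M f"
    and K_sym: "\<And>f g. f \<in> L2 M \<Longrightarrow> g \<in> L2 M \<Longrightarrow> l2_inner M f (K g) = l2_inner M (K f) g"
    and K_compact: "\<And>f :: nat \<Rightarrow> 'a \<Rightarrow> complex. (\<And>n. f n \<in> L2 M) \<Longrightarrow> (\<And>n. l2_sq M (f n) \<le> 1) \<Longrightarrow>
      \<exists>s g. strict_mono (s :: nat \<Rightarrow> nat) \<and> g \<in> L2 M \<and> (\<lambda>n. l2_sq M (\<lambda>x. K (f (s n)) x - g x)) \<longlonglongrightarrow> 0"
begin

lemma K_scale:
  assumes "f \<in> L2 M" shows "AE x in M. K (\<lambda>x. c * f x) x = c * K f x"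
  using K_lin[OF assms assms, of c 0] by simp

lemma K_diff_sq:
  assumes f: "f \<in> L2 M" and g: "g \<in> L2 M"
  shows "l2_sq M (\<lambda>x. K f x - K g x) \<le> C * l2_sq M (\<lambda>x. f x - g x)"
proof -
  have L: "(\<lambda>x. 1 * f x + (-1) * g x) \<in> L2 M" by (rule L2_comb[OF f g])
  have "l2_sq M (K (\<lambda>x. 1 * f x + (-1) * g x)) = l2_sq M (\<lambda>x. 1 * K f x + (-1) * K g x)"
    by (rule l2_sq_cong_AE[OF K_L2[OF L] L2_comb[OF K_L2[OF f] K_L2[OF g]] K_lin[OF f g]])
  with K_bound[OF L] show ?thesis by simp
qed

lemma K_tendsto:
  assumes f: "\<And>n. f n \<in> L2 M" and g: "g \<in> L2 M" and lim: "(\<lambda>n. l2_sq M (\<lambda>x. f n x - g x)) \<longlonglongrightarrow> 0"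
  shows "(\<lambda>n. l2_sq M (\<lambda>x. K (f n) x - K g x)) \<longlonglongrightarrow> 0"
proof (rule Lim_null_comparison)
  show "\<forall>\<^sub>F n in sequentially. norm (l2_sq M (\<lambda>x. K (f n) x - K g x)) \<le> C * l2_sq M (\<lambda>x. f n x - g x)"
    using K_diff_sq[OF f g] by (intro always_eventually allI) simp
  show "(\<lambda>n. C * l2_sq M (\<lambda>x. f n x - g x)) \<longlonglongrightarrow> 0" using tendsto_mult[OF tendsto_const[of C] lim] by simp
qed

lemma lim_unique_AE:
  assumes f: "\<And>n. f n \<in> L2 M" and g: "g \<in> L2 M" and h: "h \<in> L2 M"
    and lim: "(\<lambda>n. l2_sq M (\<lambda>x. f n x - g x)) \<longlonglongrightarrow> 0" "(\<lambda>n. l2_sq M (\<lambda>x. f n x - h x)) \<longlonglongrightarrow> 0"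
  shows "AE x in M. g x = h x"
proof -
  have "l2_sq M (\<lambda>x. g x - h x) \<le> 2 * l2_sq M (\<lambda>x. f n x - g x) + 2 * l2_sq M (\<lambda>x. f n x - h x)" for n
    using l2_sq_triangle[OF L2_diff[OF g f[of n]] L2_diff[OF f[of n] h]] by (simp add: norm_minus_commute)
  moreover have "(\<lambda>n. 2 * l2_sq M (\<lambda>x. f n x - g x) + 2 * l2_sq M (\<lambda>x. f n x - h x)) \<longlonglongrightarrow> 2 * 0 + 2 * 0"
    by (intro tendsto_intros lim)
  ultimately have "l2_sq M (\<lambda>x. g x - h x) \<le> 2 * 0 + 2 * 0" by (intro LIMSEQ_le_const) auto
  then have "l2_sq M (\<lambda>x. g x - h x) = 0" using l2_sq_nonneg[of M "\<lambda>x. g x - h x"] by linarith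
  then show ?thesis using l2_sq_eq_0_iff[OF L2_diff[OF g h]] by simp
qed

text \<open>A maximizing sequence for \<open>K\<close> on the orthogonal complement of the eigenvectors would yield
  \<open>g \<noteq> 0\<close> there with \<open>K (K g) = S g\<close>, \<open>S > 0\<close>, so that either \<open>K g + N g\<close> with \<open>N\<^sup>2 = S\<close> or
  \<open>g\<close> itself is one more eigenvector.\<close>

theorem eigenvectors_complete:
  assumes E: "E \<subseteq> L2 M" "\<And>e. e \<in> E \<Longrightarrow> \<exists>\<mu>. AE x in M. K e x = \<mu> * e x"
    and no_more: "\<And>g c. g \<in> L2 M \<Longrightarrow> (\<And>e. e \<in> E \<Longrightarrow> l2_inner M e g = 0) \<Longrightarrow> AE x in M. K g x = c * g x
      \<Longrightarrow> AE x in M. g x = 0"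
    and f: "f \<in> L2 M" "\<And>e. e \<in> E \<Longrightarrow> l2_inner M e f = 0"
  shows "AE x in M. K f x = 0"
proof (rule ccontr)
  assume "\<not> (AE x in M. K f x = 0)"
  then have Kf: "l2_sq M (K f) \<noteq> 0" by (simp only: l2_sq_eq_0_iff[OF K_L2[OF f(1)]] not_False_eq_True)
  define H where "H = {f \<in> L2 M. \<forall>e\<in>E. l2_inner M e f = 0}"
  have H_L2: "g \<in> L2 M" if "g \<in> H" for g using that by (simp add: H_def)
  have H_comb: "(\<lambda>x. c * g x + d * h x) \<in> H" if "g \<in> H" "h \<in> H" for g h c d
  proof -
    have "l2_inner M e (\<lambda>x. c * g x + d * h x) = 0" if e: "e \<in> E" for e
      using l2_inner_comb_right[OF _ H_L2[OF \<open>g \<in> H\<close>] H_L2[OF \<open>h \<in> H\<close>], of e c d] E(1) e \<open>g \<in> H\<close> \<open>h \<in> H\<close>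
      by (auto simp: H_def)
    with L2_comb[OF H_L2[OF \<open>g \<in> H\<close>] H_L2[OF \<open>h \<in> H\<close>]] show ?thesis by (simp add: H_def)
  qed
  have H_K: "K g \<in> H" if g: "g \<in> H" for g
  proof -
    have "l2_inner M e (K g) = 0" if e: "e \<in> E" for e
    proof -
      obtain \<mu> where mu: "AE x in M. K e x = \<mu> * e x" using E(2)[OF e] by blast
      have eL: "e \<in> L2 M" using e E(1) by auto
      have "l2_inner M e (K g) = l2_inner M (K e) g" by (rule K_sym[OF eL H_L2[OF g]])
      also have "\<dots> = l2_inner M (\<lambda>x. \<mu> * e x) g"
        by (rule l2_inner_cong_AE[OF K_L2[OF eL] L2_scale[OF eL] H_L2[OF g] H_L2[OF g] mu]) simp
      also have "\<dots> = 0"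
        using l2_inner_comb_left[OF H_L2[OF g] eL eL, of \<mu> 0] g e by (simp add: H_def)
      finally show ?thesis .
    qed
    then show ?thesis using K_L2[OF H_L2[OF g]] by (simp add: H_def)
  qed
  have H_lim: "g \<in> H" if lim: "\<And>n. h n \<in> H" "g \<in> L2 M" "(\<lambda>n. l2_sq M (\<lambda>x. h n x - g x)) \<longlonglongrightarrow> 0" for h :: "nat \<Rightarrow> 'a \<Rightarrow> complex" and g
  proof -
    have "l2_inner M e g = 0" if e: "e \<in> E" for e
    proof (rule LIMSEQ_unique)
      show "(\<lambda>n. l2_inner M e (h n)) \<longlonglongrightarrow> l2_inner M e g"
        using E(1) e H_L2[OF lim(1)] by (intro l2_inner_tendsto lim(2,3)) auto
      show "(\<lambda>n. l2_inner M e (h n)) \<longlonglongrightarrow> 0" using \<open>\<And>n. h n \<in> H\<close> e by (simp add: H_def)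
    qed
    with lim(2) show ?thesis by (simp add: H_def)
  qed
  have fH: "f \<in> H" using f by (simp add: H_def)
  have C0: "C \<ge> 0"
  proof (rule ccontr)
    assume "\<not> C \<ge> 0"
    then have "C * l2_sq M f \<le> 0" by (simp add: mult_nonpos_nonneg)
    with K_bound[OF f(1)] Kf l2_sq_nonneg[of M "K f"] show False by linarith
  qed
  \<comment> \<open>\<open>S\<close> is the squared norm of \<open>K\<close> on \<open>H\<close>,
    the orthogonal complement of the given eigenvectors, which \<open>K\<close> leaves
    invariant.\<close>
  let ?Q = "(\<lambda>g. l2_sq M (K g)) ` {g \<in> H. l2_sq M g \<le> 1}"
  define S where "S = Sup ?Q"
  have bdd: "bdd_above ?Q"
  proof (rule bdd_aboveI2[where M=C])
    fix g assume "g \<in> {g \<in> H. l2_sq M g \<le> 1}"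
    then show "l2_sq M (K g) \<le> C" using K_bound[OF H_L2, of g] C0 mult_left_mono[of "l2_sq M g" 1 C] by simp
  qed
  have S_ge1: "l2_sq M (K g) \<le> S" if "g \<in> H" "l2_sq M g \<le> 1" for g
    unfolding S_def by (rule cSUP_upper[OF _ bdd]) (use that in simp)
  have S_ge: "l2_sq M (K g) \<le> S * l2_sq M g" if g: "g \<in> H" for g
  proof (cases "l2_sq M g = 0")
    case True
    then show ?thesis using K_bound[OF H_L2[OF g]] by simp
  next
    case False
    define t where "t = l2_sq M g"
    have t: "t > 0" using False l2_sq_nonneg[of M g] unfolding t_def by linarith
    define c where "c = complex_of_real (1 / sqrt t)"
    have c: "(norm c)\<^sup>2 = 1 / t" using t by (simp add: c_def norm_divide power_divide)
    have sc: "l2_sq M (\<lambda>x. c * h x) = l2_sq M h / t" for h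
      by (simp add: norm_mult power_mult_distrib c)
    have "(\<lambda>x. c * g x) \<in> H" using H_comb[OF g g, of c 0] by simp
    moreover have "l2_sq M (\<lambda>x. c * g x) \<le> 1" unfolding sc using t by (simp add: t_def)
    ultimately have "l2_sq M (K (\<lambda>x. c * g x)) \<le> S" by (rule S_ge1)
    moreover have "l2_sq M (K (\<lambda>x. c * g x)) = l2_sq M (K g) / t"
      unfolding sc[symmetric]
      by (rule l2_sq_cong_AE[OF K_L2[OF L2_scale] L2_scale[OF K_L2] K_scale]) (rule H_L2[OF g])+
    ultimately show ?thesis using t unfolding t_def by (simp add: field_simps)
  qed
  have S: "S > 0"
  proof (rule ccontr)
    assume "\<not> S > 0"
    then have "S * l2_sq M f \<le> 0" by (simp add: mult_nonpos_nonneg)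
    with S_ge[OF fH] Kf l2_sq_nonneg[of M "K f"] show False by linarith
  qed
  have "\<exists>g. g \<in> H \<and> l2_sq M g \<le> 1 \<and> S - 1 / real (Suc n) < l2_sq M (K g)" for n
  proof -
    have ne: "?Q \<noteq> {}" using H_comb[OF fH fH, of 0 0] by (auto intro!: exI[of _ "\<lambda>_. 0"])
    have "S - 1 / real (Suc n) < S" by simp
    then show ?thesis unfolding S_def less_cSup_iff[OF ne bdd] by auto
  qed
  then obtain h where h: "\<And>n. h n \<in> H" "\<And>n. l2_sq M (h n) \<le> 1" "\<And>n. S - 1 / real (Suc n) < l2_sq M (K (h n))"
    by metis
  obtain s g where s: "strict_mono (s :: nat \<Rightarrow> nat)" and g: "g \<in> L2 M"
    and lim: "(\<lambda>n. l2_sq M (\<lambda>x. K (h (s n)) x - g x)) \<longlonglongrightarrow> 0"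
    using K_compact[of h, OF H_L2[OF h(1)] h(2)] by (elim exE conjE)
  define w where "w n = h (s n)" for n
  have w: "w n \<in> H" "l2_sq M (w n) \<le> 1" "S - 1 / real (Suc n) < l2_sq M (K (w n))" for n
  proof -
    have "1 / real (Suc (s n)) \<le> 1 / real (Suc n)" using seq_suble[OF s, of n] by (intro divide_left_mono) auto
    then show "S - 1 / real (Suc n) < l2_sq M (K (w n))" using h(3)[of "s n"] unfolding w_def by linarith
  qed (simp_all add: w_def h)
  note wL = H_L2[OF w(1)] note KwL = K_L2[OF wL] note KKwL = K_L2[OF KwL]
  have limK: "(\<lambda>n. l2_sq M (\<lambda>x. K (w n) x - g x)) \<longlonglongrightarrow> 0" using lim by (simp add: w_def)
  have gH: "g \<in> H" by (rule H_lim[OF H_K[OF w(1)] g limK])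
  have KgL: "K g \<in> L2 M" and KKgL: "K (K g) \<in> L2 M" using K_L2 g by auto
  \<comment> \<open>Expanding the square and using |K K w|^2 \<le> S |K w|^2 and |w| \<le> 1 leaves
    S (S - |K w|^2). Along a maximizing sequence this is small, so \<open>w n\<close> is almost an
    eigenvector of the square of \<open>K\<close>.\<close>
  have defect: "l2_sq M (\<lambda>x. K (K (w n)) x - of_real S * w n x) \<le> S * (1 / real (Suc n))" for n
  proof -
    have Kw: "l2_inner M (K (K (w n))) (w n) = of_real (l2_sq M (K (w n)))"
      unfolding K_sym[OF KwL wL, symmetric] l2_inner_self_eq ..
    then have wK: "l2_inner M (w n) (K (K (w n))) = of_real (l2_sq M (K (w n)))"
      unfolding l2_inner_cnj[of M "K (K (w n))", symmetric] by (simp only: complex_cnj_complex_of_real)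
    have "complex_of_real (l2_sq M (\<lambda>x. K (K (w n)) x + (- of_real S) * w n x))
        = of_real (l2_sq M (K (K (w n))) - 2 * S * l2_sq M (K (w n)) + S * S * l2_sq M (w n))"
      by (subst l2_sq_comb_expand[OF KKwL wL]) (simp add: Kw wK algebra_simps)
    then have "l2_sq M (\<lambda>x. K (K (w n)) x + (- of_real S) * w n x)
        = l2_sq M (K (K (w n))) - 2 * S * l2_sq M (K (w n)) + S * S * l2_sq M (w n)"
      by (simp only: of_real_eq_iff)
    also have "\<dots> \<le> S * l2_sq M (K (w n)) - 2 * S * l2_sq M (K (w n)) + S * S * 1"
      using S_ge[OF H_K[OF w(1)[of n]]] mult_left_mono[OF w(2)[of n], of "S * S"] by simp
    also have "\<dots> = S * (S - l2_sq M (K (w n)))" by (simp add: algebra_simps)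
    also have "\<dots> \<le> S * (1 / real (Suc n))" using w(3)[of n] S by (intro mult_left_mono) auto
    finally show ?thesis by simp
  qed
  have lim_def: "(\<lambda>n. l2_sq M (\<lambda>x. of_real S * w n x - K (K (w n)) x)) \<longlonglongrightarrow> 0"
  proof (rule Lim_null_comparison)
    show "\<forall>\<^sub>F n in sequentially. norm (l2_sq M (\<lambda>x. of_real S * w n x - K (K (w n)) x)) \<le> S * (1 / real (Suc n))"
      using defect by (intro always_eventually allI) (simp add: norm_minus_commute)
    show "(\<lambda>n. S * (1 / real (Suc n))) \<longlonglongrightarrow> 0"
      using tendsto_mult[OF tendsto_const[of S] LIMSEQ_inverse_real_of_nat] by (simp add: inverse_eq_divide)
  qed
  \<comment> \<open>K (K (w n)) tends to K g and is close to S * w n, so S * w n tends to K g.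
    Applying \<open>K\<close> once more compares K (K g) with S * g.\<close>
  have lim_Sw: "(\<lambda>n. l2_sq M (\<lambda>x. of_real S * w n x - K g x)) \<longlonglongrightarrow> 0"
  proof (rule Lim_null_comparison)
    show "\<forall>\<^sub>F n in sequentially. norm (l2_sq M (\<lambda>x. of_real S * w n x - K g x))
        \<le> 2 * l2_sq M (\<lambda>x. of_real S * w n x - K (K (w n)) x) + 2 * l2_sq M (\<lambda>x. K (K (w n)) x - K g x)"
    proof (intro always_eventually allI)
      fix n
      show "norm (l2_sq M (\<lambda>x. of_real S * w n x - K g x))
        \<le> 2 * l2_sq M (\<lambda>x. of_real S * w n x - K (K (w n)) x) + 2 * l2_sq M (\<lambda>x. K (K (w n)) x - K g x)"
        using l2_sq_triangle[OF L2_diff[OF L2_scale[OF wL[of n], of "of_real S"] KKwL[of n]] L2_diff[OF KKwL[of n] KgL]] by simp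
    qed
    have "(\<lambda>n. 2 * l2_sq M (\<lambda>x. of_real S * w n x - K (K (w n)) x) + 2 * l2_sq M (\<lambda>x. K (K (w n)) x - K g x)) \<longlonglongrightarrow> 2 * 0 + 2 * 0"
      by (intro tendsto_intros lim_def K_tendsto KwL g limK)
    then show "(\<lambda>n. 2 * l2_sq M (\<lambda>x. of_real S * w n x - K (K (w n)) x) + 2 * l2_sq M (\<lambda>x. K (K (w n)) x - K g x)) \<longlonglongrightarrow> 0"
      by simp
  qed
  have KKg: "AE x in M. K (K g) x = of_real S * g x"
  proof (rule lim_unique_AE)
    show "K (\<lambda>x. of_real S * w n x) \<in> L2 M" for n by (intro K_L2 L2_scale wL)
    show "(\<lambda>n. l2_sq M (\<lambda>x. K (\<lambda>x. of_real S * w n x) x - K (K g) x)) \<longlonglongrightarrow> 0"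
      by (rule K_tendsto[OF L2_scale[OF wL] KgL lim_Sw])
    have "l2_sq M (\<lambda>x. K (\<lambda>x. of_real S * w n x) x - of_real S * g x) = S\<^sup>2 * l2_sq M (\<lambda>x. K (w n) x - g x)" for n
    proof -
      have "l2_sq M (\<lambda>x. K (\<lambda>x. of_real S * w n x) x - of_real S * g x) = l2_sq M (\<lambda>x. of_real S * (K (w n) x - g x))"
        using K_scale[OF wL[of n], of "of_real S"]
        by (intro l2_sq_cong_AE L2_diff K_L2 L2_scale wL g) (auto simp: algebra_simps)
      then show ?thesis by (simp add: norm_mult power_mult_distrib)
    qed
    then show "(\<lambda>n. l2_sq M (\<lambda>x. K (\<lambda>x. of_real S * w n x) x - of_real S * g x)) \<longlonglongrightarrow> 0"
      using tendsto_mult[OF tendsto_const[of "S\<^sup>2"] limK] by simp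
  qed (use KKgL L2_scale[OF g] in auto)
  define N where "N = complex_of_real (sqrt S)"
  have N: "N * N = of_real S" using S by (simp add: N_def flip: of_real_mult)
  \<comment> \<open>Since (K - N) (K + N) g = 0, the vector K g + N g is an eigenvector for N
    orthogonal to \<open>E\<close>, hence zero. This in turn makes g an eigenvector for - N.\<close>
  have kw: "AE x in M. 1 * K g x + N * g x = 0"
  proof (rule no_more[where c=N])
    show "(\<lambda>x. 1 * K g x + N * g x) \<in> L2 M" by (rule L2_comb[OF KgL g])
    show "l2_inner M e (\<lambda>x. 1 * K g x + N * g x) = 0" if "e \<in> E" for e
      using H_comb[OF H_K[OF gH] gH, of 1 N] that by (simp add: H_def)
    show "AE x in M. K (\<lambda>x. 1 * K g x + N * g x) x = N * (1 * K g x + N * g x)"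
      using K_lin[OF KgL g, of 1 N] KKg
    proof eventually_elim
      case (elim x)
      show ?case unfolding elim N[symmetric] by (simp add: algebra_simps)
    qed
  qed
  have "AE x in M. g x = 0"
  proof (rule no_more[where c="- N"])
    show "l2_inner M e g = 0" if "e \<in> E" for e using gH that by (simp add: H_def)
    show "AE x in M. K g x = - N * g x" using kw by eventually_elim (simp add: eq_neg_iff_add_eq_0)
  qed (rule g)
  then have "l2_sq M g = 0" using l2_sq_eq_0_iff[OF g] by simp
  \<comment> \<open>The maximal norm survives the limit, so g cannot be zero.\<close>
  moreover have "S \<le> l2_sq M g"
  proof (rule LIMSEQ_le)
    show "(\<lambda>n. l2_sq M (K (w n))) \<longlonglongrightarrow> l2_sq M g" by (rule l2_sq_tendsto[OF KwL g limK])
    have "(\<lambda>n. S - 1 / real (Suc n)) \<longlonglongrightarrow> S - 0"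
      using LIMSEQ_inverse_real_of_nat by (intro tendsto_intros) (simp add: inverse_eq_divide)
    then show "(\<lambda>n. S - 1 / real (Suc n)) \<longlonglongrightarrow> S" by simp
    show "\<exists>k. \<forall>n\<ge>k. S - 1 / real (Suc n) \<le> l2_sq M (K (w n))" using less_imp_le[OF w(3)] by blast
  qed
  ultimately show False using S by simp
qed

end

section \<open>The Sturm--Liouville operator\<close>

lemma borel_measurable_lebesgue_on_AE:
  fixes f g :: "'a::euclidean_space \<Rightarrow> 'b::euclidean_space"
  assumes f: "f \<in> borel_measurable (lebesgue_on S)" and S: "S \<in> sets lebesgue"
    and ae: "AE x in lebesgue_on S. f x = g x"
  shows "g \<in> borel_measurable (lebesgue_on S)"
proof -
  have "AE x in lebesgue. (if x \<in> S then f x else 0) = (if x \<in> S then g x else 0)"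
    using ae S by (simp add: AE_restrict_space_iff)
  from borel_measurable_AE[OF _ this] show ?thesis
    using borel_measurable_if[OF S, of f] borel_measurable_if[OF S, of g] f by blast
qed

lemma continuous_AE_zero_imp_zero:
  fixes k :: "real \<Rightarrow> 'b::euclidean_space"
  assumes ab: "a < b" and c: "continuous_on {a..b} k"
    and ae: "AE x in lebesgue_on {a<..<b}. k x = 0" and x: "x \<in> {a..b}"
  shows "k x = 0"
proof -
  have "negligible {x \<in> {a<..<b}. k x \<noteq> 0}"
    using ae AE_lebesgue_on_iff_negligible[of "{a<..<b}" "\<lambda>x. k x = 0"] by simp
  moreover have "open {x \<in> {a<..<b}. k x \<noteq> 0}"
  proof -
    have "open ({a<..<b} \<inter> k -` (- {0}))"
      using c by (intro continuous_open_preimage) (auto intro: continuous_on_subset)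
    moreover have "{a<..<b} \<inter> k -` (- {0}) = {x \<in> {a<..<b}. k x \<noteq> 0}" by auto
    ultimately show ?thesis by simp
  qed
  ultimately have "{x \<in> {a<..<b}. k x \<noteq> 0} = {}"
    using open_not_negligible by blast
  then have "k y = 0" if "y \<in> {a<..<b}" for y using that by blast
  moreover have "closure {a<..<b} = {a..b}" using ab by simp
  ultimately show ?thesis
    using continuous_constant_on_closure[of "{a<..<b}" k 0 x] c x by simp
qed

lemma integrable_lebesgue_on_Ioo_iff:
  fixes f :: "real \<Rightarrow> 'b::euclidean_space"
  shows "integrable (lebesgue_on {a<..<b}) f \<longleftrightarrow> f absolutely_integrable_on {a..b}"
  using absolutely_integrable_on_open_interval[of a b f]
  by (simp add: integrable_restrict_space set_integrable_def)

lemma integral_lebesgue_on_Ioo: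
  fixes f :: "real \<Rightarrow> 'b::euclidean_space"
  assumes "f absolutely_integrable_on {a..b}"
  shows "(LINT x|lebesgue_on {a<..<b}. f x) = integral {a..b} f"
proof -
  have "f absolutely_integrable_on {a<..<b}"
    using assms absolutely_integrable_on_open_interval[of a b f] by simp
  from set_lebesgue_integral_eq_integral(2)[OF this] show ?thesis
    by (simp add: integral_restrict_space set_lebesgue_integral_def integral_open_interval_real)
qed

text \<open>The two boundary conditions become two linear forms in the four boundary values of a
  function and its quasi-derivative. Separated and coupled conditions are thereby treated alike
  wherever linearity is all that counts.\<close>

fun bform1 :: "sl_bc \<Rightarrow> complex \<Rightarrow> complex \<Rightarrow> complex \<Rightarrow> complex \<Rightarrow> complex" where
  "bform1 (Separated \<alpha> \<beta>) ua va ub vb = ua * of_real (cos \<alpha>) + va * of_real (sin \<alpha>)"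
| "bform1 (Coupled \<phi> R) ua va ub vb =
     ub - exp (\<i> * of_real \<phi>) * (of_real (R$1$1) * ua + of_real (R$1$2) * va)"

fun bform2 :: "sl_bc \<Rightarrow> complex \<Rightarrow> complex \<Rightarrow> complex \<Rightarrow> complex \<Rightarrow> complex" where
  "bform2 (Separated \<alpha> \<beta>) ua va ub vb = ub * of_real (cos \<beta>) - vb * of_real (sin \<beta>)"
| "bform2 (Coupled \<phi> R) ua va ub vb =
     vb - exp (\<i> * of_real \<phi>) * (of_real (R$2$1) * ua + of_real (R$2$2) * va)"

lemma sl_bc_holds_iff:
  "sl_bc_holds a b p bc g \<longleftrightarrow> bform1 bc (g a) (quasi_deriv a b p g a) (g b) (quasi_deriv a b p g b) = 0 \<and>
     bform2 bc (g a) (quasi_deriv a b p g a) (g b) (quasi_deriv a b p g b) = 0"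
  by (cases bc) auto

lemma bform_linear:
  "bform1 bc (c * ua + d * ua') (c * va + d * va') (c * ub + d * ub') (c * vb + d * vb') =
     c * bform1 bc ua va ub vb + d * bform1 bc ua' va' ub' vb'"
  "bform2 bc (c * ua + d * ua') (c * va + d * va') (c * ub + d * ub') (c * vb + d * vb') =
     c * bform2 bc ua va ub vb + d * bform2 bc ua' va' ub' vb'"
  by (cases bc; simp add: algebra_simps)+

text \<open>As c and s are real, the conjugated pair satisfies the same relation, and two vectors in
  the kernel of one nonzero row are linearly dependent.\<close>

lemma real_combination_zero_imp_wronskian_zero:
  fixes u v w y :: complex and c s :: real
  assumes "u * of_real c + v * of_real s = 0" "w * of_real c + y * of_real s = 0" "c\<^sup>2 + s\<^sup>2 = 1"
  shows "cnj u * y - cnj v * w = 0"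
proof -
  have 1: "cnj u * of_real c + cnj v * of_real s = 0"
    using arg_cong[OF assms(1), of cnj] by simp
  have "of_real c * (cnj u * y - cnj v * w) = y * (cnj u * of_real c + cnj v * of_real s) - cnj v * (w * of_real c + y * of_real s)"
    by (simp add: algebra_simps)
  then have 2: "of_real c * (cnj u * y - cnj v * w) = 0" using 1 assms(2) by simp
  have "of_real s * (cnj u * y - cnj v * w) = cnj u * (w * of_real c + y * of_real s) - w * (cnj u * of_real c + cnj v * of_real s)"
    by (simp add: algebra_simps)
  then have 3: "of_real s * (cnj u * y - cnj v * w) = 0" using 1 assms(2) by simp
  have "c \<noteq> 0 \<or> s \<noteq> 0" using assms(3) by auto
  then show ?thesis using 2 3 by auto
qed

text \<open>Separated conditions annihilate the Wronskian at either end. Coupled conditions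
  transport the data by a real matrix of determinant 1, which preserves the Wronskian, and by a
  phase, which cancels against its conjugate.\<close>

lemma bform_symmetric:
  assumes adm: "sl_bc_admissible bc"
    and u: "bform1 bc ua va ub vb = 0" "bform2 bc ua va ub vb = 0"
    and w: "bform1 bc wa ya wb yb = 0" "bform2 bc wa ya wb yb = 0"
  shows "cnj ub * yb - cnj vb * wb = cnj ua * ya - cnj va * wa"
proof (cases bc)
  case (Separated \<alpha> \<beta>)
  have "cnj ua * ya - cnj va * wa = 0"
    by (rule real_combination_zero_imp_wronskian_zero[of _ "cos \<alpha>" _ "sin \<alpha>"])
      (use u w Separated in auto)
  moreover have "cnj ub * yb - cnj vb * wb = 0"
    by (rule real_combination_zero_imp_wronskian_zero[of _ "cos \<beta>" _ "- sin \<beta>"])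
      (use u w Separated in auto)
  ultimately show ?thesis by simp
next
  case (Coupled \<phi> R)
  let ?e = "exp (\<i> * of_real \<phi>)"
  have e: "cnj ?e * ?e = 1"
    by (simp add: exp_cnj flip: exp_add)
  have det: "of_real (R$1$1) * of_real (R$2$2) - of_real (R$1$2) * of_real (R$2$1) = (1::complex)"
    using adm Coupled by (simp add: det_2 flip: of_real_mult of_real_diff)
  define r1 where "r1 = complex_of_real (R$1$1)"
  define r2 where "r2 = complex_of_real (R$1$2)"
  define r3 where "r3 = complex_of_real (R$2$1)"
  define r4 where "r4 = complex_of_real (R$2$2)"
  note defs = r1_def[symmetric] r2_def[symmetric] r3_def[symmetric] r4_def[symmetric]
  have c: "cnj r1 = r1" "cnj r2 = r2" "cnj r3 = r3" "cnj r4 = r4" by (simp_all add: r1_def r2_def r3_def r4_def)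
  have eqs: "ub = ?e * (r1 * ua + r2 * va)" "vb = ?e * (r3 * ua + r4 * va)"
    "wb = ?e * (r1 * wa + r2 * ya)" "yb = ?e * (r3 * wa + r4 * ya)"
    using u w Coupled by (simp_all add: defs)
  have "cnj ub * yb - cnj vb * wb = (cnj ?e * ?e) *
     ((r1 * cnj ua + r2 * cnj va) * (r3 * wa + r4 * ya) - (r3 * cnj ua + r4 * cnj va) * (r1 * wa + r2 * ya))"
    unfolding eqs complex_cnj_mult complex_cnj_add c by (simp only: algebra_simps)
  also have "\<dots> = (r1 * r4 - r2 * r3) * (cnj ua * ya - cnj va * wa)"
    unfolding e by (simp add: algebra_simps)
  also have "\<dots> = cnj ua * ya - cnj va * wa"
    using det unfolding defs by simp
  finally show ?thesis .
qed

locale sturm_liouville =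
  fixes a b :: real and p q r :: "real \<Rightarrow> real" and bc :: sl_bc
  assumes ab: "a < b"
    and r_meas: "r \<in> borel_measurable (lebesgue_on {a<..<b})"
    and r_pos: "AE x in lebesgue_on {a<..<b}. r x > 0"
    and r_int: "integrable (lebesgue_on {a<..<b}) r"
    and p_pos: "AE x in lebesgue_on {a<..<b}. p x > 0"
    and p_int: "integrable (lebesgue_on {a<..<b}) (\<lambda>x. 1 / p x)"
    and q_int: "integrable (lebesgue_on {a<..<b}) q"
    and adm: "sl_bc_admissible bc"
begin

abbreviation "\<Lambda> \<equiv> lebesgue_on {a<..<b}"
abbreviation "M \<equiv> sl_measure a b r"
abbreviation "T \<equiv> sl_op a b p q r bc"
abbreviation "qd \<equiv> quasi_deriv a b p"

definition "\<alpha> t = complex_of_real (1 / p t)"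
definition "\<beta> z t = complex_of_real (q t) - z * of_real (r t)"
text \<open>Integral form of tau u = z u + f with v as quasi-derivative. Prescribing the value 0
  outside [a,b] makes solutions with the same initial data equal as functions.\<close>

definition "sys z f u v \<longleftrightarrow> lin_sys a b \<alpha> (\<beta> z) (\<lambda>t. - (of_real (r t) * f t)) u v \<and>
   (\<forall>x. x \<notin> {a..b} \<longrightarrow> u x = 0 \<and> v x = 0)"

lemma ab': "a \<le> b" using ab by simp

lemma of_real_abs_int:
  "integrable \<Lambda> f \<Longrightarrow> (\<lambda>t. complex_of_real (f t)) absolutely_integrable_on {a..b}"
  using integrable_of_real by (subst integrable_lebesgue_on_Ioo_iff[symmetric]) blast

lemma abs_int:
  "\<alpha> absolutely_integrable_on {a..b}" "\<beta> z absolutely_integrable_on {a..b}"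
  "(\<lambda>t. complex_of_real (r t)) absolutely_integrable_on {a..b}"
  "(\<lambda>t. complex_of_real (q t)) absolutely_integrable_on {a..b}"
proof -
  show "\<alpha> absolutely_integrable_on {a..b}"
    using of_real_abs_int[OF p_int] by (simp add: \<alpha>_def[abs_def])
  show r: "(\<lambda>t. complex_of_real (r t)) absolutely_integrable_on {a..b}" and
    q: "(\<lambda>t. complex_of_real (q t)) absolutely_integrable_on {a..b}"
    using of_real_abs_int r_int q_int by auto
  have "(\<lambda>t. z * of_real (r t)) absolutely_integrable_on {a..b}"
    using absolutely_integrable_linear[OF r bounded_linear_mult_right[of z]] by (simp add: comp_def)
  from set_integral_diff(1)[OF q this] show "\<beta> z absolutely_integrable_on {a..b}"
    by (simp add: \<beta>_def[abs_def])
qed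

lemma quasi_deriv_unique:
  assumes "is_quasi_deriv a b p g h1" "is_quasi_deriv a b p g h2"
  shows "h1 = h2"
proof
  fix x
  have c: "continuous_on {a..b} (\<lambda>x. h1 x - h2 x)"
    using assms abs_cont_continuous_on unfolding is_quasi_deriv_def AC_on_eq_abs_cont
    by (intro continuous_on_diff) blast+
  have "AE x in \<Lambda>. h1 x = of_real (p x) * vector_derivative g (at x)"
    "AE x in \<Lambda>. h2 x = of_real (p x) * vector_derivative g (at x)"
    using assms unfolding is_quasi_deriv_def by blast+
  then have "AE x in \<Lambda>. h1 x - h2 x = 0" by eventually_elim simp
  from continuous_AE_zero_imp_zero[OF ab c this, of x] show "h1 x = h2 x"
    using assms unfolding is_quasi_deriv_def by (cases "x \<in> {a..b}") auto
qed

lemma quasi_derivI: "is_quasi_deriv a b p g h \<Longrightarrow> qd g = h"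
  unfolding quasi_deriv_def using quasi_deriv_unique by (intro the_equality) blast+

lemma sysD:
  assumes "sys z f u v"
  shows "u \<in> sl_regular a b p" "qd u = v" "AE x in \<Lambda>. sl_tau a b p q r u x = z * u x + f x"
    "continuous_on {a..b} u" "continuous_on {a..b} v"
    "indef_int a b u (\<lambda>t. \<alpha> t * v t)"
    "indef_int a b v (\<lambda>t. \<beta> z t * u t - of_real (r t) * f t)"
    "\<And>x. x \<notin> {a..b} \<Longrightarrow> u x = 0" "\<And>x. x \<notin> {a..b} \<Longrightarrow> v x = 0"
proof -
  have l: "lin_sys a b \<alpha> (\<beta> z) (\<lambda>t. - (of_real (r t) * f t)) u v" and
    z: "\<And>x. x \<notin> {a..b} \<Longrightarrow> u x = 0 \<and> v x = 0"
    using assms by (auto simp: sys_def)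
  show iu: "indef_int a b u (\<lambda>t. \<alpha> t * v t)" and iv: "indef_int a b v (\<lambda>t. \<beta> z t * u t - of_real (r t) * f t)"
    and "continuous_on {a..b} u" "continuous_on {a..b} v"
    using lin_sysD[OF l] by simp_all
  show z1: "\<And>x. x \<notin> {a..b} \<Longrightarrow> u x = 0" and z2: "\<And>x. x \<notin> {a..b} \<Longrightarrow> v x = 0" using z by auto
  have qdu: "is_quasi_deriv a b p u v"
    unfolding is_quasi_deriv_def AC_on_eq_abs_cont
  proof (intro conjI)
    show "AE x in \<Lambda>. v x = of_real (p x) * vector_derivative u (at x)"
      using indef_int_AE_deriv[OF iu] p_pos
    proof eventually_elim
      case (elim x)
      then show ?case using vector_derivative_at[OF elim(1)] by (simp add: \<alpha>_def)
    qed
  qed (use indef_int_imp_abs_cont[OF iv ab'] z2 in auto)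
  show "qd u = v" by (rule quasi_derivI[OF qdu])
  show "u \<in> sl_regular a b p"
    using qdu indef_int_imp_abs_cont[OF iu ab'] z1 unfolding sl_regular_def AC_on_eq_abs_cont by blast
  show "AE x in \<Lambda>. sl_tau a b p q r u x = z * u x + f x"
    using indef_int_AE_deriv[OF iv] r_pos
  proof eventually_elim
    case (elim x)
    then show ?case
      using vector_derivative_at[OF elim(1)] unfolding sl_tau_def \<open>qd u = v\<close>
      by (simp add: \<beta>_def field_simps)
  qed
qed

text \<open>Converse to \<open>sysD\<close>. Division by p and multiplication by r, both positive
  almost everywhere, turn the pointwise identities into the integrands of the first-order
  system.\<close>

lemma sysI:
  assumes g: "g \<in> sl_regular a b p" and t: "AE x in \<Lambda>. sl_tau a b p q r g x = z * g x + f x"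
  shows "sys z f g (qd g)"
proof -
  obtain h where h: "is_quasi_deriv a b p g h" and acg: "abs_cont a b g" and g0: "\<And>x. x \<notin> {a..b} \<Longrightarrow> g x = 0"
    using g unfolding sl_regular_def AC_on_eq_abs_cont by blast
  have qh: "qd g = h" by (rule quasi_derivI[OF h])
  have ach: "abs_cont a b h" and h0: "\<And>x. x \<notin> {a..b} \<Longrightarrow> h x = 0"
    and hg: "AE x in \<Lambda>. h x = of_real (p x) * vector_derivative g (at x)"
    using h unfolding is_quasi_deriv_def AC_on_eq_abs_cont by blast+
  obtain k where k: "indef_int a b g k" using abs_cont_imp_indef_int[OF acg ab'] ..
  obtain l where l: "indef_int a b h l" using abs_cont_imp_indef_int[OF ach ab'] ..
  have "indef_int a b g (\<lambda>t. \<alpha> t * h t)"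
  proof (rule indef_int_cong_AE[OF k])
    show "AE x in \<Lambda>. k x = \<alpha> x * h x"
      using indef_int_AE_deriv[OF k] p_pos hg
    proof eventually_elim
      case (elim x)
      then show ?case using vector_derivative_at[OF elim(1)] by (simp add: \<alpha>_def)
    qed
  qed
  moreover have "indef_int a b h (\<lambda>t. \<beta> z t * g t + - (of_real (r t) * f t))"
  proof (rule indef_int_cong_AE[OF l])
    show "AE x in \<Lambda>. l x = \<beta> z x * g x + - (of_real (r x) * f x)"
      using indef_int_AE_deriv[OF l] r_pos t
    proof eventually_elim
      case (elim x)
      have "complex_of_real (r x) \<noteq> 0" using elim(2) by simp
      then have "- l x + of_real (q x) * g x = of_real (r x) * (z * g x + f x)"
        using elim(3) vector_derivative_at[OF elim(1)] unfolding sl_tau_def qh by (simp add: field_simps)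
      then show ?case by (simp add: \<beta>_def algebra_simps)
    qed
  qed
  ultimately show ?thesis
    unfolding sys_def lin_sys_def qh using g0 h0 by blast
qed

lemma sys_exists:
  assumes "(\<lambda>t. of_real (r t) * f t) absolutely_integrable_on {a..b}"
  shows "\<exists>u v. sys z f u v \<and> u a = c \<and> v a = d"
proof -
  have "(\<lambda>t. - (of_real (r t) * f t)) absolutely_integrable_on {a..b}"
    using absolutely_integrable_linear[OF assms bounded_linear_minus[OF bounded_linear_ident]] by (simp add: comp_def)
  from lin_sys_exists[OF ab' abs_int(1,2) this] obtain u v where
    uv: "lin_sys a b \<alpha> (\<beta> z) (\<lambda>t. - (of_real (r t) * f t)) u v" "u a = c" "v a = d" by blast
  define u' where "u' = (\<lambda>x. if x \<in> {a..b} then u x else 0)"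
  define v' where "v' = (\<lambda>x. if x \<in> {a..b} then v x else 0)"
  have "indef_int a b u' (\<lambda>t. \<alpha> t * v' t)"
  proof (rule indef_int_cong_AE[OF indef_int_cong[OF lin_sysD(1)[OF uv(1)] _ ab']])
    show "AE x in \<Lambda>. \<alpha> x * v x = \<alpha> x * v' x" by (simp add: AE_restrict_space_iff v'_def)
  qed (simp add: u'_def)
  moreover have "indef_int a b v' (\<lambda>t. \<beta> z t * u' t + - (of_real (r t) * f t))"
  proof (rule indef_int_cong_AE[OF indef_int_cong[OF lin_sysD(2)[OF uv(1)] _ ab']])
    show "AE x in \<Lambda>. \<beta> z x * u x + - (of_real (r x) * f x) = \<beta> z x * u' x + - (of_real (r x) * f x)"
      by (simp add: AE_restrict_space_iff u'_def)
  qed (simp add: v'_def)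
  ultimately have "sys z f u' v'" unfolding sys_def lin_sys_def by (auto simp: u'_def v'_def)
  moreover have "u' a = c" "v' a = d" using uv ab' by (auto simp: u'_def v'_def)
  ultimately show ?thesis by blast
qed

lemma sys_combination:
  assumes "sys z f u v" "sys z g w y"
  shows "sys z (\<lambda>t. c * f t + d * g t) (\<lambda>t. c * u t + d * w t) (\<lambda>t. c * v t + d * y t)"
proof -
  have eq: "(\<lambda>t. c * - (of_real (r t) * f t) + d * - (of_real (r t) * g t)) =
     (\<lambda>t. - (of_real (r t) * (c * f t + d * g t)))" by (simp add: algebra_simps fun_eq_iff)
  have l: "lin_sys a b \<alpha> (\<beta> z) (\<lambda>t. - (of_real (r t) * f t)) u v"
    "lin_sys a b \<alpha> (\<beta> z) (\<lambda>t. - (of_real (r t) * g t)) w y"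
    using assms by (simp_all add: sys_def)
  have "lin_sys a b \<alpha> (\<beta> z) (\<lambda>t. - (of_real (r t) * (c * f t + d * g t)))
      (\<lambda>t. c * u t + d * w t) (\<lambda>t. c * v t + d * y t)"
    using lin_sys_combination[OF l, of c d] unfolding eq .
  then show ?thesis using assms unfolding sys_def by simp
qed

lemma sys_unique:
  assumes "sys z f u v" "sys z f w y" "u a = w a" "v a = y a"
  shows "u = w" "v = y"
proof -
  have *: "lin_sys a b \<alpha> (\<beta> z) (\<lambda>t. - (of_real (r t) * f t)) u v" "lin_sys a b \<alpha> (\<beta> z) (\<lambda>t. - (of_real (r t) * f t)) w y"
    using assms by (auto simp: sys_def)
  have "u x = w x \<and> v x = y x" for x
    using lin_sys_unique[OF * ab' abs_int(1,2) assms(3,4), of x] sysD(8,9)[OF assms(1), of x] sysD(8,9)[OF assms(2), of x]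
    by (cases "x \<in> {a..b}") auto
  then show "u = w" "v = y" by auto
qed

text \<open>A change of the spectral parameter is moved into the forcing term. With w = 0 an
  eigenfunction becomes a preimage under the operator; with w = \<mu> solutions for different
  parameters can be subtracted.\<close>

lemma sys_shift:
  assumes "sys z f u v"
  shows "sys w (\<lambda>t. (z - w) * u t + f t) u v"
proof -
  have "\<beta> z t * u t + - (of_real (r t) * f t) = \<beta> w t * u t + - (of_real (r t) * ((z - w) * u t + f t))" for t
    by (simp add: \<beta>_def algebra_simps)
  then show ?thesis using assms unfolding sys_def lin_sys_def by simp
qed

lemma sys_cong:
  assumes "sys z f u v" "AE x in \<Lambda>. f x = g x"
  shows "sys z g u v"
proof -
  have "AE x in \<Lambda>. sl_tau a b p q r u x = z * u x + g x"
    using sysD(3)[OF assms(1)] assms(2) by eventually_elim simp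
  from sysI[OF sysD(1)[OF assms(1)] this] show ?thesis
    using sysD(2)[OF assms(1)] by simp
qed

section \<open>The weighted measure, the domain of the operator and Lagrange's identity\<close>

lemma sets_M: "sets M = sets \<Lambda>" "space M = {a<..<b}"
  by (simp_all add: sl_measure_def)

lemma AE_M_iff: "(AE x in M. P x) \<longleftrightarrow> (AE x in \<Lambda>. P x)"
proof -
  have "(AE x in M. P x) \<longleftrightarrow> (AE x in \<Lambda>. 0 < ennreal (r x) \<longrightarrow> P x)"
    unfolding sl_measure_def using r_meas by (intro AE_density) auto
  also have "\<dots> \<longleftrightarrow> (AE x in \<Lambda>. P x)"
    using r_pos by (auto elim: eventually_elim2)
  finally show ?thesis .
qed

lemma measurable_M: "f \<in> borel_measurable M \<longleftrightarrow> f \<in> borel_measurable \<Lambda>"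
  by (simp add: sl_measure_def)

lemma integrable_M_iff:
  fixes h :: "real \<Rightarrow> 'b::euclidean_space"
  assumes "h \<in> borel_measurable M"
  shows "integrable M h \<longleftrightarrow> (\<lambda>t. r t *\<^sub>R h t) absolutely_integrable_on {a..b}"
  unfolding sl_measure_def using assms r_pos
  by (subst integrable_density)
    (auto simp: measurable_M r_meas integrable_lebesgue_on_Ioo_iff elim: eventually_mono)

lemma integral_M:
  fixes h :: "real \<Rightarrow> 'b::euclidean_space"
  assumes "h \<in> borel_measurable M" "(\<lambda>t. r t *\<^sub>R h t) absolutely_integrable_on {a..b}"
  shows "(LINT x|M. h x) = integral {a..b} (\<lambda>t. r t *\<^sub>R h t)"
proof -
  have "(LINT x|M. h x) = (LINT x|\<Lambda>. r x *\<^sub>R h x)"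
    unfolding sl_measure_def using assms(1) r_pos
    by (subst integral_density) (auto simp: measurable_M r_meas elim: eventually_mono)
  then show ?thesis using integral_lebesgue_on_Ioo[OF assms(2)] by simp
qed

lemma finite_measure_M: "finite_measure M"
proof
  have "integrable M (\<lambda>_. 1::real)"
    using r_int by (subst integrable_M_iff) (auto simp: integrable_lebesgue_on_Ioo_iff)
  then show "emeasure M (space M) \<noteq> \<infinity>"
    by (simp add: integrable_iff_bounded)
qed

lemma continuous_imp_measurable_M:
  fixes u :: "real \<Rightarrow> complex"
  assumes "continuous_on {a..b} u" shows "u \<in> borel_measurable M"
  unfolding measurable_M
  by (rule continuous_imp_measurable_on_sets_lebesgue) (use assms in \<open>auto intro: continuous_on_subset\<close>)

lemma continuous_imp_L2:
  fixes u :: "real \<Rightarrow> complex"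
  assumes "continuous_on {a..b} u" shows "u \<in> L2 M"
proof -
  have "continuous_on {a..b} (\<lambda>x. (norm (u x))\<^sup>2)" using assms by (intro continuous_intros)
  moreover have "r absolutely_integrable_on {a..b}" using r_int by (simp add: integrable_lebesgue_on_Ioo_iff)
  ultimately have "(\<lambda>t. r t *\<^sub>R (norm (u t))\<^sup>2) absolutely_integrable_on {a..b}"
    using absolutely_integrable_mult_continuous by simp
  then show ?thesis
    using continuous_imp_measurable_M[OF assms] unfolding L2_def
    by (simp add: integrable_M_iff)
qed

lemma L2_abs_int:
  assumes "f \<in> L2 M"
  shows "(\<lambda>t. of_real (r t) * f t) absolutely_integrable_on {a..b}"
proof -
  have f: "f \<in> borel_measurable M" "integrable M (\<lambda>x. (norm (f x))\<^sup>2)" using assms by (auto simp: L2_def)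
  interpret finite_measure M by (rule finite_measure_M)
  have "integrable M f"
  proof (rule Bochner_Integration.integrable_bound)
    show "integrable M (\<lambda>x. 1 + (norm (f x))\<^sup>2)" using f by auto
    show "AE x in M. norm (f x) \<le> norm (1 + (norm (f x))\<^sup>2)"
    proof (rule AE_I2)
      fix x
      have "2 * norm (f x) \<le> 1 + (norm (f x))\<^sup>2"
        using sum_squares_bound[of 1 "norm (f x)"] by simp
      then show "norm (f x) \<le> norm (1 + (norm (f x))\<^sup>2)" by (smt (verit) norm_ge_zero real_norm_def)
    qed
  qed (rule f)
  then show ?thesis
    using integrable_M_iff[OF f(1)] by (simp add: scaleR_conv_of_real)
qed

text \<open>Square integrability of tau g holds as soon as tau g equals \<open>f\<close> almost
  everywhere, so membership in the domain reduces to the equation and the two boundary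
  forms.\<close>

lemma dom_T_iff:
  assumes f: "f \<in> L2 M"
  shows "g \<in> dom_op T \<and> (AE x in M. app_op T g x = f x) \<longleftrightarrow>
    (\<exists>h. sys 0 f g h \<and> bform1 bc (g a) (h a) (g b) (h b) = 0 \<and> bform2 bc (g a) (h a) (g b) (h b) = 0)"
    (is "?L \<longleftrightarrow> ?R")
proof
  assume ?L
  then have g: "g \<in> sl_regular a b p" "sl_bc_holds a b p bc g" "AE x in \<Lambda>. sl_tau a b p q r g x = 0 * g x + f x"
    by (auto simp: sl_op_def sl_Tmax_def AE_M_iff)
  then show ?R
    using sysI[OF g(1,3)] sl_bc_holds_iff[of a b p bc g] by blast
next
  assume ?R
  then obtain h where h: "sys 0 f g h" "bform1 bc (g a) (h a) (g b) (h b) = 0" "bform2 bc (g a) (h a) (g b) (h b) = 0"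
    by blast
  note s = sysD[OF h(1)]
  have ae: "AE x in \<Lambda>. sl_tau a b p q r g x = f x" using s(3) by simp
  have "sl_tau a b p q r g \<in> L2 M"
  proof -
    have fm: "f \<in> borel_measurable \<Lambda>" using f by (simp add: L2_def measurable_M)
    have "AE x in \<Lambda>. f x = sl_tau a b p q r g x" using ae by eventually_elim simp
    then have m: "sl_tau a b p q r g \<in> borel_measurable M"
      unfolding measurable_M by (intro borel_measurable_lebesgue_on_AE[OF fm]) auto
    have "integrable M (\<lambda>x. (norm (f x))\<^sup>2)" using f by (simp add: L2_def)
    then have "integrable M (\<lambda>x. (norm (sl_tau a b p q r g x))\<^sup>2)"
      by (rule integrable_cong_AE_imp) (use m ae in \<open>auto simp: AE_M_iff elim: eventually_mono\<close>)
    with m show ?thesis by (simp add: L2_def)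
  qed
  then show ?L
    using s(1,2) ae h(2,3) continuous_imp_L2[OF s(4)] unfolding sl_op_def sl_Tmax_def
    by (simp add: sl_bc_holds_iff AE_M_iff)
qed

lemma eigenspace_iff:
  "g \<in> eigenspace M T z \<longleftrightarrow>
    (\<exists>h. sys z (\<lambda>_. 0) g h \<and> bform1 bc (g a) (h a) (g b) (h b) = 0 \<and> bform2 bc (g a) (h a) (g b) (h b) = 0)"
    (is "?L \<longleftrightarrow> ?R")
proof
  assume L: ?L
  then have "g \<in> sl_regular a b p" by (auto simp: eigenspace_def sl_op_def sl_Tmax_def)
  then have "continuous_on {a..b} g"
    unfolding sl_regular_def AC_on_eq_abs_cont by (blast intro: abs_cont_continuous_on)
  then have "(\<lambda>x. z * g x) \<in> L2 M" by (intro continuous_imp_L2 continuous_intros)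
  from dom_T_iff[OF this, of g] L obtain h where
    h: "sys 0 (\<lambda>x. z * g x) g h" "bform1 bc (g a) (h a) (g b) (h b) = 0" "bform2 bc (g a) (h a) (g b) (h b) = 0"
    by (auto simp: eigenspace_def)
  from sys_shift[OF h(1), of z] h show ?R by auto
next
  assume ?R
  then obtain h where h: "sys z (\<lambda>_. 0) g h" "bform1 bc (g a) (h a) (g b) (h b) = 0" "bform2 bc (g a) (h a) (g b) (h b) = 0"
    by blast
  have "(\<lambda>x. z * g x) \<in> L2 M"
    using sysD(4)[OF h(1)] by (intro continuous_imp_L2 continuous_intros)
  from dom_T_iff[OF this, of g] sys_shift[OF h(1), of 0] h show ?L
    by (auto simp: eigenspace_def)
qed

text \<open>Symmetry of the operator. The derivative of cnj u * y - cnj v * w is r (cnj f * w - cnj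
  u * g), the terms with 1/p and q cancelling because these are real. The boundary values at a and b
  agree by \<open>bform_symmetric\<close>.\<close>

lemma lagrange:
  assumes s: "sys 0 f u v" "sys 0 g w y"
    and u: "bform1 bc (u a) (v a) (u b) (v b) = 0" "bform2 bc (u a) (v a) (u b) (v b) = 0"
    and w: "bform1 bc (w a) (y a) (w b) (y b) = 0" "bform2 bc (w a) (y a) (w b) (y b) = 0"
    and L2: "f \<in> L2 M" "g \<in> L2 M"
  shows "l2_inner M f w = l2_inner M u g"
proof -
  note d1 = sysD[OF s(1)] and d2 = sysD[OF s(2)]
  note cu = indef_int_linear[OF d1(6) bounded_linear_cnj] and cv = indef_int_linear[OF d1(7) bounded_linear_cnj]
  have i1: "indef_int a b (\<lambda>t. cnj (u t) * y t)
     (\<lambda>t. cnj (u t) * (\<beta> 0 t * w t - of_real (r t) * g t) + cnj (\<alpha> t * v t) * y t)"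
    by (rule indef_int_mult[OF cu d2(7) ab'])
  have i2: "indef_int a b (\<lambda>t. cnj (v t) * w t)
     (\<lambda>t. cnj (v t) * (\<alpha> t * y t) + cnj (\<beta> 0 t * u t - of_real (r t) * f t) * w t)"
    by (rule indef_int_mult[OF cv d2(6) ab'])
  have i: "indef_int a b (\<lambda>t. cnj (u t) * y t + - (cnj (v t) * w t))
    (\<lambda>t. (cnj (u t) * (\<beta> 0 t * w t - of_real (r t) * g t) + cnj (\<alpha> t * v t) * y t) +
      - (cnj (v t) * (\<alpha> t * y t) + cnj (\<beta> 0 t * u t - of_real (r t) * f t) * w t))"
    by (rule indef_int_add[OF i1 indef_int_linear[OF i2 bounded_linear_minus[OF bounded_linear_ident]]])
  have eq: "(cnj (u t) * (\<beta> 0 t * w t - of_real (r t) * g t) + cnj (\<alpha> t * v t) * y t) +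
      - (cnj (v t) * (\<alpha> t * y t) + cnj (\<beta> 0 t * u t - of_real (r t) * f t) * w t) =
      r t *\<^sub>R (cnj (f t) * w t) - r t *\<^sub>R (cnj (u t) * g t)" for t
    by (simp add: \<alpha>_def \<beta>_def algebra_simps scaleR_conv_of_real)
  have cf: "(\<lambda>t. cnj (of_real (r t) * f t)) absolutely_integrable_on {a..b}"
    using absolutely_integrable_linear[OF L2_abs_int[OF L2(1)] bounded_linear_cnj] by (simp add: comp_def)
  have a1: "(\<lambda>t. r t *\<^sub>R (cnj (f t) * w t)) absolutely_integrable_on {a..b}"
    using absolutely_integrable_mult_continuous[OF cf d2(4)] by (simp add: scaleR_conv_of_real mult_ac)
  have a2: "(\<lambda>t. r t *\<^sub>R (cnj (u t) * g t)) absolutely_integrable_on {a..b}"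
    using absolutely_integrable_mult_continuous[OF L2_abs_int[OF L2(2)] continuous_on_cnj[OF d1(4)]]
    by (simp add: scaleR_conv_of_real mult_ac)
  have m: "f \<in> borel_measurable M" "g \<in> borel_measurable M" "u \<in> borel_measurable M" "w \<in> borel_measurable M"
    using L2 continuous_imp_measurable_M d1(4) d2(4) by (auto simp: L2_def)
  have m1: "(\<lambda>t. cnj (f t) * w t) \<in> borel_measurable M" "(\<lambda>t. cnj (u t) * g t) \<in> borel_measurable M"
    using m by (auto intro!: borel_measurable_times borel_measurable_continuous_on[of cnj] continuous_intros)
  have "(cnj (u b) * y b + - (cnj (v b) * w b)) - (cnj (u a) * y a + - (cnj (v a) * w a)) =
     integral {a..b} (\<lambda>t. r t *\<^sub>R (cnj (f t) * w t) - r t *\<^sub>R (cnj (u t) * g t))"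
    using indef_int_diff[OF i, of a b] ab' unfolding eq by simp
  also have "\<dots> = integral {a..b} (\<lambda>t. r t *\<^sub>R (cnj (f t) * w t)) - integral {a..b} (\<lambda>t. r t *\<^sub>R (cnj (u t) * g t))"
    using a1 a2 by (intro integral_diff absolutely_integrable_on_imp_integrable_on)
  also have "\<dots> = l2_inner M f w - l2_inner M u g"
    unfolding l2_inner_def using integral_M[OF m1(1) a1] integral_M[OF m1(2) a2] by simp
  finally show ?thesis
    using bform_symmetric[OF adm u w] by simp
qed

end

section \<open>The characteristic function\<close>

lemma two_by_two_kernel:
  fixes a11 a12 a21 a22 :: "'a::field"
  assumes "a11 * a22 - a12 * a21 = 0"
  obtains c d where "(c, d) \<noteq> (0, 0)" "c * a11 + d * a12 = 0" "c * a21 + d * a22 = 0"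
proof (cases "a11 = 0 \<and> a12 = 0")
  case True
  show ?thesis
  proof (cases "a21 = 0 \<and> a22 = 0")
    case True
    with \<open>a11 = 0 \<and> a12 = 0\<close> show ?thesis by (intro that[of 1 0]) auto
  next
    case False
    with \<open>a11 = 0 \<and> a12 = 0\<close> show ?thesis by (intro that[of "-a22" a21]) auto
  qed
next
  case False
  with assms show ?thesis by (intro that[of "-a12" a11]) (auto simp: algebra_simps)
qed

lemma two_by_two_trivial_kernel:
  fixes a11 a12 a21 a22 :: "'a::field"
  assumes "a11 * a22 - a12 * a21 \<noteq> 0" "c * a11 + d * a12 = 0" "c * a21 + d * a22 = 0"
  shows "c = 0" "d = 0"
proof -
  have "c * (a11 * a22 - a12 * a21) = (c * a11 + d * a12) * a22 - (c * a21 + d * a22) * a12"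
    "d * (a11 * a22 - a12 * a21) = (c * a21 + d * a22) * a11 - (c * a11 + d * a12) * a21"
    by (simp_all add: algebra_simps)
  then have "c * (a11 * a22 - a12 * a21) = 0" "d * (a11 * a22 - a12 * a21) = 0"
    unfolding assms(2,3) by simp_all
  with assms(1) show "c = 0" "d = 0" by auto
qed

lemma two_by_two_solve:
  fixes a11 a12 a21 a22 :: "'a::field"
  assumes "a11 * a22 - a12 * a21 \<noteq> 0"
  obtains c d where "c * a11 + d * a12 = s" "c * a21 + d * a22 = t"
proof -
  let ?D = "a11 * a22 - a12 * a21"
  have "(s * a22 - t * a12) / ?D * a11 + (t * a11 - s * a21) / ?D * a12 = s * ?D / ?D"
    "(s * a22 - t * a12) / ?D * a21 + (t * a11 - s * a21) / ?D * a22 = t * ?D / ?D"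
    unfolding times_divide_eq_left add_divide_distrib[symmetric] by (simp_all add: algebra_simps)
  then show ?thesis using assms by (intro that[of "(s * a22 - t * a12) / ?D" "(t * a11 - s * a21) / ?D"]) auto
qed

text \<open>A vanishing derivative of the determinant at a point where the matrix has rank one yields a
  Jordan chain.\<close>

lemma two_by_two_jordan_chain_aux:
  fixes a11 a12 a21 a22 :: "'a::field"
  assumes "a11 \<noteq> 0" and det: "a11 * a22 - a12 * a21 = 0"
    and det': "b11 * a22 + a11 * b22 - b12 * a21 - a12 * b21 = 0"
  shows "\<exists>c d e f. (c, d) \<noteq> (0, 0) \<and> c * a11 + d * a12 = 0 \<and> c * a21 + d * a22 = 0 \<and>
    e * a11 + f * a12 + (c * b11 + d * b12) = 0 \<and> e * a21 + f * a22 + (c * b21 + d * b22) = 0"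
proof -
  \<comment> \<open>The kernel vector is (-a12, a11). If the second component of the chain is 0, the
    first row determines e, and the second row then follows from \<open>det\<close> and
    \<open>det'\<close>.\<close>
  define e where "e = - (- a12 * b11 + a11 * b12) / a11"
  have a: "a22 = a12 * a21 / a11" using assms by (simp add: field_simps)
  have 1: "e * a11 + 0 * a12 + (- a12 * b11 + a11 * b12) = 0"
    using assms by (simp add: e_def)
  have "a11 * (e * a21 + 0 * a22 + (- a12 * b21 + a11 * b22)) =
     (e * a11) * a21 + a11 * (- a12 * b21 + a11 * b22)" by (simp add: algebra_simps)
  also have "e * a11 = - (- a12 * b11 + a11 * b12)" using assms by (simp add: e_def)
  also have "- (- a12 * b11 + a11 * b12) * a21 + a11 * (- a12 * b21 + a11 * b22) =
     b11 * (a12 * a21 - a11 * a22) + a11 * (b11 * a22 + a11 * b22 - b12 * a21 - a12 * b21)"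
    by (simp add: algebra_simps)
  also have "\<dots> = 0" using det det' by (simp add: algebra_simps)
  finally have 2: "e * a21 + 0 * a22 + (- a12 * b21 + a11 * b22) = 0" using assms by simp
  show ?thesis
    by (intro exI[of _ "- a12"] exI[of _ a11] exI[of _ e] exI[of _ 0])
      (use assms 1 2 in \<open>auto simp: algebra_simps\<close>)
qed

lemma two_by_two_jordan_chain:
  fixes a11 a12 a21 a22 :: "'a::field"
  assumes ne: "\<not> (a11 = 0 \<and> a12 = 0 \<and> a21 = 0 \<and> a22 = 0)" and det: "a11 * a22 - a12 * a21 = 0"
    and det': "b11 * a22 + a11 * b22 - b12 * a21 - a12 * b21 = 0"
  shows "\<exists>c d e f. (c, d) \<noteq> (0, 0) \<and> c * a11 + d * a12 = 0 \<and> c * a21 + d * a22 = 0 \<and>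
    e * a11 + f * a12 + (c * b11 + d * b12) = 0 \<and> e * a21 + f * a22 + (c * b21 + d * b22) = 0"
proof -
  \<comment> \<open>Exchanging rows or columns moves a nonzero entry to the top left. An exchange of
    columns also exchanges the components of both chain vectors.\<close>
  consider "a11 \<noteq> 0" | "a12 \<noteq> 0" | "a21 \<noteq> 0" | "a22 \<noteq> 0" using ne by auto
  then show ?thesis
  proof cases
    case 1
    then show ?thesis using two_by_two_jordan_chain_aux[OF 1 det det'] by blast
  next
    case 2
    have "\<exists>c d e f. (c, d) \<noteq> (0, 0) \<and> c * a12 + d * a11 = 0 \<and> c * a22 + d * a21 = 0 \<and>
      e * a12 + f * a11 + (c * b12 + d * b11) = 0 \<and> e * a22 + f * a21 + (c * b22 + d * b21) = 0"
      by (rule two_by_two_jordan_chain_aux) (use 2 det det' in \<open>auto simp: algebra_simps\<close>)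
    then obtain c d e f where "(c, d) \<noteq> (0, 0) \<and> c * a12 + d * a11 = 0 \<and> c * a22 + d * a21 = 0 \<and>
      e * a12 + f * a11 + (c * b12 + d * b11) = 0 \<and> e * a22 + f * a21 + (c * b22 + d * b21) = 0" by blast
    then show ?thesis by (intro exI[of _ d] exI[of _ c] exI[of _ f] exI[of _ e]) (auto simp: add.commute)
  next
    case 3
    have "\<exists>c d e f. (c, d) \<noteq> (0, 0) \<and> c * a21 + d * a22 = 0 \<and> c * a11 + d * a12 = 0 \<and>
      e * a21 + f * a22 + (c * b21 + d * b22) = 0 \<and> e * a11 + f * a12 + (c * b11 + d * b12) = 0"
      by (rule two_by_two_jordan_chain_aux) (use 3 det det' in \<open>auto simp: algebra_simps\<close>)
    then show ?thesis by blast
  next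
    case 4
    have "\<exists>c d e f. (c, d) \<noteq> (0, 0) \<and> c * a22 + d * a21 = 0 \<and> c * a12 + d * a11 = 0 \<and>
      e * a22 + f * a21 + (c * b22 + d * b21) = 0 \<and> e * a12 + f * a11 + (c * b12 + d * b11) = 0"
      by (rule two_by_two_jordan_chain_aux) (use 4 det det' in \<open>auto simp: algebra_simps\<close>)
    then obtain c d e f where "(c, d) \<noteq> (0, 0) \<and> c * a22 + d * a21 = 0 \<and> c * a12 + d * a11 = 0 \<and>
      e * a22 + f * a21 + (c * b22 + d * b21) = 0 \<and> e * a12 + f * a11 + (c * b12 + d * b11) = 0" by blast
    then show ?thesis by (intro exI[of _ d] exI[of _ c] exI[of _ f] exI[of _ e]) (auto simp: add.commute)
  qed
qed

text \<open>If the matrix vanishes at \<mu>, a factor z - \<mu> comes out of each entry, and a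
  kernel vector of the derivative matrix would be a chain with e = f = 0; so the order is exactly 2.
  Otherwise a vanishing derivative of the determinant would produce a chain, so the zero is
  simple.\<close>

lemma zorder_det_of_no_jordan_chain:
  fixes w11 w12 w21 w22 :: "complex \<Rightarrow> complex"
  assumes hol: "w11 holomorphic_on UNIV" "w12 holomorphic_on UNIV" "w21 holomorphic_on UNIV" "w22 holomorphic_on UNIV"
    and det: "w11 \<mu> * w22 \<mu> - w12 \<mu> * w21 \<mu> = 0"
    and no_chain: "\<And>c d e f. (c, d) \<noteq> (0, 0) \<Longrightarrow> c * w11 \<mu> + d * w12 \<mu> = 0 \<Longrightarrow> c * w21 \<mu> + d * w22 \<mu> = 0 \<Longrightarrow>
      e * w11 \<mu> + f * w12 \<mu> + (c * deriv w11 \<mu> + d * deriv w12 \<mu>) = 0 \<Longrightarrow>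
      e * w21 \<mu> + f * w22 \<mu> + (c * deriv w21 \<mu> + d * deriv w22 \<mu>) = 0 \<Longrightarrow> False"
  shows "zorder (\<lambda>z. w11 z * w22 z - w12 z * w21 z) \<mu> =
    (if w11 \<mu> = 0 \<and> w12 \<mu> = 0 \<and> w21 \<mu> = 0 \<and> w22 \<mu> = 0 then 2 else 1)"
proof (cases "w11 \<mu> = 0 \<and> w12 \<mu> = 0 \<and> w21 \<mu> = 0 \<and> w22 \<mu> = 0")
  case True
  have "\<exists>g. g holomorphic_on UNIV \<and> g \<mu> = deriv w \<mu> \<and> (\<forall>z. w z = (z - \<mu>) * g z)"
    if "w holomorphic_on UNIV" "w \<mu> = 0" for w
    using pole_lemma[OF that(1), of \<mu>] that(2)
    by (intro exI[of _ "\<lambda>z. if z = \<mu> then deriv w \<mu> else (w z - w \<mu>) / (z - \<mu>)"]) auto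
  then obtain v11 v12 v21 v22 where v: "v11 holomorphic_on UNIV" "v12 holomorphic_on UNIV" "v21 holomorphic_on UNIV" "v22 holomorphic_on UNIV"
    "v11 \<mu> = deriv w11 \<mu>" "v12 \<mu> = deriv w12 \<mu>" "v21 \<mu> = deriv w21 \<mu>" "v22 \<mu> = deriv w22 \<mu>"
    "\<And>z. w11 z = (z - \<mu>) * v11 z" "\<And>z. w12 z = (z - \<mu>) * v12 z" "\<And>z. w21 z = (z - \<mu>) * v21 z" "\<And>z. w22 z = (z - \<mu>) * v22 z"
    using hol True by metis
  have "zorder (\<lambda>z. w11 z * w22 z - w12 z * w21 z) \<mu> = 2"
  proof (rule zorder_eqI[where S = UNIV and g = "\<lambda>z. v11 z * v22 z - v12 z * v21 z"])
    show "(\<lambda>z. v11 z * v22 z - v12 z * v21 z) holomorphic_on UNIV" by (intro holomorphic_intros v)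
    show "v11 \<mu> * v22 \<mu> - v12 \<mu> * v21 \<mu> \<noteq> 0"
    proof
      assume "v11 \<mu> * v22 \<mu> - v12 \<mu> * v21 \<mu> = 0"
      then obtain c d where cd: "(c, d) \<noteq> (0, 0)" "c * v11 \<mu> + d * v12 \<mu> = 0" "c * v21 \<mu> + d * v22 \<mu> = 0"
        by (rule two_by_two_kernel)
      show False
        by (rule no_chain[OF cd(1), of 0 0]) (use True cd v(5-8) in auto)
    qed
    show "w11 z * w22 z - w12 z * w21 z = (v11 z * v22 z - v12 z * v21 z) * (z - \<mu>) powi 2" for z
      unfolding v(9-12) by (simp add: power2_eq_square algebra_simps)
  qed auto
  with True show ?thesis by simp
next
  case False
  have d: "(w has_field_derivative deriv w \<mu>) (at \<mu>)" if "w holomorphic_on UNIV" for w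
    by (rule holomorphic_derivI[OF that open_UNIV UNIV_I])
  have D: "((\<lambda>z. w11 z * w22 z - w12 z * w21 z) has_field_derivative
     (deriv w11 \<mu> * w22 \<mu> + deriv w22 \<mu> * w11 \<mu>) - (deriv w12 \<mu> * w21 \<mu> + deriv w21 \<mu> * w12 \<mu>)) (at \<mu>)"
    by (intro DERIV_diff DERIV_mult d hol)
  have "deriv w11 \<mu> * w22 \<mu> + w11 \<mu> * deriv w22 \<mu> - deriv w12 \<mu> * w21 \<mu> - w12 \<mu> * deriv w21 \<mu> \<noteq> 0"
    using two_by_two_jordan_chain[OF False det] no_chain by metis
  moreover have "deriv (\<lambda>z. w11 z * w22 z - w12 z * w21 z) \<mu> =
      deriv w11 \<mu> * w22 \<mu> + w11 \<mu> * deriv w22 \<mu> - deriv w12 \<mu> * w21 \<mu> - w12 \<mu> * deriv w21 \<mu>"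
    using DERIV_imp_deriv[OF D] by (simp add: algebra_simps)
  ultimately have "deriv (\<lambda>z. w11 z * w22 z - w12 z * w21 z) \<mu> \<noteq> 0" by metis
  moreover have "(\<lambda>z. w11 z * w22 z - w12 z * w21 z) holomorphic_on UNIV"
    by (intro holomorphic_intros hol)
  ultimately have "zorder (\<lambda>z. w11 z * w22 z - w12 z * w21 z) \<mu> = int 1"
    using det by (intro zorder_zero_eqI[of _ UNIV]) auto
  with False show ?thesis by auto
qed

section \<open>Fundamental solutions and the boundary matrix\<close>

context sturm_liouville
begin

abbreviation "\<theta> z \<equiv> sl_theta a b p q r z"
abbreviation "\<phi> z \<equiv> sl_phi a b p q r z"
abbreviation "\<theta>' z \<equiv> qd (\<theta> z)"
abbreviation "\<phi>' z \<equiv> qd (\<phi> z)"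
abbreviation "F z \<equiv> sl_char a b p q r bc z"

lemma sl_solution_iff: "sl_solution a b p q r z y \<longleftrightarrow> sys z (\<lambda>_. 0) y (qd y)"
  using sysI[of y z "\<lambda>_. 0"] sysD(1,3)[of z "\<lambda>_. 0" y "qd y"] unfolding sl_solution_def by auto

lemma sl_solution_the:
  "\<exists>!y. sl_solution a b p q r z y \<and> y a = c \<and> qd y a = d"
proof -
  obtain u v where uv: "sys z (\<lambda>_. 0) u v" "u a = c" "v a = d"
    using sys_exists[of "\<lambda>_. 0" z c d] by (auto simp: absolutely_integrable_on_def)
  have "qd u = v" by (rule sysD(2)[OF uv(1)])
  with uv have "sl_solution a b p q r z u \<and> u a = c \<and> qd u a = d" by (simp add: sl_solution_iff)
  moreover have "y = u" if "sl_solution a b p q r z y \<and> y a = c \<and> qd y a = d" for y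
    using sys_unique(1)[of z "\<lambda>_. 0" y "qd y" u v] that uv unfolding sl_solution_iff by auto
  ultimately show ?thesis by blast
qed

lemma theta: "sys z (\<lambda>_. 0) (\<theta> z) (\<theta>' z)" "\<theta> z a = 1" "\<theta>' z a = 0"
  using theI'[OF sl_solution_the[of z 1 0]] unfolding sl_theta_def[symmetric] by (simp_all add: sl_solution_iff[symmetric])

lemma phi: "sys z (\<lambda>_. 0) (\<phi> z) (\<phi>' z)" "\<phi> z a = 0" "\<phi>' z a = 1"
  using theI'[OF sl_solution_the[of z 0 1]] unfolding sl_phi_def[symmetric] by (simp_all add: sl_solution_iff[symmetric])

lemma sys_hom_combination:
  "sys z (\<lambda>_. 0) (\<lambda>t. c * \<theta> z t + d * \<phi> z t) (\<lambda>t. c * \<theta>' z t + d * \<phi>' z t)"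
  using sys_combination[OF theta(1)[of z] phi(1)[of z], of c d] by simp

lemma sys_hom_eq:
  assumes "sys z (\<lambda>_. 0) u v"
  shows "u = (\<lambda>t. u a * \<theta> z t + v a * \<phi> z t)" "v = (\<lambda>t. u a * \<theta>' z t + v a * \<phi>' z t)"
proof -
  have "u a = u a * \<theta> z a + v a * \<phi> z a" "v a = u a * \<theta>' z a + v a * \<phi>' z a"
    by (simp_all add: theta phi)
  from sys_unique[OF assms sys_hom_combination this]
  show "u = (\<lambda>t. u a * \<theta> z t + v a * \<phi> z t)" "v = (\<lambda>t. u a * \<theta>' z t + v a * \<phi>' z t)" by blast+
qed

lemma wronskian: "\<theta> z b * \<phi>' z b - \<theta>' z b * \<phi> z b = 1"
proof -
  note d1 = sysD[OF theta(1)[of z]] and d2 = sysD[OF phi(1)[of z]]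
  have i: "indef_int a b (\<lambda>t. \<theta> z t * \<phi>' z t + - (\<theta>' z t * \<phi> z t))
    (\<lambda>t. (\<theta> z t * (\<beta> z t * \<phi> z t - of_real (r t) * 0) + (\<alpha> t * \<theta>' z t) * \<phi>' z t) +
       - (\<theta>' z t * (\<alpha> t * \<phi>' z t) + (\<beta> z t * \<theta> z t - of_real (r t) * 0) * \<phi> z t))"
    by (rule indef_int_add[OF indef_int_mult[OF d1(6) d2(7) ab']
        indef_int_linear[OF indef_int_mult[OF d1(7) d2(6) ab'] bounded_linear_minus[OF bounded_linear_ident]]])
  have "(\<theta> z b * \<phi>' z b + - (\<theta>' z b * \<phi> z b)) - (\<theta> z a * \<phi>' z a + - (\<theta>' z a * \<phi> z a)) = 0"
    using indef_int_diff[OF i, of a b] ab' by (simp add: algebra_simps)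
  then show ?thesis by (simp add: theta phi)
qed

text \<open>The boundary forms on the basis \<theta>, \<phi> of the solution space, whose members
  have initial data (1,0) and (0,1). The kernel of this matrix therefore consists of the initial
  data of eigenfunctions.\<close>

definition "w11 z = bform1 bc 1 0 (\<theta> z b) (\<theta>' z b)"
definition "w12 z = bform1 bc 0 1 (\<phi> z b) (\<phi>' z b)"
definition "w21 z = bform2 bc 1 0 (\<theta> z b) (\<theta>' z b)"
definition "w22 z = bform2 bc 0 1 (\<phi> z b) (\<phi>' z b)"

lemma bform_combination:
  "bform1 bc c d (c * \<theta> z b + d * \<phi> z b) (c * \<theta>' z b + d * \<phi>' z b) = c * w11 z + d * w12 z"
  "bform2 bc c d (c * \<theta> z b + d * \<phi> z b) (c * \<theta>' z b + d * \<phi>' z b) = c * w21 z + d * w22 z"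
  using bform_linear(1)[of bc c 1 d 0 0 1 "\<theta> z b" "\<phi> z b" "\<theta>' z b" "\<phi>' z b"]
    bform_linear(2)[of bc c 1 d 0 0 1 "\<theta> z b" "\<phi> z b" "\<theta>' z b" "\<phi>' z b"]
  by (simp_all add: w11_def w12_def w21_def w22_def)

text \<open>For coupled conditions the exponential of 2 i \<phi> in \<open>F\<close> arises from det
  R = 1 and the constant 1 from the Wronskian of \<theta> and \<phi>.\<close>

lemma char_eq_det: "F z = w11 z * w22 z - w12 z * w21 z"
proof (cases bc)
  case (Separated \<alpha> \<beta>)
  show ?thesis
    unfolding w11_def w12_def w21_def w22_def unfolding Separated by (simp add: algebra_simps)
next
  case (Coupled \<phi>0 R)
  let ?e = "exp (\<i> * of_real \<phi>0)"
  have e2: "exp (2 * \<i> * of_real \<phi>0) = ?e * ?e" by (simp add: mult.assoc flip: exp_add)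
  have det: "of_real (R$1$1) * of_real (R$2$2) - of_real (R$1$2) * of_real (R$2$1) = (1::complex)"
    using adm Coupled by (simp add: det_2 flip: of_real_mult of_real_diff)
  have gen: "(t - e * r1) * (y - e * r4) - (f - e * r2) * (s - e * r3) =
     e * (r2 * s - r4 * t + r3 * f - r1 * y) + e * e * (r1 * r4 - r2 * r3) + (t * y - s * f)"
    for t y f s e r1 r2 r3 r4 :: complex by (simp add: algebra_simps)
  show ?thesis
    using gen[of "\<theta> z b" ?e "of_real (R$1$1)" "\<phi>' z b" "of_real (R$2$2)" "\<phi> z b" "of_real (R$1$2)" "\<theta>' z b" "of_real (R$2$1)"]
    unfolding det wronskian w11_def w12_def w21_def w22_def unfolding Coupled by (simp add: e2)
qed

lemma eigenspace_eq:
  "eigenspace M T z = {\<lambda>t. c * \<theta> z t + d * \<phi> z t | c d. c * w11 z + d * w12 z = 0 \<and> c * w21 z + d * w22 z = 0}"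
proof (intro set_eqI iffI)
  fix g assume "g \<in> eigenspace M T z"
  then obtain h where h: "sys z (\<lambda>_. 0) g h" "bform1 bc (g a) (h a) (g b) (h b) = 0" "bform2 bc (g a) (h a) (g b) (h b) = 0"
    unfolding eigenspace_iff by blast
  note e = sys_hom_eq[OF h(1)]
  have "g b = g a * \<theta> z b + h a * \<phi> z b" "h b = g a * \<theta>' z b + h a * \<phi>' z b"
    using fun_cong[OF e(1), of b] fun_cong[OF e(2), of b] by auto
  then have "g a * w11 z + h a * w12 z = 0 \<and> g a * w21 z + h a * w22 z = 0"
    using h(2,3) bform_combination by metis
  with e(1) show "g \<in> {\<lambda>t. c * \<theta> z t + d * \<phi> z t | c d. c * w11 z + d * w12 z = 0 \<and> c * w21 z + d * w22 z = 0}"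
    by blast
next
  fix g assume "g \<in> {\<lambda>t. c * \<theta> z t + d * \<phi> z t | c d. c * w11 z + d * w12 z = 0 \<and> c * w21 z + d * w22 z = 0}"
  then obtain c d where g: "g = (\<lambda>t. c * \<theta> z t + d * \<phi> z t)" and w: "c * w11 z + d * w12 z = 0" "c * w21 z + d * w22 z = 0"
    by blast
  show "g \<in> eigenspace M T z"
    unfolding eigenspace_iff g
    by (intro exI[of _ "\<lambda>t. c * \<theta>' z t + d * \<phi>' z t"] conjI sys_hom_combination)
      (use w bform_combination[of c d z] in \<open>simp_all add: theta phi\<close>)
qed

lemma combination_eq_zero_iff: "(\<lambda>t. c * \<theta> z t + d * \<phi> z t) = (\<lambda>_. 0) \<longleftrightarrow> c = 0 \<and> d = 0"
proof
  assume 0: "(\<lambda>t. c * \<theta> z t + d * \<phi> z t) = (\<lambda>_. 0)"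
  have "sys z (\<lambda>_. 0) (\<lambda>_. 0) (\<lambda>_. 0)"
    using sys_hom_combination[of z 0 0] by simp
  from sysD(2)[OF this] sysD(2)[OF sys_hom_combination[of z c d]] 0
  have "(\<lambda>t. c * \<theta>' z t + d * \<phi>' z t) = (\<lambda>_. 0)" by simp
  from fun_cong[OF this, of a] fun_cong[OF 0, of a] show "c = 0 \<and> d = 0"
    by (simp add: theta phi)
qed simp

lemma eigenspace_continuous:
  assumes "g \<in> eigenspace M T z"
  shows "continuous_on {a..b} g" "\<And>x. x \<notin> {a..b} \<Longrightarrow> g x = 0" "g \<in> L2 M"
  using assms sysD(4,8) continuous_imp_L2 unfolding eigenspace_iff by blast+

lemma AE_zero_imp_zero:
  assumes "continuous_on {a..b} g" "\<And>x. x \<notin> {a..b} \<Longrightarrow> g x = (0::complex)" "AE x in M. g x = 0"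
  shows "g = (\<lambda>_. 0)"
  using continuous_AE_zero_imp_zero[OF ab assms(1)] assms(2,3) unfolding AE_M_iff by blast

lemma eigenvalue_real:
  assumes g: "g \<in> eigenspace M T z" "g \<noteq> (\<lambda>_. 0)"
  shows "cnj z = z"
proof -
  obtain h where h: "sys z (\<lambda>_. 0) g h" "bform1 bc (g a) (h a) (g b) (h b) = 0" "bform2 bc (g a) (h a) (g b) (h b) = 0"
    using g unfolding eigenspace_iff by blast
  have s: "sys 0 (\<lambda>t. z * g t) g h" using sys_shift[OF h(1), of 0] by simp
  have L: "(\<lambda>t. z * g t) \<in> L2 M"
    using eigenspace_continuous(1)[OF g(1)] by (intro continuous_imp_L2 continuous_intros)
  have "cnj z * l2_inner M g g = z * l2_inner M g g"
    using lagrange[OF s s h(2,3) h(2,3) L L] by (simp add: l2_inner_scale)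
  moreover have "l2_inner M g g \<noteq> 0"
    using l2_inner_self_eq_0_iff[OF eigenspace_continuous(3)[OF g(1)]] AE_zero_imp_zero eigenspace_continuous[OF g(1)] g(2) by blast
  ultimately show ?thesis by simp
qed

lemma eigenvalues_iff: "z \<in> eigenvalues M T \<longleftrightarrow> (\<exists>g\<in>eigenspace M T z. g \<noteq> (\<lambda>_. 0))"
proof -
  have "(AE x in M. g x = 0) \<longleftrightarrow> g = (\<lambda>_. 0)" if "g \<in> eigenspace M T z" for g
    using AE_zero_imp_zero[OF eigenspace_continuous(1,2)[OF that]] by auto
  then show ?thesis unfolding eigenvalues_def by blast
qed

lemma eigenvalues_iff_char: "z \<in> eigenvalues M T \<longleftrightarrow> F z = 0"
proof
  assume "z \<in> eigenvalues M T"
  then obtain c d where cd: "(\<lambda>t. c * \<theta> z t + d * \<phi> z t) \<noteq> (\<lambda>_. 0)" "c * w11 z + d * w12 z = 0" "c * w21 z + d * w22 z = 0"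
    unfolding eigenvalues_iff eigenspace_eq by blast
  show "F z = 0"
  proof (rule ccontr)
    assume "F z \<noteq> 0"
    then have "c = 0" "d = 0" using two_by_two_trivial_kernel[OF _ cd(2,3)] by (auto simp: char_eq_det)
    with cd(1) show False by simp
  qed
next
  assume "F z = 0"
  then obtain c d where cd: "(c, d) \<noteq> (0, 0)" "c * w11 z + d * w12 z = 0" "c * w21 z + d * w22 z = 0"
    using two_by_two_kernel[of "w11 z" "w22 z" "w12 z" "w21 z"] by (metis char_eq_det)
  then have "(\<lambda>t. c * \<theta> z t + d * \<phi> z t) \<in> eigenspace M T z" unfolding eigenspace_eq by blast
  moreover have "(\<lambda>t. c * \<theta> z t + d * \<phi> z t) \<noteq> (\<lambda>_. 0)" using cd(1) combination_eq_zero_iff by auto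
  ultimately show "z \<in> eigenvalues M T" unfolding eigenvalues_iff by blast
qed


section \<open>Bounds and holomorphy in the spectral parameter\<close>

lemma norm_abs_int:
  "(\<lambda>t. norm (\<alpha> t)) absolutely_integrable_on {a..b}" "(\<lambda>t. norm (\<beta> z t)) absolutely_integrable_on {a..b}"
  "(\<lambda>t. \<bar>r t\<bar>) absolutely_integrable_on {a..b}" "(\<lambda>t. \<bar>q t\<bar>) absolutely_integrable_on {a..b}"
  using absolutely_integrable_norm'[OF abs_int(1)] absolutely_integrable_norm'[OF abs_int(2)[of z]]
    absolutely_integrable_norm'[OF abs_int(3)] absolutely_integrable_norm'[OF abs_int(4)] by simp_all

definition "R\<^sub>r = integral {a..b} (\<lambda>t. \<bar>r t\<bar>)"
definition "\<Omega> = integral {a..b} (\<lambda>t. norm (\<alpha> t) + (\<bar>q t\<bar> + \<bar>r t\<bar>))"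

lemma \<Omega>_integrable: "(\<lambda>t. norm (\<alpha> t) + (\<bar>q t\<bar> + \<bar>r t\<bar>)) integrable_on {a..b}"
  by (intro integrable_add absolutely_integrable_on_imp_integrable_on norm_abs_int)

lemma \<Omega>_nonneg: "\<Omega> \<ge> 0"
  unfolding \<Omega>_def using \<Omega>_integrable by (rule integral_nonneg) simp

text \<open>For |z| \<le> k^2 and k \<ge> 1 one has |q - z r| / k \<le> k (|q| + |r|). The exponent
  in the solution bound is thus linear in k, that is, of the size of the square root of z.\<close>

lemma weight_integral_le:
  assumes k: "k \<ge> 1" "norm z \<le> k\<^sup>2"
  shows "integral {a..b} (\<lambda>t. k * norm (\<alpha> t) + norm (\<beta> z t) / k) \<le> k * \<Omega>"
proof -
  have "integral {a..b} (\<lambda>t. k * norm (\<alpha> t) + norm (\<beta> z t) / k) \<le>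
     integral {a..b} (\<lambda>t. k * (norm (\<alpha> t) + (\<bar>q t\<bar> + \<bar>r t\<bar>)))"
  proof (rule integral_le)
    show "(\<lambda>t. k * norm (\<alpha> t) + norm (\<beta> z t) / k) integrable_on {a..b}"
      using integrable_on_mult_right[OF absolutely_integrable_on_imp_integrable_on[OF norm_abs_int(1)], of k]
        integrable_on_mult_right[OF absolutely_integrable_on_imp_integrable_on[OF norm_abs_int(2)], of "1/k" z]
      by (intro integrable_add) auto
    show "(\<lambda>t. k * (norm (\<alpha> t) + (\<bar>q t\<bar> + \<bar>r t\<bar>))) integrable_on {a..b}"
      by (rule integrable_on_mult_right[OF \<Omega>_integrable])
    fix t
    have "norm (\<beta> z t) \<le> \<bar>q t\<bar> + norm z * \<bar>r t\<bar>"
      unfolding \<beta>_def using norm_triangle_ineq4[of "of_real (q t)" "z * of_real (r t)"] by (simp add: norm_mult)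
    also have "\<dots> \<le> k\<^sup>2 * \<bar>q t\<bar> + k\<^sup>2 * \<bar>r t\<bar>"
    proof (intro add_mono mult_right_mono k)
      have "1 \<le> k\<^sup>2" using k(1) by (simp add: one_le_power)
      then show "\<bar>q t\<bar> \<le> k\<^sup>2 * \<bar>q t\<bar>" using mult_right_mono[of 1 "k\<^sup>2" "\<bar>q t\<bar>"] by simp
    qed simp
    finally have "norm (\<beta> z t) / k \<le> k * (\<bar>q t\<bar> + \<bar>r t\<bar>)"
      using k(1) by (simp add: field_simps power2_eq_square)
    then show "k * norm (\<alpha> t) + norm (\<beta> z t) / k \<le> k * (norm (\<alpha> t) + (\<bar>q t\<bar> + \<bar>r t\<bar>))"
      by (simp add: distrib_left)
  qed
  also have "\<dots> = k * \<Omega>" unfolding \<Omega>_def by (rule integral_mult_right)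
  finally show ?thesis .
qed

lemma sys_bound:
  assumes s: "sys z f u v" and f: "(\<lambda>t. of_real (r t) * f t) absolutely_integrable_on {a..b}"
    and k: "k \<ge> 1" "norm z \<le> k\<^sup>2" and x: "x \<in> {a..b}"
  shows "k * norm (u x) + norm (v x) \<le>
    (k * norm (u a) + norm (v a) + integral {a..b} (\<lambda>t. norm (of_real (r t) * f t))) * exp (k * \<Omega>)"
proof -
  have l: "lin_sys a b \<alpha> (\<beta> z) (\<lambda>t. - (of_real (r t) * f t)) u v" using s by (simp add: sys_def)
  have g: "(\<lambda>t. - (of_real (r t) * f t)) absolutely_integrable_on {a..b}"
    using absolutely_integrable_linear[OF f bounded_linear_minus[OF bounded_linear_ident]] by (simp add: comp_def)
  have "k * norm (u x) + norm (v x) \<le>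
    (k * norm (u a) + norm (v a) + integral {a..b} (\<lambda>t. norm (of_real (r t) * f t))) *
      exp (integral {a..b} (\<lambda>t. k * norm (\<alpha> t) + norm (\<beta> z t) / k))"
    using lin_sys_bound[OF l ab' abs_int(1,2) g _ x, of k] k(1) by simp
  also have "\<dots> \<le> (k * norm (u a) + norm (v a) + integral {a..b} (\<lambda>t. norm (of_real (r t) * f t))) * exp (k * \<Omega>)"
  proof (rule mult_left_mono)
    show "exp (integral {a..b} (\<lambda>t. k * norm (\<alpha> t) + norm (\<beta> z t) / k)) \<le> exp (k * \<Omega>)"
      using weight_integral_le[OF k] by simp
    have "integral {a..b} (\<lambda>t. norm (of_real (r t) * f t)) \<ge> 0"
      by (rule integral_nonneg[OF absolutely_integrable_on_imp_integrable_on[OF absolutely_integrable_norm'[OF f]]]) simp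
    then show "0 \<le> k * norm (u a) + norm (v a) + integral {a..b} (\<lambda>t. norm (of_real (r t) * f t))"
      using k(1) by simp
  qed
  finally show ?thesis .
qed

lemma integral_forcing_le:
  fixes f :: "real \<Rightarrow> complex"
  assumes f: "continuous_on {a..b} f" and B: "\<And>t. t \<in> {a..b} \<Longrightarrow> norm (f t) \<le> B"
  shows "(\<lambda>t. of_real (r t) * f t) absolutely_integrable_on {a..b}"
    and "integral {a..b} (\<lambda>t. norm (of_real (r t) * f t)) \<le> B * R\<^sub>r"
proof -
  show 1: "(\<lambda>t. of_real (r t) * f t) absolutely_integrable_on {a..b}"
    by (rule absolutely_integrable_mult_continuous[OF abs_int(3) f])
  have "integral {a..b} (\<lambda>t. norm (of_real (r t) * f t)) \<le> integral {a..b} (\<lambda>t. B * \<bar>r t\<bar>)"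
  proof (rule integral_le)
    show "(\<lambda>t. norm (of_real (r t) * f t)) integrable_on {a..b}"
      by (rule absolutely_integrable_on_imp_integrable_on[OF absolutely_integrable_norm'[OF 1]])
    show "(\<lambda>t. B * \<bar>r t\<bar>) integrable_on {a..b}"
      by (rule integrable_on_mult_right[OF absolutely_integrable_on_imp_integrable_on[OF norm_abs_int(3)]])
    show "norm (of_real (r t) * f t) \<le> B * \<bar>r t\<bar>" if "t \<in> {a..b}" for t
      using mult_right_mono[OF B[OF that], of "\<bar>r t\<bar>"] by (simp add: norm_mult mult.commute)
  qed
  also have "\<dots> = B * R\<^sub>r" unfolding R\<^sub>r_def by (rule integral_mult_right)
  finally show "integral {a..b} (\<lambda>t. norm (of_real (r t) * f t)) \<le> B * R\<^sub>r" .
qed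

lemma sys_bound_continuous:
  assumes s: "sys z f u v" and f: "continuous_on {a..b} f" "\<And>t. t \<in> {a..b} \<Longrightarrow> norm (f t) \<le> B"
    and k: "k \<ge> 1" "norm z \<le> k\<^sup>2" and x: "x \<in> {a..b}"
  shows "norm (u x) \<le> (k * norm (u a) + norm (v a) + B * R\<^sub>r) * exp (k * \<Omega>)"
    "norm (v x) \<le> (k * norm (u a) + norm (v a) + B * R\<^sub>r) * exp (k * \<Omega>)"
proof -
  have "k * norm (u x) + norm (v x) \<le>
    (k * norm (u a) + norm (v a) + integral {a..b} (\<lambda>t. norm (of_real (r t) * f t))) * exp (k * \<Omega>)"
    by (rule sys_bound[OF s integral_forcing_le(1)[OF f] k x])
  also have "\<dots> \<le> (k * norm (u a) + norm (v a) + B * R\<^sub>r) * exp (k * \<Omega>)"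
    using integral_forcing_le(2)[OF f] by (intro mult_right_mono add_left_mono) auto
  finally have "k * norm (u x) + norm (v x) \<le> (k * norm (u a) + norm (v a) + B * R\<^sub>r) * exp (k * \<Omega>)" .
  moreover have "norm (u x) \<le> k * norm (u x)" using mult_right_mono[OF k(1) norm_ge_zero[of "u x"]] by simp
  ultimately show "norm (u x) \<le> (k * norm (u a) + norm (v a) + B * R\<^sub>r) * exp (k * \<Omega>)"
    "norm (v x) \<le> (k * norm (u a) + norm (v a) + B * R\<^sub>r) * exp (k * \<Omega>)"
    using norm_ge_zero[of "u x"] norm_ge_zero[of "v x"] by linarith+
qed

text \<open>Formal differentiation in z of the equation for \<open>U z\<close>, with fixed initial
  data, gives the equation for \<eta> with forcing \<open>U \<mu>\<close>. The solution bound is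
  applied twice: to U z - U \<mu>, which is of first order in z - \<mu>, and to the remainder of the
  linear approximation, which is of second order.\<close>

lemma sys_spectral_derivative:
  assumes s: "\<And>z. sys z (\<lambda>_. 0) (U z) (V z)" "\<And>z. U z a = c" "\<And>z. V z a = d"
    and \<eta>: "sys \<mu> (U \<mu>) \<eta> \<zeta>" "\<eta> a = 0" "\<zeta> a = 0"
  shows "((\<lambda>z. U z b) has_field_derivative \<eta> b) (at \<mu>)" "((\<lambda>z. V z b) has_field_derivative \<zeta> b) (at \<mu>)"
proof -
  \<comment> \<open>One k for all parameters in the unit disc around \<mu>: |z| \<le> |\<mu>| + 1
    \<le> k \<le> k^2.\<close>
  define k where "k = norm \<mu> + 2"
  have k1: "k \<ge> 1" by (simp add: k_def)
  have kz: "norm z \<le> k\<^sup>2" if "norm (z - \<mu>) \<le> 1" for z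
  proof -
    have "norm z \<le> norm \<mu> + 1" using norm_triangle_ineq[of "z - \<mu>" \<mu>] that by simp
    also have "\<dots> \<le> k * 1" by (simp add: k_def)
    also have "\<dots> \<le> k * k" using k1 by (intro mult_left_mono) auto
    finally show ?thesis by (simp add: power2_eq_square)
  qed
  define E where "E = exp (k * \<Omega>)"
  have E: "E > 0" by (simp add: E_def)
  define K where "K = (k * norm c + norm d) * E"
  have K: "norm (U z t) \<le> K" if "norm (z - \<mu>) \<le> 1" "t \<in> {a..b}" for z t
    using sys_bound_continuous(1)[OF s(1) _ _ k1 kz[OF that(1)] that(2), of 0] s(2,3) by (simp add: K_def E_def)
  define K' where "K' = K * R\<^sub>r * E"
  have \<Delta>: "norm (U z t - U \<mu> t) \<le> norm (z - \<mu>) * K'" if z: "norm (z - \<mu>) \<le> 1" and t: "t \<in> {a..b}" for z t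
  proof -
    have s1: "sys \<mu> (\<lambda>t. (z - \<mu>) * U z t) (U z) (V z)" using sys_shift[OF s(1)[of z], of \<mu>] by simp
    have s2: "sys \<mu> (\<lambda>t. (z - \<mu>) * U z t) (\<lambda>t. U z t - U \<mu> t) (\<lambda>t. V z t - V \<mu> t)"
      using sys_combination[OF s1 s(1)[of \<mu>], of 1 "-1"] by simp
    have "norm (U z t - U \<mu> t) \<le> (k * norm (U z a - U \<mu> a) + norm (V z a - V \<mu> a) + (norm (z - \<mu>) * K) * R\<^sub>r) * exp (k * \<Omega>)"
    proof (rule sys_bound_continuous(1)[OF s2 _ _ k1 _ t])
      show "continuous_on {a..b} (\<lambda>t. (z - \<mu>) * U z t)"
        using sysD(4)[OF s(1)[of z]] by (intro continuous_intros)
      show "norm ((z - \<mu>) * U z t) \<le> norm (z - \<mu>) * K" if "t \<in> {a..b}" for t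
        using K[OF z that] by (simp add: norm_mult mult_left_mono)
      show "norm \<mu> \<le> k\<^sup>2" by (rule kz) simp
    qed
    then show ?thesis by (simp add: s(2,3) K'_def E_def mult.assoc)
  qed
  have D: "norm (U z b - U \<mu> b - \<eta> b * (z - \<mu>)) \<le> norm (z - \<mu>) * (norm (z - \<mu>) * (K' * R\<^sub>r * E))"
    "norm (V z b - V \<mu> b - \<zeta> b * (z - \<mu>)) \<le> norm (z - \<mu>) * (norm (z - \<mu>) * (K' * R\<^sub>r * E))"
    if z: "norm (z - \<mu>) \<le> 1" for z
  proof -
    have s1: "sys \<mu> (\<lambda>t. (z - \<mu>) * U z t) (U z) (V z)" using sys_shift[OF s(1)[of z], of \<mu>] by simp
    have s2: "sys \<mu> (\<lambda>t. (z - \<mu>) * U z t) (\<lambda>t. U z t - U \<mu> t) (\<lambda>t. V z t - V \<mu> t)"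
      using sys_combination[OF s1 s(1)[of \<mu>], of 1 "-1"] by simp
    \<comment> \<open>The remainder has zero initial data and the forcing (z - \<mu>) (U z - U
      \<mu>), which is already of second order.\<close>
    have s3: "sys \<mu> (\<lambda>t. (z - \<mu>) * (U z t - U \<mu> t)) (\<lambda>t. U z t - U \<mu> t - \<eta> t * (z - \<mu>)) (\<lambda>t. V z t - V \<mu> t - \<zeta> t * (z - \<mu>))"
      using sys_combination[OF s2 \<eta>(1), of 1 "- (z - \<mu>)"] by (simp add: algebra_simps)
    have c: "continuous_on {a..b} (\<lambda>t. (z - \<mu>) * (U z t - U \<mu> t))"
      using sysD(4)[OF s(1)[of z]] sysD(4)[OF s(1)[of \<mu>]] by (intro continuous_intros)
    have B: "norm ((z - \<mu>) * (U z t - U \<mu> t)) \<le> norm (z - \<mu>) * (norm (z - \<mu>) * K')" if "t \<in> {a..b}" for t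
      using \<Delta>[OF z that] by (simp add: norm_mult mult_left_mono)
    have kl: "norm \<mu> \<le> k\<^sup>2" by (rule kz) simp
    have bb: "b \<in> {a..b}" using ab' by simp
    note * = sys_bound_continuous[OF s3 c B k1 kl bb]
    show "norm (U z b - U \<mu> b - \<eta> b * (z - \<mu>)) \<le> norm (z - \<mu>) * (norm (z - \<mu>) * (K' * R\<^sub>r * E))"
      "norm (V z b - V \<mu> b - \<zeta> b * (z - \<mu>)) \<le> norm (z - \<mu>) * (norm (z - \<mu>) * (K' * R\<^sub>r * E))"
      using * by (simp_all add: s(2,3) \<eta>(2,3) E_def mult.assoc)
  qed
  have gen: "(f has_field_derivative D) (at \<mu>)"
    if "\<And>z. norm (z - \<mu>) \<le> 1 \<Longrightarrow> norm (f z - f \<mu> - D * (z - \<mu>)) \<le> norm (z - \<mu>) * (norm (z - \<mu>) * C)" for f D C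
    unfolding has_field_derivative_def has_derivative_at_alt
  proof (intro conjI allI impI bounded_linear_mult_right)
    fix e :: real assume e: "e > 0"
    show "\<exists>d>0. \<forall>y. norm (y - \<mu>) < d \<longrightarrow> norm (f y - f \<mu> - D * (y - \<mu>)) \<le> e * norm (y - \<mu>)"
    proof (intro exI[of _ "min 1 (e / (\<bar>C\<bar> + 1))"] conjI allI impI)
      fix y assume y: "norm (y - \<mu>) < min 1 (e / (\<bar>C\<bar> + 1))"
      have "norm (y - \<mu>) * C \<le> norm (y - \<mu>) * (\<bar>C\<bar> + 1)" by (intro mult_left_mono) auto
      also have "\<dots> \<le> e" using y by (simp add: field_simps)
      finally have "norm (y - \<mu>) * (norm (y - \<mu>) * C) \<le> norm (y - \<mu>) * e" by (intro mult_left_mono) auto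
      then show "norm (f y - f \<mu> - D * (y - \<mu>)) \<le> e * norm (y - \<mu>)"
        using that[of y] y by (simp add: mult.commute)
    qed (use e in auto)
  qed
  show "((\<lambda>z. U z b) has_field_derivative \<eta> b) (at \<mu>)" by (rule gen[OF D(1)])
  show "((\<lambda>z. V z b) has_field_derivative \<zeta> b) (at \<mu>)" by (rule gen[OF D(2)])
qed

lemma endpoint_holomorphic:
  "(\<lambda>z. \<theta> z b) holomorphic_on UNIV" "(\<lambda>z. \<theta>' z b) holomorphic_on UNIV"
  "(\<lambda>z. \<phi> z b) holomorphic_on UNIV" "(\<lambda>z. \<phi>' z b) holomorphic_on UNIV"
proof -
  have *: "(\<lambda>z. U z b) holomorphic_on UNIV \<and> (\<lambda>z. V z b) holomorphic_on UNIV"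
    if s: "\<And>z. sys z (\<lambda>_. 0) (U z) (V z)" "\<And>z. U z a = c" "\<And>z. V z a = d" for U V c d
  proof -
    have "\<exists>\<eta> \<zeta>. sys \<mu> (U \<mu>) \<eta> \<zeta> \<and> \<eta> a = 0 \<and> \<zeta> a = 0" for \<mu>
      by (intro sys_exists absolutely_integrable_mult_continuous abs_int sysD(4)[OF s(1)])
    then show ?thesis
      using sys_spectral_derivative[OF s] unfolding holomorphic_on_open[OF open_UNIV] by blast
  qed
  show "(\<lambda>z. \<theta> z b) holomorphic_on UNIV" "(\<lambda>z. \<theta>' z b) holomorphic_on UNIV"
    using *[OF theta] by auto
  show "(\<lambda>z. \<phi> z b) holomorphic_on UNIV" "(\<lambda>z. \<phi>' z b) holomorphic_on UNIV"
    using *[OF phi] by auto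
qed

lemma w_holomorphic: "w11 holomorphic_on UNIV" "w12 holomorphic_on UNIV" "w21 holomorphic_on UNIV" "w22 holomorphic_on UNIV"
  by (cases bc; unfold w11_def[abs_def] w12_def[abs_def] w21_def[abs_def] w22_def[abs_def]; simp; intro holomorphic_intros endpoint_holomorphic)+

lemma char_holomorphic: "F holomorphic_on UNIV"
  unfolding char_eq_det[abs_def] by (intro holomorphic_intros w_holomorphic)

lemma no_jordan_chain:
  assumes cd: "(c, d) \<noteq> (0, 0)" "c * w11 \<mu> + d * w12 \<mu> = 0" "c * w21 \<mu> + d * w22 \<mu> = 0"
    and ef: "e * w11 \<mu> + f * w12 \<mu> + (c * deriv w11 \<mu> + d * deriv w12 \<mu>) = 0"
      "e * w21 \<mu> + f * w22 \<mu> + (c * deriv w21 \<mu> + d * deriv w22 \<mu>) = 0"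
  shows False
proof -
  define U where "U = (\<lambda>z t. c * \<theta> z t + d * \<phi> z t)"
  define V where "V = (\<lambda>z t. c * \<theta>' z t + d * \<phi>' z t)"
  have s: "sys z (\<lambda>_. 0) (U z) (V z)" "U z a = c" "V z a = d" for z
    using sys_hom_combination[of z c d] by (simp_all add: U_def V_def theta phi)
  have cU: "continuous_on {a..b} (U \<mu>)" by (rule sysD(4)[OF s(1)])
  obtain \<eta>0 \<zeta>0 where eta0: "sys \<mu> (U \<mu>) \<eta>0 \<zeta>0" "\<eta>0 a = 0" "\<zeta>0 a = 0"
    using sys_exists[OF absolutely_integrable_mult_continuous[OF abs_int(3) cU], of \<mu> 0 0] by blast
  note der = sys_spectral_derivative[OF s eta0]
  have b1: "c * w11 z + d * w12 z = bform1 bc c d (U z b) (V z b)" and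
    b2: "c * w21 z + d * w22 z = bform2 bc c d (U z b) (V z b)" for z
    using bform_combination[of c d z] by (simp_all add: U_def V_def)
  have dw: "(w has_field_derivative deriv w \<mu>) (at \<mu>)" if "w holomorphic_on UNIV" for w
    by (rule holomorphic_derivI[OF that open_UNIV UNIV_I])
  have D1: "((\<lambda>z. c * w11 z + d * w12 z) has_field_derivative c * deriv w11 \<mu> + d * deriv w12 \<mu>) (at \<mu>)"
    and D2: "((\<lambda>z. c * w21 z + d * w22 z) has_field_derivative c * deriv w21 \<mu> + d * deriv w22 \<mu>) (at \<mu>)"
    by (intro DERIV_add DERIV_cmult dw w_holomorphic)+
  \<comment> \<open>The initial data of \<open>U z\<close> do not depend on z, so differentiating
    the linear boundary forms amounts to inserting the z-derivative \<eta>0 with initial data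
    0.\<close>
  have "((\<lambda>z. bform1 bc c d (U z b) (V z b)) has_field_derivative bform1 bc 0 0 (\<eta>0 b) (\<zeta>0 b)) (at \<mu>)"
    by (cases bc) (use der in \<open>auto intro!: derivative_eq_intros\<close>)
  then have e1: "c * deriv w11 \<mu> + d * deriv w12 \<mu> = bform1 bc 0 0 (\<eta>0 b) (\<zeta>0 b)"
    using DERIV_unique D1 unfolding b1 by blast
  have "((\<lambda>z. bform2 bc c d (U z b) (V z b)) has_field_derivative bform2 bc 0 0 (\<eta>0 b) (\<zeta>0 b)) (at \<mu>)"
    by (cases bc) (use der in \<open>auto intro!: derivative_eq_intros\<close>)
  then have e2: "c * deriv w21 \<mu> + d * deriv w22 \<mu> = bform2 bc 0 0 (\<eta>0 b) (\<zeta>0 b)"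
    using DERIV_unique D2 unfolding b2 by blast
  \<comment> \<open>The second chain vector (e, f) supplies initial data that make both boundary
    forms of \<eta> vanish without changing its forcing.\<close>
  define \<eta> where "\<eta> = (\<lambda>t. \<eta>0 t + (e * \<theta> \<mu> t + f * \<phi> \<mu> t))"
  define \<zeta> where "\<zeta> = (\<lambda>t. \<zeta>0 t + (e * \<theta>' \<mu> t + f * \<phi>' \<mu> t))"
  have s\<eta>: "sys \<mu> (U \<mu>) \<eta> \<zeta>"
    using sys_combination[OF eta0(1) sys_hom_combination[of \<mu> e f], of 1 1] by (simp add: \<eta>_def \<zeta>_def)
  have \<eta>a: "\<eta> a = e" "\<zeta> a = f" by (simp_all add: \<eta>_def \<zeta>_def eta0 theta phi)
  have bc1: "bform1 bc (\<eta> a) (\<zeta> a) (\<eta> b) (\<zeta> b) = 0"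
    using bform_linear(1)[of bc 1 0 1 e 0 f "\<eta>0 b" "e * \<theta> \<mu> b + f * \<phi> \<mu> b" "\<zeta>0 b" "e * \<theta>' \<mu> b + f * \<phi>' \<mu> b"]
      bform_combination(1)[of e f \<mu>] ef(1) e1 unfolding \<eta>a by (simp add: \<eta>_def \<zeta>_def add.commute)
  have bc2: "bform2 bc (\<eta> a) (\<zeta> a) (\<eta> b) (\<zeta> b) = 0"
    using bform_linear(2)[of bc 1 0 1 e 0 f "\<eta>0 b" "e * \<theta> \<mu> b + f * \<phi> \<mu> b" "\<zeta>0 b" "e * \<theta>' \<mu> b + f * \<phi>' \<mu> b"]
      bform_combination(2)[of e f \<mu>] ef(2) e2 unfolding \<eta>a by (simp add: \<eta>_def \<zeta>_def add.commute)
  have u1: "bform1 bc (U \<mu> a) (V \<mu> a) (U \<mu> b) (V \<mu> b) = 0" "bform2 bc (U \<mu> a) (V \<mu> a) (U \<mu> b) (V \<mu> b) = 0"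
    using cd(2,3) b1 b2 by (simp_all add: s(2,3))
  have UE: "U \<mu> \<in> eigenspace M T \<mu>"
    unfolding eigenspace_iff using s(1) u1 by blast
  have Un: "U \<mu> \<noteq> (\<lambda>_. 0)" using combination_eq_zero_iff[of c \<mu> d] cd(1) by (auto simp: U_def)
  have real: "cnj \<mu> = \<mu>" by (rule eigenvalue_real[OF UE Un])
  have s1: "sys 0 (\<lambda>t. \<mu> * U \<mu> t) (U \<mu>) (V \<mu>)" using sys_shift[OF s(1)[of \<mu>], of 0] by simp
  have s2: "sys 0 (\<lambda>t. \<mu> * \<eta> t + U \<mu> t) \<eta> \<zeta>" using sys_shift[OF s\<eta>, of 0] by simp
  have c\<eta>: "continuous_on {a..b} \<eta>" by (rule sysD(4)[OF s\<eta>])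
  have L: "(\<lambda>t. \<mu> * U \<mu> t) \<in> L2 M" "(\<lambda>t. \<mu> * \<eta> t + U \<mu> t) \<in> L2 M"
    by (rule continuous_imp_L2, intro continuous_intros cU c\<eta>)+
  have "l2_inner M (\<lambda>t. \<mu> * U \<mu> t) \<eta> = l2_inner M (U \<mu>) (\<lambda>t. \<mu> * \<eta> t + U \<mu> t)"
    by (rule lagrange[OF s1 s2 u1 bc1 bc2 L])
  also have "\<dots> = l2_inner M (U \<mu>) (\<lambda>t. \<mu> * \<eta> t) + l2_inner M (U \<mu>) (U \<mu>)"
  proof -
    have i: "integrable M (\<lambda>x. cnj (U \<mu> x) * g x)" if "continuous_on {a..b} g" for g
    proof -
      have "continuous_on {a..b} (\<lambda>x. cnj (U \<mu> x) * g x)" using cU that by (intro continuous_intros)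
      from absolutely_integrable_mult_continuous[OF abs_int(3) this] show ?thesis
        using integrable_M_iff[OF continuous_imp_measurable_M[OF \<open>continuous_on {a..b} (\<lambda>x. cnj (U \<mu> x) * g x)\<close>]]
        by (simp add: scaleR_conv_of_real)
    qed
    have "continuous_on {a..b} (\<lambda>t. \<mu> * \<eta> t)" using c\<eta> by (intro continuous_intros)
    from Bochner_Integration.integral_add[OF i[OF this] i[OF cU]] show ?thesis
      unfolding l2_inner_def by (simp add: distrib_left)
  qed
  finally have "l2_inner M (U \<mu>) (U \<mu>) = 0" by (simp add: l2_inner_scale real)
  then have "AE x in M. U \<mu> x = 0"
    using l2_inner_self_eq_0_iff[OF continuous_imp_L2[OF cU]] by simp
  then show False using AE_zero_imp_zero[OF cU sysD(8)[OF s(1)]] Un by blast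
qed

text \<open>Eigenvalues are real, so i provides a point showing that \<open>F\<close> is not
  identically zero.\<close>

lemma char_at_ii: "F \<i> \<noteq> 0"
proof
  assume "F \<i> = 0"
  then obtain g where "g \<in> eigenspace M T \<i>" "g \<noteq> (\<lambda>_. 0)"
    using eigenvalues_iff_char eigenvalues_iff by blast
  then have "cnj \<i> = \<i>" by (rule eigenvalue_real)
  then show False by (simp add: complex_eq_iff)
qed

lemma zorder_char:
  assumes "F \<mu> = 0"
  shows "zorder F \<mu> = (if w11 \<mu> = 0 \<and> w12 \<mu> = 0 \<and> w21 \<mu> = 0 \<and> w22 \<mu> = 0 then 2 else 1)"
  unfolding char_eq_det[abs_def]
proof (rule zorder_det_of_no_jordan_chain[OF w_holomorphic])
  show "w11 \<mu> * w22 \<mu> - w12 \<mu> * w21 \<mu> = 0" using assms by (simp add: char_eq_det)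
qed (rule no_jordan_chain)

lemma multiplicity_eq:
  "multiplicity_op M T \<mu> = (if F \<mu> \<noteq> 0 then 0 else if w11 \<mu> = 0 \<and> w12 \<mu> = 0 \<and> w21 \<mu> = 0 \<and> w22 \<mu> = 0 then 2 else 1)"
proof -
  interpret vs: vector_space "\<lambda>(c::complex) (f::real \<Rightarrow> complex) x. c * f x"
    by (rule vector_space_complex_fun)
  let ?E = "eigenspace M T \<mu>"
  have fz: "(0 :: real \<Rightarrow> complex) = (\<lambda>_. 0)" by (simp add: fun_eq_iff)
  consider (none) "F \<mu> \<noteq> 0" | (two) "F \<mu> = 0" "w11 \<mu> = 0 \<and> w12 \<mu> = 0 \<and> w21 \<mu> = 0 \<and> w22 \<mu> = 0"
    | (one) "F \<mu> = 0" "\<not> (w11 \<mu> = 0 \<and> w12 \<mu> = 0 \<and> w21 \<mu> = 0 \<and> w22 \<mu> = 0)" by blast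
  then show ?thesis
  proof cases
    case none
    then have "g = 0" if "g \<in> ?E" for g
      using that eigenvalues_iff_char eigenvalues_iff fz by metis
    then have "?E \<subseteq> vs.span {}" by auto
    then have "vs.dim ?E = 0" using vs.dim_le_card[of ?E "{}"] by simp
    then show ?thesis using none by (simp add: multiplicity_op_def)
  next
    case two
    have E: "?E = {\<lambda>t. c * \<theta> \<mu> t + d * \<phi> \<mu> t | c d. True}"
      unfolding eigenspace_eq using two by auto
    have ne: "\<theta> \<mu> \<noteq> \<phi> \<mu>" using theta(2)[of \<mu>] phi(2)[of \<mu>] by auto
    have "vs.dim ?E = 2"
    proof (rule vs.dim_unique[of "{\<theta> \<mu>, \<phi> \<mu>}"])
      have "\<theta> \<mu> = (\<lambda>t. 1 * \<theta> \<mu> t + 0 * \<phi> \<mu> t)" "\<phi> \<mu> = (\<lambda>t. 0 * \<theta> \<mu> t + 1 * \<phi> \<mu> t)" by auto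
      then show "{\<theta> \<mu>, \<phi> \<mu>} \<subseteq> ?E" unfolding E by blast
      show "?E \<subseteq> vs.span {\<theta> \<mu>, \<phi> \<mu>}"
      proof
        fix g assume "g \<in> ?E"
        then obtain c d where g: "g = (\<lambda>t. c * \<theta> \<mu> t + d * \<phi> \<mu> t)" unfolding E by blast
        have "(\<lambda>t. c * \<theta> \<mu> t) + (\<lambda>t. d * \<phi> \<mu> t) \<in> vs.span {\<theta> \<mu>, \<phi> \<mu>}"
          by (intro vs.span_add vs.span_scale vs.span_base) auto
        then show "g \<in> vs.span {\<theta> \<mu>, \<phi> \<mu>}" by (simp add: g plus_fun_def)
      qed
      have "vs.independent {\<phi> \<mu>}"
        using combination_eq_zero_iff[of 0 \<mu> 1] fz by (simp add: vs.dependent_single)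
      moreover have "\<theta> \<mu> \<notin> vs.span {\<phi> \<mu>}"
      proof
        assume "\<theta> \<mu> \<in> vs.span {\<phi> \<mu>}"
        then obtain s where "\<theta> \<mu> = (\<lambda>x. s * \<phi> \<mu> x)" unfolding vs.span_singleton by blast
        then have "\<theta> \<mu> a = s * \<phi> \<mu> a" by metis
        then show False by (simp add: theta phi)
      qed
      ultimately show "vs.independent {\<theta> \<mu>, \<phi> \<mu>}"
        by (simp add: vs.independent_insert ne)
      show "card {\<theta> \<mu>, \<phi> \<mu>} = 2" using ne by simp
    qed
    then show ?thesis using two by (simp add: multiplicity_op_def)
  next
    case one
    obtain c d where cd: "(c, d) \<noteq> (0, 0)" "c * w11 \<mu> + d * w12 \<mu> = 0" "c * w21 \<mu> + d * w22 \<mu> = 0"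
      using two_by_two_kernel[of "w11 \<mu>" "w22 \<mu>" "w12 \<mu>" "w21 \<mu>"] one(1) by (metis char_eq_det)
    define g where "g = (\<lambda>t. c * \<theta> \<mu> t + d * \<phi> \<mu> t)"
    \<comment> \<open>Two linearly independent kernel vectors would force all four entries of the
      matrix to vanish.\<close>
    have mult: "\<exists>s. c' = s * c \<and> d' = s * d" if "c' * w11 \<mu> + d' * w12 \<mu> = 0" "c' * w21 \<mu> + d' * w22 \<mu> = 0" for c' d'
    proof -
      have z: "c' * d - d' * c = 0"
      proof (rule ccontr)
        assume nz: "c' * d - d' * c \<noteq> 0"
        have "w11 \<mu> * (c' * d - d' * c) = d * (c' * w11 \<mu> + d' * w12 \<mu>) - d' * (c * w11 \<mu> + d * w12 \<mu>)"
          "w12 \<mu> * (c' * d - d' * c) = c' * (c * w11 \<mu> + d * w12 \<mu>) - c * (c' * w11 \<mu> + d' * w12 \<mu>)"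
          "w21 \<mu> * (c' * d - d' * c) = d * (c' * w21 \<mu> + d' * w22 \<mu>) - d' * (c * w21 \<mu> + d * w22 \<mu>)"
          "w22 \<mu> * (c' * d - d' * c) = c' * (c * w21 \<mu> + d * w22 \<mu>) - c * (c' * w21 \<mu> + d' * w22 \<mu>)"
          by (simp_all add: algebra_simps)
        then have "w11 \<mu> * (c' * d - d' * c) = 0" "w12 \<mu> * (c' * d - d' * c) = 0"
          "w21 \<mu> * (c' * d - d' * c) = 0" "w22 \<mu> * (c' * d - d' * c) = 0"
          unfolding that cd(2,3) by simp_all
        then show False using nz one(2) by auto
      qed
      show ?thesis
      proof (cases "c = 0")
        case True
        with cd(1) z show ?thesis by (intro exI[of _ "d' / d"]) auto
      next
        case False
        with z show ?thesis by (intro exI[of _ "c' / c"]) (auto simp: field_simps)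
      qed
    qed
    have "vs.dim ?E = 1"
    proof (rule vs.dim_unique[of "{g}"])
      show "{g} \<subseteq> ?E" unfolding eigenspace_eq g_def using cd by blast
      show "?E \<subseteq> vs.span {g}"
      proof
        fix h assume "h \<in> ?E"
        then obtain c' d' where h: "h = (\<lambda>t. c' * \<theta> \<mu> t + d' * \<phi> \<mu> t)" "c' * w11 \<mu> + d' * w12 \<mu> = 0" "c' * w21 \<mu> + d' * w22 \<mu> = 0"
          unfolding eigenspace_eq by blast
        then obtain s where "c' = s * c" "d' = s * d" using mult by blast
        then have "h = (\<lambda>x. s * g x)" by (simp add: h g_def algebra_simps)
        then show "h \<in> vs.span {g}" unfolding vs.span_singleton by blast
      qed
      show "vs.independent {g}"
        using combination_eq_zero_iff[of c \<mu> d] cd(1) fz by (simp add: vs.dependent_single g_def)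
    qed simp
    then show ?thesis using one by (simp add: multiplicity_op_def)
  qed
qed

lemma zorder_char_eq_multiplicity: "F \<mu> = 0 \<Longrightarrow> zorder F \<mu> = int (multiplicity_op M T \<mu>)"
  using zorder_char[of \<mu>] multiplicity_eq[of \<mu>] by auto

lemma bform_bound: "\<exists>c\<ge>0. \<forall>ua va ub vb.
  norm (bform1 bc ua va ub vb) \<le> c * (norm ua + norm va + norm ub + norm vb) \<and>
  norm (bform2 bc ua va ub vb) \<le> c * (norm ua + norm va + norm ub + norm vb)"
proof -
  have lin: "\<exists>c\<ge>0. \<forall>ua va ub vb. norm (c1 * ua + c2 * va + c3 * ub + c4 * vb) \<le> c * (norm ua + norm va + norm ub + norm vb)"
    for c1 c2 c3 c4 :: complex
  proof (intro exI[of _ "norm c1 + norm c2 + norm c3 + norm c4"] conjI allI)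
    fix ua va ub vb
    have "norm (c1 * ua + c2 * va + c3 * ub + c4 * vb) \<le> norm (c1 * ua) + norm (c2 * va) + norm (c3 * ub) + norm (c4 * vb)"
      by (intro norm_triangle_le add_mono norm_triangle_ineq order_refl)
    also have "\<dots> \<le> (norm c1 + norm c2 + norm c3 + norm c4) * (norm ua + norm va + norm ub + norm vb)"
      unfolding norm_mult by (simp add: algebra_simps add_nonneg_nonneg)
    finally show "norm (c1 * ua + c2 * va + c3 * ub + c4 * vb) \<le> (norm c1 + norm c2 + norm c3 + norm c4) * (norm ua + norm va + norm ub + norm vb)" .
  qed (simp add: add_nonneg_nonneg)
  have r1: "\<exists>c1 c2 c3 c4. \<forall>ua va ub vb. bform1 bc ua va ub vb = c1 * ua + c2 * va + c3 * ub + c4 * vb"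
  proof (cases bc)
    case (Separated \<alpha> \<beta>)
    then show ?thesis
      by (intro exI[of _ "of_real (cos \<alpha>)"] exI[of _ "of_real (sin \<alpha>)"] exI[of _ 0] exI[of _ 0]) (simp add: mult.commute)
  next
    case (Coupled \<phi> R)
    then show ?thesis
      by (intro exI[of _ "- exp (\<i> * of_real \<phi>) * of_real (R$1$1)"] exI[of _ "- exp (\<i> * of_real \<phi>) * of_real (R$1$2)"]
          exI[of _ 1] exI[of _ 0]) (simp add: algebra_simps)
  qed
  have r2: "\<exists>c1 c2 c3 c4. \<forall>ua va ub vb. bform2 bc ua va ub vb = c1 * ua + c2 * va + c3 * ub + c4 * vb"
  proof (cases bc)
    case (Separated \<alpha> \<beta>)
    then show ?thesis
      by (intro exI[of _ 0] exI[of _ 0] exI[of _ "of_real (cos \<beta>)"] exI[of _ "- of_real (sin \<beta>)"]) (simp add: mult.commute)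
  next
    case (Coupled \<phi> R)
    then show ?thesis
      by (intro exI[of _ "- exp (\<i> * of_real \<phi>) * of_real (R$2$1)"] exI[of _ "- exp (\<i> * of_real \<phi>) * of_real (R$2$2)"]
          exI[of _ 0] exI[of _ 1]) (simp add: algebra_simps)
  qed
  obtain c where c: "c \<ge> 0" "\<And>ua va ub vb. norm (bform1 bc ua va ub vb) \<le> c * (norm ua + norm va + norm ub + norm vb)"
    using r1 lin by metis
  obtain c' where c': "c' \<ge> 0" "\<And>ua va ub vb. norm (bform2 bc ua va ub vb) \<le> c' * (norm ua + norm va + norm ub + norm vb)"
    using r2 lin by metis
  have le: "x * (norm ua + norm va + norm ub + norm vb) \<le> max c c' * (norm ua + norm va + norm ub + norm vb)"
    if "x = c \<or> x = c'" for x and ua va ub vb :: complex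
    using that by (intro mult_right_mono) auto
  show ?thesis
  proof (intro exI[of _ "max c c'"] conjI allI)
    show "norm (bform1 bc ua va ub vb) \<le> max c c' * (norm ua + norm va + norm ub + norm vb)" for ua va ub vb
      by (rule order_trans[OF c(2) le]) simp
    show "norm (bform2 bc ua va ub vb) \<le> max c c' * (norm ua + norm va + norm ub + norm vb)" for ua va ub vb
      by (rule order_trans[OF c'(2) le]) simp
  qed (use c(1) in simp)
qed

lemma char_growth: "\<exists>C\<ge>0. \<forall>z. norm (F z) \<le> exp (C * (1 + sqrt (norm z)))"
proof -
  obtain c where c: "c \<ge> 0" "\<And>ua va ub vb. norm (bform1 bc ua va ub vb) \<le> c * (norm ua + norm va + norm ub + norm vb)"
    "\<And>ua va ub vb. norm (bform2 bc ua va ub vb) \<le> c * (norm ua + norm va + norm ub + norm vb)"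
    using bform_bound by blast
  \<comment> \<open>With X = exp (k (\<Omega> + 1)) bounding the endpoint values, each matrix entry
    is at most c (1 + 2 X) \<le> 3 c X, so the determinant is at most 18 c^2 X^2. The square of X
    gives the first summand of \<open>C\<close>; the second absorbs 18 c^2 into an
    exponential.\<close>
  define C where "C = 2 * (\<Omega> + 1) + 18 * c\<^sup>2"
  have "norm (F z) \<le> exp (C * (1 + sqrt (norm z)))" for z
  proof -
    define k where "k = 1 + sqrt (norm z)"
    have k: "k \<ge> 1" by (simp add: k_def)
    have "(sqrt (norm z))\<^sup>2 \<le> k\<^sup>2" by (rule power_mono) (auto simp: k_def)
    then have kz: "norm z \<le> k\<^sup>2" by simp
    define X where "X = exp (k * (\<Omega> + 1))"
    have "k * (\<Omega> + 1) \<ge> 0" using k \<Omega>_nonneg by simp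
    then have X1: "X \<ge> 1" by (simp add: X_def)
    have kX: "k * exp (k * \<Omega>) \<le> X"
    proof -
      have "k \<le> exp k" using exp_ge_add_one_self[of k] by linarith
      then have "k * exp (k * \<Omega>) \<le> exp k * exp (k * \<Omega>)" by (rule mult_right_mono) simp
      then show ?thesis by (simp add: X_def distrib_left exp_add mult.commute)
    qed
    have "exp (k * \<Omega>) \<le> k * exp (k * \<Omega>)" using k mult_right_mono[OF k, of "exp (k * \<Omega>)"] by simp
    with kX have eX: "exp (k * \<Omega>) \<le> X" by linarith
    have bb: "b \<in> {a..b}" using ab' by simp
    have th: "norm (\<theta> z b) \<le> X" "norm (\<theta>' z b) \<le> X"
      using sys_bound_continuous[OF theta(1) _ _ k kz bb, of 0] kX by (simp_all add: theta)
    have ph: "norm (\<phi> z b) \<le> X" "norm (\<phi>' z b) \<le> X"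
      using sys_bound_continuous[OF phi(1) _ _ k kz bb, of 0] eX by (simp_all add: phi)
    have w: "norm (w11 z) \<le> c * (3 * X)" "norm (w12 z) \<le> c * (3 * X)" "norm (w21 z) \<le> c * (3 * X)" "norm (w22 z) \<le> c * (3 * X)"
      unfolding w11_def w12_def w21_def w22_def
      using th ph X1 by (intro order_trans[OF c(2)] order_trans[OF c(3)] mult_left_mono[OF _ c(1)]; simp)+
    have "norm (F z) \<le> norm (w11 z) * norm (w22 z) + norm (w12 z) * norm (w21 z)"
      unfolding char_eq_det by (rule order_trans[OF norm_triangle_ineq4]) (simp add: norm_mult)
    also have "\<dots> \<le> (c * (3 * X)) * (c * (3 * X)) + (c * (3 * X)) * (c * (3 * X))"
      using c(1) X1 by (intro add_mono mult_mono w) auto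
    also have "\<dots> = 18 * c\<^sup>2 * X\<^sup>2" by (simp add: power2_eq_square)
    also have "\<dots> \<le> exp (18 * c\<^sup>2 * k) * X\<^sup>2"
    proof (rule mult_right_mono)
      have "18 * c\<^sup>2 \<le> 18 * c\<^sup>2 * k" using mult_left_mono[OF k, of "18 * c\<^sup>2"] by simp
      also have "\<dots> \<le> exp (18 * c\<^sup>2 * k)" using exp_ge_add_one_self[of "18 * c\<^sup>2 * k"] by linarith
      finally show "18 * c\<^sup>2 \<le> exp (18 * c\<^sup>2 * k)" .
    qed simp
    also have "\<dots> = exp (C * k)"
      unfolding X_def C_def power2_eq_square exp_add[symmetric] by (simp add: algebra_simps)
    finally show ?thesis by (simp add: k_def)
  qed
  moreover have "C \<ge> 0" using \<Omega>_nonneg by (simp add: C_def)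
  ultimately show ?thesis by blast
qed

end

section \<open>The inverse and its trace\<close>

context sturm_liouville
begin

definition bvp :: "(real \<Rightarrow> complex) \<Rightarrow> (real \<Rightarrow> complex) \<Rightarrow> (real \<Rightarrow> complex) \<Rightarrow> bool"
  where "bvp f u v \<longleftrightarrow> sys 0 f u v \<and>
    bform1 bc (u a) (v a) (u b) (v b) = 0 \<and> bform2 bc (u a) (v a) (u b) (v b) = 0"

text \<open>The Green operator. \<open>op_inverse\<close> merely chooses a preimage, but domain
  functions are continuous on [a,b] and vanish outside, so for F 0 \<noteq> 0 the preimage is unique
  as a function.\<close>

definition G :: "(real \<Rightarrow> complex) \<Rightarrow> (real \<Rightarrow> complex)"
  where "G = app_op (op_inverse M T)"

lemma bvp_combination:
  assumes "bvp f u v" "bvp g w y"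
  shows "bvp (\<lambda>t. c * f t + d * g t) (\<lambda>t. c * u t + d * w t) (\<lambda>t. c * v t + d * y t)"
  using assms sys_combination[of 0 f u v g w y c d] unfolding bvp_def by (simp add: bform_linear)

text \<open>A particular solution with zero initial data is corrected by a homogeneous one. Its two
  coefficients enter the boundary forms through a matrix of determinant \<open>F 0\<close>.\<close>

lemma bvp_zero_data:
  assumes "sys 0 f u0 v0" "u0 a = 0" "v0 a = 0"
  shows "sys 0 f (\<lambda>t. u0 t + (c * \<theta> 0 t + d * \<phi> 0 t)) (\<lambda>t. v0 t + (c * \<theta>' 0 t + d * \<phi>' 0 t))"
    "bform1 bc c d (u0 b + (c * \<theta> 0 b + d * \<phi> 0 b)) (v0 b + (c * \<theta>' 0 b + d * \<phi>' 0 b)) =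
       bform1 bc 0 0 (u0 b) (v0 b) + (c * w11 0 + d * w12 0)"
    "bform2 bc c d (u0 b + (c * \<theta> 0 b + d * \<phi> 0 b)) (v0 b + (c * \<theta>' 0 b + d * \<phi>' 0 b)) =
       bform2 bc 0 0 (u0 b) (v0 b) + (c * w21 0 + d * w22 0)"
  using sys_combination[OF assms(1) sys_hom_combination[of 0 c d], of 1 1]
    bform_linear[of bc 1 0 1 c 0 d "u0 b" "c * \<theta> 0 b + d * \<phi> 0 b" "v0 b" "c * \<theta>' 0 b + d * \<phi>' 0 b"]
  by (simp_all add: bform_combination)

lemma bvp_exists:
  assumes F0: "F 0 \<noteq> 0" and f: "f \<in> L2 M"
  shows "\<exists>u v. bvp f u v"
proof -
  obtain u0 v0 where uv: "sys 0 f u0 v0" "u0 a = 0" "v0 a = 0"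
    using sys_exists[OF L2_abs_int[OF f], of 0 0 0] by blast
  obtain c d where "c * w11 0 + d * w12 0 = - bform1 bc 0 0 (u0 b) (v0 b)"
      "c * w21 0 + d * w22 0 = - bform2 bc 0 0 (u0 b) (v0 b)"
    using two_by_two_solve F0 unfolding char_eq_det by metis
  then have "bvp f (\<lambda>t. u0 t + (c * \<theta> 0 t + d * \<phi> 0 t)) (\<lambda>t. v0 t + (c * \<theta>' 0 t + d * \<phi>' 0 t))"
    unfolding bvp_def using bvp_zero_data[OF uv] by (simp add: uv theta phi)
  then show ?thesis by blast
qed

lemma bvp_unique:
  assumes F0: "F 0 \<noteq> 0" and "bvp f u v" "bvp f w y"
  shows "u = w"
proof -
  have "bvp (\<lambda>_. 0) (\<lambda>t. u t - w t) (\<lambda>t. v t - y t)"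
    using bvp_combination[OF assms(2,3), of 1 "-1"] by simp
  then have "(\<lambda>t. u t - w t) \<in> eigenspace M T 0" unfolding bvp_def eigenspace_iff by blast
  with F0 have "(\<lambda>t. u t - w t) = (\<lambda>_. 0)" using eigenvalues_iff_char eigenvalues_iff by blast
  then show ?thesis by (simp add: fun_eq_iff)
qed

lemma G_bvp:
  assumes F0: "F 0 \<noteq> 0" and f: "f \<in> L2 M"
  shows "\<exists>v. bvp f (G f) v"
proof -
  have "\<exists>g. g \<in> dom_op T \<and> (AE x in M. app_op T g x = f x)"
    using bvp_exists[OF F0 f] dom_T_iff[OF f] unfolding bvp_def by blast
  then have "G f \<in> dom_op T \<and> (AE x in M. app_op T (G f) x = f x)"
    unfolding G_def op_inverse_def snd_conv by (rule someI_ex)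
  then show ?thesis using dom_T_iff[OF f] unfolding bvp_def by blast
qed

lemma dom_op_inverse:
  assumes F0: "F 0 \<noteq> 0" shows "dom_op (op_inverse M T) = L2 M"
  unfolding op_inverse_def fst_conv
  using G_bvp[OF F0] dom_T_iff unfolding bvp_def by blast

lemma G_eq:
  assumes F0: "F 0 \<noteq> 0" and f: "f \<in> L2 M" and "bvp f u v" shows "G f = u"
  using G_bvp[OF F0 f] bvp_unique[OF F0] assms(3) by blast

lemma G_continuous:
  assumes F0: "F 0 \<noteq> 0" and f: "f \<in> L2 M"
  shows "continuous_on {a..b} (G f)" "\<And>x. x \<notin> {a..b} \<Longrightarrow> G f x = 0" "G f \<in> L2 M"
proof -
  obtain v where "sys 0 f (G f) v" using G_bvp[OF assms] by (auto simp: bvp_def)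
  from sysD(4,8)[OF this] continuous_imp_L2
  show "continuous_on {a..b} (G f)" "\<And>x. x \<notin> {a..b} \<Longrightarrow> G f x = 0" "G f \<in> L2 M" by blast+
qed

lemma G_linear:
  assumes F0: "F 0 \<noteq> 0" and f: "f \<in> L2 M" and g: "g \<in> L2 M"
  shows "G (\<lambda>x. c * f x + d * g x) = (\<lambda>x. c * G f x + d * G g x)"
proof -
  obtain v y where "bvp f (G f) v" "bvp g (G g) y" using G_bvp[OF F0] f g by metis
  from bvp_combination[OF this] show ?thesis by (rule G_eq[OF F0 L2_comb[OF f g]])
qed

lemma G_symmetric:
  assumes F0: "F 0 \<noteq> 0" and f: "f \<in> L2 M" and g: "g \<in> L2 M"
  shows "l2_inner M f (G g) = l2_inner M (G f) g"
proof -
  obtain v y where "bvp f (G f) v" "bvp g (G g) y" using G_bvp[OF F0] f g by metis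
  then show ?thesis unfolding bvp_def using lagrange[OF _ _ _ _ _ _ f g] by blast
qed

lemma G_injective:
  assumes F0: "F 0 \<noteq> 0" and f: "f \<in> L2 M" and 0: "G f = (\<lambda>_. 0)"
  shows "AE x in M. f x = 0"
proof -
  obtain v where "sys 0 f (\<lambda>_. 0) v" using G_bvp[OF F0 f] unfolding 0 bvp_def by blast
  from sysD(3)[OF this] have 1: "AE x in \<Lambda>. sl_tau a b p q r (\<lambda>_. 0) x = f x" by simp
  have "sys 0 (\<lambda>_. 0) (\<lambda>_. 0) (\<lambda>_. 0)" using sys_hom_combination[of 0 0 0] by simp
  from sysD(3)[OF this] 1 have "AE x in \<Lambda>. f x = 0" by (auto elim: eventually_elim2)
  then show ?thesis by (simp add: AE_M_iff)
qed

text \<open>Cauchy--Schwarz against the constant 1, whose norm is finite. The left side is an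
  integral with respect to \<open>M\<close>, because r is positive almost everywhere.\<close>

lemma integral_norm_forcing_le:
  assumes f: "f \<in> L2 M"
  shows "integral {a..b} (\<lambda>t. norm (of_real (r t) * f t)) \<le> sqrt (measure M (space M)) * l2_norm M f"
proof -
  have fm: "f \<in> borel_measurable M" by (rule L2_measurable[OF f])
  define N where "N = {x \<in> {a<..<b}. \<not> r x > 0} \<union> {a, b}"
  have "negligible {x \<in> {a<..<b}. \<not> r x > 0}"
    using r_pos by (subst AE_lebesgue_on_iff_negligible[symmetric]) simp_all
  then have N: "negligible N" unfolding N_def by (intro negligible_Un) auto
  have eq: "norm (of_real (r t) * f t) = r t *\<^sub>R norm (f t)" if "t \<in> {a..b} - N" for t
  proof -
    have "r t > 0" using that by (auto simp: N_def)
    then show ?thesis by (simp add: norm_mult)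
  qed
  have ai: "(\<lambda>t. norm (of_real (r t) * f t)) absolutely_integrable_on {a..b}"
    by (rule absolutely_integrable_norm'[OF L2_abs_int[OF f]])
  have ai': "(\<lambda>t. r t *\<^sub>R norm (f t)) absolutely_integrable_on {a..b}"
    by (rule absolutely_integrable_spike[OF ai N]) (use eq in simp)
  have "integral {a..b} (\<lambda>t. norm (of_real (r t) * f t)) = integral {a..b} (\<lambda>t. r t *\<^sub>R norm (f t))"
    by (rule integral_spike[OF N]) (use eq in simp)
  also have "\<dots> = (LINT x|M. norm (f x))" using fm ai' by (intro integral_M[symmetric]) auto
  finally have I: "integral {a..b} (\<lambda>t. norm (of_real (r t) * f t)) = (LINT x|M. norm (f x))" .
  interpret finite_measure M by (rule finite_measure_M)
  have one: "(\<lambda>_. 1) \<in> L2 M" by (simp add: L2_def)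
  have nf: "(\<lambda>x. of_real (norm (f x))) \<in> L2 M"
  proof -
    have "(\<lambda>y::complex. complex_of_real (norm y)) \<in> borel_measurable borel"
      by (intro borel_measurable_continuous_onI continuous_intros)
    from measurable_compose[OF fm this] show ?thesis using f by (simp add: L2_def)
  qed
  have "l2_inner M (\<lambda>_. 1) (\<lambda>x. of_real (norm (f x))) = of_real (LINT x|M. norm (f x))"
    by (simp add: l2_inner_def)
  then have "(LINT x|M. norm (f x))\<^sup>2 \<le> measure M (space M) * l2_sq M f"
    using l2_cauchy_schwarz[OF one nf] by simp
  then have "(LINT x|M. norm (f x)) \<le> sqrt (measure M (space M) * l2_sq M f)" by (rule real_le_rsqrt)
  then show ?thesis unfolding I by (simp add: real_sqrt_mult l2_norm_def)
qed

text \<open>The bound on the function yields boundedness of the inverse, the one on the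
  quasi-derivative equicontinuity. The initial data solve a linear system with determinant
  \<open>F 0\<close>, and Cramer's rule controls them by the particular solution with zero initial
  data.\<close>

lemma bvp_bound:
  assumes F0: "F 0 \<noteq> 0"
  obtains C where "C \<ge> 0" "\<And>f u v x. f \<in> L2 M \<Longrightarrow> bvp f u v \<Longrightarrow> x \<in> {a..b} \<Longrightarrow>
     norm (u x) \<le> C * l2_norm M f \<and> norm (v x) \<le> C * l2_norm M f"
proof -
  define E where "E = exp \<Omega>"
  obtain k where k: "k \<ge> 0" "\<And>ua va ub vb. norm (bform1 bc ua va ub vb) \<le> k * (norm ua + norm va + norm ub + norm vb)"
     "\<And>ua va ub vb. norm (bform2 bc ua va ub vb) \<le> k * (norm ua + norm va + norm ub + norm vb)"
    using bform_bound by blast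
  define W where "W = norm (w11 0) + norm (w12 0) + norm (w21 0) + norm (w22 0)"
  have W: "norm (w11 0) \<le> W" "norm (w12 0) \<le> W" "norm (w21 0) \<le> W" "norm (w22 0) \<le> W" "W \<ge> 0"
    unfolding W_def by simp_all
  \<comment> \<open>From Cramer's rule: with I the integral of the norm of the forcing, the right
    sides are at most k I E and the matrix entries at most W, so |c| |F 0| \<le> 2 k I E W, and
    likewise for d.\<close>
  define L where "L = 2 * (k * E * W) / norm (F 0)"
  have L: "L \<ge> 0" unfolding L_def E_def using k(1) W by simp
  define C where "C = (2 * L + 1) * E * sqrt (measure M (space M))"
  have "norm (u x) \<le> C * l2_norm M f \<and> norm (v x) \<le> C * l2_norm M f"
    if f: "f \<in> L2 M" and uv: "bvp f u v" and x: "x \<in> {a..b}" for f u v x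
  proof -
    define I where "I = integral {a..b} (\<lambda>t. norm (of_real (r t) * f t))"
    have I: "I \<ge> 0" unfolding I_def
      by (rule integral_nonneg[OF absolutely_integrable_on_imp_integrable_on[OF absolutely_integrable_norm'[OF L2_abs_int[OF f]]]]) simp
    have s: "sys 0 f u v" using uv by (simp add: bvp_def)
    define c where "c = u a" define d where "d = v a"
    obtain u0 v0 where uv0: "sys 0 f u0 v0" "u0 a = 0" "v0 a = 0"
      using sys_exists[OF L2_abs_int[OF f], of 0 0 0] by blast
    have bnd0: "norm (u0 b) + norm (v0 b) \<le> I * E"
      using sys_bound[OF uv0(1) L2_abs_int[OF f], of 1 b] ab by (simp add: uv0 I_def E_def)
    have e: "u = (\<lambda>t. u0 t + (c * \<theta> 0 t + d * \<phi> 0 t))" "v = (\<lambda>t. v0 t + (c * \<theta>' 0 t + d * \<phi>' 0 t))"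
      by (rule sys_unique[OF s bvp_zero_data(1)[OF uv0]]; simp add: uv0 theta phi c_def d_def)+
    have eb: "u b = u0 b + (c * \<theta> 0 b + d * \<phi> 0 b)" "v b = v0 b + (c * \<theta>' 0 b + d * \<phi>' 0 b)"
      using fun_cong[OF e(1), of b] fun_cong[OF e(2), of b] by simp_all
    define S1 where "S1 = bform1 bc 0 0 (u0 b) (v0 b)" define S2 where "S2 = bform2 bc 0 0 (u0 b) (v0 b)"
    have S: "S1 + (c * w11 0 + d * w12 0) = 0" "S2 + (c * w21 0 + d * w22 0) = 0"
      using uv unfolding bvp_def c_def[symmetric] d_def[symmetric] eb bvp_zero_data(2,3)[OF uv0] S1_def S2_def by auto
    have S_le: "norm S1 \<le> k * (I * E)" "norm S2 \<le> k * (I * E)"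
      using k(2)[of 0 0 "u0 b" "v0 b"] k(3)[of 0 0 "u0 b" "v0 b"] mult_left_mono[OF bnd0 k(1)] unfolding S1_def S2_def by auto
    have "c * F 0 = S2 * w12 0 - S1 * w22 0" "d * F 0 = S1 * w21 0 - S2 * w11 0"
    proof -
      have S': "S1 = - (c * w11 0 + d * w12 0)" "S2 = - (c * w21 0 + d * w22 0)" using S by (simp_all only: eq_neg_iff_add_eq_0)
      then show "c * F 0 = S2 * w12 0 - S1 * w22 0" "d * F 0 = S1 * w21 0 - S2 * w11 0"
        unfolding char_eq_det S' by (simp_all add: algebra_simps)
    qed
    then have "norm c * norm (F 0) = norm (S2 * w12 0 - S1 * w22 0)" "norm d * norm (F 0) = norm (S1 * w21 0 - S2 * w11 0)"
      by (simp_all flip: norm_mult)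
    moreover have tw: "norm (s * w - t * w') \<le> k * (I * E) * W + k * (I * E) * W"
      if "norm s \<le> k * (I * E)" "norm t \<le> k * (I * E)" "norm w \<le> W" "norm w' \<le> W" for s t w w' :: complex
    proof -
      have "k * (I * E) \<ge> 0" using k(1) I by (simp add: E_def)
      with that W(5) show ?thesis
        by (intro order_trans[OF norm_triangle_ineq4] add_mono) (auto simp: norm_mult intro!: mult_mono)
    qed
    ultimately have "norm c * norm (F 0) \<le> 2 * (k * (I * E) * W)" "norm d * norm (F 0) \<le> 2 * (k * (I * E) * W)"
      using tw[OF S_le(2,1) W(2,4)] tw[OF S_le W(3,1)] by linarith+
    then have cd: "norm c \<le> L * I" "norm d \<le> L * I"
      using F0 unfolding L_def by (simp_all add: field_simps)
    have "norm (u x) + norm (v x) \<le> (norm c + norm d + I) * E"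
      using sys_bound[OF s L2_abs_int[OF f], of 1 x] x by (simp add: c_def d_def I_def E_def)
    also have "\<dots> \<le> ((2 * L + 1) * I) * E"
      using cd by (intro mult_right_mono) (auto simp: algebra_simps E_def)
    also have "\<dots> \<le> ((2 * L + 1) * (sqrt (measure M (space M)) * l2_norm M f)) * E"
      using integral_norm_forcing_le[OF f] L unfolding I_def[symmetric] by (intro mult_right_mono mult_left_mono) (auto simp: E_def)
    also have "\<dots> = C * l2_norm M f" by (simp add: C_def)
    finally show ?thesis using norm_ge_zero[of "u x"] norm_ge_zero[of "v x"] by linarith
  qed
  moreover have "C \<ge> 0" unfolding C_def E_def using L by simp
  ultimately show ?thesis using that by blast
qed

lemma l2_sq_le_sup:
  assumes u: "continuous_on {a..b} u" and B: "\<And>x. x \<in> {a..b} \<Longrightarrow> norm (u x) \<le> B"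
  shows "l2_sq M u \<le> B\<^sup>2 * measure M (space M)"
proof -
  interpret finite_measure M by (rule finite_measure_M)
  have "l2_sq M u \<le> (LINT x|M. B\<^sup>2)"
    using continuous_imp_L2[OF u] B
    by (intro integral_mono) (auto simp: L2_def sets_M intro!: power_mono)
  then show ?thesis by (simp add: mult.commute)
qed

text \<open>The quasi-derivatives are uniformly bounded by B, so B times the modulus of continuity
  of the integral of |1/p| serves all n at once.\<close>

lemma bvp_equicontinuous:
  assumes B: "\<And>n x. x \<in> {a..b} \<Longrightarrow> norm (v n x) \<le> B" and s: "\<And>n. sys 0 (f n) (u n) (v n)"
    and x: "x \<in> {a..b}" and e: "e > 0"
  shows "\<exists>d>0. \<forall>n y. y \<in> {a..b} \<and> norm (x - y) < d \<longrightarrow> norm (u n x - u n y) < (e::real)"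
proof -
  define A where "A y = integral {a..y} (\<lambda>t. norm (\<alpha> t))" for y
  have ai: "(\<lambda>t. norm (\<alpha> t)) absolutely_integrable_on {a..b}" by (rule norm_abs_int(1))
  have iA: "indef_int a b A (\<lambda>t. norm (\<alpha> t))" unfolding indef_int_def using ai by (simp add: A_def)
  have B0: "B \<ge> 0" using order_trans[OF norm_ge_zero B[OF x]] .
  have le: "norm (u n y - u n x) \<le> B * (A y - A x)" if "a \<le> x" "x \<le> y" "y \<le> b" for n x y
  proof -
    note iu = sysD(6)[OF s[of n]]
    have "u n y - u n x = integral {x..y} (\<lambda>t. \<alpha> t * v n t)" by (rule indef_int_diff[OF iu that])
    also have "norm \<dots> \<le> integral {x..y} (\<lambda>t. B * norm (\<alpha> t))"
    proof (rule integral_norm_bound_integral)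
      show "(\<lambda>t. \<alpha> t * v n t) integrable_on {x..y}"
        using that by (intro integrable_on_subinterval[OF absolutely_integrable_on_imp_integrable_on[OF indef_intD(1)[OF iu]]]) auto
      show "(\<lambda>t. B * norm (\<alpha> t)) integrable_on {x..y}"
        using that by (intro integrable_on_mult_right integrable_on_subinterval[OF absolutely_integrable_on_imp_integrable_on[OF ai]]) auto
      show "norm (\<alpha> t * v n t) \<le> B * norm (\<alpha> t)" if "t \<in> {x..y}" for t
        using B[of t n] that \<open>a \<le> x\<close> \<open>y \<le> b\<close> by (simp add: norm_mult mult.commute[of B] mult_left_mono)
    qed
    also have "\<dots> = B * (A y - A x)" unfolding indef_int_diff[OF iA that] by simp
    finally show ?thesis .
  qed
  have le': "norm (u n x - u n y) \<le> B * \<bar>A x - A y\<bar>" if "y \<in> {a..b}" for n y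
  proof (cases "x \<le> y")
    case True
    have "B * (A y - A x) \<le> B * \<bar>A x - A y\<bar>" using B0 by (intro mult_left_mono) auto
    then show ?thesis using le[of x y n] True x that by (simp add: norm_minus_commute)
  next
    case False
    have "B * (A x - A y) \<le> B * \<bar>A x - A y\<bar>" using B0 by (intro mult_left_mono) auto
    then show ?thesis using le[of y x n] False x that by simp
  qed
  have "continuous_on {a..b} A" by (rule indef_int_continuous_on[OF iA])
  then have "\<exists>d>0. \<forall>y\<in>{a..b}. dist y x < d \<longrightarrow> dist (A y) (A x) < e / (B + 1)"
    using x e B0 unfolding continuous_on_iff by simp
  then obtain d where d: "d > 0" "\<And>y. y \<in> {a..b} \<Longrightarrow> dist y x < d \<Longrightarrow> dist (A y) (A x) < e / (B + 1)" by blast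
  have "norm (u n x - u n y) < e" if "y \<in> {a..b}" "norm (x - y) < d" for n y
  proof -
    have "\<bar>A x - A y\<bar> < e / (B + 1)" using d(2)[OF that(1)] that(2) by (simp add: dist_real_def abs_minus_commute)
    then have "(B + 1) * \<bar>A x - A y\<bar> < e" using B0 by (simp add: field_simps)
    then show ?thesis using le'[OF that(1), of n] by (simp add: algebra_simps)
  qed
  with d(1) show ?thesis by blast
qed

lemma G_compact_symmetric:
  assumes F0: "F 0 \<noteq> 0"
  obtains C where "compact_symmetric M G C"
proof -
  obtain C where C: "C \<ge> 0" "\<And>f u v x. f \<in> L2 M \<Longrightarrow> bvp f u v \<Longrightarrow> x \<in> {a..b} \<Longrightarrow>
     norm (u x) \<le> C * l2_norm M f \<and> norm (v x) \<le> C * l2_norm M f" using bvp_bound[OF F0] by blast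
  define m where "m = measure M (space M)"
  have m: "m \<ge> 0" by (simp add: m_def)
  have "compact_symmetric M G (C\<^sup>2 * m)"
  proof
    show "G f \<in> L2 M" if "f \<in> L2 M" for f by (rule G_continuous(3)[OF F0 that])
    show "AE x in M. G (\<lambda>x. c * f x + d * g x) x = c * G f x + d * G g x" if "f \<in> L2 M" "g \<in> L2 M" for f g c d
      unfolding G_linear[OF F0 that] by simp
    show "l2_inner M f (G g) = l2_inner M (G f) g" if "f \<in> L2 M" "g \<in> L2 M" for f g
      by (rule G_symmetric[OF F0 that])
    show "l2_sq M (G f) \<le> C\<^sup>2 * m * l2_sq M f" if f: "f \<in> L2 M" for f
    proof -
      obtain v where "bvp f (G f) v" using G_bvp[OF F0 f] by blast
      then have "l2_sq M (G f) \<le> (C * l2_norm M f)\<^sup>2 * m"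
        unfolding m_def using C(2)[OF f] by (intro l2_sq_le_sup G_continuous(1)[OF F0 f]) blast
      then show ?thesis unfolding power_mult_distrib l2_norm_sq by (simp add: mult_ac)
    qed
    fix f :: "nat \<Rightarrow> real \<Rightarrow> complex"
    assume f: "\<And>n. f n \<in> L2 M" "\<And>n. l2_sq M (f n) \<le> 1"
    have f1: "l2_norm M (f n) \<le> 1" for n using f(2)[of n] by (simp add: l2_norm_def)
    obtain v where v: "\<And>n. bvp (f n) (G (f n)) (v n)" using G_bvp[OF F0 f(1)] by metis
    have le: "norm (G (f n) x) \<le> C" "norm (v n x) \<le> C" if "x \<in> {a..b}" for n x
      using C(2)[OF f(1) v that, of n] mult_left_mono[OF f1[of n] C(1)] by auto
    have s: "sys 0 (f n) (G (f n)) (v n)" for n using v by (simp add: bvp_def)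
    obtain g k where g: "continuous_on {a..b} g" and k: "strict_mono (k :: nat \<Rightarrow> nat)"
      and lim: "\<And>e. 0 < e \<Longrightarrow> \<exists>N. \<forall>n x. n \<ge> N \<and> x \<in> {a..b} \<longrightarrow> norm (G (f (k n)) x - g x) < e"
      using Arzela_Ascoli[of "{a..b}" "\<lambda>n. G (f n)" C, OF compact_Icc le(1) bvp_equicontinuous[OF le(2) s]] by blast
    have "(\<lambda>n. l2_sq M (\<lambda>x. G (f (k n)) x - g x)) \<longlonglongrightarrow> 0"
    proof (rule LIMSEQ_I)
      fix e :: real assume e: "e > 0"
      define d where "d = sqrt (e / (m + 1))"
      have d: "d > 0" "d\<^sup>2 * m < e" using e m by (simp_all add: d_def field_simps)
      obtain N where N: "\<And>n x. n \<ge> N \<Longrightarrow> x \<in> {a..b} \<Longrightarrow> norm (G (f (k n)) x - g x) < d" using lim[OF d(1)] by blast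
      have "l2_sq M (\<lambda>x. G (f (k n)) x - g x) \<le> d\<^sup>2 * m" if "n \<ge> N" for n
        unfolding m_def using N[OF that] g G_continuous(1)[OF F0 f(1)]
        by (intro l2_sq_le_sup continuous_intros) (auto intro: less_imp_le)
      then show "\<exists>no. \<forall>n\<ge>no. norm (l2_sq M (\<lambda>x. G (f (k n)) x - g x) - 0) < e" using d(2) by fastforce
    qed
    then show "\<exists>s g. strict_mono (s :: nat \<Rightarrow> nat) \<and> g \<in> L2 M \<and> (\<lambda>n. l2_sq M (\<lambda>x. G (f (s n)) x - g x)) \<longlonglongrightarrow> 0"
      using k continuous_imp_L2[OF g] by blast
  qed
  then show ?thesis using that by blast
qed

lemma bounded_op_inverse:
  assumes F0: "F 0 \<noteq> 0" shows "bounded_op M (op_inverse M T)"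
proof -
  obtain C where "compact_symmetric M G C" using G_compact_symmetric[OF F0] by blast
  then interpret K: compact_symmetric M G C .
  have "l2_norm M (G f) \<le> sqrt C * l2_norm M f" if "f \<in> L2 M" for f
    using real_sqrt_le_mono[OF K.K_bound[OF that]] by (simp add: l2_norm_def real_sqrt_mult)
  then show ?thesis
    unfolding bounded_op_def dom_op_inverse[OF F0] unfolding G_def[symmetric] using K.K_L2 K.K_lin by blast
qed


section \<open>Orthonormal bases of the eigenspaces and the trace\<close>

lemma eigenspace_comb:
  assumes "f \<in> eigenspace M T z" "g \<in> eigenspace M T z"
  shows "(\<lambda>x. c * f x + d * g x) \<in> eigenspace M T z"
proof -
  obtain h k where h: "sys z (\<lambda>_. 0) f h" "bform1 bc (f a) (h a) (f b) (h b) = 0" "bform2 bc (f a) (h a) (f b) (h b) = 0"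
    and k: "sys z (\<lambda>_. 0) g k" "bform1 bc (g a) (k a) (g b) (k b) = 0" "bform2 bc (g a) (k a) (g b) (k b) = 0"
    using assms unfolding eigenspace_iff by blast
  have "sys z (\<lambda>_. 0) (\<lambda>x. c * f x + d * g x) (\<lambda>x. c * h x + d * k x)"
    using sys_combination[OF h(1) k(1), of c d] by simp
  moreover have "bform1 bc (c * f a + d * g a) (c * h a + d * k a) (c * f b + d * g b) (c * h b + d * k b) = 0"
    "bform2 bc (c * f a + d * g a) (c * h a + d * k a) (c * f b + d * g b) (c * h b + d * k b) = 0"
    unfolding bform_linear using h k by simp_all
  ultimately show ?thesis unfolding eigenspace_iff by blast
qed

lemma eigenspace_zero: "(\<lambda>_. 0) \<in> eigenspace M T z"
  unfolding eigenspace_eq by (auto intro!: exI[of _ 0])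

text \<open>Take an orthonormal subset of largest size; sizes are at most 2 since the eigenspace
  lies in the span of \<theta> and \<phi>. Maximality gives completeness, hence spanning, so its
  size is the dimension that defines the multiplicity.\<close>

lemma eigenspace_orthonormal_basis:
  "\<exists>B \<subseteq> eigenspace M T z. orthonormal M B \<and> finite B \<and> card B = multiplicity_op M T z \<and>
     (\<forall>g\<in>eigenspace M T z. (\<forall>e\<in>B. l2_inner M e g = 0) \<longrightarrow> g = (\<lambda>_. 0))"
proof -
  interpret vs: vector_space "\<lambda>(c::complex) (f::real \<Rightarrow> complex) x. c * f x"
    by (rule vector_space_complex_fun)
  let ?V = "eigenspace M T z"
  have fz: "(0 :: real \<Rightarrow> complex) = (\<lambda>_. 0)" by (simp add: fun_eq_iff)
  have subsp: "vs.subspace ?V"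
  proof (rule vs.subspaceI)
    show "0 \<in> ?V" unfolding fz by (rule eigenspace_zero)
    show "f + g \<in> ?V" if "f \<in> ?V" "g \<in> ?V" for f g
      using eigenspace_comb[OF that, of 1 1] by (simp add: plus_fun_def)
    show "(\<lambda>x. c * f x) \<in> ?V" if "f \<in> ?V" for c f
      using eigenspace_comb[OF that that, of c 0] by simp
  qed
  have span: "?V \<subseteq> vs.span {\<theta> z, \<phi> z}"
  proof
    fix g assume "g \<in> ?V"
    then obtain c d where g: "g = (\<lambda>t. c * \<theta> z t + d * \<phi> z t)" unfolding eigenspace_eq by blast
    have "(\<lambda>t. c * \<theta> z t) + (\<lambda>t. d * \<phi> z t) \<in> vs.span {\<theta> z, \<phi> z}"
      by (intro vs.span_add vs.span_scale vs.span_base) auto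
    then show "g \<in> vs.span {\<theta> z, \<phi> z}" by (simp add: g plus_fun_def)
  qed
  define P where "P B \<longleftrightarrow> B \<subseteq> ?V \<and> orthonormal M B" for B
  have P_bound: "finite B \<and> card B \<le> 2" if "P B" for B
  proof -
    have "\<not> vs.dependent B" using that orthonormal.independent unfolding P_def by blast
    moreover have "B \<subseteq> vs.span {\<theta> z, \<phi> z}" using that span unfolding P_def by blast
    ultimately have "finite B \<and> card B \<le> card {\<theta> z, \<phi> z}" by (intro vs.independent_span_bound) auto
    moreover have "card {\<theta> z, \<phi> z} \<le> 2" by (simp add: card_insert_if)
    ultimately show ?thesis by linarith
  qed
  have "P {}" by (simp add: P_def orthonormal_def)
  moreover have "\<forall>B. P B \<longrightarrow> card B < 3" using P_bound by fastforce
  ultimately obtain B where B: "P B" and max: "\<And>B'. P B' \<Longrightarrow> card B' \<le> card B"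
    using ex_has_greatest_nat[of P "{}" card 3] by blast
  interpret B: orthonormal M B using B by (simp add: P_def)
  have BV: "B \<subseteq> ?V" and fin: "finite B" using B P_bound by (auto simp: P_def)
  have complete: "g = (\<lambda>_. 0)" if g: "g \<in> ?V" "\<And>e. e \<in> B \<Longrightarrow> l2_inner M e g = 0" for g
  proof (rule ccontr)
    assume "g \<noteq> (\<lambda>_. 0)"
    note gc = eigenspace_continuous[OF g(1)]
    have "l2_sq M g \<noteq> 0"
      using l2_sq_eq_0_iff[OF gc(3)] AE_zero_imp_zero[OF gc(1,2)] \<open>g \<noteq> (\<lambda>_. 0)\<close> by blast
    then have n: "l2_sq M g > 0" using l2_sq_nonneg[of M g] by linarith
    define s where "s = complex_of_real (1 / sqrt (l2_sq M g))"
    define e0 where "e0 = (\<lambda>x. s * g x)"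
    have e0V: "e0 \<in> ?V" using eigenspace_comb[OF g(1) g(1), of s 0] by (simp add: e0_def)
    have e00: "l2_inner M e0 e0 = 1"
    proof -
      have "l2_sq M e0 = (norm s)\<^sup>2 * l2_sq M g" by (simp add: e0_def norm_mult power_mult_distrib)
      also have "(norm s)\<^sup>2 = 1 / l2_sq M g" using n by (simp add: s_def norm_divide power_divide)
      finally show ?thesis using n by (simp add: l2_inner_self_eq)
    qed
    have e0B: "l2_inner M e e0 = 0" if "e \<in> B" for e unfolding e0_def l2_inner_scale g(2)[OF that] by simp
    then have Be0: "l2_inner M e0 e = 0" if "e \<in> B" for e
      using that l2_inner_cnj[of M e e0] by simp
    have "e0 \<notin> B" using e00 e0B by auto
    have "P (insert e0 B)"
      unfolding P_def orthonormal_def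
      using BV e0V B.sub eigenspace_continuous(3)[OF e0V] e00 e0B Be0 B.on \<open>e0 \<notin> B\<close> by auto
    from max[OF this] show False using \<open>e0 \<notin> B\<close> fin by simp
  qed
  have "?V \<subseteq> vs.span B"
  proof
    fix g assume g: "g \<in> ?V"
    note gL = eigenspace_continuous(3)[OF g]
    let ?S = "\<Sum>e\<in>B. (\<lambda>x. l2_inner M e g * e x)"
    have S: "?S = (\<lambda>x. \<Sum>e\<in>B. l2_inner M e g * e x)" by (simp add: fun_eq_iff sum_apply_fun)
    have "?S \<in> ?V" using BV by (intro vs.subspace_sum[OF subsp] vs.subspace_scale[OF subsp]) auto
    then have "g - ?S \<in> ?V" using vs.subspace_diff[OF subsp g] by blast
    then have "g - ?S = (\<lambda>_. 0)"
    proof (rule complete)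
      fix e assume e: "e \<in> B"
      have "l2_inner M e (\<lambda>x. 1 * g x + (-1) * ?S x) = 0"
        unfolding S using l2_inner_comb_right[OF B.in_L2[OF e] gL B.sum_in_L2[OF order_refl], of 1 "-1"]
          B.inner_sum[OF fin order_refl e] e by simp
      then show "l2_inner M e (g - ?S) = 0" by (simp add: fun_diff_def)
    qed
    then have "g = ?S" unfolding fz[symmetric] by simp
    moreover have "?S \<in> vs.span B" by (intro vs.span_sum vs.span_scale vs.span_base)
    ultimately show "g \<in> vs.span B" by metis
  qed
  then have "vs.dim ?V = card B" using vs.dim_unique[OF BV _ B.independent] by simp
  then show ?thesis using BV B fin complete unfolding P_def multiplicity_op_def by auto
qed

lemma eigenspaces_orthogonal:
  assumes f: "f \<in> eigenspace M T z" "f \<noteq> (\<lambda>_. 0)" and g: "g \<in> eigenspace M T w" and ne: "z \<noteq> w"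
  shows "l2_inner M f g = 0"
proof -
  obtain h where h: "sys z (\<lambda>_. 0) f h" "bform1 bc (f a) (h a) (f b) (h b) = 0" "bform2 bc (f a) (h a) (f b) (h b) = 0"
    using f unfolding eigenspace_iff by blast
  obtain k where k: "sys w (\<lambda>_. 0) g k" "bform1 bc (g a) (k a) (g b) (k b) = 0" "bform2 bc (g a) (k a) (g b) (k b) = 0"
    using g unfolding eigenspace_iff by blast
  have s: "sys 0 (\<lambda>t. z * f t) f h" "sys 0 (\<lambda>t. w * g t) g k"
    using sys_shift[OF h(1), of 0] sys_shift[OF k(1), of 0] by simp_all
  have "l2_inner M (\<lambda>t. z * f t) g = l2_inner M f (\<lambda>t. w * g t)"
    by (rule lagrange[OF s h(2,3) k(2,3) L2_scale L2_scale]) (rule eigenspace_continuous(3), rule f g)+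
  then have "z * l2_inner M f g = w * l2_inner M f g"
    unfolding l2_inner_scale eigenvalue_real[OF f] .
  with ne show ?thesis by simp
qed

lemma G_eigenvector:
  assumes F0: "F 0 \<noteq> 0" and g: "g \<in> eigenspace M T z" and z: "z \<noteq> 0"
  shows "G g = (\<lambda>x. 1 / z * g x)"
proof -
  obtain h where h: "sys z (\<lambda>_. 0) g h" "bform1 bc (g a) (h a) (g b) (h b) = 0" "bform2 bc (g a) (h a) (g b) (h b) = 0"
    using g unfolding eigenspace_iff by blast
  have "bvp (\<lambda>t. z * g t) g h" using sys_shift[OF h(1), of 0] h(2,3) by (simp add: bvp_def)
  from bvp_combination[OF this this, of "1/z" 0] z have "bvp g (\<lambda>x. 1 / z * g x) (\<lambda>x. 1 / z * h x)" by simp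
  then show ?thesis by (rule G_eq[OF F0 eigenspace_continuous(3)[OF g]])
qed

text \<open>The image \<open>G g\<close> is used because g is an arbitrary representative and need
  not lie in the domain, while its image does.\<close>

lemma G_eigenspace:
  assumes F0: "F 0 \<noteq> 0" and g: "g \<in> L2 M" and eig: "AE x in M. G g x = c * g x" and c: "c \<noteq> 0"
  shows "G g \<in> eigenspace M T (1 / c)"
proof -
  obtain v where v: "bvp g (G g) v" using G_bvp[OF F0 g] by blast
  then have s: "sys 0 g (G g) v" by (simp add: bvp_def)
  have "sys 0 (\<lambda>x. 1 / c * G g x) (G g) v"
  proof (rule sys_cong[OF s])
    show "AE x in \<Lambda>. g x = 1 / c * G g x" using eig[unfolded AE_M_iff] by eventually_elim (use c in simp)
  qed
  from sys_shift[OF this, of "1 / c"] have "sys (1 / c) (\<lambda>_. 0) (G g) v" by simp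
  with v show ?thesis unfolding eigenspace_iff bvp_def by blast
qed

text \<open>The diagonal entries are indexed by basis vectors, the hypotheses by zeros of
  \<open>F\<close>. Grouping the basis vectors by eigenvalue makes z contribute 1/z as often as its
  multiplicity says, which identifies the two sums.\<close>

theorem trace_op_inverse:
  assumes F0: "F 0 \<noteq> 0"
    and hs: "((\<lambda>z. of_nat (multiplicity_op M T z) / z) has_sum s) {z. F z = 0}"
    and summ: "(\<lambda>z. real (multiplicity_op M T z) / norm z) summable_on {z. F z = 0}"
  shows "trace_class M (op_inverse M T)" "op_trace M (op_inverse M T) = s"
proof -
  define Z where "Z = {z. F z = 0}"
  have Z0: "z \<noteq> 0" if "z \<in> Z" for z using that F0 by (auto simp: Z_def)
  obtain B where B: "\<And>z. B z \<subseteq> eigenspace M T z" "\<And>z. orthonormal M (B z)" "\<And>z. finite (B z)"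
      "\<And>z. card (B z) = multiplicity_op M T z"
      "\<And>z g. g \<in> eigenspace M T z \<Longrightarrow> (\<And>e. e \<in> B z \<Longrightarrow> l2_inner M e g = 0) \<Longrightarrow> g = (\<lambda>_. 0)"
    using eigenspace_orthonormal_basis by metis
  have B1: "l2_inner M e e = 1" if "e \<in> B z" for e z using orthonormal.on[OF B(2) that that] by simp
  have Bne: "e \<noteq> (\<lambda>_. 0)" if "e \<in> B z" for e z using B1[OF that] by (auto simp: l2_inner_def)
  have Borth: "l2_inner M e e' = 0" if "e \<in> B z" "e' \<in> B w" "z \<noteq> w" for e e' z w
    using eigenspaces_orthogonal[OF _ Bne[OF that(1)] _ that(3)] that B(1) by blast
  have Bdisj: "z = w" if "e \<in> B z" "e \<in> B w" for e z w
    using Borth[OF that] B1[OF that(1)] by auto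
  define E where "E = (\<Union>z\<in>Z. B z)"
  have BG: "G e = (\<lambda>x. 1 / z * e x)" if "z \<in> Z" "e \<in> B z" for z e
    using G_eigenvector[OF F0 _ Z0] that B(1) by blast
  have EL2: "E \<subseteq> L2 M" unfolding E_def using B(1) eigenspace_continuous(3) by blast
  have orth: "orthonormal M E"
  proof
    show "E \<subseteq> L2 M" by (rule EL2)
    fix e e' assume "e \<in> E" "e' \<in> E"
    then obtain z w where zw: "z \<in> Z" "e \<in> B z" "w \<in> Z" "e' \<in> B w" by (auto simp: E_def)
    show "l2_inner M e e' = (if e = e' then 1 else 0)"
    proof (cases "z = w")
      case True
      then show ?thesis using orthonormal.on[OF B(2) zw(2)] zw(4) by blast
    next
      case False
      then show ?thesis using Borth[OF zw(2,4)] Bdisj zw by auto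
    qed
  qed
  obtain C where "compact_symmetric M G C" using G_compact_symmetric[OF F0] by blast
  then interpret K: compact_symmetric M G C .
  have "orthonormal_basis M E"
    unfolding orthonormal_basis_iff
  proof (intro conjI orth ballI impI)
    fix f assume f: "f \<in> L2 M" "\<forall>e\<in>E. l2_inner M e f = 0"
    have "AE x in M. G f x = 0"
    proof (rule K.eigenvectors_complete[OF EL2])
      show "\<exists>\<mu>. AE x in M. G e x = \<mu> * e x" if e: "e \<in> E" for e
      proof -
        obtain z where "z \<in> Z" "e \<in> B z" using e by (auto simp: E_def)
        then show ?thesis by (intro exI[of _ "1 / z"]) (simp add: BG)
      qed
      fix g c assume g: "g \<in> L2 M" "\<And>e. e \<in> E \<Longrightarrow> l2_inner M e g = 0" "AE x in M. G g x = c * g x"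
      \<comment> \<open>For c = 0 continuity turns vanishing almost everywhere into vanishing. For c
        \<noteq> 0 the image lies in the eigenspace of 1/c and is orthogonal to the basis of that
        eigenspace. In both cases injectivity of \<open>G\<close> then removes g.\<close>
      have "G g = (\<lambda>_. 0)"
      proof (cases "c = 0")
        case True
        then show ?thesis using g(3) by (intro AE_zero_imp_zero G_continuous[OF F0 g(1)]) simp_all
      next
        case False
        note G1 = G_eigenspace[OF F0 g(1,3) False]
        show ?thesis
        proof (rule ccontr)
          assume "G g \<noteq> (\<lambda>_. 0)"
          then have "1 / c \<in> Z" using G1 eigenvalues_iff_char eigenvalues_iff unfolding Z_def by blast
          have "G g = (\<lambda>_. 0)"
          proof (rule B(5)[OF G1])
            fix e assume "e \<in> B (1 / c)"
            with \<open>1 / c \<in> Z\<close> have e: "e \<in> E" by (auto simp: E_def)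
            have eL: "e \<in> L2 M" using e EL2 by blast
            have "l2_inner M e (G g) = l2_inner M e (\<lambda>x. c * g x)"
              by (rule l2_inner_cong_AE[OF eL eL G_continuous(3)[OF F0 g(1)] L2_scale[OF g(1)] _ g(3)]) simp
            then show "l2_inner M e (G g) = 0" unfolding l2_inner_scale g(2)[OF e] by simp
          qed
          with \<open>G g \<noteq> (\<lambda>_. 0)\<close> show False by simp
        qed
      qed
      then show "AE x in M. g x = 0" by (rule G_injective[OF F0 g(1)])
    qed (use f in auto)
    then have "G f = (\<lambda>_. 0)" by (intro AE_zero_imp_zero G_continuous[OF F0 f(1)])
    then show "AE x in M. f x = 0" by (rule G_injective[OF F0 f(1)])
  qed
  then interpret E: orthonormal_base M E by unfold_locales
  \<comment> \<open>The eigenvalues are real, so taking the real part loses nothing;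
    \<open>trace_class_diagonal\<close> expects real diagonal entries.\<close>
  define \<mu> where "\<mu> e = Re (l2_inner M e (G e))" for e
  have mu: "of_real (\<mu> e) = 1 / z" if "z \<in> Z" "e \<in> B z" for z e
  proof -
    have "cnj z = z" using eigenvalue_real[OF _ Bne[OF that(2)]] B(1) that by blast
    then have "z = of_real (Re z)" by (simp add: complex_eq_iff)
    then have "1 / z = of_real (1 / Re z)" by (metis of_real_1 of_real_divide)
    moreover have "l2_inner M e (G e) = 1 / z" unfolding BG[OF that] l2_inner_scale B1[OF that(2)] by simp
    ultimately show ?thesis unfolding \<mu>_def by (metis Re_complex_of_real)
  qed
  have diag: "l2_inner M e (G f) = of_real (\<mu> e) * l2_inner M e f" if e: "e \<in> E" and f: "f \<in> L2 M" for e f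
  proof -
    obtain z where z: "z \<in> Z" "e \<in> B z" using e by (auto simp: E_def)
    have "l2_inner M e (G f) = l2_inner M (G e) f" by (rule G_symmetric[OF F0 E.in_L2[OF e] f])
    also have "\<dots> = cnj (1 / z) * l2_inner M e f" unfolding BG[OF z] l2_inner_scale ..
    also have "cnj (1 / z) = of_real (\<mu> e)" unfolding mu[OF z, symmetric] by simp
    finally show ?thesis .
  qed
  \<comment> \<open>Bases for different eigenvalues are disjoint, so sums over \<open>E\<close> can
    be written as iterated sums over eigenvalues and their basis vectors.\<close>
  have bij: "bij_betw snd (Sigma Z B) E"
    unfolding bij_betw_def
  proof
    show "inj_on snd (Sigma Z B)" using Bdisj by (auto simp: inj_on_def)
    show "snd ` Sigma Z B = E" unfolding E_def by force
  qed
  have inner: "((\<lambda>e. norm (\<mu> e)) has_sum real (multiplicity_op M T z) / norm z) (B z)" if "z \<in> Z" for z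
  proof (rule has_sum_finiteI[OF B(3)])
    have "norm (\<mu> e) = 1 / norm z" if "e \<in> B z" for e
      using arg_cong[OF mu[OF \<open>z \<in> Z\<close> that], of norm] by (simp add: norm_divide)
    then show "real (multiplicity_op M T z) / norm z = (\<Sum>e\<in>B z. norm (\<mu> e))" by (simp add: B(4))
  qed
  have "(\<lambda>y. norm (\<mu> (snd y))) summable_on Sigma Z B"
    by (rule summable_on_SigmaI[where g="\<lambda>z. real (multiplicity_op M T z) / norm z"])
       (use inner summ in \<open>simp_all add: Z_def\<close>)
  then have summ': "(\<lambda>e. norm (\<mu> e)) summable_on E"
    using summable_on_reindex_bij_betw[OF bij, of "\<lambda>e. norm (\<mu> e)"] by simp
  then have "\<mu> summable_on E" by (rule abs_summable_summable)
  then have "((\<lambda>e. of_real (\<mu> e) :: complex) has_sum of_real (infsum \<mu> E)) E" by (intro has_sum_of_real) simp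
  then have "((\<lambda>y. of_real (\<mu> (snd y)) :: complex) has_sum of_real (infsum \<mu> E)) (Sigma Z B)"
    using has_sum_reindex_bij_betw[OF bij, of "\<lambda>e. complex_of_real (\<mu> e)"] by simp
  then have "((\<lambda>z. of_nat (multiplicity_op M T z) / z) has_sum of_real (infsum \<mu> E)) Z"
  proof (rule has_sum_SigmaD)
    fix z assume z: "z \<in> Z"
    show "((\<lambda>e. of_real (\<mu> (snd (z, e)))) has_sum of_nat (multiplicity_op M T z) / z) (B z)"
      by (rule has_sum_finiteI[OF B(3)]) (simp add: mu[OF z] flip: B(4))
  qed
  with hs have s: "s = of_real (infsum \<mu> E)" unfolding Z_def by (rule has_sum_unique)
  show "trace_class M (op_inverse M T)" "op_trace M (op_inverse M T) = s"
    unfolding s using E.trace_class_diagonal[OF bounded_op_inverse[OF F0] _ summ'] diag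
    unfolding G_def by blast+
qed

end

section \<open>Zeros and orders translated into eigenvalues and multiplicities\<close>

theorem theorem4p1:
  fixes a b :: real
    and p q r :: "real \<Rightarrow> real"
    and bc :: sl_bc
    and M :: "real measure"
    and T :: "real l2_operator"
    and F :: "complex \<Rightarrow> complex"
    and m0 :: nat
    and coef bn :: "nat \<Rightarrow> complex"
  assumes "a < b"
    and "p \<in> borel_measurable (lebesgue_on {a<..<b})"
    and "q \<in> borel_measurable (lebesgue_on {a<..<b})"
    and "r \<in> borel_measurable (lebesgue_on {a<..<b})"
    and "AE x in lebesgue_on {a<..<b}. r x > 0"
    and "integrable (lebesgue_on {a<..<b}) r"
    and "AE x in lebesgue_on {a<..<b}. p x > 0"
    and "integrable (lebesgue_on {a<..<b}) (\<lambda>x. 1 / p x)"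
    and "integrable (lebesgue_on {a<..<b}) q"
    and "sl_bc_admissible bc"
    and "M = sl_measure a b r"
    and "T = sl_op a b p q r bc"
    and "F = sl_char a b p q r bc"
    and "m0 = multiplicity_op M T 0"
    and "\<forall>\<^sub>F z in nhds 0. (\<lambda>j. coef j * z ^ j) sums F z"
    and "bn 1 = coef (1 + m0) / coef m0"
    and "\<forall>j\<ge>2. bn j = coef (j + m0) / coef m0
           - (\<Sum>l=1..j-1. of_nat l / of_nat j * (coef (j - l + m0) / coef m0) * bn l)"
  shows "(\<forall>n::nat. n \<ge> 1 \<longrightarrow>
            (\<lambda>lam. norm (zeta_term M T (of_nat n) lam)) summable_on (eigenvalues M T - {0}) \<and>
            spectral_zeta M T (of_nat n) =
              - residue (\<lambda>z. z powi (- int n) * (deriv F z / F z)) 0 \<and>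
            - residue (\<lambda>z. z powi (- int n) * (deriv F z / F z)) 0 = - of_nat n * bn n) \<and>
         (0 \<notin> eigenvalues M T \<longrightarrow>
            trace_class M (op_inverse M T) \<and>
            op_trace M (op_inverse M T) = spectral_zeta M T 1 \<and>
            spectral_zeta M T 1 = - (coef 1 / coef 0))"
proof -
  interpret sturm_liouville a b p q r bc
    by unfold_locales (use assms(1,4-10) in blast)+
  have M: "M = sl_measure a b r" and T: "T = sl_op a b p q r bc" and F: "F = sl_char a b p q r bc"
    using assms(11-13) by blast+
  have mult: "F z = 0 \<Longrightarrow> multiplicity_op M T z = nat (zorder F z)" for z
    using zorder_char_eq_multiplicity[of z] unfolding M T F by simp
  have "multiplicity_op M T 0 = 0" if "F 0 \<noteq> 0" using that multiplicity_eq[of 0] unfolding M T F by simp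
  then have m0: "m0 = (if F 0 = 0 then nat (zorder F 0) else 0)" using assms(14) mult by simp
  obtain C where C: "C \<ge> 0" "\<And>z. norm (F z) \<le> exp (C * (1 + sqrt (norm z)))"
    using char_growth unfolding F by blast
  interpret Z: entire_zeros F C m0 coef bn \<i>
    using char_holomorphic char_at_ii C m0 assms(15-17) unfolding F by unfold_locales
  have ev: "eigenvalues M T = {z. F z = 0}" using eigenvalues_iff_char unfolding M T F by blast
  have zterm: "zeta_term M T (of_nat (Suc k)) z = of_nat (nat (zorder F z)) / z ^ Suc k"
    if "z \<in> {z. F z = 0} - {0}" for z k
  proof -
    \<comment> \<open>At a negative integer exponent the principal branch gives the reciprocal of
      the ordinary power for every nonzero base, negative eigenvalues included.\<close>
    have "z powr (- of_nat (Suc k)) = inverse (z ^ Suc k)"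
      using that by (simp only: powr_minus powr_nat) simp
    then show ?thesis using that mult[of z] by (simp only: zeta_term_def divide_inverse) simp
  qed
  have zeta: "((\<lambda>z. zeta_term M T (of_nat (Suc k)) z) has_sum - Z.g k) (eigenvalues M T - {0})" for k
    unfolding ev by (rule has_sum_cong[THEN iffD2, OF _ Z.zeros_power_sums(1)[of k]], rule zterm)
  have powers: "(\<lambda>z. norm (zeta_term M T (of_nat (Suc k)) z)) summable_on (eigenvalues M T - {0})" for k
  proof -
    have "norm (zeta_term M T (of_nat (Suc k)) z) = real (nat (zorder F z)) / norm z ^ Suc k"
      if "z \<in> {z. F z = 0} - {0}" for z
      unfolding zterm[OF that] norm_divide norm_power norm_of_nat ..
    then show ?thesis unfolding ev by (rule summable_on_cong[THEN iffD2, OF _ Z.zeros_power_sums(2)[of k]])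
  qed
  have zeta_eq: "spectral_zeta M T (of_nat (Suc k)) = - Z.g k" for k
    unfolding spectral_zeta_def by (rule infsumI[OF zeta])
  show ?thesis
  proof (intro conjI allI impI)
    fix n :: nat assume "n \<ge> 1"
    then obtain k where n: "n = Suc k" by (cases n) auto
    show "(\<lambda>lam. norm (zeta_term M T (of_nat n) lam)) summable_on (eigenvalues M T - {0})"
      unfolding n by (rule powers)
    show "spectral_zeta M T (of_nat n) = - residue (\<lambda>z. z powi (- int n) * (deriv F z / F z)) 0"
      unfolding n zeta_eq Z.residue_eq ..
    show "- residue (\<lambda>z. z powi (- int n) * (deriv F z / F z)) 0 = - of_nat n * bn n"
      using Z.g_eq_bn[of n] unfolding n Z.residue_eq by (simp del: of_nat_Suc)
  next
    assume "0 \<notin> eigenvalues M T"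
    then have F0: "F 0 \<noteq> 0" by (simp add: ev)
    then have minus: "{z. F z = 0} - {0} = {z. F z = 0}" by auto
    have m: "of_nat (multiplicity_op M T z) / z = of_nat (nat (zorder F z)) / z ^ Suc 0"
      "real (multiplicity_op M T z) / norm z = real (nat (zorder F z)) / norm z ^ Suc 0"
      if "z \<in> {z. F z = 0}" for z
      using mult[of z] that by simp_all
    have "((\<lambda>z. of_nat (multiplicity_op M T z) / z) has_sum - Z.g 0) {z. F z = 0}"
      by (rule has_sum_cong[THEN iffD2, OF _ Z.zeros_power_sums(1)[of 0, unfolded minus]], rule m)
    moreover have "(\<lambda>z. real (multiplicity_op M T z) / norm z) summable_on {z. F z = 0}"
      by (rule summable_on_cong[THEN iffD2, OF _ Z.zeros_power_sums(2)[of 0, unfolded minus]], rule m)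
    ultimately have tr: "trace_class M (op_inverse M T)" "op_trace M (op_inverse M T) = - Z.g 0"
      using trace_op_inverse F0 unfolding M T F by blast+
    show "trace_class M (op_inverse M T)" by (rule tr)
    show "op_trace M (op_inverse M T) = spectral_zeta M T 1" using tr(2) zeta_eq[of 0] by simp
    show "spectral_zeta M T 1 = - (coef 1 / coef 0)"
      using zeta_eq[of 0] Z.g_eq_bn[of 1] assms(16) m0 F0 by simp
  qed
qed

end
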